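(* Let $$0<n<+\infty,\qquad 0\le j\le n,\qquad \frac jn\le\vartheta\le\frac jn+\frac d{2n}<1,$$ and let $r\in[2,+\infty]$ be defined by $\frac1r=\frac12-\frac{\vartheta n-j}d$. Let $G(j,n,\vartheta)$ be the sharp constant of the Gagliardo-Nirenberg inequality $$H^n\subset\mathcal L^{2,r,j},\qquad\|D^jf\|_{\mathcal L^r}\le G\,\|f\|^{1-\vartheta}_{\mathcal L^2}\|D^nf\|^\vartheta_{\mathcal L^2}\quad\text{for some } G\in[0,+\infty)\text{ and all } f\in H^n.$$ Then $$G(j,n,\vartheta)\ge G_{--}(j,n,\vartheta),\qquad G_{--}(j,n,\vartheta):=\frac{S_{--}(j,n,\vartheta)}{\sqrt{(1-\vartheta)^{1-\vartheta}\vartheta^\vartheta}},$$ where $$S_{--}(j,n,\vartheta):=\frac{I(j,n,\vartheta)}{\pi^{d/4+1/2}}\sqrt{\Gamma(d/2)\,n\,\sin\big(\pi(\tfrac jn+\tfrac d{2n})\big)\,\frac{(1-\vartheta)^{1-\vartheta}\vartheta^\vartheta}{(1-\frac jn-\frac d{2n})^{1-\vartheta}(\frac jn+\frac d{2n})^\vartheta}},$$ $$I(j,n,\vartheta):=\begin{cases}\dfrac{\pi}{2^{d/2}\Gamma(d/2)\,n\,\sin(\pi\vartheta)}&\text{if }\vartheta=\frac jn+\frac d{2n},\\[3mm]\left(\dfrac{2\pi^{d/2}}{\Gamma(d/2)}\displaystyle\int_0^{+\infty}d\rho\,\rho^{d-1}|L_{jn}(\rho)|^r\right)^{1/r}&\text{if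 }\vartheta\ne\frac jn+\frac d{2n},\end{cases}$$ and $L_{jn}\in C([0,+\infty),\mathbb R)$ is defined by $$L_{jn}(\rho):=\int_0^{+\infty}d\xi\,\frac{J_{d/2-1}(\rho\xi)}{(\rho\xi)^{d/2-1}}\,\frac{\xi^{d+2j-1}}{1+\xi^{2n}}\ \text{ for }\rho>0,\qquad L_{jn}(0)=\frac\pi{2^{d/2}\Gamma(d/2)\,n\,\sin\big(\pi\frac{2j+d}{2n}\big)}.$$ The equality $G(j,n,\vartheta)=G_{--}(j,n,\vartheta)$ holds in the cases: (a) $\vartheta=0$, where $j=0$, $r=2$ and $G(j,n,\vartheta)=1$; (b) $\vartheta=\frac jn+\frac d{2n}$, where $$G(j,n,\vartheta)=\frac1{\sqrt{(1-\vartheta)^{1-\vartheta}\vartheta^\vartheta}}\cdot\frac1{2^{d/2}\pi^{d/4-1/2}\sqrt{\Gamma(d/2)\,n\,\sin(\pi\vartheta)}}.$$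
   Context: Fix $d\in\{1,2,3,\dots\}$; functions are complex-valued on $\mathbb R^d$. $\mathcal S$ is the Schwartz space; the Fourier transform is $\mathcal F\varphi(k)=(2\pi)^{-d/2}\int_{\mathbb R^d}e^{-ik\cdot x}\varphi(x)\,dx$. $\Phi:=\{\phi\in\mathcal S:\int x_{i_1}\cdots x_{i_m}\phi(x)dx=0 \text{ for all } m\ge 0, i_1,\dots,i_m\}$ and $\Psi:=\{\psi\in\mathcal S: \partial_{i_1\cdots i_m}\psi(0)=0\text{ for all } m\ge0,i_1,\dots,i_m\}$ are closed subspaces of $\mathcal S$ with $\mathcal F\Phi=\Psi$; $\Phi',\Psi'$ are their topological duals. $\mathcal F:\Phi'\to\Psi'$ is the bijection $\langle\mathcal Ff,\psi\rangle:=\langle f,\mathcal F^{-1}\psi_R\rangle$, $\psi_R(k)=\psi(-k)$. For $s\in\mathbb R$ and $g\in\Psi'$, $|k|^sg\in\Psi'$ is $\langle|k|^sg,\psi\rangle:=\langle g,|k|^s\psi\rangle$, and $D^s:\Phi'\to\Phi'$ is the bijection $D^sf:=\mathcal F^{-1}(|k|^s\mathcal Ff)$ (so $D=\sqrt{-\Delta}$). $\mathcal L^p:=L^p(\mathbb R^d,\mathbb C)$ for $p\in[1,+\infty)$, while $\mathcal L^\infty:=C_0(\mathbb R^d,\mathbb C)$ (continuous functions vanishing at infinity, sup norm). A function $f\in\mathcal L^p$ is identified with the element $\phi\mapsto\int f\phi$ of $\Phi'$ (this map is injective). $H^n:=\{f\in\mathcal L^2:D^nf\in\mathcal L^2\}$,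 $\mathcal L^{2,r,j}:=\{f\in\mathcal L^2:D^jf\in\mathcal L^r\}$. Convention: $0^0:=1$. The sharp constant of an inequality is the smallest constant for which it holds; under the stated conditions on $j,n,\vartheta$ the Gagliardo-Nirenberg inequality above is known to hold. $J_\nu$ is the Bessel function of the first kind. *)

theory Defs
  imports "HOL-Analysis.Analysis"
begin

type_synonym 'd cfun = "real ^ 'd \<Rightarrow> complex"
type_synonym 'd functional = "'d cfun \<Rightarrow> complex"

(* The convention 0^0 = 1; the library has 0 powr 0 = 0. *)
definition rpow :: "real \<Rightarrow> real \<Rightarrow> real" where
  "rpow x y = (if y = 0 then 1 else x powr y)"


definition partial_deriv :: "'d::finite \<Rightarrow> 'd cfun \<Rightarrow> 'd cfun" where
  "partial_deriv i f = (\<lambda>x. frechet_derivative f (at x) (axis i 1))"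

primrec partial_derivs :: "'d::finite list \<Rightarrow> 'd cfun \<Rightarrow> 'd cfun" where
  "partial_derivs [] f = f"
| "partial_derivs (i # idx) f = partial_deriv i (partial_derivs idx f)"

definition smooth_fun :: "'d::finite cfun \<Rightarrow> bool" where
  "smooth_fun f \<longleftrightarrow> (\<forall>idx x. partial_derivs idx f differentiable (at x))"

definition schwartz :: "'d::finite cfun set" where
  "schwartz = {f. smooth_fun f \<and>
     (\<forall>N idx. bounded (range (\<lambda>x. norm x ^ N *\<^sub>R partial_derivs idx f x)))}"

definition schwartz_seminorm :: "nat \<Rightarrow> 'd::finite list \<Rightarrow> 'd cfun \<Rightarrow> real" where
  "schwartz_seminorm N idx f = (SUP x. norm x ^ N * norm (partial_derivs idx f x))"

definition schwartz_topology :: "'d::finite cfun topology" where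
  "schwartz_topology = topology_generated_by
     {{g \<in> schwartz. schwartz_seminorm N idx (\<lambda>x. g x - f x) < e} | f N idx e.
        f \<in> schwartz \<and> e > 0}"

definition Phi :: "'d::finite cfun set" where
  "Phi = {\<phi> \<in> schwartz. \<forall>idx.
     (LINT x|lborel. complex_of_real (\<Prod>i\<leftarrow>idx. x $ i) * \<phi> x) = 0}"

definition Psi :: "'d::finite cfun set" where
  "Psi = {\<psi> \<in> schwartz. \<forall>idx. partial_derivs idx \<psi> 0 = 0}"

(* Functionals on V are total HOL functions; they are made extensional (equal to
   undefined off V) so that functionals agreeing on V are equal. *)
definition top_dual :: "'d::finite cfun set \<Rightarrow> 'd functional set" where
  "top_dual V = {u \<in> extensional V.
     (\<forall>f\<in>V. \<forall>g\<in>V. u (\<lambda>x. f x + g x) = u f + u g) \<and>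
     (\<forall>c. \<forall>f\<in>V. u (\<lambda>x. c * f x) = c * u f) \<and>
     continuous_map (subtopology schwartz_topology V) euclidean u}"


definition fourier :: "'d::finite cfun \<Rightarrow> 'd cfun" where
  "fourier f = (\<lambda>k. complex_of_real ((2 * pi) powr (- real CARD('d) / 2)) *
     (LINT x|lborel. exp (- (\<i> * complex_of_real (k \<bullet> x))) * f x))"

definition fourier_inv :: "'d::finite cfun \<Rightarrow> 'd cfun" where
  "fourier_inv = inv_into schwartz fourier"

definition fourier_dual :: "'d::finite functional \<Rightarrow> 'd functional" where
  "fourier_dual u = (\<lambda>\<psi>\<in>Psi. u (fourier_inv (\<lambda>k. \<psi> (- k))))"

definition fourier_dual_inv :: "'d::finite functional \<Rightarrow> 'd functional" where
  "fourier_dual_inv = inv_into (top_dual Phi) fourier_dual"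

definition mult_norm_pow :: "real \<Rightarrow> 'd::finite functional \<Rightarrow> 'd functional" where
  "mult_norm_pow s g = (\<lambda>\<psi>\<in>Psi. g (\<lambda>k. complex_of_real (rpow (norm k) s) * \<psi> k))"

definition D_op :: "real \<Rightarrow> 'd::finite functional \<Rightarrow> 'd functional" where
  "D_op s f = fourier_dual_inv (mult_norm_pow s (fourier_dual f))"


(* Representatives. The case p = \<infinity> is C_0, not the usual essentially bounded functions. *)
definition Lp_fun :: "ereal \<Rightarrow> 'd::finite cfun set" where
  "Lp_fun p =
     (if p = \<infinity> then {f. continuous_on UNIV f \<and> (f \<longlongrightarrow> 0) at_infinity}
      else {f \<in> borel_measurable lborel.
              integrable lborel (\<lambda>x. norm (f x) powr real_of_ereal p)})"

definition Lp_fun_norm :: "ereal \<Rightarrow> 'd::finite cfun \<Rightarrow> real" where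
  "Lp_fun_norm p f =
     (if p = \<infinity> then (SUP x. norm (f x))
      else (LINT x|lborel. norm (f x) powr real_of_ereal p) powr (1 / real_of_ereal p))"

definition embed :: "'d::finite cfun \<Rightarrow> 'd functional" where
  "embed f = (\<lambda>\<phi>\<in>Phi. LINT x|lborel. f x * \<phi> x)"

(* Members of Lp are elements of the dual of Phi; two representatives of the same
   member agree almost everywhere, so its norm is that of any of them. *)
definition Lp :: "ereal \<Rightarrow> 'd::finite functional set" where
  "Lp p = embed ` Lp_fun p"

definition Lp_norm :: "ereal \<Rightarrow> 'd::finite functional \<Rightarrow> real" where
  "Lp_norm p u = Lp_fun_norm p (inv_into (Lp_fun p) embed u)"

definition sobolev_H :: "real \<Rightarrow> 'd::finite functional set" where
  "sobolev_H n = {f \<in> Lp 2. D_op n f \<in> Lp 2}"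

definition L2_rj :: "ereal \<Rightarrow> real \<Rightarrow> 'd::finite functional set" where
  "L2_rj r j = {f \<in> Lp 2. D_op j f \<in> Lp r}"


definition gn_inequality ::
    "'d::finite itself \<Rightarrow> real \<Rightarrow> real \<Rightarrow> real \<Rightarrow> ereal \<Rightarrow> real \<Rightarrow> bool" where
  "gn_inequality _ j n \<theta> r G \<longleftrightarrow>
     0 \<le> G \<and> (sobolev_H n :: 'd functional set) \<subseteq> L2_rj r j \<and>
     (\<forall>f \<in> (sobolev_H n :: 'd functional set).
        Lp_norm r (D_op j f) \<le> G * rpow (Lp_norm 2 f) (1 - \<theta>) * rpow (Lp_norm 2 (D_op n f)) \<theta>)"

definition gn_sharp ::
    "'d::finite itself \<Rightarrow> real \<Rightarrow> real \<Rightarrow> real \<Rightarrow> ereal \<Rightarrow> real" where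
  "gn_sharp T j n \<theta> r = (LEAST G. gn_inequality T j n \<theta> r G)"


(* Only meaningful for x > 0, because of powr; rGamma covers the poles of Gamma. *)
definition bessel_J :: "real \<Rightarrow> real \<Rightarrow> real" where
  "bessel_J \<nu> x =
     (\<Sum>m. (-1) ^ m / fact m * rGamma (real m + \<nu> + 1) * (x / 2) powr (2 * real m + \<nu>))"

definition gn_L :: "nat \<Rightarrow> real \<Rightarrow> real \<Rightarrow> real \<Rightarrow> real" where
  "gn_L d j n \<rho> =
     (if \<rho> = 0
      then pi / (2 powr (real d / 2) * Gamma (real d / 2) * n * sin (pi * ((2 * j + real d) / (2 * n))))
      else (LBINT \<xi>:{0<..}.
              bessel_J (real d / 2 - 1) (\<rho> * \<xi>) / (\<rho> * \<xi>) powr (real d / 2 - 1) *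
              (\<xi> powr (real d + 2 * j - 1) / (1 + \<xi> powr (2 * n)))))"

(* The exponent r is infinite exactly in the first case. *)
definition gn_I :: "nat \<Rightarrow> real \<Rightarrow> real \<Rightarrow> real \<Rightarrow> ereal \<Rightarrow> real" where
  "gn_I d j n \<theta> r =
     (if \<theta> = j / n + real d / (2 * n)
      then pi / (2 powr (real d / 2) * Gamma (real d / 2) * n * sin (pi * \<theta>))
      else (2 * pi powr (real d / 2) / Gamma (real d / 2) *
              (LBINT \<rho>:{0<..}. \<rho> ^ (d - 1) * \<bar>gn_L d j n \<rho>\<bar> powr real_of_ereal r))
           powr (1 / real_of_ereal r))"

definition gn_S_lower :: "nat \<Rightarrow> real \<Rightarrow> real \<Rightarrow> real \<Rightarrow> ereal \<Rightarrow> real" where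
  "gn_S_lower d j n \<theta> r =
     gn_I d j n \<theta> r / pi powr (real d / 4 + 1 / 2) *
     sqrt (Gamma (real d / 2) * n * sin (pi * (j / n + real d / (2 * n))) *
           (rpow (1 - \<theta>) (1 - \<theta>) * rpow \<theta> \<theta> /
            (rpow (1 - j / n - real d / (2 * n)) (1 - \<theta>) *
             rpow (j / n + real d / (2 * n)) \<theta>)))"

definition gn_G_lower :: "nat \<Rightarrow> real \<Rightarrow> real \<Rightarrow> real \<Rightarrow> ereal \<Rightarrow> real" where
  "gn_G_lower d j n \<theta> r =
     gn_S_lower d j n \<theta> r / sqrt (rpow (1 - \<theta>) (1 - \<theta>) * rpow \<theta> \<theta>)"

end

theory Submission
  imports Defs
begin

text \<open>
  All functionals that occur are given by their Fourier transform: \<open>f\<close> in the Sobolev space corresponds to a function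
  \<open>a\<close> such that \<open>a\<close> and \<open>|k|^n a\<close> are square integrable, with \<open>A = \<parallel>f\<parallel>\<^sup>2\<close> and \<open>B = \<parallel>D\<^sup>n f\<parallel>\<^sup>2\<close> the squared
  norms of these two functions (\<open>sobolev_H_transform\<close>, \<open>L2_dualT\<close>), and \<open>D\<^sup>j f\<close> is the inverse transform of
  \<open>|k|^j a\<close> (\<open>D_op_dualT\<close>).

  Upper bound. Let \<open>c = j/n + d/(2n)\<close>. For every \<open>\<mu> > 0\<close> the Cauchy--Schwarz inequality with the weight
  \<open>1 + \<mu> |k|^(2n)\<close> bounds the square of \<open>\<integral> |k|^j |a|\<close> by \<open>\<mu>^(-c) Q (A + \<mu> B)\<close>, where
  \<open>Q = \<integral> |k|^(2j) / (1 + |k|^(2n))\<close> (\<open>mulp_L1_bound\<close>); this controls the sup norm of \<open>D\<^sup>j f\<close>. A pointwise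
  estimate bounds its square norm by \<open>\<mu>^(-j/n) (A + \<mu> B)\<close> (\<open>mulp_L2_bound\<close>). Interpolation gives
  \<open>\<parallel>D\<^sup>j f\<parallel>\<^sub>r\<^sup>2 \<le> ((2 \<pi>)^(-d) Q)^(1 - 2/r) \<mu>^(-\<theta>) (A + \<mu> B)\<close>, and minimising over \<open>\<mu>\<close> (\<open>scaling_optimum\<close>) yields
  the inequality with an explicit constant (\<open>gn_inequality_explicit\<close>). In particular a least constant exists
  (\<open>gn_sharp_least\<close>).

  Lower bound. The Cauchy--Schwarz step is an equality for \<open>a = |k|^j / (1 + |k|^(2n))\<close>. For this trial function the
  norms are Beta integrals, \<open>A = (1 - c) Q\<close> and \<open>B = c Q\<close> (\<open>trial_norms\<close>), and \<open>D\<^sup>j f\<close> is the radial function with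
  profile \<open>gn_L\<close> (\<open>gn_L_eq_fourier\<close>), whose norm is at least \<open>gn_I\<close>, with equality for finite \<open>r\<close> (\<open>gn_I_trial\<close>). Hence the quotient
  of both sides is at least \<open>gn_G_lower\<close> (\<open>gn_G_lower_eq\<close>). For \<open>\<theta> = 0\<close>, where \<open>r = 2\<close>, and for \<open>\<theta> = c\<close>, where \<open>r = \<infinity>\<close>, the explicit
  upper constant has the same value, so the sharp constant is determined.

  Most of the text provides the analysis on which this rests: Schwartz functions and the two test function spaces,
  Fourier inversion, the norm bounds for square integrable functions, the injectivity of the embedding of functions into
  the dual of \<open>Phi\<close> (\<open>small_annihilates_Phi\<close>), without which the norms of functionals would depend on
  representatives, and the Bessel formula for transforms of radial functions (\<open>radial_cos_integral\<close>).
\<close>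

section \<open>Lebesgue integrals: affine maps, polar coordinates and Gamma integrals\<close>

lemma nn_integral_affine_euclidean:
  fixes f :: "'a::euclidean_space \<Rightarrow> ennreal"
  assumes [measurable]: "f \<in> borel_measurable borel" and c: "c \<noteq> 0"
  shows "(\<integral>\<^sup>+x. f x \<partial>lborel) = ennreal (\<bar>c\<bar> ^ DIM('a)) * (\<integral>\<^sup>+x. f (t + c *\<^sub>R x) \<partial>lborel)"
  by (subst lborel_affine[OF c, of t])
     (simp add: nn_integral_density nn_integral_distr nn_integral_cmult)

lemma integrable_affine_euclidean:
  fixes f :: "'a::euclidean_space \<Rightarrow> 'b::{banach,second_countable_topology}"
  assumes f: "integrable lborel f" and c: "c \<noteq> 0"
  shows "integrable lborel (\<lambda>x. f (t + c *\<^sub>R x))"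
proof -
  have [measurable]: "f \<in> borel_measurable borel" using f by (auto dest: borel_measurable_integrable)
  have "(\<integral>\<^sup>+x. norm (f x) \<partial>lborel) < \<infinity>" using f by (simp add: integrable_iff_bounded)
  moreover have "(\<integral>\<^sup>+x. norm (f x) \<partial>lborel) =
      ennreal (\<bar>c\<bar> ^ DIM('a)) * (\<integral>\<^sup>+x. norm (f (t + c *\<^sub>R x)) \<partial>lborel)"
    by (rule nn_integral_affine_euclidean) (use c in auto)
  ultimately show ?thesis
    using c by (auto simp: integrable_iff_bounded ennreal_mult_less_top)
qed

lemma integral_affine_euclidean:
  fixes f :: "'a::euclidean_space \<Rightarrow> 'b::{banach,second_countable_topology}"
  assumes f: "integrable lborel f" and c: "c \<noteq> 0"
  shows "(LBINT x. f (t + c *\<^sub>R x)) = (LBINT x. f x) /\<^sub>R \<bar>c\<bar> ^ DIM('a)"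
proof -
  have [measurable]: "f \<in> borel_measurable borel" using f by (auto dest: borel_measurable_integrable)
  have "(LBINT x. f x) = \<bar>c\<bar> ^ DIM('a) *\<^sub>R (LBINT x. f (t + c *\<^sub>R x))"
    by (subst lborel_affine[OF c, of t]) (simp add: integral_density integral_distr)
  then show ?thesis using c by simp
qed

lemma measure_eq_if_atMost_eq:
  fixes M N :: "real measure"
  assumes "sets M = sets borel" "sets N = sets borel"
    and "emeasure M {..0} = 0" "emeasure N {..0} = 0"
    and eq: "\<And>R. R > 0 \<Longrightarrow> emeasure M {..R} = emeasure N {..R}"
    and fin: "\<And>R. R > 0 \<Longrightarrow> emeasure M {..R} < \<infinity>"
  shows "M = N"
proof (rule measure_eqI_generator_eq[where E="range (\<lambda>a. {..a::real})" and \<Omega>=UNIV and A="\<lambda>i. {..real i}"])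
  show "Int_stable (range (\<lambda>a. {..a::real}))"
    by (auto simp: Int_stable_def)
  show "sets M = sigma_sets UNIV (range (\<lambda>a. {..a::real}))"
    "sets N = sigma_sets UNIV (range (\<lambda>a. {..a::real}))"
    using assms(1,2) by (simp_all add: borel_eq_atMost)
  show "(\<Union>i. {..real i}) = UNIV"
    by (auto intro: real_arch_simple)
  have zero: "emeasure M {..R} = 0" "emeasure N {..R} = 0" if "R \<le> 0" for R
    using emeasure_mono[of "{..R}" "{..0}" M] emeasure_mono[of "{..R}" "{..0}" N] assms(1-4) that by auto
  show "emeasure M X = emeasure N X" if "X \<in> range (\<lambda>a. {..a::real})" for X
    using that zero eq by (auto, metis not_less)
  show "emeasure M {..real i} \<noteq> \<infinity>" for i
    using fin[of "real i"] zero[of "real i"] by (cases "i = 0") auto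
qed auto

lemma emeasure_density_power_atMost:
  fixes C :: real
  assumes "C \<ge> 0" "R > 0" "n > 0"
  shows "emeasure (density lborel (\<lambda>\<rho>. ennreal (C * \<rho> ^ (n - 1)) * indicator {0<..} \<rho>)) {..R}
     = ennreal (C / real n * R ^ n)"
proof -
  have "emeasure (density lborel (\<lambda>\<rho>. ennreal (C * \<rho> ^ (n - 1)) * indicator {0<..} \<rho>)) {..R}
     = (\<integral>\<^sup>+\<rho>. ennreal (C * \<rho> ^ (n - 1)) * indicator {0<..} \<rho> * indicator {..R} \<rho> \<partial>lborel)"
    by (subst emeasure_density) auto
  also have "\<dots> = (\<integral>\<^sup>+\<rho>. ennreal (C * \<rho> ^ (n - 1)) * indicator {0..R} \<rho> \<partial>lborel)"
    by (rule nn_integral_cong_AE, rule AE_I[where N="{0}"]) (auto simp: indicator_def split: if_splits)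
  also have "\<dots> = ennreal (C / real n * R ^ n - C / real n * 0 ^ n)"
  proof (rule nn_integral_FTC_Icc)
    show "((\<lambda>x. C / real n * x ^ n) has_real_derivative C * x ^ (n - 1)) (at x)"
      for x
      using assms by (auto intro!: derivative_eq_intros)
  qed (use assms in auto)
  finally show ?thesis using assms by (simp add: power_0_left)
qed

text \<open>Polar coordinates without surface measure. Push the measure with density \<open>p\<close> forward along the norm.
Homogeneity makes the mass of a ball of radius \<open>R\<close> proportional to \<open>R ^ (DIM('a) + m)\<close>, so the image measure on
the half line agrees with a power density on all initial segments, and these determine it. The case \<open>p = 1\<close> gives
integrals of radial functions; powers of linear forms give the moments of balls.\<close>

lemma nn_integral_homogeneous_radial:
  fixes p :: "'a::euclidean_space \<Rightarrow> real"
  assumes p[measurable]: "p \<in> borel_measurable borel" and nonneg: "\<And>x. p x \<ge> 0"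
    and hom: "\<And>c x. c > 0 \<Longrightarrow> p (c *\<^sub>R x) = c ^ m * p x"
    and C: "C \<ge> 0" and vol: "(\<integral>\<^sup>+x. ennreal (p x) * indicator (cball 0 1) x \<partial>lborel)
                 = ennreal (C / real (DIM('a) + m))"
    and h[measurable]: "h \<in> borel_measurable borel"
  shows "(\<integral>\<^sup>+x. ennreal (p x) * h (norm x) \<partial>lborel)
       = (\<integral>\<^sup>+\<rho>. ennreal (C * \<rho> ^ (DIM('a) + m - 1)) * indicator {0<..} \<rho> * h \<rho> \<partial>lborel)"
proof -
  let ?n = "DIM('a) + m"
  define M where "M = distr (density lborel (\<lambda>x. ennreal (p x))) borel norm"
  define N where "N = density lborel (\<lambda>\<rho>. ennreal (C * \<rho> ^ (?n - 1)) * indicator {0<..} \<rho>)"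
  have n: "?n > 0" using DIM_positive[where 'a='a] by linarith
  have eM: "emeasure M {..R} = (\<integral>\<^sup>+x. ennreal (p x) * indicator (cball 0 R) x \<partial>lborel)" for R
  proof -
    have "emeasure M {..R} = emeasure (density lborel (\<lambda>x. ennreal (p x))) (norm -` {..R} \<inter> UNIV)"
      unfolding M_def by (subst emeasure_distr) auto
    also have "norm -` {..R} \<inter> UNIV = cball (0::'a) R" by auto
    finally show ?thesis by (subst (asm) emeasure_density) auto
  qed
  have eMR: "emeasure M {..R} = ennreal (C / real ?n * R ^ ?n)" if R: "R > 0" for R
  proof -
    have [measurable]: "cball (0::'a) R \<in> sets borel" "cball (0::'a) 1 \<in> sets borel" by simp_all
    have ind: "indicator (cball 0 R) (0 + R *\<^sub>R x) = (indicator (cball 0 1) x :: ennreal)" for x :: 'a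
      using R by (auto simp: indicator_def)
    have "emeasure M {..R} = ennreal (\<bar>R\<bar> ^ DIM('a)) *
        (\<integral>\<^sup>+x. ennreal (p (0 + R *\<^sub>R x)) * indicator (cball 0 R) (0 + R *\<^sub>R x) \<partial>lborel)"
      unfolding eM by (rule nn_integral_affine_euclidean) (use R in auto)
    also have "(\<integral>\<^sup>+x. ennreal (p (0 + R *\<^sub>R x)) * indicator (cball 0 R) (0 + R *\<^sub>R x) \<partial>lborel)
       = (\<integral>\<^sup>+x. ennreal (R ^ m) * (ennreal (p x) * indicator (cball 0 1) x) \<partial>lborel)"
      unfolding ind using R nonneg by (intro nn_integral_cong) (auto simp: hom ennreal_mult mult.assoc)
    also have "\<dots> = ennreal (R ^ m) * ennreal (C / real ?n)"
      by (subst nn_integral_cmult) (auto simp: vol)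
    finally show ?thesis using R C
      by (simp add: ennreal_mult[symmetric] power_add mult_ac)
  qed
  have "M = N"
  proof (rule measure_eq_if_atMost_eq)
    show "sets M = sets borel" "sets N = sets borel" by (auto simp: M_def N_def)
    have "(\<integral>\<^sup>+x. ennreal (p x) * indicator (cball 0 0) x \<partial>lborel) = (\<integral>\<^sup>+(x::'a). 0 \<partial>lborel)"
      by (rule nn_integral_cong_AE, rule AE_I[where N="{0}"]) (auto simp: indicator_def split: if_splits)
    then show "emeasure M {..0} = 0" unfolding eM by simp
    show "emeasure N {..0} = 0"
      unfolding N_def by (subst emeasure_density) (auto simp: nn_integral_0_iff_AE indicator_def)
    show "emeasure M {..R} = emeasure N {..R}" if "R > 0" for R
      unfolding eMR[OF that] N_def using emeasure_density_power_atMost[OF C that n] by simp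
    show "emeasure M {..R} < \<infinity>" if "R > 0" for R using eMR[OF that] by simp
  qed
  then have "(\<integral>\<^sup>+\<rho>. h \<rho> \<partial>M) = (\<integral>\<^sup>+\<rho>. h \<rho> \<partial>N)" by simp
  then show ?thesis unfolding M_def N_def
    by (simp add: nn_integral_distr nn_integral_density)
qed

definition sphere_area :: "nat \<Rightarrow> real" where
  "sphere_area d = 2 * pi powr (real d / 2) / Gamma (real d / 2)"

lemma sphere_area_pos: "d > 0 \<Longrightarrow> sphere_area d > 0"
  by (auto simp: sphere_area_def intro!: divide_pos_pos Gamma_real_pos)

lemma nn_integral_radial:
  fixes h :: "real \<Rightarrow> ennreal"
  assumes h[measurable]: "h \<in> borel_measurable borel"
  shows "(\<integral>\<^sup>+x. h (norm (x::'a::euclidean_space)) \<partial>lborel)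
       = (\<integral>\<^sup>+\<rho>. ennreal (sphere_area DIM('a) * \<rho> ^ (DIM('a) - 1)) * indicator {0<..} \<rho> * h \<rho> \<partial>lborel)"
proof -
  have pos: "DIM('a) > 0" by simp
  have "Gamma (real DIM('a) / 2 + 1) = real DIM('a) / 2 * Gamma (real DIM('a) / 2)"
    by (rule Gamma_plus1) (use pos in \<open>auto dest!: nonpos_Ints_nonpos simp del: DIM_positive\<close>)
  then have area: "sphere_area DIM('a) / real DIM('a) = unit_ball_vol (real DIM('a))"
    unfolding sphere_area_def unit_ball_vol_def by (simp only:) (simp add: field_simps)
  have "(\<integral>\<^sup>+x. ennreal 1 * h (norm (x::'a)) \<partial>lborel)
       = (\<integral>\<^sup>+\<rho>. ennreal (sphere_area DIM('a) * \<rho> ^ (DIM('a) + 0 - 1)) * indicator {0<..} \<rho> * h \<rho> \<partial>lborel)"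
  proof (rule nn_integral_homogeneous_radial)
    show "(\<integral>\<^sup>+x. ennreal 1 * indicator (cball (0::'a) 1) x \<partial>lborel) = ennreal (sphere_area DIM('a) / real (DIM('a) + 0))"
      using area by (simp add: emeasure_cball)
  qed (use sphere_area_pos[OF pos] in auto)
  then show ?thesis by simp
qed

text \<open>The substitution \<open>s = \<rho> powr a\<close> is obtained by the same comparison of image measures on initial segments:
this avoids differentiability and injectivity hypotheses at the singular point \<open>0\<close>.\<close>

lemma nn_integral_powr_substitution:
  fixes f :: "real \<Rightarrow> ennreal"
  assumes a: "a > 0" and f[measurable]: "f \<in> borel_measurable borel"
  shows "(\<integral>\<^sup>+\<rho>. ennreal (a * \<rho> powr (a - 1)) * indicator {0<..} \<rho> * f (\<rho> powr a) \<partial>lborel)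
       = (\<integral>\<^sup>+s. indicator {0<..} s * f s \<partial>lborel)"
proof -
  define g where "g = (\<lambda>\<rho>. ennreal (a * \<rho> powr (a - 1)) * indicator {0<..} \<rho>)"
  have [measurable]: "g \<in> borel_measurable borel" unfolding g_def by measurable
  define M where "M = distr (density lborel g) borel (\<lambda>\<rho>. \<rho> powr a)"
  define N where "N = density lborel (\<lambda>s::real. indicator {0<..} s)"
  have eM: "emeasure M {..R} = (\<integral>\<^sup>+\<rho>. g \<rho> * indicator {..R} (\<rho> powr a) \<partial>lborel)" for R
  proof -
    have "emeasure M {..R} = emeasure (density lborel g) ((\<lambda>\<rho>. \<rho> powr a) -` {..R} \<inter> UNIV)"
      unfolding M_def by (subst emeasure_distr) auto
    also have "\<dots> = (\<integral>\<^sup>+\<rho>. g \<rho> * indicator ((\<lambda>\<rho>. \<rho> powr a) -` {..R} \<inter> UNIV) \<rho> \<partial>lborel)"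
    proof (rule emeasure_density)
      have "(\<lambda>\<rho>. \<rho> powr a) -` {..R} \<inter> space borel \<in> sets borel"
        by (rule measurable_sets[where A=borel]) auto
      then show "(\<lambda>\<rho>. \<rho> powr a) -` {..R} \<inter> UNIV \<in> sets lborel" by simp
    qed auto
    finally show ?thesis by (simp add: indicator_def vimage_def)
  qed
  have eMR: "emeasure M {..R} = ennreal R" if R: "R > 0" for R
  proof -
    define c where "c = R powr (1 / a)"
    have c: "c > 0" "c powr a = R" using R a by (auto simp: c_def powr_powr)
    have le: "\<rho> powr a \<le> R \<longleftrightarrow> \<rho> \<le> c" if "\<rho> > 0" for \<rho>
    proof -
      have "\<rho> powr a \<le> c powr a \<longleftrightarrow> \<rho> \<le> c"
        using that c a by (metis less_eq_real_def linorder_not_less powr_less_mono2 powr_mono2)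
      then show ?thesis using c by simp
    qed
    have "emeasure M {..R} = (\<integral>\<^sup>+\<rho>. ennreal (a * \<rho> powr (a - 1)) * indicator {0..c} \<rho> \<partial>lborel)"
      unfolding eM
    proof (rule nn_integral_cong_AE, rule AE_I[where N="{0}"])
      show "{x \<in> space lborel. g x * indicator {..R} (x powr a) \<noteq> ennreal (a * x powr (a - 1)) * indicator {0..c} x} \<subseteq> {0}"
        using le by (auto simp: g_def indicator_def split: if_splits)
    qed auto
    also have "\<dots> = ennreal R"
    proof -
      have "((\<lambda>x. a * x powr (a - 1)) has_integral (a * (c powr (a - 1 + 1) / (a - 1 + 1)))) {0..c}"
        by (rule has_integral_mult_right[OF has_integral_powr_from_0]) (use a c in auto)
      then have "((\<lambda>x. a * x powr (a - 1)) has_integral R) {0..c}" using a c by simp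
      then have "(\<integral>\<^sup>+x. ennreal (indicator {0..c} x * (a * x powr (a - 1))) \<partial>lborel) = R"
        by (intro nn_integral_has_integral_lebesgue) (use a in auto)
      moreover have "(\<integral>\<^sup>+x. ennreal (indicator {0..c} x * (a * x powr (a - 1))) \<partial>lborel)
          = (\<integral>\<^sup>+\<rho>. ennreal (a * \<rho> powr (a - 1)) * indicator {0..c} \<rho> \<partial>lborel)"
        by (intro nn_integral_cong) (auto simp: indicator_def)
      ultimately show ?thesis by simp
    qed
    finally show ?thesis .
  qed
  have "M = N"
  proof (rule measure_eq_if_atMost_eq)
    show "sets M = sets borel" "sets N = sets borel" by (auto simp: M_def N_def)
    have "(\<integral>\<^sup>+\<rho>. g \<rho> * indicator {..0} (\<rho> powr a) \<partial>lborel) = (\<integral>\<^sup>+(\<rho>::real). 0 \<partial>lborel)"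
      by (rule nn_integral_cong) (auto simp: g_def indicator_def)
    then show "emeasure M {..0} = 0" unfolding eM by simp
    show "emeasure N {..0} = 0"
      unfolding N_def by (subst emeasure_density) (auto simp: nn_integral_0_iff_AE indicator_def)
    show "emeasure M {..R} = emeasure N {..R}" if "R > 0" for R
    proof -
      have "emeasure N {..R} = (\<integral>\<^sup>+s. indicator {0<..R} s \<partial>lborel)"
      proof -
        have "emeasure N {..R} = (\<integral>\<^sup>+s. indicator {0<..} s * indicator {..R} s \<partial>lborel)"
          unfolding N_def by (subst emeasure_density) auto
        also have "\<dots> = (\<integral>\<^sup>+s. indicator {0<..R} s \<partial>lborel)"
          by (rule nn_integral_cong) (auto simp: indicator_def)
        finally show ?thesis .
      qed
      then show ?thesis using eMR[OF that] that by simp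
    qed
    show "emeasure M {..R} < \<infinity>" if "R > 0" for R using eMR[OF that] by simp
  qed
  then have "(\<integral>\<^sup>+\<rho>. f \<rho> \<partial>M) = (\<integral>\<^sup>+\<rho>. f \<rho> \<partial>N)" by simp
  then show ?thesis unfolding M_def N_def
    by (simp add: nn_integral_distr nn_integral_density g_def)
qed

lemma nn_integral_Gamma_scaled:
  assumes c: "c > 0" and u: "u > (0::real)"
  shows "(\<integral>\<^sup>+s. indicator {0<..} s * ennreal (s powr (c - 1) * exp (- (u * s))) \<partial>lborel)
      = ennreal (Gamma c * u powr (- c))"
proof -
  have base: "(\<integral>\<^sup>+s. indicator {0<..} s * ennreal (s powr (c - 1) * exp (- s)) \<partial>lborel) = ennreal (Gamma c)"
  proof -
    have "(\<integral>\<^sup>+t. ennreal (indicator {0..} t * t powr (c - 1) / exp t) \<partial>lborel) = Gamma c"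
      using Gamma_conv_nn_integral_real[OF c] by simp
    moreover have "(\<integral>\<^sup>+t. ennreal (indicator {0..} t * t powr (c - 1) / exp t) \<partial>lborel)
      = (\<integral>\<^sup>+s. indicator {0<..} s * ennreal (s powr (c - 1) * exp (- s)) \<partial>lborel)"
      by (rule nn_integral_cong) (auto simp: indicator_def exp_minus field_simps)
    ultimately show ?thesis by simp
  qed
  have "(\<integral>\<^sup>+s. indicator {0<..} s * ennreal (s powr (c - 1) * exp (- s)) \<partial>lborel)
     = ennreal \<bar>u\<bar> * (\<integral>\<^sup>+s. indicator {0<..} (0 + u * s) * ennreal ((0 + u * s) powr (c - 1) * exp (- (0 + u * s))) \<partial>lborel)"
    by (rule nn_integral_real_affine) (use u in auto)
  also have "(\<integral>\<^sup>+s. indicator {0<..} (0 + u * s) * ennreal ((0 + u * s) powr (c - 1) * exp (- (0 + u * s))) \<partial>lborel)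
     = (\<integral>\<^sup>+s. ennreal (u powr (c - 1)) * (indicator {0<..} s * ennreal (s powr (c - 1) * exp (- (u * s)))) \<partial>lborel)"
    using u by (intro nn_integral_cong)
      (auto simp: indicator_def powr_mult ennreal_mult[symmetric] mult_ac zero_less_mult_iff)
  also have "\<dots> = ennreal (u powr (c - 1)) * (\<integral>\<^sup>+s. indicator {0<..} s * ennreal (s powr (c - 1) * exp (- (u * s))) \<partial>lborel)"
    by (rule nn_integral_cmult) auto
  finally have "ennreal (Gamma c) = ennreal (u powr c) * (\<integral>\<^sup>+s. indicator {0<..} s * ennreal (s powr (c - 1) * exp (- (u * s))) \<partial>lborel)"
    (is "_ = _ * ?I") using base u by (simp add: mult.assoc[symmetric] ennreal_mult[symmetric] powr_mult_base)
  then have "ennreal (u powr (- c)) * ennreal (Gamma c) = ennreal (u powr (- c)) * ennreal (u powr c) * ?I"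
    by (simp add: mult.assoc)
  also have "ennreal (u powr (- c)) * ennreal (u powr c) = 1"
    using u by (simp add: ennreal_mult[symmetric] powr_add[symmetric])
  finally show ?thesis using c Gamma_real_pos[OF c] by (simp add: ennreal_mult[symmetric] mult.commute)
qed

lemma nn_integral_gauss_moment:
  assumes n: "n > 0"
  shows "(\<integral>\<^sup>+\<rho>. ennreal (\<rho> ^ (n - 1)) * indicator {0<..} \<rho> * ennreal (exp (- \<rho>\<^sup>2 / 2)) \<partial>lborel)
     = ennreal (2 powr (real n / 2 - 1) * Gamma (real n / 2))"
proof -
  define f where "f = (\<lambda>s. ennreal (1/2) * ennreal (s powr (real n / 2 - 1) * exp (- (1/2 * s))))"
  have [measurable]: "f \<in> borel_measurable borel" unfolding f_def by measurable
  have "(\<integral>\<^sup>+\<rho>. ennreal (\<rho> ^ (n - 1)) * indicator {0<..} \<rho> * ennreal (exp (- \<rho>\<^sup>2 / 2)) \<partial>lborel)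
     = (\<integral>\<^sup>+\<rho>. ennreal (2 * \<rho> powr (2 - 1)) * indicator {0<..} \<rho> * f (\<rho> powr 2) \<partial>lborel)"
  proof (rule nn_integral_cong)
    fix \<rho> :: real
    show "ennreal (\<rho> ^ (n - 1)) * indicator {0<..} \<rho> * ennreal (exp (- \<rho>\<^sup>2 / 2))
      = ennreal (2 * \<rho> powr (2 - 1)) * indicator {0<..} \<rho> * f (\<rho> powr 2)"
    proof (cases "\<rho> > 0")
      case True
      have 1: "\<rho> ^ (n - 1) = \<rho> * (\<rho> powr (real n - 2))"
        using n True by (subst powr_realpow[symmetric]) (auto simp: powr_mult_base of_nat_diff)
      have 2: "(\<rho>\<^sup>2) powr (real n / 2 - 1) = \<rho> powr (real n - 2)"
      proof -
        have "(\<rho>\<^sup>2) powr (real n / 2 - 1) = (\<rho> powr 2) powr (real n / 2 - 1)" using True by simp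
        also have "\<dots> = \<rho> powr (2 * (real n / 2 - 1))" by (rule powr_powr)
        also have "2 * (real n / 2 - 1) = real n - 2" by simp
        finally show ?thesis .
      qed
      have 3: "f (\<rho> powr 2) = ennreal (1/2 * (\<rho> powr (real n - 2) * exp (- \<rho>\<^sup>2 / 2)))"
        using True unfolding f_def by (subst ennreal_mult[symmetric]) (auto simp: 2)
      show ?thesis using True unfolding 3
        by (simp only: ennreal_mult[symmetric] indicator_simps mult_1_right greaterThan_iff)
           (use True 1 in \<open>simp add: ennreal_mult[symmetric] del: One_nat_def\<close>)
    qed auto
  qed
  also have "\<dots> = (\<integral>\<^sup>+s. indicator {0<..} s * f s \<partial>lborel)"
    by (rule nn_integral_powr_substitution) auto
  also have "\<dots> = (\<integral>\<^sup>+s. ennreal (1/2) * (indicator {0<..} s * ennreal (s powr (real n / 2 - 1) * exp (- (1/2 * s)))) \<partial>lborel)"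
    unfolding f_def by (simp add: mult_ac)
  also have "\<dots> = ennreal (1/2) * ennreal (Gamma (real n / 2) * (1/2) powr (- (real n / 2)))"
    by (subst nn_integral_cmult, simp, subst nn_integral_Gamma_scaled) (use n in auto)
  also have "\<dots> = ennreal (1/2 * (Gamma (real n / 2) * (1/2) powr (- (real n / 2))))"
    by (rule ennreal_mult[symmetric]) (use n in \<open>auto intro!: mult_nonneg_nonneg Gamma_real_nonneg\<close>)
  also have "1/2 * (Gamma (real n / 2) * (1/2) powr (- (real n / 2))) = 2 powr (real n / 2 - 1) * Gamma (real n / 2)"
    by (simp add: powr_minus_divide powr_divide powr_diff)
  finally show ?thesis .
qed

text \<open>In polar coordinates the sphere area cancels the Gamma factor of the radial Gaussian moment; no
reduction to one-dimensional products is involved.\<close>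

lemma gauss_integral:
  "integrable lborel (\<lambda>x::'a::euclidean_space. exp (- (norm x)\<^sup>2 / 2))" (is "integrable _ ?g")
  "(LBINT x. exp (- (norm (x::'a))\<^sup>2 / 2)) = (2 * pi) powr (real DIM('a) / 2)"
proof -
  let ?d = "DIM('a)"
  have d: "?d > 0" by simp
  have "(\<integral>\<^sup>+x. ennreal (?g x) \<partial>lborel)
    = (\<integral>\<^sup>+\<rho>. ennreal (sphere_area ?d * \<rho> ^ (?d - 1)) * indicator {0<..} \<rho> * ennreal (exp (- \<rho>\<^sup>2 / 2)) \<partial>lborel)"
    using nn_integral_radial[of "\<lambda>\<rho>. ennreal (exp (- \<rho>\<^sup>2 / 2))", where 'a='a] by simp
  also have "\<dots> = (\<integral>\<^sup>+\<rho>. ennreal (sphere_area ?d) * (ennreal (\<rho> ^ (?d - 1)) * indicator {0<..} \<rho> * ennreal (exp (- \<rho>\<^sup>2 / 2))) \<partial>lborel)"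
    using sphere_area_pos[OF d] by (intro nn_integral_cong) (auto simp: ennreal_mult mult_ac indicator_def)
  also have "\<dots> = ennreal (sphere_area ?d) * ennreal (2 powr (real ?d / 2 - 1) * Gamma (real ?d / 2))"
    by (subst nn_integral_cmult, simp, subst nn_integral_gauss_moment[OF d]) auto
  also have "\<dots> = ennreal ((2 * pi) powr (real ?d / 2))"
  proof -
    have "Gamma (real ?d / 2) > 0" by (rule Gamma_real_pos) auto
    then have "sphere_area ?d * (2 powr (real ?d / 2 - 1) * Gamma (real ?d / 2)) = (2 * pi) powr (real ?d / 2)"
      by (simp add: sphere_area_def powr_diff powr_mult less_imp_neq[symmetric])
    then show ?thesis using sphere_area_pos[OF d]
      by (subst ennreal_mult'[symmetric]) auto
  qed
  finally have *: "(\<integral>\<^sup>+x. ennreal (?g x) \<partial>lborel) = ennreal ((2 * pi) powr (real ?d / 2))" .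
  show "integrable lborel ?g"
    by (rule integrableI_nonneg) (use * in auto)
  show "(LBINT x. ?g x) = (2 * pi) powr (real DIM('a) / 2)"
    by (subst integral_eq_nn_integral) (use * in auto)
qed

lemma nn_integral_inverse_square: "(\<integral>\<^sup>+\<rho>. ennreal (1 / (1 + \<rho>)\<^sup>2) * indicator {0..} \<rho> \<partial>lborel) = 1"
proof -
  have "((\<lambda>x::real. - 1 / (1 + x)) \<longlongrightarrow> 0) at_top"
    by (intro tendsto_divide_0[OF tendsto_const] filterlim_at_top_imp_at_infinity
        filterlim_tendsto_add_at_top[OF tendsto_const] filterlim_ident)
  then have "(\<integral>\<^sup>+\<rho>. ennreal (1 / (1 + \<rho>)\<^sup>2) * indicator {0..} \<rho> \<partial>lborel) = ennreal (0 - (- 1 / (1 + 0)))"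
    by (intro nn_integral_FTC_atLeast[where F="\<lambda>x. - 1 / (1 + x)"])
       (auto intro!: derivative_eq_intros simp: power2_eq_square)
  then show ?thesis by simp
qed

lemma integrable_weight:
  assumes N: "N > DIM('a::euclidean_space)"
  shows "integrable lborel (\<lambda>x::'a. 1 / (1 + norm x) ^ N)"
proof (rule integrableI_nonneg)
  let ?d = "DIM('a)"
  have "(\<integral>\<^sup>+x. ennreal (1 / (1 + norm (x::'a)) ^ N) \<partial>lborel)
    = (\<integral>\<^sup>+\<rho>. ennreal (sphere_area ?d * \<rho> ^ (?d - 1)) * indicator {0<..} \<rho> * ennreal (1 / (1 + \<rho>) ^ N) \<partial>lborel)"
    using nn_integral_radial[of "\<lambda>\<rho>. ennreal (1 / (1 + \<rho>) ^ N)", where 'a='a] by simp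
  also have "\<dots> \<le> (\<integral>\<^sup>+\<rho>. ennreal (sphere_area ?d) * (ennreal (1 / (1 + \<rho>)\<^sup>2) * indicator {0..} \<rho>) \<partial>lborel)"
  proof (rule nn_integral_mono)
    fix \<rho> :: real
    show "ennreal (sphere_area ?d * \<rho> ^ (?d - 1)) * indicator {0<..} \<rho> * ennreal (1 / (1 + \<rho>) ^ N)
      \<le> ennreal (sphere_area ?d) * (ennreal (1 / (1 + \<rho>)\<^sup>2) * indicator {0..} \<rho>)"
    proof (cases "\<rho> > 0")
      case True
      have "\<rho> ^ (?d - 1) * (1 + \<rho>)\<^sup>2 \<le> (1 + \<rho>) ^ (?d - 1) * (1 + \<rho>)\<^sup>2"
        using True by (intro mult_right_mono power_mono) auto
      also have "\<dots> = (1 + \<rho>) ^ (?d - 1 + 2)" by (rule power_add[symmetric])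
      also have "\<dots> \<le> (1 + \<rho>) ^ N" using True N by (intro power_increasing) auto
      finally have "\<rho> ^ (?d - 1) * (1 / (1 + \<rho>) ^ N) \<le> 1 / (1 + \<rho>)\<^sup>2"
        using True by (simp add: field_simps)
      then have "sphere_area ?d * (\<rho> ^ (?d - 1) * (1 / (1 + \<rho>) ^ N)) \<le> sphere_area ?d * (1 / (1 + \<rho>)\<^sup>2)"
        using sphere_area_pos[of ?d] by (intro mult_left_mono) auto
      then show ?thesis using True sphere_area_pos[of ?d]
        by (simp add: ennreal_mult[symmetric] mult_ac)
    qed auto
  qed
  also have "\<dots> = ennreal (sphere_area ?d)"
    by (subst nn_integral_cmult) (auto simp: nn_integral_inverse_square)
  finally show "(\<integral>\<^sup>+x. ennreal (1 / (1 + norm (x::'a)) ^ N) \<partial>lborel) < \<infinity>"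
    using le_less_trans by fastforce
qed auto

text \<open>The quadratic polynomial \<open>t \<mapsto> \<integral> (t |f| - |g|)\<^sup>2\<close> is nonnegative, so its discriminant is not positive.\<close>

lemma Cauchy_Schwarz_integral:
  fixes f g :: "'a \<Rightarrow> real"
  assumes [measurable]: "f \<in> borel_measurable M" "g \<in> borel_measurable M"
    and f: "integrable M (\<lambda>x. (f x)\<^sup>2)" and g: "integrable M (\<lambda>x. (g x)\<^sup>2)"
  shows "integrable M (\<lambda>x. f x * g x)"
    and "(\<integral>x. \<bar>f x * g x\<bar> \<partial>M)\<^sup>2 \<le> (\<integral>x. (f x)\<^sup>2 \<partial>M) * (\<integral>x. (g x)\<^sup>2 \<partial>M)"
proof -
  show int: "integrable M (\<lambda>x. f x * g x)"
  proof (rule Bochner_Integration.integrable_bound[where f="\<lambda>x. (f x)\<^sup>2 + (g x)\<^sup>2"])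
    show "AE x in M. norm (f x * g x) \<le> norm ((f x)\<^sup>2 + (g x)\<^sup>2)"
    proof (rule AE_I2)
      fix x
      have "2 * \<bar>f x * g x\<bar> \<le> (f x)\<^sup>2 + (g x)\<^sup>2"
        using sum_squares_bound[of "\<bar>f x\<bar>" "\<bar>g x\<bar>"] by (simp add: abs_mult)
      then show "norm (f x * g x) \<le> norm ((f x)\<^sup>2 + (g x)\<^sup>2)" by simp
    qed
  qed (use f g in auto)
  define F where "F = (\<integral>x. (f x)\<^sup>2 \<partial>M)"
  define G where "G = (\<integral>x. (g x)\<^sup>2 \<partial>M)"
  define P where "P = (\<integral>x. \<bar>f x * g x\<bar> \<partial>M)"
  have FG: "F \<ge> 0" "G \<ge> 0" "P \<ge> 0" unfolding F_def G_def P_def by auto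
  have q: "0 \<le> t\<^sup>2 * F - 2 * t * P + G" for t
  proof -
    have "0 \<le> (\<integral>x. (t * \<bar>f x\<bar> - \<bar>g x\<bar>)\<^sup>2 \<partial>M)" by simp
    also have "(\<lambda>x. (t * \<bar>f x\<bar> - \<bar>g x\<bar>)\<^sup>2) = (\<lambda>x. t\<^sup>2 * (f x)\<^sup>2 - 2 * t * \<bar>f x * g x\<bar> + (g x)\<^sup>2)"
      by (auto simp: power2_diff abs_mult power_mult_distrib fun_eq_iff)
    also have "(\<integral>x. t\<^sup>2 * (f x)\<^sup>2 - 2 * t * \<bar>f x * g x\<bar> + (g x)\<^sup>2 \<partial>M) = t\<^sup>2 * F - 2 * t * P + G"
      unfolding F_def G_def P_def using f g int by simp
    finally show ?thesis .
  qed
  have "P\<^sup>2 \<le> F * G"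
  proof (cases "F = 0")
    case True
    have "P = 0"
    proof (rule ccontr)
      assume "P \<noteq> 0" then have "P > 0" using FG by simp
      then show False using q[of "(G + 1) / (2 * P)"] True by simp
    qed
    then show ?thesis using FG by simp
  next
    case False
    then have "F > 0" using FG by simp
    have "0 \<le> (P / F)\<^sup>2 * F - 2 * (P / F) * P + G" by (rule q)
    also have "\<dots> = G - P\<^sup>2 / F" using \<open>F > 0\<close> by (simp add: power2_eq_square field_simps)
    finally show ?thesis using \<open>F > 0\<close> by (simp add: field_simps)
  qed
  then show "(\<integral>x. \<bar>f x * g x\<bar> \<partial>M)\<^sup>2 \<le> (\<integral>x. (f x)\<^sup>2 \<partial>M) * (\<integral>x. (g x)\<^sup>2 \<partial>M)"
    by (simp add: F_def G_def P_def)
qed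

abbreviation cplx :: "real \<Rightarrow> complex" where "cplx \<equiv> complex_of_real"

section \<open>Calculus of Schwartz functions\<close>

lemma partial_deriv_eq:
  assumes "(f has_derivative D) (at x)"
  shows "partial_deriv i f x = D (axis i 1)"
  unfolding partial_deriv_def using frechet_derivative_at[OF assms] by simp

lemma has_derivative_partial_derivs:
  fixes f :: "'d::finite cfun"
  assumes "f differentiable (at x)"
  shows "(f has_derivative (\<lambda>v. \<Sum>i\<in>UNIV. cplx (v $ i) * partial_deriv i f x)) (at x)"
proof -
  let ?D = "frechet_derivative f (at x)"
  have D: "(f has_derivative ?D) (at x)" using assms by (simp add: frechet_derivative_works)
  have lin: "linear ?D" using D by (rule has_derivative_linear)
  have "?D v = (\<Sum>i\<in>UNIV. cplx (v $ i) * partial_deriv i f x)" for v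
  proof -
    have "?D v = ?D (\<Sum>i\<in>UNIV. v $ i *\<^sub>R axis i 1)"
      using basis_expansion[of v] by (simp add: scalar_mult_eq_scaleR)
    also have "\<dots> = (\<Sum>i\<in>UNIV. v $ i *\<^sub>R ?D (axis i 1))"
      using lin by (simp add: linear_sum linear_cmul)
    finally show ?thesis by (simp add: partial_deriv_def scaleR_conv_of_real)
  qed
  then have "?D = (\<lambda>v. \<Sum>i\<in>UNIV. cplx (v $ i) * partial_deriv i f x)" by auto
  then show ?thesis using D by simp
qed

text \<open>Only the size of a single function is recorded here, so that the seminorm conditions of a Schwartz function
split into differentiability and rapid decay of each iterated derivative.\<close>

definition rapid :: "'d::finite cfun \<Rightarrow> bool" where
  "rapid f \<longleftrightarrow> (\<forall>N. \<exists>C. \<forall>x. norm x ^ N * norm (f x) \<le> C)"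

lemma rapid_iff: "rapid f \<longleftrightarrow> (\<forall>N. bounded (range (\<lambda>x. norm x ^ N *\<^sub>R f x)))"
  unfolding rapid_def bounded_iff by auto

lemma schwartz_iff:
  "f \<in> schwartz \<longleftrightarrow> (\<forall>idx x. partial_derivs idx f differentiable (at x)) \<and> (\<forall>idx. rapid (partial_derivs idx f))"
  unfolding schwartz_def smooth_fun_def rapid_iff by auto

text \<open>The inequality \<open>(1 + t) ^ N \<le> 2 ^ N * (1 + t ^ N)\<close> turns bounds for separate powers of the norm into one
estimate, which is the form in which decay is used for integrability.\<close>

lemma rapidD:
  assumes "rapid f"
  obtains C where "C \<ge> 0" "\<And>x. norm (f x) \<le> C / (1 + norm x) ^ N"
proof -
  obtain C0 where C0: "norm x ^ 0 * norm (f x) \<le> C0" for x using assms unfolding rapid_def by metis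
  obtain C1 where C1: "norm x ^ N * norm (f x) \<le> C1" for x using assms unfolding rapid_def by metis
  have "C0 \<ge> 0" using order_trans[OF _ C0[of 0]] by simp
  have "C1 \<ge> 0" using order_trans[OF _ C1[of 0]] by simp
  have "norm (f x) \<le> (2 ^ N * (C0 + C1)) / (1 + norm x) ^ N" for x
  proof -
    have "(1 + norm x) ^ N \<le> (2 * max 1 (norm x)) ^ N" by (intro power_mono) auto
    also have "\<dots> = 2 ^ N * max 1 (norm x) ^ N" by (simp add: power_mult_distrib)
    also have "max 1 (norm x) ^ N \<le> 1 + norm x ^ N" by (auto simp: max_def)
    finally have "(1 + norm x) ^ N * norm (f x) \<le> 2 ^ N * (1 + norm x ^ N) * norm (f x)"
      by (intro mult_right_mono) auto
    also have "\<dots> = 2 ^ N * (norm x ^ 0 * norm (f x) + norm x ^ N * norm (f x))" by (simp add: algebra_simps)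
    also have "\<dots> \<le> 2 ^ N * (C0 + C1)" using C0[of x] C1[of x] by (intro mult_left_mono add_mono) auto
    finally show ?thesis by (simp add: pos_le_divide_eq add_pos_nonneg mult.commute)
  qed
  with \<open>C0 \<ge> 0\<close> \<open>C1 \<ge> 0\<close> show ?thesis by (intro that[of "2 ^ N * (C0 + C1)"]) auto
qed

lemma rapidI:
  assumes "\<And>N. \<exists>C. \<forall>x. norm x ^ N * norm (f x) \<le> C"
  shows "rapid f" using assms unfolding rapid_def by blast

text \<open>Finite linear combinations. Coinduction up to \<open>lspan\<close> is what makes the product rule usable: the derivative
of a product leaves a given generating set, but stays in its span.\<close>

inductive_set lspan :: "'d::finite cfun set \<Rightarrow> 'd cfun set" for A where
  lspan_base: "f \<in> A \<Longrightarrow> f \<in> lspan A"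
| lspan_add: "f \<in> lspan A \<Longrightarrow> g \<in> lspan A \<Longrightarrow> (\<lambda>x. f x + g x) \<in> lspan A"
| lspan_cmult: "f \<in> lspan A \<Longrightarrow> (\<lambda>x. c * f x) \<in> lspan A"

lemma partial_deriv_add:
  assumes "f differentiable (at x)" "g differentiable (at x)"
  shows "partial_deriv i (\<lambda>x. f x + g x) x = partial_deriv i f x + partial_deriv i g x"
proof -
  have "((\<lambda>x. f x + g x) has_derivative (\<lambda>v. frechet_derivative f (at x) v + frechet_derivative g (at x) v)) (at x)"
    using assms by (intro has_derivative_add) (auto simp: frechet_derivative_works)
  from partial_deriv_eq[OF this] show ?thesis by (simp add: partial_deriv_def)
qed

lemma partial_deriv_mult:
  fixes f g :: "'d::finite cfun"
  assumes "f differentiable (at x)" "g differentiable (at x)"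
  shows "partial_deriv i (\<lambda>x. f x * g x) x = f x * partial_deriv i g x + partial_deriv i f x * g x"
proof -
  have "((\<lambda>x. f x * g x) has_derivative (\<lambda>v. f x * frechet_derivative g (at x) v + frechet_derivative f (at x) v * g x)) (at x)"
    using assms by (intro has_derivative_mult) (auto simp: frechet_derivative_works)
  from partial_deriv_eq[OF this] show ?thesis by (simp add: partial_deriv_def)
qed

lemma partial_deriv_const: "partial_deriv i (\<lambda>x. c) x = 0"
  using partial_deriv_eq[OF has_derivative_const] by auto

lemma partial_deriv_cmult:
  fixes f :: "'d::finite cfun"
  assumes "f differentiable (at x)"
  shows "partial_deriv i (\<lambda>x. c * f x) x = c * partial_deriv i f x"
  using partial_deriv_mult[of "\<lambda>_. c" x f i] assms by (simp add: partial_deriv_const)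

lemma has_derivative_coord: "((\<lambda>x::real^'d::finite. cplx (x $ i)) has_derivative (\<lambda>v. cplx (v $ i))) F"
  by (intro has_derivative_of_real bounded_linear.has_derivative[OF bounded_linear_vec_nth] has_derivative_ident)

lemma partial_deriv_coord:
  fixes f :: "'d::finite cfun"
  assumes "f differentiable (at x)"
  shows "partial_deriv l (\<lambda>x. cplx (x $ i) * f x) x
    = cplx (x $ i) * partial_deriv l f x + (if l = i then 1 else 0) * f x"
proof -
  have d: "(\<lambda>x::real^'d. cplx (x $ i)) differentiable (at x)"
    using has_derivative_coord differentiableI by blast
  have "partial_deriv l (\<lambda>x. cplx (x $ i)) x = (if l = i then 1 else 0)"
    by (subst partial_deriv_eq[OF has_derivative_coord]) (auto simp: axis_def)
  then show ?thesis using partial_deriv_mult[OF d assms, of l] by simp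
qed

lemma differentiable_coord:
  "f differentiable (at x) \<Longrightarrow> (\<lambda>x::real^'d::finite. cplx (x $ i) * f x) differentiable (at x)"
  by (intro differentiable_mult) (use has_derivative_coord differentiableI in blast)

lemma rapid_add: "rapid f \<Longrightarrow> rapid g \<Longrightarrow> rapid (\<lambda>x. f x + g x)"
proof (rule rapidI)
  fix N assume "rapid f" "rapid g"
  then obtain C D where "\<And>x. norm x ^ N * norm (f x) \<le> C" "\<And>x. norm x ^ N * norm (g x) \<le> D"
    unfolding rapid_def by metis
  moreover have "norm x ^ N * norm (f x + g x) \<le> norm x ^ N * norm (f x) + norm x ^ N * norm (g x)" for x
    using mult_left_mono[OF norm_triangle_ineq[of "f x" "g x"], of "norm x ^ N"] by (simp add: distrib_left)
  ultimately show "\<exists>C. \<forall>x. norm x ^ N * norm (f x + g x) \<le> C"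
    by (intro exI[of _ "C + D"] allI) (meson add_mono order_trans)
qed

lemma rapid_mult_bounded:
  assumes "rapid g" and B: "\<And>x. norm (f x) \<le> B"
  shows "rapid (\<lambda>x. f x * g x)"
proof (rule rapidI)
  fix N
  obtain C where C: "\<And>x. norm x ^ N * norm (g x) \<le> C" using assms unfolding rapid_def by metis
  have "norm x ^ N * norm (f x * g x) \<le> B * C" for x
  proof -
    have "norm x ^ N * norm (f x * g x) = norm (f x) * (norm x ^ N * norm (g x))" by (simp add: norm_mult)
    also have "\<dots> \<le> B * C"
      using B[of x] C[of x] by (intro mult_mono) (auto intro: order_trans[OF norm_ge_zero])
    finally show ?thesis .
  qed
  then show "\<exists>C. \<forall>x. norm x ^ N * norm (f x * g x) \<le> C" by blast
qed

lemma rapid_cmult: "rapid g \<Longrightarrow> rapid (\<lambda>x. c * g x)"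
  by (rule rapid_mult_bounded[of g "\<lambda>_. c" "norm c"]) auto

lemma rapid_coord:
  assumes "rapid f" shows "rapid (\<lambda>x. cplx (x $ i) * f x)"
proof (rule rapidI)
  fix N
  obtain C where C: "\<And>x. norm x ^ (Suc N) * norm (f x) \<le> C" using assms unfolding rapid_def by metis
  have "norm x ^ N * norm (cplx (x $ i) * f x) \<le> C" for x
  proof -
    have "norm x ^ N * norm (cplx (x $ i) * f x) = \<bar>x $ i\<bar> * (norm x ^ N * norm (f x))"
      by (simp add: norm_mult)
    also have "\<dots> \<le> norm x * (norm x ^ N * norm (f x))"
      by (intro mult_right_mono component_le_norm_cart) auto
    also have "\<dots> \<le> C" using C[of x] by (simp add: mult.assoc)
    finally show ?thesis .
  qed
  then show "\<exists>C. \<forall>x. norm x ^ N * norm (cplx (x $ i) * f x) \<le> C" by blast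
qed

text \<open>A set with this property consists of Schwartz functions: derivatives of generators are combinations of
generators, so the whole span is stable under differentiation and every member decays. Membership in the Schwartz
space is thereby reduced to first derivatives, as in a coinductive proof.\<close>

definition schwartz_closed :: "'d::finite cfun set \<Rightarrow> bool" where
  "schwartz_closed A \<longleftrightarrow>
     (\<forall>f\<in>A. rapid f \<and> (\<forall>x. f differentiable (at x)) \<and> (\<forall>i. partial_deriv i f \<in> lspan A))"

lemma schwartz_closed_lspan:
  assumes A: "schwartz_closed A" and f: "f \<in> lspan A"
  shows "rapid f" "f differentiable (at x)" "partial_deriv i f \<in> lspan A"
proof -
  have "rapid f \<and> (\<forall>x. f differentiable (at x)) \<and> (\<forall>i. partial_deriv i f \<in> lspan A)"
    using f
  proof induction
    case (lspan_base f) then show ?case using A unfolding schwartz_closed_def by blast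
  next
    case (lspan_add f g)
    then have "partial_deriv i (\<lambda>x. f x + g x) = (\<lambda>x. partial_deriv i f x + partial_deriv i g x)" for i
      by (auto simp: partial_deriv_add)
    with lspan_add show ?case by (auto intro: rapid_add lspan.lspan_add)
  next
    case (lspan_cmult f c)
    then have "partial_deriv i (\<lambda>x. c * f x) = (\<lambda>x. c * partial_deriv i f x)" for i
      by (auto simp: partial_deriv_cmult)
    with lspan_cmult show ?case by (auto intro: rapid_cmult lspan.lspan_cmult)
  qed
  then show "rapid f" "f differentiable (at x)" "partial_deriv i f \<in> lspan A" by auto
qed

lemma schwartz_closed_derivs:
  assumes "schwartz_closed A" "f \<in> lspan A" shows "partial_derivs idx f \<in> lspan A"
  by (induction idx) (use assms schwartz_closed_lspan in auto)

lemma schwartz_coinduct: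
  assumes "schwartz_closed A" "f \<in> A" shows "f \<in> schwartz"
  unfolding schwartz_iff
  using schwartz_closed_derivs[OF assms(1) lspan_base[OF assms(2)]] schwartz_closed_lspan[OF assms(1)] by blast

lemma schwartz_coinduct_span:
  assumes "schwartz_closed A" "f \<in> lspan A" shows "f \<in> schwartz"
  unfolding schwartz_iff
  using schwartz_closed_derivs[OF assms] schwartz_closed_lspan[OF assms(1)] by blast

lemma partial_derivs_snoc: "partial_derivs idx (partial_deriv i f) = partial_derivs (idx @ [i]) f"
  by (induction idx) auto

lemma
  assumes "f \<in> schwartz"
  shows schwartz_rapid: "rapid f" and schwartz_differentiable: "f differentiable (at x)"
    and schwartz_partial_deriv: "partial_deriv i f \<in> schwartz"
  using assms unfolding schwartz_iff
  by (auto simp: partial_derivs_snoc dest: spec[of _ "[]"])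

lemma schwartz_closed_schwartz: "schwartz_closed schwartz"
  unfolding schwartz_closed_def
  using schwartz_rapid schwartz_differentiable schwartz_partial_deriv lspan_base by blast

lemma schwartz_add: "f \<in> schwartz \<Longrightarrow> g \<in> schwartz \<Longrightarrow> (\<lambda>x. f x + g x) \<in> schwartz"
  by (rule schwartz_coinduct_span[OF schwartz_closed_schwartz]) (intro lspan.intros)

lemma schwartz_cmult: "f \<in> schwartz \<Longrightarrow> (\<lambda>x. c * f x) \<in> schwartz"
  by (rule schwartz_coinduct_span[OF schwartz_closed_schwartz]) (intro lspan.intros)

lemma schwartz_diff: "f \<in> schwartz \<Longrightarrow> g \<in> schwartz \<Longrightarrow> (\<lambda>x. f x - g x) \<in> schwartz"
  using schwartz_add[of f "\<lambda>x. - 1 * g x"] schwartz_cmult[of g "- 1"] by simp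

lemma schwartz_zero: "(\<lambda>x. 0) \<in> schwartz"
  by (rule schwartz_coinduct[where A="{\<lambda>x. 0}"])
     (auto simp: schwartz_closed_def rapid_def partial_deriv_const[abs_def] intro: lspan_base)

lemma schwartz_sum: "(\<And>i. i \<in> I \<Longrightarrow> f i \<in> schwartz) \<Longrightarrow> (\<lambda>x. \<Sum>i\<in>I. f i x) \<in> schwartz"
  by (induction I rule: infinite_finite_induct) (auto simp: schwartz_zero schwartz_add)

lemma schwartz_coord:
  assumes "f \<in> schwartz" shows "(\<lambda>x. cplx (x $ i) * f x) \<in> schwartz"
proof (rule schwartz_coinduct)
  let ?A = "{\<lambda>x. cplx (x $ i) * f x | f. f \<in> schwartz} \<union> schwartz"
  show "(\<lambda>x. cplx (x $ i) * f x) \<in> ?A" using assms by blast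
  show "schwartz_closed ?A"
    unfolding schwartz_closed_def
  proof (intro ballI conjI allI)
    fix g x l assume "g \<in> ?A"
    then consider (1) "g \<in> schwartz" | (2) h where "h \<in> schwartz" "g = (\<lambda>x. cplx (x $ i) * h x)" by blast
    then have "rapid g \<and> g differentiable (at x) \<and> partial_deriv l g \<in> lspan ?A"
    proof cases
      case 1
      then show ?thesis
        by (auto intro: schwartz_rapid schwartz_differentiable schwartz_partial_deriv lspan_base)
    next
      case 2
      then have "partial_deriv l g = (\<lambda>x. cplx (x $ i) * partial_deriv l h x + (if l = i then 1 else 0) * h x)"
        using partial_deriv_coord schwartz_differentiable by fastforce
      then have "partial_deriv l g \<in> lspan ?A" using 2 schwartz_partial_deriv
        by (simp only:, intro lspan_add lspan_cmult) (auto intro!: lspan_base)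
      then show ?thesis using 2 rapid_coord[OF schwartz_rapid] differentiable_coord[OF schwartz_differentiable] by auto
    qed
    then show "rapid g" "g differentiable (at x)" "partial_deriv l g \<in> lspan ?A" by auto
  qed
qed

lemma schwartz_bounded:
  assumes "f \<in> schwartz" obtains B where "B \<ge> 0" "\<And>x. norm (f x) \<le> B"
  using rapidD[OF schwartz_rapid[OF assms], of 0] by auto

lemma lspan_mult_closed:
  assumes B: "\<And>g i. g \<in> B \<Longrightarrow> g \<in> schwartz \<and> partial_deriv i g \<in> B"
  shows "schwartz_closed {\<lambda>x. f x * g x | f g. f \<in> schwartz \<and> g \<in> B}" (is "schwartz_closed ?A")
  unfolding schwartz_closed_def
proof (intro ballI conjI allI)
  fix h x l assume "h \<in> ?A"
  then obtain f g where h: "h = (\<lambda>x. f x * g x)" and fg: "f \<in> schwartz" "g \<in> B" "g \<in> schwartz" using B by blast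
  show "rapid h" unfolding h using fg schwartz_bounded[of f]
    by (metis rapid_mult_bounded schwartz_rapid)
  show "h differentiable (at x)" unfolding h using fg by (intro differentiable_mult schwartz_differentiable)
  have "partial_deriv l h = (\<lambda>x. f x * partial_deriv l g x + partial_deriv l f x * g x)"
    unfolding h using fg schwartz_differentiable partial_deriv_mult by blast
  then show "partial_deriv l h \<in> lspan ?A"
    using fg B schwartz_partial_deriv[OF fg(1)]
    by (simp only:, intro lspan_add lspan_base) blast+
qed

text \<open>The affine images of all Schwartz functions, together, form a set that is closed up to the factor \<open>c\<close> under
differentiation.\<close>

lemma schwartz_affine:
  fixes f :: "'d::finite cfun"
  assumes "f \<in> schwartz" "c \<noteq> 0" shows "(\<lambda>x. f (t + c *\<^sub>R x)) \<in> schwartz"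
    and "partial_deriv i (\<lambda>x. f (t + c *\<^sub>R x)) = (\<lambda>x. cplx c * partial_deriv i f (t + c *\<^sub>R x))"
proof -
  let ?A = "{\<lambda>x. f (t + c *\<^sub>R x) | f :: 'd cfun. f \<in> schwartz}"
  have aff: "((\<lambda>x::real^'d. t + c *\<^sub>R x) has_derivative (\<lambda>v. c *\<^sub>R v)) (at x)" for x
    by (auto intro!: derivative_eq_intros)
  have D: "((\<lambda>x. h (t + c *\<^sub>R x)) has_derivative
      (\<lambda>v. \<Sum>i\<in>UNIV. cplx ((c *\<^sub>R v) $ i) * partial_deriv i h (t + c *\<^sub>R x))) (at x)"
    if "h \<in> schwartz" for h :: "'d cfun" and x
    using has_derivative_compose[OF aff has_derivative_partial_derivs[OF schwartz_differentiable[OF that]]] .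
  have P: "partial_deriv l (\<lambda>x. h (t + c *\<^sub>R x)) = (\<lambda>x. cplx c * partial_deriv l h (t + c *\<^sub>R x))"
    if "h \<in> schwartz" for h :: "'d cfun" and l
  proof
    fix x
    show "partial_deriv l (\<lambda>x. h (t + c *\<^sub>R x)) x = cplx c * partial_deriv l h (t + c *\<^sub>R x)"
      unfolding partial_deriv_eq[OF D[OF that]]
      by (subst sum.remove[of _ l]) (auto simp: axis_def intro!: sum.neutral)
  qed
  show "partial_deriv i (\<lambda>x. f (t + c *\<^sub>R x)) = (\<lambda>x. cplx c * partial_deriv i f (t + c *\<^sub>R x))"
    using P assms by blast
  show "(\<lambda>x. f (t + c *\<^sub>R x)) \<in> schwartz"
  proof (rule schwartz_coinduct)
    show "(\<lambda>x. f (t + c *\<^sub>R x)) \<in> ?A" using assms by blast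
    show "schwartz_closed ?A"
      unfolding schwartz_closed_def
    proof (intro ballI conjI allI)
      fix g x l assume "g \<in> ?A"
      then obtain h where g: "g = (\<lambda>x. h (t + c *\<^sub>R x))" and h: "h \<in> schwartz" by blast
      show "g differentiable (at x)" unfolding g using D[OF h] differentiableI by blast
      show "partial_deriv l g \<in> lspan ?A" unfolding g P[OF h]
        using schwartz_partial_deriv[OF h] by (intro lspan_cmult lspan_base) blast
      show "rapid g" unfolding g
      proof (rule rapidI)
        fix N
        obtain C where C: "C \<ge> 0" "\<And>x. norm (h x) \<le> C / (1 + norm x) ^ N"
          using rapidD[OF schwartz_rapid[OF h]] by blast
        have "norm x ^ N * norm (h (t + c *\<^sub>R x)) \<le> ((1 + norm t) / \<bar>c\<bar>) ^ N * C" for x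
        proof -
          let ?y = "t + c *\<^sub>R x"
          have "\<bar>c\<bar> * norm x = norm (?y - t)" by simp
          also have "\<dots> \<le> norm ?y + norm t" by (rule norm_triangle_ineq4)
          also have "\<dots> \<le> (1 + norm ?y) * (1 + norm t)" by (simp add: algebra_simps)
          finally have "norm x \<le> (1 + norm t) / \<bar>c\<bar> * (1 + norm ?y)" using assms(2) by (simp add: field_simps)
          then have "norm x ^ N \<le> ((1 + norm t) / \<bar>c\<bar> * (1 + norm ?y)) ^ N" by (intro power_mono) auto
          also have "\<dots> = ((1 + norm t) / \<bar>c\<bar>) ^ N * (1 + norm ?y) ^ N" by (rule power_mult_distrib)
          finally have "norm x ^ N * norm (h ?y) \<le> (((1 + norm t) / \<bar>c\<bar>) ^ N * (1 + norm ?y) ^ N) * (C / (1 + norm ?y) ^ N)"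
            using C by (intro mult_mono) auto
          also have "1 + norm ?y > 0" by (simp add: add_pos_nonneg)
          then have "(((1 + norm t) / \<bar>c\<bar>) ^ N * (1 + norm ?y) ^ N) * (C / (1 + norm ?y) ^ N) = ((1 + norm t) / \<bar>c\<bar>) ^ N * C"
            by (simp add: less_imp_neq[symmetric])
          finally show ?thesis .
        qed
        then show "\<exists>C. \<forall>x. norm x ^ N * norm (h (t + c *\<^sub>R x)) \<le> C" by blast
      qed
    qed
  qed
qed

lemma schwartz_continuous: "f \<in> schwartz \<Longrightarrow> continuous_on UNIV f"
  by (intro continuous_at_imp_continuous_on ballI differentiable_imp_continuous_within) (auto intro: schwartz_differentiable)

lemma schwartz_measurable: "f \<in> schwartz \<Longrightarrow> f \<in> borel_measurable borel"
  by (intro borel_measurable_continuous_onI schwartz_continuous)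

text \<open>A power of the norm larger than the dimension is available as an integrable majorant.\<close>

lemma schwartz_integrable:
  fixes f :: "'d::finite cfun" assumes "f \<in> schwartz" shows "integrable lborel f"
proof -
  obtain C where C: "C \<ge> 0" "\<And>x. norm (f x) \<le> C / (1 + norm x) ^ Suc (CARD('d))"
    using rapidD[OF schwartz_rapid[OF assms]] by blast
  have "integrable lborel (\<lambda>x::real^'d. C * (1 / (1 + norm x) ^ Suc CARD('d)))"
    by (intro integrable_mult_right integrable_weight) auto
  then show ?thesis
    by (rule Bochner_Integration.integrable_bound) (use C schwartz_measurable[OF assms] in \<open>auto\<close>)
qed

section \<open>Schwartz functions that vanish to infinite order at the origin\<close>

lemma Psi_coinduct:
  assumes "schwartz_closed A" "\<And>f. f \<in> A \<Longrightarrow> f 0 = 0" "f \<in> lspan A"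
  shows "f \<in> Psi"
proof -
  have z: "g 0 = 0" if "g \<in> lspan A" for g using that by induction (auto simp: assms(2))
  show ?thesis unfolding Psi_def
    using schwartz_coinduct_span[OF assms(1,3)] z[OF schwartz_closed_derivs[OF assms(1,3)]] by auto
qed

lemma Psi_schwartz: "f \<in> Psi \<Longrightarrow> f \<in> schwartz" by (simp add: Psi_def)

lemma Psi_zero_at: "f \<in> Psi \<Longrightarrow> f 0 = 0" unfolding Psi_def by (auto dest!: spec[of _ "[]"])

lemma Psi_partial_deriv: "f \<in> Psi \<Longrightarrow> partial_deriv i f \<in> Psi"
  unfolding Psi_def by (auto simp: schwartz_partial_deriv partial_derivs_snoc)

lemma PsiI:
  assumes "f \<in> schwartz" "f 0 = 0" "\<And>i. partial_deriv i f \<in> Psi"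
  shows "f \<in> Psi"
proof -
  have "partial_derivs idx f 0 = 0" for idx
  proof (cases idx rule: rev_cases)
    case (snoc js i)
    then show ?thesis using assms(3)[of i] unfolding Psi_def by (auto simp: partial_derivs_snoc)
  qed (use assms in auto)
  then show ?thesis using assms(1) by (auto simp: Psi_def)
qed

lemma schwartz_closed_Psi: "schwartz_closed Psi"
  unfolding schwartz_closed_def
  by (auto intro: schwartz_rapid schwartz_differentiable lspan_base Psi_partial_deriv Psi_schwartz)

lemma Psi_add: "f \<in> Psi \<Longrightarrow> g \<in> Psi \<Longrightarrow> (\<lambda>x. f x + g x) \<in> Psi"
  by (rule Psi_coinduct[OF schwartz_closed_Psi]) (auto intro: lspan.intros Psi_zero_at)

lemma Psi_cmult: "f \<in> Psi \<Longrightarrow> (\<lambda>x. c * f x) \<in> Psi"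
  by (rule Psi_coinduct[OF schwartz_closed_Psi]) (auto intro: lspan.intros Psi_zero_at)

lemma Psi_mult: "f \<in> schwartz \<Longrightarrow> g \<in> Psi \<Longrightarrow> (\<lambda>x. f x * g x) \<in> Psi"
  by (rule Psi_coinduct[OF lspan_mult_closed[of Psi]])
     (auto intro!: Psi_partial_deriv Psi_schwartz lspan_base simp: Psi_zero_at)

text \<open>Taylor's theorem at the origin, by induction on the order: if the first derivatives are bounded by
\<open>C * norm k ^ M\<close>, the mean value inequality on the segment from \<open>0\<close> to \<open>k\<close> gains one more power.\<close>

lemma Psi_flat:
  fixes f :: "'d::finite cfun"
  assumes "f \<in> Psi" shows "\<exists>C. \<forall>k. norm (f k) \<le> C * norm k ^ M"
  using assms
proof (induction M arbitrary: f)
  case 0 then show ?case using schwartz_bounded[OF Psi_schwartz] by (metis mult.right_neutral power_0)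
next
  case (Suc M)
  have "\<exists>C. \<forall>k. norm (partial_deriv i f k) \<le> C * norm k ^ M" for i
    using Suc.IH[OF Psi_partial_deriv[OF Suc.prems]] .
  then obtain C where C: "\<And>i k. norm (partial_deriv i f k) \<le> C i * norm k ^ M" by metis
  have Cn: "C i \<ge> 0" for i
    using order_trans[OF norm_ge_zero C[of i "axis i 1"]] by (simp add: norm_axis_1)
  have "norm (f k) \<le> (\<Sum>i\<in>UNIV. C i) * norm k ^ Suc M" for k
  proof -
    have "norm (f k - f 0) \<le> ((\<Sum>i\<in>UNIV. C i) * norm k ^ M) * norm (k - 0)"
    proof (rule differentiable_bound[of "cball 0 (norm k)"])
      fix x :: "real^'d" assume x: "x \<in> cball 0 (norm k)"
      show "(f has_derivative (\<lambda>v. \<Sum>i\<in>UNIV. cplx (v $ i) * partial_deriv i f x)) (at x within cball 0 (norm k))"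
        by (rule has_derivative_at_withinI[OF has_derivative_partial_derivs])
           (rule schwartz_differentiable[OF Psi_schwartz[OF Suc.prems]])
      show "onorm (\<lambda>v. \<Sum>i\<in>UNIV. cplx (v $ i) * partial_deriv i f x) \<le> (\<Sum>i\<in>UNIV. C i) * norm k ^ M"
      proof (rule onorm_le)
        fix v :: "real^'d"
        have "norm (\<Sum>i\<in>UNIV. cplx (v $ i) * partial_deriv i f x) \<le> (\<Sum>i\<in>UNIV. \<bar>v $ i\<bar> * norm (partial_deriv i f x))"
          by (rule order_trans[OF norm_sum]) (simp add: norm_mult)
        also have "\<dots> \<le> (\<Sum>i\<in>UNIV. norm v * (C i * norm k ^ M))"
        proof (intro sum_mono mult_mono component_le_norm_cart)
          fix i
          have "norm (partial_deriv i f x) \<le> C i * norm x ^ M" by (rule C)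
          also have "\<dots> \<le> C i * norm k ^ M" using x Cn by (intro mult_left_mono power_mono) auto
          finally show "norm (partial_deriv i f x) \<le> C i * norm k ^ M" .
        qed auto
        finally show "norm (\<Sum>i\<in>UNIV. cplx (v $ i) * partial_deriv i f x) \<le> (\<Sum>i\<in>UNIV. C i) * norm k ^ M * norm v"
          by (simp add: sum_distrib_left sum_distrib_right mult_ac)
      qed
    qed auto
    then show ?thesis using Psi_zero_at[OF Suc.prems] by (simp add: mult_ac)
  qed
  then show ?case by blast
qed

text \<open>Vanishing faster than every power at the origin and decaying faster than every power at infinity are
combined in one condition with arbitrary real exponents; it is stable under multiplication by any power of the norm,
negative powers included.\<close>

definition superflat :: "'d::finite cfun \<Rightarrow> bool" where
  "superflat f \<longleftrightarrow> f 0 = 0 \<and> (\<forall>s. \<exists>C. \<forall>k. norm k powr s * norm (f k) \<le> C)"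

lemma superflat_rapid: assumes "superflat f" shows "rapid f"
proof (rule rapidI)
  fix N
  obtain C where C: "\<And>k. norm k powr (real N) * norm (f k) \<le> C" using assms unfolding superflat_def by metis
  have "norm k ^ N * norm (f k) \<le> C" for k
    using C[of k] assms by (cases "k = 0") (auto simp: superflat_def powr_realpow)
  then show "\<exists>C. \<forall>x. norm x ^ N * norm (f x) \<le> C" by blast
qed

lemma superflat_bound: assumes "superflat f" obtains C where "\<And>k. norm (f k) \<le> C * norm k ^ M"
proof -
  obtain C where C: "\<And>k. norm k powr (- real M) * norm (f k) \<le> C" using assms unfolding superflat_def by metis
  have "norm (f k) \<le> C * norm k ^ M" for k
  proof (cases "k = 0")
    case True then show ?thesis using assms C[of 0] by (auto simp: superflat_def)
  next
    case False then show ?thesis using C[of k] by (simp add: powr_minus powr_realpow field_simps)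
  qed
  then show ?thesis using that by blast
qed

lemma Psi_superflat: fixes f :: "'d::finite cfun" assumes "f \<in> Psi" shows "superflat f"
  unfolding superflat_def
proof (intro conjI allI)
  show "f 0 = 0" using Psi_zero_at[OF assms] .
  fix s :: real
  obtain M :: nat where M: "\<bar>s\<bar> \<le> real M" using real_arch_simple by blast
  obtain C where C: "\<And>k. norm (f k) \<le> C * norm k ^ M" using Psi_flat[OF assms] by blast
  obtain D where D: "\<And>k. norm k ^ M * norm (f k) \<le> D" using schwartz_rapid[OF Psi_schwartz[OF assms]] unfolding rapid_def by metis
  have "C \<ge> 0" using order_trans[OF norm_ge_zero C[of "axis undefined 1"]] by (simp add: norm_axis_1)
  have "D \<ge> 0" using order_trans[OF _ D[of 0]] by simp
  have "norm k powr s * norm (f k) \<le> C + D" for k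
  proof (cases "k = 0")
    case True then show ?thesis using \<open>C \<ge> 0\<close> \<open>D \<ge> 0\<close> by simp
  next
    case k: False
    show ?thesis
    proof (cases "norm k \<le> 1")
      case True
      have "norm k powr s * norm (f k) \<le> norm k powr s * (C * norm k ^ M)" by (intro mult_left_mono C) auto
      also have "\<dots> = C * norm k powr (s + real M)" using k by (simp add: powr_add powr_realpow)
      also have "\<dots> \<le> C * 1" using True k M \<open>C \<ge> 0\<close> by (intro mult_left_mono powr_le1) auto
      finally show ?thesis using \<open>D \<ge> 0\<close> by simp
    next
      case False
      have "norm k powr s * norm (f k) \<le> norm k powr (real M) * norm (f k)"
        using False M by (intro mult_right_mono powr_mono) auto
      also have "\<dots> \<le> D" using D[of k] k by (simp add: powr_realpow)
      finally show ?thesis using \<open>C \<ge> 0\<close> by simp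
    qed
  qed
  then show "\<exists>C. \<forall>k. norm k powr s * norm (f k) \<le> C" by blast
qed

lemma superflat_coord: assumes "superflat f" shows "superflat (\<lambda>k. cplx (k $ i) * f k)"
  unfolding superflat_def
proof (intro conjI allI)
  show "cplx (0 $ i) * f 0 = 0" by simp
  fix s :: real
  obtain C where C: "\<And>k. norm k powr (1 + s) * norm (f k) \<le> C" using assms unfolding superflat_def by metis
  have "norm k powr s * norm (cplx (k $ i) * f k) \<le> C" for k
  proof -
    have "norm k powr s * norm (cplx (k $ i) * f k) = \<bar>k $ i\<bar> * (norm k powr s * norm (f k))"
      by (simp add: norm_mult)
    also have "\<dots> \<le> norm k * (norm k powr s * norm (f k))"
      by (intro mult_right_mono component_le_norm_cart) auto
    also have "\<dots> = norm k powr (1 + s) * norm (f k)" by (cases "k = 0") (auto simp: powr_add)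
    also have "\<dots> \<le> C" by (rule C)
    finally show ?thesis .
  qed
  then show "\<exists>C. \<forall>k. norm k powr s * norm (cplx (k $ i) * f k) \<le> C" by blast
qed

lemma has_derivative_zero_if_quadratic:
  fixes f :: "'d::finite cfun"
  assumes "\<And>k. norm (f k - f 0) \<le> C * norm k ^ 2"
  shows "(f has_derivative (\<lambda>v. 0)) (at 0)"
  unfolding has_derivative_at
proof (intro conjI bounded_linear_zero)
  have "((\<lambda>h::real^'d. C * norm h) \<longlongrightarrow> C * norm (0::real^'d)) (at 0)"
    by (intro tendsto_intros)
  then have lim: "((\<lambda>h::real^'d. C * norm h) \<longlongrightarrow> 0) (at 0)" by simp
  show "(\<lambda>h. norm (f (0 + h) - f 0 - 0) / norm h) \<midarrow>0\<rightarrow> 0"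
  proof (rule tendsto_sandwich[OF _ _ tendsto_const lim])
    show "\<forall>\<^sub>F h in at 0. norm (f (0 + h) - f 0 - 0) / norm h \<le> C * norm h"
      unfolding eventually_at
      using assms by (intro exI[of _ 1]) (auto simp: divide_le_eq power2_eq_square mult_ac)
  qed auto
qed

text \<open>Coinduction for functions that are only known explicitly away from the origin. Superflatness gives the
derivative \<open>0\<close> at the origin, so the formula for the partial derivative off the origin extends to it.\<close>

lemma Psi_coinduct_flat:
  fixes A :: "'d::finite cfun set"
  assumes A: "\<And>f. f \<in> A \<Longrightarrow> superflat f"
    and diff: "\<And>f k. f \<in> A \<Longrightarrow> k \<noteq> 0 \<Longrightarrow> f differentiable (at k)"
    and part: "\<And>f i. f \<in> A \<Longrightarrow> \<exists>g\<in>lspan A. \<forall>k. k \<noteq> 0 \<longrightarrow> partial_deriv i f k = g k"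
    and f: "f \<in> lspan A"
  shows "f \<in> Psi"
proof (rule Psi_coinduct[OF _ _ f])
  show z: "g 0 = 0" if "g \<in> A" for g using A[OF that] by (simp add: superflat_def)
  have z': "g 0 = 0" if "g \<in> lspan A" for g using that by induction (auto simp: z)
  show "schwartz_closed A" unfolding schwartz_closed_def
  proof (intro ballI conjI allI)
    fix g x i assume g: "g \<in> A"
    show "rapid g" by (rule superflat_rapid[OF A[OF g]])
    obtain C where "\<And>k. norm (g k) \<le> C * norm k ^ 2" using superflat_bound[OF A[OF g]] by metis
    then have D0: "(g has_derivative (\<lambda>v. 0)) (at 0)"
      using z[OF g] by (intro has_derivative_zero_if_quadratic[of g C]) simp
    show "g differentiable (at x)"
      using diff[OF g, of x] D0 by (cases "x = 0") (auto intro: differentiableI)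
    obtain h where h: "h \<in> lspan A" "\<And>k. k \<noteq> 0 \<Longrightarrow> partial_deriv i g k = h k" using part[OF g] by blast
    have "partial_deriv i g = h"
    proof
      fix k show "partial_deriv i g k = h k"
        using h(2)[of k] partial_deriv_eq[OF D0] z'[OF h(1)] by (cases "k = 0") auto
    qed
    then show "partial_deriv i g \<in> lspan A" using h by simp
  qed
qed

lemma has_derivative_radial:
  fixes g :: "real \<Rightarrow> real" and k :: "real^'d::finite"
  assumes "(g has_real_derivative g') (at ((norm k)\<^sup>2))"
  shows "((\<lambda>k. cplx (g ((norm k)\<^sup>2))) has_derivative (\<lambda>v. cplx (2 * (k \<bullet> v) * g'))) (at k)"
proof -
  have "((\<lambda>k::real^'d. (norm k)\<^sup>2) has_derivative (\<lambda>v. 2 * (k \<bullet> v))) (at k)"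
    unfolding power2_norm_eq_inner by (auto intro!: derivative_eq_intros simp: inner_commute)
  from has_derivative_compose[OF this assms[unfolded has_field_derivative_def]]
  have "((\<lambda>k. g ((norm k)\<^sup>2)) has_derivative (\<lambda>v. 2 * (k \<bullet> v) * g')) (at k)"
    by (simp add: mult.commute)
  then show ?thesis by (rule has_derivative_of_real)
qed

lemma partial_deriv_radial:
  fixes g :: "real \<Rightarrow> real" and k :: "real^'d::finite"
  assumes "(g has_real_derivative g') (at ((norm k)\<^sup>2))"
  shows "partial_deriv i (\<lambda>k. cplx (g ((norm k)\<^sup>2))) k = cplx (k $ i) * cplx (2 * g')"
    and "(\<lambda>k. cplx (g ((norm k)\<^sup>2))) differentiable (at k)"
  using partial_deriv_eq[OF has_derivative_radial[OF assms], of i] has_derivative_radial[OF assms]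
  by (auto simp: inner_axis differentiableI)

lemma norm_powr_radial: "norm k powr s = ((norm k)\<^sup>2) powr (s / 2)"
proof (cases "k = 0")
  case False
  then have "((norm k)\<^sup>2) powr (s / 2) = (norm k powr 2) powr (s / 2)" by simp
  also have "\<dots> = norm k powr s" by (simp only: powr_powr) simp
  finally show ?thesis by simp
qed simp

lemma partial_deriv_norm_powr:
  fixes k :: "real^'d::finite"
  assumes "k \<noteq> 0"
  shows "partial_deriv i (\<lambda>k. cplx (norm k powr s)) k
      = cplx (k $ i) * cplx (s * norm k powr (s - 2))"
    and "(\<lambda>k::real^'d. cplx (norm k powr s)) differentiable (at k)"
proof -
  have D: "((\<lambda>u. u powr (s / 2)) has_real_derivative (s / 2 * ((norm k)\<^sup>2) powr (s / 2 - 1))) (at ((norm k)\<^sup>2))"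
    using assms by (intro has_real_derivative_powr) auto
  have e: "(\<lambda>k::real^'d. cplx (norm k powr s)) = (\<lambda>k. cplx ((norm k)\<^sup>2 powr (s / 2)))"
    by (subst norm_powr_radial) (rule refl)
  have e2: "((norm k)\<^sup>2) powr (s / 2 - 1) = norm k powr (s - 2)"
    using norm_powr_radial[of k "s - 2"] by (simp add: diff_divide_distrib)
  show "partial_deriv i (\<lambda>k. cplx (norm k powr s)) k
      = cplx (k $ i) * cplx (s * norm k powr (s - 2))"
    unfolding e partial_deriv_radial(1)[OF D] e2 by simp
  show "(\<lambda>k::real^'d. cplx (norm k powr s)) differentiable (at k)"
    unfolding e by (rule partial_deriv_radial(2)[OF D])
qed

lemma superflat_norm_powr: 
  assumes "superflat f" shows "superflat (\<lambda>k. cplx (norm k powr s) * f k)"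
  unfolding superflat_def
proof (intro conjI allI)
  show "cplx (norm 0 powr s) * f 0 = 0" by simp
  fix t :: real
  obtain C where C: "\<And>k. norm k powr (t + s) * norm (f k) \<le> C" using assms unfolding superflat_def by metis
  have "norm k powr t * norm (cplx (norm k powr s) * f k) \<le> C" for k
    using C[of k] by (simp add: norm_mult powr_add mult.assoc)
  then show "\<exists>C. \<forall>k. norm k powr t * norm (cplx (norm k powr s) * f k) \<le> C" by blast
qed

lemma Psi_coord:
  fixes \<psi> :: "'d::finite cfun"
  assumes "\<psi> \<in> Psi" shows "(\<lambda>k. cplx (k $ i) * \<psi> k) \<in> Psi"
proof (rule Psi_coinduct)
  let ?B = "{\<lambda>k. cplx (k $ i) * \<psi> k | \<psi> :: 'd cfun. \<psi> \<in> Psi} \<union> Psi"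
  show "(\<lambda>k. cplx (k $ i) * \<psi> k) \<in> lspan ?B" using assms by (intro lspan_base) blast
  show "g 0 = 0" if "g \<in> ?B" for g using that Psi_zero_at by auto
  show "schwartz_closed ?B" unfolding schwartz_closed_def
  proof (intro ballI conjI allI)
    fix g x l assume g: "g \<in> ?B"
    have gS: "g \<in> schwartz" using g by (auto intro: schwartz_coord Psi_schwartz)
    show "rapid g" "g differentiable (at x)" using gS by (auto intro: schwartz_rapid schwartz_differentiable)
    consider "g \<in> Psi" | h where "h \<in> Psi" "g = (\<lambda>x. cplx (x $ i) * h x)" using g by blast
    then show "partial_deriv l g \<in> lspan ?B"
    proof cases
      case 1 then show ?thesis by (intro lspan_base) (auto intro: Psi_partial_deriv)
    next
      case 2
      have "partial_deriv l g = (\<lambda>x. cplx (x $ i) * partial_deriv l h x + (if l = i then 1 else 0) * h x)"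
        unfolding 2(2) by (intro ext partial_deriv_coord schwartz_differentiable Psi_schwartz 2(1))
      moreover have "(\<lambda>x. cplx (x $ i) * partial_deriv l h x) \<in> ?B"
        using Psi_partial_deriv[OF 2(1)] by blast
      moreover have "h \<in> ?B" using 2(1) by blast
      ultimately show ?thesis by (simp only: lspan_add lspan_cmult lspan_base)
    qed
  qed
qed

text \<open>Multiplication by \<open>norm k powr s\<close> preserves the space for all real \<open>s\<close>. Differentiation only
produces further functions of the same kind, with \<open>s\<close> lowered by two and a coordinate factor, and the
flatness at the origin absorbs the singular powers. This is what makes \<open>D_op\<close> act on the dual of \<open>Phi\<close>.\<close>

lemma Psi_norm_powr:
  fixes \<psi> :: "'d::finite cfun"
  assumes "\<psi> \<in> Psi" shows "(\<lambda>k. cplx (norm k powr s) * \<psi> k) \<in> Psi"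
proof (rule Psi_coinduct_flat)
  let ?A = "{\<lambda>k. cplx (norm k powr s) * \<psi> k | s (\<psi> :: 'd cfun). \<psi> \<in> Psi}"
  show "(\<lambda>k. cplx (norm k powr s) * \<psi> k) \<in> lspan ?A" using assms by (intro lspan_base) blast
  fix f assume "f \<in> ?A"
  then obtain s \<psi> where f: "f = (\<lambda>k. cplx (norm k powr s) * \<psi> k)" and p: "\<psi> \<in> Psi" by blast
  show "superflat f" unfolding f by (intro superflat_norm_powr Psi_superflat p)
  show "f differentiable (at k)" if "k \<noteq> 0" for k
    unfolding f using that by (intro differentiable_mult partial_deriv_norm_powr schwartz_differentiable Psi_schwartz p)
  fix i
  show "\<exists>g\<in>lspan ?A. \<forall>k. k \<noteq> 0 \<longrightarrow> partial_deriv i f k = g k"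
  proof (intro bexI allI impI)
    fix k :: "real^'d" assume k: "k \<noteq> 0"
    have "partial_deriv i f k = cplx (norm k powr s) * partial_deriv i \<psi> k
        + cplx (k $ i) * cplx (s * norm k powr (s - 2)) * \<psi> k"
      unfolding f using k
      by (subst partial_deriv_mult) (auto intro: partial_deriv_norm_powr schwartz_differentiable Psi_schwartz p simp: partial_deriv_norm_powr(1))
    then show "partial_deriv i f k = cplx (norm k powr s) * partial_deriv i \<psi> k
       + s * (cplx (norm k powr (s - 2)) * (cplx (k $ i) * \<psi> k))" by simp
  next
    have "(\<lambda>k. cplx (k $ i) * \<psi> k) \<in> Psi" by (rule Psi_coord[OF p])
    then have "(\<lambda>k. cplx (norm k powr (s - 2)) * (cplx (k $ i) * \<psi> k)) \<in> ?A"
      by - (intro CollectI exI conjI, rule refl)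
    moreover have "(\<lambda>k. cplx (norm k powr s) * partial_deriv i \<psi> k) \<in> ?A"
      using Psi_partial_deriv[OF p] by blast
    ultimately show "(\<lambda>k. cplx (norm k powr s) * partial_deriv i \<psi> k
       + s * (cplx (norm k powr (s - 2)) * (cplx (k $ i) * \<psi> k))) \<in> lspan ?A"
      by (intro lspan_add lspan_cmult lspan_base)
  qed
qed

section \<open>Gaussians, flat cutoffs and plateaus\<close>

text \<open>Closing under multiplication by coordinates makes explicit families of radial functions stable under
differentiation, since \<open>\<partial>\<^sub>i g(|k|\<^sup>2) = 2 k\<^sub>i g'(|k|\<^sup>2)\<close>.\<close>

inductive_set coord_closure :: "'d::finite cfun set \<Rightarrow> 'd cfun set" for B where
  coord_base: "f \<in> B \<Longrightarrow> f \<in> coord_closure B"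
| coord_step: "f \<in> coord_closure B \<Longrightarrow> (\<lambda>k. cplx (k $ i) * f k) \<in> coord_closure B"

lemma lspan_coord:
  assumes "f \<in> lspan (coord_closure B)"
  shows "(\<lambda>k. cplx (k $ i) * f k) \<in> lspan (coord_closure B)"
  using assms
proof induction
  case (lspan_base f) then show ?case by (intro lspan.lspan_base coord_step)
next
  case (lspan_add f g)
  then show ?case using lspan.lspan_add by (simp add: distrib_left)
next
  case (lspan_cmult f c)
  have "(\<lambda>k. cplx (k $ i) * (c * f k)) = (\<lambda>k. c * (cplx (k $ i) * f k))" by auto
  then show ?case using lspan.lspan_cmult[OF lspan_cmult.IH, of c] by simp
qed

lemma power_le_fact_exp: "u \<ge> 0 \<Longrightarrow> u ^ n \<le> fact n * exp (u::real)"
proof -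
  assume u: "u \<ge> 0"
  have s: "(\<lambda>n. u ^ n / fact n) sums exp u"
    using exp_converges[of u] by (simp add: divide_inverse mult.commute)
  have "sum (\<lambda>n. u ^ n / fact n) {n} \<le> (\<Sum>n. u ^ n / fact n)"
    using u s by (intro sum_le_suminf) (auto simp: sums_iff)
  then have "u ^ n / fact n \<le> exp u" using s by (simp add: sums_iff)
  then show ?thesis by (simp add: field_simps)
qed

definition gauss :: "'d::finite cfun" where
  "gauss x = cplx (exp (- (norm x)\<^sup>2 / 2))"

lemma partial_deriv_gauss:
  "partial_deriv i gauss k = - 1 * (cplx (k $ i) * gauss k)" "gauss differentiable (at k)"
proof -
  have D: "((\<lambda>u::real. exp (- u / 2)) has_real_derivative (- exp (- (norm k)\<^sup>2 / 2) / 2)) (at ((norm k)\<^sup>2))"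
    by (auto intro!: derivative_eq_intros)
  show "partial_deriv i gauss k = - 1 * (cplx (k $ i) * gauss k)"
    using partial_deriv_radial(1)[OF D] by (simp add: gauss_def[abs_def])
  show "gauss differentiable (at k)" using partial_deriv_radial(2)[OF D] by (simp add: gauss_def[abs_def])
qed

lemma rapid_gauss: "rapid gauss"
proof (rule rapidI)
  fix N
  have "norm x ^ N * norm (gauss x) \<le> 1 + 2 ^ N * fact N" for x :: "real^'d"
  proof -
    let ?u = "(norm x)\<^sup>2 / 2"
    have "norm x ^ N \<le> 1 + (norm x ^ N) ^ 2"
    proof -
      define y where "y = norm x ^ N"
      have "0 \<le> (y - 1)\<^sup>2" by simp
      then have 1: "2 * y \<le> 1 + y\<^sup>2" by (simp add: power2_diff)
      have 2: "0 \<le> y\<^sup>2" by simp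
      have "y \<le> 1 + y\<^sup>2" using 1 2 by linarith
      then show ?thesis by (simp add: y_def)
    qed
    also have "(norm x ^ N) ^ 2 = 2 ^ N * ?u ^ N"
      by (simp add: power_divide power_mult[symmetric] mult.commute)
    also have "1 + 2 ^ N * ?u ^ N \<le> exp ?u + 2 ^ N * (fact N * exp ?u)"
      by (intro add_mono mult_left_mono power_le_fact_exp) auto
    finally have "norm x ^ N * exp (- ?u) \<le> (exp ?u + 2 ^ N * (fact N * exp ?u)) * exp (- ?u)"
      by (intro mult_right_mono) auto
    also have "\<dots> = 1 + 2 ^ N * fact N" by (simp add: exp_minus field_simps)
    finally show ?thesis by (simp add: gauss_def)
  qed
  then show "\<exists>C. \<forall>x::real^'d. norm x ^ N * norm (gauss x) \<le> C" by blast
qed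

lemma schwartz_gauss: "(gauss :: 'd::finite cfun) \<in> schwartz"
proof (rule schwartz_coinduct)
  let ?A = "coord_closure {gauss :: 'd cfun}"
  show "gauss \<in> ?A" by (intro coord_base) auto
  show "schwartz_closed ?A" unfolding schwartz_closed_def
  proof
    fix f assume "f \<in> ?A"
    then show "rapid f \<and> (\<forall>x. f differentiable (at x)) \<and> (\<forall>i. partial_deriv i f \<in> lspan ?A)"
    proof induction
      case (coord_base f)
      have "(\<lambda>k. - 1 * (cplx (k $ i) * gauss k)) \<in> lspan ?A" for i
        by (intro lspan_cmult lspan_base coord_step coord_closure.coord_base) auto
      then have "partial_deriv i gauss \<in> lspan ?A" for i :: 'd
        by (subst partial_deriv_gauss(1)[abs_def])
      then show ?case using coord_base rapid_gauss partial_deriv_gauss(2) by auto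
    next
      case (coord_step f l)
      have "partial_deriv i (\<lambda>k. cplx (k $ l) * f k)
        = (\<lambda>x. cplx (x $ l) * partial_deriv i f x + (if i = l then 1 else 0) * f x)" for i
        by (intro ext partial_deriv_coord) (use coord_step in auto)
      moreover have "(\<lambda>x. cplx (x $ l) * partial_deriv i f x + (if i = l then 1 else 0) * f x) \<in> lspan ?A" for i
        using coord_step by (intro lspan_add lspan_cmult lspan_coord) (auto intro: lspan_base)
      ultimately show ?case using coord_step by (auto intro: rapid_coord differentiable_coord)
    qed
  qed
qed

text \<open>A smooth decreasing profile from \<open>1\<close> at \<open>0\<close> to \<open>0\<close> at infinity. It solves
\<open>\<sigma>' = - \<sigma> (1 - \<sigma>) (1 + 1 / u\<^sup>2)\<close>, so all its derivatives are polynomials in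
\<open>\<sigma>\<close>, \<open>1 - \<sigma>\<close> and \<open>1 / u\<close>; and \<open>\<sigma> (1 - \<sigma>)\<close> is flat at both ends.\<close>

definition sig :: "real \<Rightarrow> real" where "sig u = 1 / (1 + exp (u - 1 / u))"

lemma sig_bounds: "sig u > 0" "sig u < 1" "sig u \<le> exp (1 / u - u)" "1 - sig u \<le> exp (u - 1 / u)"
proof -
  have p: "1 + exp (u - 1 / u) > 0" by (simp add: add_pos_pos)
  show "sig u > 0" "sig u < 1" using p by (auto simp: sig_def)
  have "1 \<le> exp (1 / u - u) * (1 + exp (u - 1 / u))" by (simp add: distrib_left exp_add[symmetric])
  then show "sig u \<le> exp (1 / u - u)" using p by (simp add: sig_def divide_le_eq)
  have "1 - sig u = exp (u - 1 / u) / (1 + exp (u - 1 / u))" using p by (simp add: sig_def field_simps)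
  also have "\<dots> \<le> exp (u - 1 / u)" using p by (simp add: divide_le_eq)
  finally show "1 - sig u \<le> exp (u - 1 / u)" .
qed

lemma sig_deriv:
  assumes "u > 0" shows "(sig has_real_derivative (- (sig u * (1 - sig u) * (1 + 1 / u\<^sup>2)))) (at u)"
proof -
  let ?e = "exp (u - 1 / u)"
  have p: "1 + ?e > 0" "1 + ?e \<noteq> 0" by (simp_all add: add_pos_pos less_imp_neq[symmetric])
  have e: "1 - sig u = ?e / (1 + ?e)" using p by (simp add: sig_def field_simps)
  have "((\<lambda>u. 1 / (1 + exp (u - 1 / u))) has_real_derivative (- (?e * (1 + 1 / u\<^sup>2)) / (1 + ?e)\<^sup>2)) (at u)"
    using assms p by (auto intro!: derivative_eq_intros simp: power2_eq_square)
  also have "- (?e * (1 + 1 / u\<^sup>2)) / (1 + ?e)\<^sup>2 = - (sig u * (1 - sig u) * (1 + 1 / u\<^sup>2))"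
    unfolding e using p by (simp add: sig_def power2_eq_square)
  finally show ?thesis by (simp add: sig_def[abs_def])
qed

text \<open>Where \<open>u \<ge> 1\<close> the factor \<open>sig u\<close> is exponentially small in \<open>u\<close>, where \<open>u \<le> 1\<close> the other factor
is exponentially small in \<open>1 / u\<close>.\<close>

lemma sig_flat: "\<exists>C. \<forall>u>0. u powr t * (sig u * (1 - sig u)) \<le> C"
proof -
  obtain M :: nat where M: "\<bar>t\<bar> \<le> real M" using real_arch_simple by blast
  have *: "w powr s * exp (- w) \<le> fact M" if "w \<ge> 1" "s \<le> real M" for w s
  proof -
    have "w powr s \<le> w ^ M" using that by (subst powr_realpow[symmetric]) (auto intro: powr_mono)
    also have "\<dots> \<le> fact M * exp w" using that by (intro power_le_fact_exp) auto
    finally show ?thesis by (simp add: exp_minus field_simps)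
  qed
  have "u powr t * (sig u * (1 - sig u)) \<le> exp 1 * fact M" if u: "u > 0" for u
  proof (cases "u \<ge> 1")
    case True
    have "sig u * (1 - sig u) \<le> exp (1 / u - u) * 1"
      using sig_bounds[of u] by (intro mult_mono) auto
    also have "\<dots> \<le> exp 1 * exp (- u)" using True by (simp add: exp_add[symmetric])
    finally have "u powr t * (sig u * (1 - sig u)) \<le> exp 1 * (u powr t * exp (- u))"
      using mult_left_mono[of _ _ "u powr t"] by (fastforce simp: mult_ac)
    also have "\<dots> \<le> exp 1 * fact M" using *[of u t] True M by (intro mult_left_mono) auto
    finally show ?thesis .
  next
    case False
    have "sig u * (1 - sig u) \<le> 1 * exp (u - 1 / u)"
      using sig_bounds[of u] by (intro mult_mono) auto
    also have "\<dots> \<le> exp 1 * exp (- (1 / u))" using False by (simp add: exp_add[symmetric])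
    finally have "u powr t * (sig u * (1 - sig u)) \<le> exp 1 * (u powr t * exp (- (1 / u)))"
      using mult_left_mono[of _ _ "u powr t"] by (fastforce simp: mult_ac)
    also have "u powr t = (1 / u) powr (- t)" using u by (simp add: powr_minus powr_divide)
    also have "exp 1 * ((1 / u) powr (- t) * exp (- (1 / u))) \<le> exp 1 * fact M"
      using *[of "1 / u" "- t"] False u M by (intro mult_left_mono) auto
    finally show ?thesis using u by (simp add: powr_minus powr_divide)
  qed
  then show ?thesis by blast
qed

text \<open>The monomials generated by differentiating \<open>sig (norm k ^ 2)\<close>.\<close>

definition sigT :: "real \<Rightarrow> nat \<Rightarrow> nat \<Rightarrow> 'd::finite cfun" where
  "sigT t a b k = cplx (((norm k)\<^sup>2) powr t * sig ((norm k)\<^sup>2) ^ a * (1 - sig ((norm k)\<^sup>2)) ^ b)"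

lemma sigT_superflat:
  assumes "a \<ge> 1" "b \<ge> 1" shows "superflat (sigT t a b :: 'd::finite cfun)"
  unfolding superflat_def
proof (intro conjI allI)
  show "sigT t a b (0 :: real^'d) = 0" by (simp add: sigT_def)
  fix s :: real
  obtain C where C: "\<And>u. u > 0 \<Longrightarrow> u powr (s / 2 + t) * (sig u * (1 - sig u)) \<le> C" using sig_flat by blast
  have "norm k powr s * norm (sigT t a b k) \<le> max C 0" for k :: "real^'d"
  proof (cases "k = 0")
    case False
    let ?u = "(norm k)\<^sup>2"
    have u: "?u > 0" using False by simp
    have "sig ?u ^ a \<le> sig ?u ^ 1" "(1 - sig ?u) ^ b \<le> (1 - sig ?u) ^ 1"
      using assms sig_bounds[of ?u] by (intro power_decreasing; simp)+
    then have "sig ?u ^ a * (1 - sig ?u) ^ b \<le> sig ?u * (1 - sig ?u)"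
      using sig_bounds[of ?u] by (intro mult_mono) auto
    then have "?u powr (s / 2 + t) * (sig ?u ^ a * (1 - sig ?u) ^ b) \<le> C"
      using C[OF u] by (meson mult_left_mono order_trans powr_ge_zero)
    moreover have "norm k powr s * norm (sigT t a b k) = ?u powr (s / 2 + t) * (sig ?u ^ a * (1 - sig ?u) ^ b)"
    proof -
      have "norm (sigT t a b k) = ?u powr t * sig ?u ^ a * (1 - sig ?u) ^ b"
        using sig_bounds[of ?u] unfolding sigT_def norm_of_real by (intro abs_of_nonneg) simp
      then show ?thesis unfolding norm_powr_radial[of k s] by (simp add: powr_add mult_ac)
    qed
    ultimately show ?thesis by linarith
  qed simp
  then show "\<exists>C. \<forall>k::real^'d. norm k powr s * norm (sigT t a b k) \<le> C" by blast
qed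

lemma sigT_deriv:
  fixes k :: "real^'d::finite" and t :: real and a b :: nat
  assumes k: "k \<noteq> 0" and ab: "a \<ge> 1" "b \<ge> 1"
  shows "sigT t a b differentiable (at k)"
    and "partial_deriv i (sigT t a b) k =
      2 * t * (cplx (k $ i) * sigT (t - 1) a b k) +
      ((- 2 * real a) * (cplx (k $ i) * sigT t a (b + 1) k) +
       ((- 2 * real a) * (cplx (k $ i) * sigT (t - 2) a (b + 1) k) +
        ((2 * real b) * (cplx (k $ i) * sigT t (a + 1) b k) +
         (2 * real b) * (cplx (k $ i) * sigT (t - 2) (a + 1) b k))))"
proof -
  let ?u = "(norm k)\<^sup>2"
  have u: "?u > 0" using k by simp
  define s where "s = sig ?u"
  obtain a' b' where ab': "a = Suc a'" "b = Suc b'" using ab by (metis One_nat_def Suc_le_D)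
  define D where "D = t * ?u powr (t - 1) * s ^ a * (1 - s) ^ b
     - real a * ?u powr t * (1 + 1 / ?u\<^sup>2) * s ^ a * (1 - s) ^ (b + 1)
     + real b * ?u powr t * (1 + 1 / ?u\<^sup>2) * s ^ (a + 1) * (1 - s) ^ b"
  have "((\<lambda>u. u powr t * sig u ^ a * (1 - sig u) ^ b) has_real_derivative D) (at ?u)"
  proof -
    have 1: "((\<lambda>u. u powr t * sig u ^ a * (1 - sig u) ^ b) has_real_derivative
      ((?u powr t * (real a * (- (s * (1 - s) * (1 + 1 / ?u\<^sup>2))) * s ^ (a - 1))
         + (t * ?u powr (t - 1)) * s ^ a) * (1 - s) ^ b
       + ?u powr t * s ^ a * (real b * (s * (1 - s) * (1 + 1 / ?u\<^sup>2)) * (1 - s) ^ (b - 1)))) (at ?u)"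
      unfolding s_def
      by (rule derivative_eq_intros sig_deriv[OF u] has_real_derivative_powr[OF u] refl | simp)+
    have 2: "((?u powr t * (real a * (- (s * (1 - s) * (1 + 1 / ?u\<^sup>2))) * s ^ (a - 1))
         + (t * ?u powr (t - 1)) * s ^ a) * (1 - s) ^ b
       + ?u powr t * s ^ a * (real b * (s * (1 - s) * (1 + 1 / ?u\<^sup>2)) * (1 - s) ^ (b - 1))) = D"
    proof -
      define w where "w = 1 + 1 / ?u\<^sup>2"
      show ?thesis unfolding D_def ab' w_def[symmetric] by (simp add: algebra_simps)
    qed
    show ?thesis using 1 unfolding 2 .
  qed
  note R = partial_deriv_radial[OF this]
  have eq: "(sigT t a b :: 'd cfun) = (\<lambda>k. cplx ((norm k)\<^sup>2 powr t * sig ((norm k)\<^sup>2) ^ a * (1 - sig ((norm k)\<^sup>2)) ^ b))"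
    by (auto simp: sigT_def)
  show "sigT t a b differentiable (at k)" unfolding eq by (rule R(2))
  have p2: "?u powr (t - 2) = ?u powr t * (1 / ?u\<^sup>2)" using u by (simp add: powr_diff powr_realpow)
  have D2: "2 * D = 2 * t * (?u powr (t - 1) * s ^ a * (1 - s) ^ b) +
      ((- 2 * real a) * (?u powr t * s ^ a * (1 - s) ^ (b + 1)) +
       ((- 2 * real a) * (?u powr (t - 2) * s ^ a * (1 - s) ^ (b + 1)) +
        ((2 * real b) * (?u powr t * s ^ (a + 1) * (1 - s) ^ b) +
         (2 * real b) * (?u powr (t - 2) * s ^ (a + 1) * (1 - s) ^ b))))"
  proof -
    define q where "q = 1 / ?u\<^sup>2"
    show ?thesis unfolding D_def p2 q_def[symmetric] by (simp add: algebra_simps)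
  qed
  show "partial_deriv i (sigT t a b) k =
      2 * t * (cplx (k $ i) * sigT (t - 1) a b k) +
      ((- 2 * real a) * (cplx (k $ i) * sigT t a (b + 1) k) +
       ((- 2 * real a) * (cplx (k $ i) * sigT (t - 2) a (b + 1) k) +
        ((2 * real b) * (cplx (k $ i) * sigT t (a + 1) b k) +
         (2 * real b) * (cplx (k $ i) * sigT (t - 2) (a + 1) b k))))"
    unfolding eq R(1) D2 sigT_def s_def[symmetric] by (simp add: algebra_simps)
qed

definition sigT_closure :: "'d::finite cfun set" where
  "sigT_closure = coord_closure {sigT t a b | t a b. a \<ge> 1 \<and> b \<ge> 1}"

lemma sigT_in_closure: "a \<ge> 1 \<Longrightarrow> b \<ge> 1 \<Longrightarrow> sigT t a b \<in> sigT_closure"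
  unfolding sigT_closure_def by (intro coord_base CollectI exI conjI, rule refl)

lemma sigT_closure_coord: "f \<in> sigT_closure \<Longrightarrow> (\<lambda>k. cplx (k $ i) * f k) \<in> sigT_closure"
  unfolding sigT_closure_def by (rule coord_step)

lemma sigT_closure_induct [consumes 1, case_names base step]:
  assumes "f \<in> sigT_closure" "\<And>t a b. a \<ge> 1 \<Longrightarrow> b \<ge> 1 \<Longrightarrow> Q (sigT t a b)"
    "\<And>f i. f \<in> sigT_closure \<Longrightarrow> Q f \<Longrightarrow> Q (\<lambda>k. cplx (k $ i) * f k)"
  shows "Q f"
  using assms(1) unfolding sigT_closure_def
proof induction
  case (coord_base f)
  then obtain t a b where "f = sigT t a b" "a \<ge> 1" "b \<ge> 1" by blast
  then show ?case using assms(2) by simp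
next
  case (coord_step f i)
  then show ?case using assms(3)[of f i] unfolding sigT_closure_def by simp
qed

lemma sigT_partial_in_span:
  fixes t :: real and a b :: nat and i :: "'d::finite"
  assumes ab: "a \<ge> 1" "b \<ge> 1"
  shows "\<exists>h\<in>lspan sigT_closure. \<forall>k. k \<noteq> 0 \<longrightarrow> partial_deriv i (sigT t a b) k = h k"
proof -
  define h where "h = (\<lambda>k::real^'d. 2 * t * (cplx (k $ i) * sigT (t - 1) a b k) +
      ((- 2 * real a) * (cplx (k $ i) * sigT t a (b + 1) k) +
       ((- 2 * real a) * (cplx (k $ i) * sigT (t - 2) a (b + 1) k) +
        ((2 * real b) * (cplx (k $ i) * sigT t (a + 1) b k) +
         (2 * real b) * (cplx (k $ i) * sigT (t - 2) (a + 1) b k)))))"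
  have T: "(\<lambda>k. cplx (k $ i) * sigT t a b k) \<in> sigT_closure" if "a \<ge> 1" "b \<ge> 1" for t a b
    by (intro sigT_closure_coord sigT_in_closure that)
  have "h \<in> lspan sigT_closure"
    unfolding h_def using ab by (intro lspan_add lspan_cmult lspan_base T) auto
  moreover have "partial_deriv i (sigT t a b) k = h k" if "k \<noteq> 0" for k
    unfolding h_def by (rule sigT_deriv(2)[OF that ab])
  ultimately show ?thesis by auto
qed

text \<open>With both exponents positive each monomial is superflat, and differentiation keeps both exponents positive.\<close>

lemma coord_sigT_Psi:
  fixes f :: "'d::finite cfun"
  assumes "f \<in> lspan sigT_closure" shows "f \<in> Psi"
proof (rule Psi_coinduct_flat[OF _ _ _ assms])
  show "superflat g" if "g \<in> sigT_closure" for g :: "'d cfun"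
    using that by (induction rule: sigT_closure_induct) (auto intro: superflat_coord sigT_superflat)
  show dd: "g differentiable (at k)" if "g \<in> sigT_closure" "k \<noteq> 0" for g :: "'d cfun" and k
    using that by (induction rule: sigT_closure_induct) (auto intro: differentiable_coord sigT_deriv)
  show "\<exists>h\<in>lspan sigT_closure. \<forall>k. k \<noteq> 0 \<longrightarrow> partial_deriv i g k = h k" if "g \<in> sigT_closure" for g :: "'d cfun" and i
    using that
  proof (induction rule: sigT_closure_induct)
    case (base t a b) then show ?case by (rule sigT_partial_in_span)
  next
    case (step g l)
    then obtain h where h: "h \<in> lspan sigT_closure" "\<And>k. k \<noteq> 0 \<Longrightarrow> partial_deriv i g k = h k" by blast
    define h' where "h' = (\<lambda>k. cplx (k $ l) * h k + (if i = l then 1 else 0) * g k)"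
    have "partial_deriv i (\<lambda>k. cplx (k $ l) * g k) k = h' k" if "k \<noteq> 0" for k
      using partial_deriv_coord[OF dd[OF step.hyps that], of i l] h(2)[OF that] by (simp add: h'_def)
    moreover have "h' \<in> lspan sigT_closure"
      using h(1) step.hyps unfolding h'_def sigT_closure_def by (intro lspan_add[OF lspan_coord lspan_cmult[OF lspan_base]])
    ultimately show ?case by auto
  qed
qed

text \<open>The product \<open>\<sigma> (1 - \<sigma>)\<close> as a radial function: both factors are positive off the origin, so dividing by it is
harmless there.\<close>

definition bump :: "'d::finite cfun" where "bump = sigT 0 1 1"

lemma bump_Psi: "bump \<in> Psi"
  unfolding bump_def by (rule coord_sigT_Psi[OF lspan_base[OF sigT_in_closure]]; simp)

lemma bump_nonzero: "k \<noteq> 0 \<Longrightarrow> bump k \<noteq> 0"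
  using sig_bounds[of "(norm k)\<^sup>2"] by (auto simp: bump_def sigT_def)

text \<open>A Schwartz function with value \<open>1\<close> at the origin all of whose derivatives vanish there. The origin is treated
separately because \<open>sig 0 = 1 / 2\<close>, by the convention \<open>1 / 0 = 0\<close>.\<close>

definition plateau :: "'d::finite cfun" where
  "plateau k = cplx (if k = 0 then 1 else sig ((norm k)\<^sup>2))"

lemma plateau_deriv:
  "plateau differentiable (at (k::real^'d::finite))" "partial_deriv i (plateau :: 'd cfun) \<in> Psi"
proof -
  let ?h = "\<lambda>k::real^'d. (- 2) * (cplx (k $ i) * sigT 0 1 1 k) + (- 2) * (cplx (k $ i) * sigT (- 2) 1 1 k)"
  have hP: "?h \<in> Psi" by (intro coord_sigT_Psi lspan_add lspan_cmult lspan_base sigT_closure_coord sigT_in_closure) auto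
  have at0: "(plateau has_derivative (\<lambda>v. 0)) (at (0::real^'d))"
  proof (rule has_derivative_zero_if_quadratic)
    fix k :: "real^'d"
    show "norm (plateau k - plateau (0::real^'d)) \<le> exp 1 * (norm k)\<^sup>2"
    proof (cases "k = 0")
      case False
      let ?u = "(norm k)\<^sup>2"
      have u: "?u > 0" using False by simp
      have "1 - sig ?u \<le> exp 1 * ?u"
      proof (cases "?u \<le> 1")
        case True
        have "1 - sig ?u \<le> exp (?u - 1 / ?u)" by (rule sig_bounds)
        also have "\<dots> \<le> exp 1 * exp (- (1 / ?u))" using True by (simp add: exp_add[symmetric])
        also have "exp (- (1 / ?u)) \<le> ?u"
        proof -
          have "1 / ?u \<le> exp (1 / ?u)" using exp_ge_add_one_self[of "1 / ?u"] by linarith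
          then show ?thesis using u by (simp add: exp_minus field_simps)
        qed
        finally show ?thesis by simp
      next
        case False
        have "1 - sig ?u \<le> 1" using sig_bounds[of ?u] by simp
        also have "1 \<le> exp 1 * (1::real)" using exp_ge_add_one_self[of 1] by simp
        also have "\<dots> \<le> exp 1 * ?u" using False by (intro mult_left_mono) auto
        finally show ?thesis .
      qed
      moreover have "norm (plateau k - plateau (0::real^'d)) = 1 - sig ?u"
      proof -
        have "plateau k - plateau (0::real^'d) = cplx (- (1 - sig ?u))" using False by (simp add: plateau_def)
        then have "norm (plateau k - plateau (0::real^'d)) = norm (cplx (- (1 - sig ?u)))" by (rule arg_cong)
        also have "\<dots> = \<bar>- (1 - sig ?u)\<bar>" by (rule norm_of_real)
        finally show ?thesis using sig_bounds[of ?u] by simp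
      qed
      ultimately show ?thesis by simp
    qed simp
  qed
  have off: "partial_deriv i plateau k = ?h k \<and> plateau differentiable (at k)" if k: "k \<noteq> 0" for k :: "real^'d"
  proof -
    let ?u = "(norm k)\<^sup>2"
    have u: "?u > 0" using k by simp
    note R = has_derivative_radial[OF sig_deriv[OF u]]
    have "eventually (\<lambda>x. x \<in> - {0}) (nhds k)" using k by (intro eventually_nhds_in_open) auto
    then have ev: "eventually (\<lambda>x. plateau x = cplx (sig ((norm x)\<^sup>2))) (nhds k)"
      by (rule eventually_mono) (auto simp: plateau_def)
    have D: "(plateau has_derivative (\<lambda>v. cplx (2 * (k \<bullet> v) * (- (sig ?u * (1 - sig ?u) * (1 + 1 / ?u\<^sup>2)))))) (at k)"
      by (rule has_derivative_transform_eventually[OF R])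
         (use ev eventually_nhds_x_imp_x[OF ev] in \<open>auto simp: eventually_at_filter elim: eventually_mono\<close>)
    have p2: "?u powr (- 2) = 1 / ?u\<^sup>2" using u by (simp add: powr_minus_divide powr_realpow)
    have "partial_deriv i plateau k = ?h k"
    proof -
      define q where "q = 1 / ?u\<^sup>2"
      show ?thesis unfolding partial_deriv_eq[OF D] sigT_def p2 q_def[symmetric]
        using u k by (simp add: inner_axis algebra_simps)
    qed
    then show ?thesis using D differentiableI by blast
  qed
  show "plateau differentiable (at k)" using off at0 differentiableI by (cases "k = 0") blast+
  have "partial_deriv i plateau = ?h"
  proof
    fix k show "partial_deriv i plateau k = ?h k"
      using off[of k] partial_deriv_eq[OF at0] by (cases "k = 0") auto
  qed
  then show "partial_deriv i (plateau :: 'd cfun) \<in> Psi" using hP by simp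
qed

lemma plateau_schwartz: "(plateau :: 'd::finite cfun) \<in> schwartz"
proof (rule schwartz_coinduct)
  let ?A = "insert (plateau :: 'd cfun) Psi"
  show "plateau \<in> ?A" by simp
  have r: "rapid (plateau :: 'd cfun)"
  proof (rule rapidI)
    fix N
    have "norm k ^ N * norm (plateau k) \<le> exp 1 * fact N" for k :: "real^'d"
    proof (cases "norm k \<ge> 1")
      case True
      then have k: "k \<noteq> 0" by auto
      let ?u = "(norm k)\<^sup>2"
      have u1: "?u \<ge> 1" "norm k \<le> ?u"
        using True power_increasing[of 1 2 "norm k"] by (auto intro: one_le_power)
      have "sig ?u \<le> exp (1 / ?u - ?u)" by (rule sig_bounds)
      also have "\<dots> \<le> exp 1 * exp (- ?u)" using u1 by (simp add: exp_add[symmetric] divide_le_eq)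
      finally have s: "sig ?u \<le> exp 1 * exp (- ?u)" .
      have "norm k ^ N \<le> ?u ^ N" using u1 by (intro power_mono) auto
      also have "\<dots> \<le> fact N * exp ?u" by (rule power_le_fact_exp) simp
      finally have "norm k ^ N * sig ?u \<le> (fact N * exp ?u) * (exp 1 * exp (- ?u))"
        using s sig_bounds[of ?u] by (intro mult_mono) auto
      then show ?thesis using k sig_bounds[of ?u] by (simp add: plateau_def exp_minus field_simps)
    next
      case False
      have "norm (plateau k) \<le> 1" using sig_bounds[of "(norm k)\<^sup>2"] by (simp add: plateau_def)
      then have "norm k ^ N * norm (plateau k) \<le> 1 * 1" using False by (intro mult_mono power_le_one) auto
      also have "\<dots> \<le> exp 1 * fact N" using exp_ge_add_one_self[of 1] by (intro mult_mono) (auto simp: fact_ge_1)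
      finally show ?thesis .
    qed
    then show "\<exists>C. \<forall>k::real^'d. norm k ^ N * norm (plateau k) \<le> C" by blast
  qed
  show "schwartz_closed ?A" unfolding schwartz_closed_def
  proof (intro ballI conjI allI)
    fix f x i assume "f \<in> ?A"
    then consider "f = plateau" | "f \<in> Psi" by blast
    then show "rapid f" "f differentiable (at x)" "partial_deriv i f \<in> lspan ?A"
      using r plateau_deriv
      by (cases; auto intro!: lspan_base intro: schwartz_rapid schwartz_differentiable Psi_partial_deriv Psi_schwartz)+
  qed
qed

lemma Psi_scale:
  fixes f :: "'d::finite cfun"
  assumes f: "f \<in> Psi" and c0: "c \<noteq> 0" shows "(\<lambda>k. f (c *\<^sub>R k)) \<in> Psi"
proof -
  have SP: "(\<lambda>k::real^'d. f (0 + c *\<^sub>R k)) \<in> Psi" if "f \<in> Psi" for f :: "'d cfun"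
  proof (rule Psi_coinduct)
    let ?A = "{\<lambda>k::real^'d. f (0 + c *\<^sub>R k) | f. f \<in> Psi}"
    show "(\<lambda>k::real^'d. f (0 + c *\<^sub>R k)) \<in> lspan ?A" using that by (intro lspan_base) blast
    show "g 0 = 0" if "g \<in> ?A" for g using that Psi_zero_at by auto
    show "schwartz_closed ?A" unfolding schwartz_closed_def
    proof (intro ballI conjI allI)
      fix g x l assume "g \<in> ?A"
      then obtain h where g: "g = (\<lambda>k. h (0 + c *\<^sub>R k))" and h: "h \<in> Psi" by blast
      have gS: "g \<in> schwartz" unfolding g by (rule schwartz_affine(1)[OF Psi_schwartz[OF h] c0])
      then show "rapid g" "g differentiable (at x)" by (auto intro: schwartz_rapid schwartz_differentiable)
      show "partial_deriv l g \<in> lspan ?A"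
        unfolding g schwartz_affine(2)[OF Psi_schwartz[OF h] c0]
        using Psi_partial_deriv[OF h] by (intro lspan_cmult lspan_base) blast
    qed
  qed
  from SP[OF f] show ?thesis by simp
qed

text \<open>Two dilates of the plateau agree to infinite order at the origin. Hence, on the Fourier side, dilates of
its transform with the same total mass differ by elements of \<open>Phi\<close>.\<close>

lemma plateau_dilation_diff:
  assumes "c \<noteq> 0" shows "(\<lambda>k::real^'d::finite. plateau k - plateau (c *\<^sub>R k)) \<in> Psi"
proof (rule PsiI)
  have S: "(\<lambda>k::real^'d. plateau (0 + c *\<^sub>R k)) \<in> schwartz" by (rule schwartz_affine(1)[OF plateau_schwartz assms])
  then show "(\<lambda>k::real^'d. plateau k - plateau (c *\<^sub>R k)) \<in> schwartz"
    using schwartz_diff[OF plateau_schwartz] by simp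
  show "plateau (0::real^'d) - plateau (c *\<^sub>R (0::real^'d)) = 0" by simp
  fix i :: 'd
  have "partial_deriv i (\<lambda>k::real^'d. plateau k - plateau (c *\<^sub>R k)) k
     = partial_deriv i plateau k + (- cplx c) * partial_deriv i plateau (0 + c *\<^sub>R k)" for k
  proof -
    have "partial_deriv i (\<lambda>k::real^'d. plateau k + (- 1) * plateau (0 + c *\<^sub>R k)) k
      = partial_deriv i plateau k + partial_deriv i (\<lambda>k. (- 1) * plateau (0 + c *\<^sub>R k)) k"
      by (rule partial_deriv_add) (intro schwartz_differentiable plateau_schwartz schwartz_cmult S)+
    also have "partial_deriv i (\<lambda>k. (- 1) * plateau (0 + c *\<^sub>R k)) k = (- 1) * partial_deriv i (\<lambda>k. plateau (0 + c *\<^sub>R k)) k"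
      by (rule partial_deriv_cmult[OF schwartz_differentiable[OF S]])
    also have "partial_deriv i (\<lambda>k. plateau (0 + c *\<^sub>R k)) k = cplx c * partial_deriv i plateau (0 + c *\<^sub>R k)"
      by (subst schwartz_affine(2)[OF plateau_schwartz assms]) (rule refl)
    finally show ?thesis by simp
  qed
  then have e: "partial_deriv i (\<lambda>k::real^'d. plateau k - plateau (c *\<^sub>R k))
     = (\<lambda>k. partial_deriv i plateau k + (- cplx c) * partial_deriv i plateau (0 + c *\<^sub>R k))" by auto
  show "partial_deriv i (\<lambda>k::real^'d. plateau k - plateau (c *\<^sub>R k)) \<in> Psi"
    unfolding e using Psi_scale[OF plateau_deriv(2) assms] by (intro Psi_add Psi_cmult plateau_deriv(2)) simp
qed

section \<open>The Fourier transform of Schwartz functions\<close>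

definition fconst :: "'d::finite itself \<Rightarrow> real" where
  "fconst _ = (2 * pi) powr (- real CARD('d) / 2)"

lemma fconst_pos: "fconst TYPE('d::finite) > 0" by (simp add: fconst_def)

definition chr :: "real^'d::finite \<Rightarrow> real^'d \<Rightarrow> complex" where
  "chr k x = exp (- (\<i> * cplx (k \<bullet> x)))"

lemma chr_simps [simp]: "norm (chr k x) = 1" "chr 0 x = 1" "chr k 0 = 1"
  by (auto simp: chr_def)

lemma chr_add: "chr (k + l) x = chr k x * chr l x" "chr k (x + y) = chr k x * chr k y"
  by (auto simp: chr_def exp_add[symmetric] inner_add_left inner_add_right algebra_simps)

lemma chr_minus: "chr (- k) x = chr k (- x)" by (simp add: chr_def)

lemma chr_commute: "chr k x = chr x k" by (simp add: chr_def inner_commute)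

lemma chr_scale: "chr (c *\<^sub>R k) x = chr k (c *\<^sub>R x)" by (simp add: chr_def)

lemma chr_measurable [measurable]: "chr k \<in> borel_measurable borel"
  unfolding chr_def[abs_def] by (intro borel_measurable_continuous_onI continuous_intros)

lemma chr_measurable2 [measurable]: "(\<lambda>p. chr (fst p) (snd p)) \<in> borel_measurable (borel \<Otimes>\<^sub>M borel)"
  unfolding chr_def borel_prod by (intro borel_measurable_continuous_onI continuous_intros)

lemma fourier_eq: "fourier (f :: 'd::finite cfun) k = cplx (fconst TYPE('d)) * (LBINT x. chr k x * f x)"
  by (simp add: fourier_def fconst_def chr_def)

lemma integrable_chr_mult:
  fixes f :: "'d::finite cfun"
  assumes "integrable lborel f" shows "integrable lborel (\<lambda>x. chr k x * f x)"
  by (rule Bochner_Integration.integrable_bound[OF assms])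
     (use assms in \<open>auto simp: norm_mult dest: borel_measurable_integrable\<close>)

lemma fourier_norm_le:
  fixes f :: "'d::finite cfun"
  shows "norm (fourier f k) \<le> fconst TYPE('d) * (LBINT x. norm (f x))"
proof -
  have "norm (LBINT x. chr k x * f x) \<le> (LBINT x. norm (chr k x * f x))" by (rule integral_norm_bound)
  then show ?thesis using fconst_pos[where 'd='d] by (simp add: fourier_eq norm_mult)
qed

lemma fourier_add:
  fixes f g :: "'d::finite cfun"
  assumes "integrable lborel f" "integrable lborel g"
  shows "fourier (\<lambda>x. f x + g x) k = fourier f k + fourier g k"
  using integrable_chr_mult[OF assms(1)] integrable_chr_mult[OF assms(2)]
  by (simp add: fourier_eq distrib_left)

lemma fourier_cmult: "fourier (\<lambda>x. c * f x) k = c * fourier f k"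
  by (simp add: fourier_eq mult.left_commute[of _ c])

lemma fourier_diff:
  fixes f g :: "'d::finite cfun"
  assumes "integrable lborel f" "integrable lborel g"
  shows "fourier (\<lambda>x. f x - g x) k = fourier f k - fourier g k"
  using fourier_add[of f "\<lambda>x. - 1 * g x"] assms fourier_cmult[of "- 1" g] by simp

lemma fourier_reflect:
  fixes f :: "'d::finite cfun"
  assumes "integrable lborel f" shows "fourier (\<lambda>x. f (- x)) k = fourier f (- k)"
proof -
  have "(LBINT x. chr (- k) (0 + (- 1) *\<^sub>R x) * f (0 + (- 1) *\<^sub>R x)) = (LBINT x. chr (- k) x * f x) /\<^sub>R \<bar>- 1\<bar> ^ DIM(real^'d)"
    by (rule integral_affine_euclidean[OF integrable_chr_mult[OF assms]]) simp
  then show ?thesis by (simp add: fourier_eq chr_minus)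
qed

lemma norm_exp_i_remainder: "norm (exp (\<i> * cplx t) - 1 - \<i> * cplx t) \<le> t\<^sup>2"
  using Taylor_exp[of "\<i> * cplx t" 1] by (simp add: norm_mult power2_eq_square diff_diff_eq)

lemma integrable_norm_sq_schwartz:
  fixes f :: "'d::finite cfun"
  assumes "f \<in> schwartz" shows "integrable lborel (\<lambda>x. (norm x)\<^sup>2 * norm (f x))"
proof -
  have "integrable lborel (\<lambda>x. \<Sum>i\<in>UNIV. norm (cplx (x $ i) * (cplx (x $ i) * f x)))"
    by (intro Bochner_Integration.integrable_sum integrable_norm schwartz_integrable schwartz_coord assms)
  moreover have "(norm x)\<^sup>2 * norm (f x) = (\<Sum>i\<in>UNIV. norm (cplx (x $ i) * (cplx (x $ i) * f x)))" for x
    by (simp add: norm_vec_def L2_set_def sum_nonneg norm_mult sum_distrib_right power2_eq_square flip: mult.assoc)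
  ultimately show ?thesis by simp
qed

text \<open>Differentiation under the integral sign, with the quadratic remainder of the exponential dominated by
\<open>(norm x)\<^sup>2 * norm (f x)\<close>.\<close>

lemma fourier_partial_deriv:
  fixes f :: "'d::finite cfun"
  assumes f: "f \<in> schwartz"
  shows "fourier f differentiable (at k)"
    and "partial_deriv i (fourier f) k = fourier (\<lambda>x. (- \<i>) * (cplx (x $ i) * f x)) k"
proof -
  let ?c = "cplx (fconst TYPE('d))"
  let ?D = "\<lambda>v. \<Sum>i\<in>UNIV. cplx (v $ i) * fourier (\<lambda>x. (- \<i>) * (cplx (x $ i) * f x)) k"
  note int = schwartz_integrable[OF f]
  have intc: "integrable lborel (\<lambda>x. cplx (x $ i) * f x)" for i
    by (rule schwartz_integrable[OF schwartz_coord[OF f]])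
  have lin: "bounded_linear ?D"
    by (intro bounded_linear_sum bounded_linear_mult_const bounded_linear_compose[OF bounded_linear_of_real] bounded_linear_vec_nth)
  have Deq: "?D v = ?c * (LBINT x. chr k x * ((- \<i>) * cplx (v \<bullet> x) * f x))" for v
  proof -
    have "(LBINT x. chr k x * ((- \<i>) * cplx (v \<bullet> x) * f x))
       = (LBINT x. (\<Sum>i\<in>UNIV. cplx (v $ i) * (chr k x * ((- \<i>) * (cplx (x $ i) * f x)))))"
      by (intro Bochner_Integration.integral_cong refl)
         (simp add: inner_vec_def sum_distrib_left sum_distrib_right mult_ac)
    also have "\<dots> = (\<Sum>i\<in>UNIV. \<integral>x. cplx (v $ i) * (chr k x * ((- \<i>) * (cplx (x $ i) * f x))) \<partial>lborel)"
      by (intro Bochner_Integration.integral_sum integrable_mult_right integrable_chr_mult intc)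
    also have "\<dots> = (\<Sum>i\<in>UNIV. cplx (v $ i) * (LBINT x. chr k x * ((- \<i>) * (cplx (x $ i) * f x))))"
      by (simp only: integral_mult_right_zero)
    finally have I: "(LBINT x. chr k x * ((- \<i>) * cplx (v \<bullet> x) * f x)) = \<dots>" .
    show ?thesis unfolding I fourier_eq sum_distrib_left
      by (intro sum.cong refl) (simp only: mult.left_commute)
  qed
  define M where "M = fconst TYPE('d) * (LBINT x. (norm x)\<^sup>2 * norm (f x))"
  have rem: "norm (fourier f (k + h) - fourier f k - ?D h) \<le> M * (norm h)\<^sup>2" for h
  proof -
    have intv: "integrable lborel (\<lambda>x. (- \<i>) * cplx (h \<bullet> x) * f x)"
    proof -
      have "integrable lborel (\<lambda>x. (- \<i>) * (\<Sum>i\<in>UNIV. cplx (h $ i) * (cplx (x $ i) * f x)))"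
        by (intro integrable_mult_right Bochner_Integration.integrable_sum intc)
      then show ?thesis by (simp add: inner_vec_def sum_distrib_left sum_distrib_right mult_ac)
    qed
    let ?R = "\<lambda>x. chr k x * (chr h x - 1 - (- \<i>) * cplx (h \<bullet> x)) * f x"
    have "fourier f (k + h) - fourier f k - ?D h
      = ?c * ((LBINT x. chr (k + h) x * f x) - (LBINT x. chr k x * f x)
           - (LBINT x. chr k x * ((- \<i>) * cplx (h \<bullet> x) * f x)))"
      unfolding Deq by (simp add: fourier_eq algebra_simps)
    also have "\<dots> = ?c * (LBINT x. chr (k + h) x * f x - chr k x * f x - chr k x * ((- \<i>) * cplx (h \<bullet> x) * f x))"
      using integrable_chr_mult[OF int] integrable_chr_mult[OF intv]
      by (subst Bochner_Integration.integral_diff, simp_all del: mult_minus_left)+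
    also have "\<dots> = ?c * (LBINT x. ?R x)"
      by (simp add: chr_add algebra_simps)
    finally have "norm (fourier f (k + h) - fourier f k - ?D h) = fconst TYPE('d) * norm (LBINT x. ?R x)"
      using fconst_pos[where 'd='d] by (simp add: norm_mult)
    moreover have "norm (LBINT x. ?R x) \<le> (LBINT x. (norm h)\<^sup>2 * ((norm x)\<^sup>2 * norm (f x)))"
    proof (rule Bochner_Integration.integral_norm_bound_integral)
      show "integrable lborel ?R"
      proof -
        have "integrable lborel (\<lambda>x. chr (k + h) x * f x - chr k x * f x - chr k x * ((- \<i>) * cplx (h \<bullet> x) * f x))"
          by (intro Bochner_Integration.integrable_diff integrable_chr_mult int intv)
        then show ?thesis by (simp add: chr_add algebra_simps)
      qed
      show "integrable lborel (\<lambda>x. (norm h)\<^sup>2 * ((norm x)\<^sup>2 * norm (f x)))"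
        by (intro integrable_mult_right integrable_norm_sq_schwartz f)
      fix x :: "real^'d"
      have "norm (chr h x - 1 - (- \<i>) * cplx (h \<bullet> x)) \<le> (h \<bullet> x)\<^sup>2"
        using norm_exp_i_remainder[of "- (h \<bullet> x)"] by (simp add: chr_def)
      also have "\<dots> \<le> (norm h * norm x)\<^sup>2"
        using Cauchy_Schwarz_ineq2[of h x] by (intro abs_le_square_iff[THEN iffD1]) (simp add: abs_mult)
      finally have "norm (chr h x - 1 - (- \<i>) * cplx (h \<bullet> x)) * norm (f x) \<le> (norm h * norm x)\<^sup>2 * norm (f x)"
        by (intro mult_right_mono) auto
      then show "norm (?R x) \<le> (norm h)\<^sup>2 * ((norm x)\<^sup>2 * norm (f x))"
        by (simp add: norm_mult power_mult_distrib mult.assoc)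
    qed
    ultimately have "norm (fourier f (k + h) - fourier f k - ?D h)
        \<le> fconst TYPE('d) * (LBINT x. (norm h)\<^sup>2 * ((norm x)\<^sup>2 * norm (f x)))"
      using fconst_pos[where 'd='d] by (simp only: mult_left_mono less_imp_le)
    also have "(LBINT x. (norm h)\<^sup>2 * ((norm x)\<^sup>2 * norm (f x))) = (norm h)\<^sup>2 * (LBINT x. (norm x)\<^sup>2 * norm (f x))"
      by (rule integral_mult_right_zero)
    finally show ?thesis unfolding M_def by (simp only: mult_ac)
  qed
  have D: "(fourier f has_derivative ?D) (at k)"
    unfolding has_derivative_at
  proof (intro conjI lin)
    have "((\<lambda>h::real^'d. M * norm h) \<longlongrightarrow> M * norm (0::real^'d)) (at 0)"
      by (intro tendsto_intros)
    then have lim: "((\<lambda>h::real^'d. M * norm h) \<longlongrightarrow> 0) (at 0)" by simp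
    show "(\<lambda>h. norm (fourier f (k + h) - fourier f k - ?D h) / norm h) \<midarrow>0\<rightarrow> 0"
    proof (rule tendsto_sandwich[OF _ _ tendsto_const lim])
      show "\<forall>\<^sub>F h in at 0. norm (fourier f (k + h) - fourier f k - ?D h) / norm h \<le> M * norm h"
        unfolding eventually_at
        using rem by (intro exI[of _ 1]) (auto simp: divide_le_eq power2_eq_square mult_ac)
    qed auto
  qed
  show "fourier f differentiable (at k)" using D differentiableI by blast
  show "partial_deriv i (fourier f) k = fourier (\<lambda>x. (- \<i>) * (cplx (x $ i) * f x)) k"
    unfolding partial_deriv_eq[OF D]
    by (subst sum.remove[of _ i]) (auto simp: axis_def intro!: sum.neutral)
qed

lemma onorm_partial_derivs_le:
  "onorm (\<lambda>v::real^'d::finite. \<Sum>i\<in>UNIV. cplx (v $ i) * p i) \<le> (\<Sum>i\<in>UNIV. norm (p i))"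
proof (rule onorm_le)
  fix v :: "real^'d"
  have "norm (\<Sum>i\<in>UNIV. cplx (v $ i) * p i) \<le> (\<Sum>i\<in>UNIV. \<bar>v $ i\<bar> * norm (p i))"
    by (rule order_trans[OF norm_sum]) (simp add: norm_mult)
  also have "\<dots> \<le> (\<Sum>i\<in>UNIV. norm v * norm (p i))"
    by (intro sum_mono mult_right_mono component_le_norm_cart) auto
  finally show "norm (\<Sum>i\<in>UNIV. cplx (v $ i) * p i) \<le> (\<Sum>i\<in>UNIV. norm (p i)) * norm v"
    by (simp add: sum_distrib_right sum_distrib_left mult.commute)
qed

text \<open>Translation invariance makes the integral of every difference quotient vanish, and the quotients converge
boundedly because the derivatives decay rapidly.\<close>

lemma integral_partial_deriv_zero:
  fixes g :: "'d::finite cfun"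
  assumes g: "g \<in> schwartz" shows "(LBINT x. partial_deriv i g x) = 0"
proof -
  let ?e = "axis i 1 :: real^'d"
  define t where "t n = 1 / real (Suc n)" for n
  have t: "t n > 0" "t n \<le> 1" for n by (auto simp: t_def)
  define q where "q n x = (g (x + t n *\<^sub>R ?e) - g x) /\<^sub>R t n" for n x
  let ?M = "Suc CARD('d)"
  have "rapid (partial_deriv l g)" for l using g by (intro schwartz_rapid schwartz_partial_deriv)
  then have "\<exists>C\<ge>0. \<forall>x. norm (partial_deriv l g x) \<le> C / (1 + norm x) ^ ?M" for l
    using rapidD[of "partial_deriv l g" ?M] by metis
  then obtain C where C: "\<And>l. C l \<ge> 0" "\<And>l x. norm (partial_deriv l g x) \<le> C l / (1 + norm x) ^ ?M" by metis
  define K where "K = (\<Sum>l\<in>UNIV. C l) * 2 ^ ?M"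
  have gm [measurable]: "g \<in> borel_measurable borel" "partial_deriv i g \<in> borel_measurable borel"
    using g by (auto intro: schwartz_measurable schwartz_partial_deriv)
  have bound: "norm (q n x) \<le> K * (1 / (1 + norm x) ^ ?M)" for n x
  proof -
    have "norm (g (x + t n *\<^sub>R ?e) - g x) \<le> (K * (1 / (1 + norm x) ^ ?M)) * norm ((x + t n *\<^sub>R ?e) - x)"
    proof (rule differentiable_bound[of "cball x 1"])
      fix y assume y: "y \<in> cball x 1"
      show "(g has_derivative (\<lambda>v. \<Sum>l\<in>UNIV. cplx (v $ l) * partial_deriv l g y)) (at y within cball x 1)"
        by (rule has_derivative_at_withinI[OF has_derivative_partial_derivs[OF schwartz_differentiable[OF g]]])
      have "norm x \<le> norm y + 1" using y norm_triangle_sub[of x y] by (simp add: dist_norm)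
      then have "1 + norm x \<le> 2 + norm y" by simp
      also have "\<dots> \<le> 2 + 2 * norm y" by simp
      also have "\<dots> = 2 * (1 + norm y)" by simp
      finally have "1 + norm x \<le> 2 * (1 + norm y)" .
      then have "(1 + norm x) ^ ?M \<le> (2 * (1 + norm y)) ^ ?M" by (intro power_mono) auto
      then have "(1 + norm x) ^ ?M \<le> 2 ^ ?M * (1 + norm y) ^ ?M" by (simp only: power_mult_distrib)
      then have le: "1 / (1 + norm y) ^ ?M \<le> 2 ^ ?M * (1 / (1 + norm x) ^ ?M)"
        by (simp add: field_simps add_pos_nonneg del: power_Suc)
      have "onorm (\<lambda>v. \<Sum>l\<in>UNIV. cplx (v $ l) * partial_deriv l g y) \<le> (\<Sum>l\<in>UNIV. norm (partial_deriv l g y))"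
        by (rule onorm_partial_derivs_le)
      also have "\<dots> \<le> (\<Sum>l\<in>UNIV. C l * (1 / (1 + norm y) ^ ?M))"
        using C(2) by (intro sum_mono) simp
      also have "\<dots> \<le> (\<Sum>l\<in>UNIV. C l * (2 ^ ?M * (1 / (1 + norm x) ^ ?M)))"
        using C(1) le by (intro sum_mono mult_left_mono)
      also have "\<dots> = K * (1 / (1 + norm x) ^ ?M)" unfolding K_def by (simp only: sum_distrib_right mult.assoc)
      finally show "onorm (\<lambda>v. \<Sum>l\<in>UNIV. cplx (v $ l) * partial_deriv l g y) \<le> K * (1 / (1 + norm x) ^ ?M)" .
    qed (use t[of n] in \<open>auto simp: dist_norm norm_axis_1\<close>)
    moreover have "norm (q n x) = norm (g (x + t n *\<^sub>R ?e) - g x) / t n"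
      using t[of n] by (simp add: q_def divide_inverse mult.commute)
    ultimately show ?thesis using t[of n] by (simp add: pos_divide_le_eq norm_axis_1)
  qed
  have int0: "(LBINT x. q n x) = 0" for n
  proof -
    have i1: "integrable lborel (\<lambda>x. g (t n *\<^sub>R ?e + 1 *\<^sub>R x))" by (rule integrable_affine_euclidean[OF schwartz_integrable[OF g]]) simp
    have "(LBINT x. g (t n *\<^sub>R ?e + 1 *\<^sub>R x)) = (LBINT x. g x) /\<^sub>R \<bar>1\<bar> ^ DIM(real^'d)"
      by (rule integral_affine_euclidean[OF schwartz_integrable[OF g]]) simp
    then show ?thesis using i1 schwartz_integrable[OF g] by (simp add: q_def add.commute)
  qed
  have lim: "(\<lambda>n. q n x) \<longlonglongrightarrow> partial_deriv i g x" for x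
  proof -
    let ?D = "frechet_derivative g (at x)"
    have D: "(g has_derivative ?D) (at x)" using schwartz_differentiable[OF g] by (simp add: frechet_derivative_works)
    have l: "linear ?D" using D by (rule has_derivative_linear)
    have "filterlim (\<lambda>n. t n *\<^sub>R ?e) (at 0) sequentially"
      unfolding filterlim_at
    proof
      have "(\<lambda>n. t n *\<^sub>R ?e) \<longlonglongrightarrow> 0 *\<^sub>R ?e"
        unfolding t_def using LIMSEQ_inverse_real_of_nat by (intro tendsto_intros) (simp add: inverse_eq_divide)
      then show "(\<lambda>n. t n *\<^sub>R ?e) \<longlonglongrightarrow> 0" by simp
      show "\<forall>\<^sub>F n in sequentially. t n *\<^sub>R ?e \<in> UNIV \<and> t n *\<^sub>R ?e \<noteq> 0"
        using t by (auto simp: axis_eq_0_iff less_imp_neq[symmetric])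
    qed
    moreover have "((\<lambda>h. norm (g (x + h) - g x - ?D h) / norm h) \<longlongrightarrow> 0) (at 0)"
      using D unfolding has_derivative_at by blast
    ultimately have "(\<lambda>n. norm (g (x + t n *\<^sub>R ?e) - g x - ?D (t n *\<^sub>R ?e)) / norm (t n *\<^sub>R ?e)) \<longlonglongrightarrow> 0"
      by (rule filterlim_compose[rotated])
    moreover have "norm (g (x + t n *\<^sub>R ?e) - g x - ?D (t n *\<^sub>R ?e)) / norm (t n *\<^sub>R ?e) = norm (q n x - partial_deriv i g x)" for n
    proof -
      have "q n x - partial_deriv i g x = (g (x + t n *\<^sub>R ?e) - g x - ?D (t n *\<^sub>R ?e)) /\<^sub>R t n"
        using t[of n] l by (simp add: q_def partial_deriv_def linear_cmul scaleR_diff_right)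
      then show ?thesis using t[of n] by (simp add: norm_axis_1 divide_inverse mult.commute)
    qed
    ultimately show ?thesis by (simp add: LIM_zero_cancel tendsto_norm_zero_iff)
  qed
  have "(\<lambda>n. \<integral>x. q n x \<partial>lborel) \<longlonglongrightarrow> (LBINT x. partial_deriv i g x)"
  proof (rule integral_dominated_convergence[where w="\<lambda>x. K * (1 / (1 + norm x) ^ ?M)"])
    show "integrable lborel (\<lambda>x::real^'d. K * (1 / (1 + norm x) ^ ?M))"
      by (intro integrable_mult_right integrable_weight) simp
  qed (use bound lim in \<open>auto simp: q_def\<close>)
  then show ?thesis unfolding int0 by (simp add: LIMSEQ_const_iff)
qed

lemma schwartz_chr:
  fixes f :: "'d::finite cfun"
  assumes "f \<in> schwartz"
  shows "(\<lambda>x. chr k x * f x) \<in> schwartz"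
    and "partial_deriv i (\<lambda>x. chr k x * f x) x = chr k x * partial_deriv i f x + (- \<i> * cplx (k $ i)) * (chr k x * f x)"
proof -
  have D: "(chr k has_derivative (\<lambda>v. (- \<i> * cplx (k \<bullet> v)) * chr k x)) (at x)" for x
  proof -
    have "((\<lambda>x. - (\<i> * cplx (k \<bullet> x))) has_derivative (\<lambda>v. - (\<i> * cplx (k \<bullet> v)))) (at x)"
      by (auto intro!: derivative_eq_intros)
    from has_derivative_compose[OF this DERIV_exp[unfolded has_field_derivative_def]]
    show ?thesis unfolding chr_def[abs_def] by (simp add: mult_ac)
  qed
  have P: "partial_deriv l (\<lambda>x. chr k x * h x) x = chr k x * partial_deriv l h x + (- \<i> * cplx (k $ l)) * (chr k x * h x)"
    if "h \<in> schwartz" for h :: "'d cfun" and l x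
    using differentiableI[OF D] schwartz_differentiable[OF that]
    by (subst partial_deriv_mult) (auto simp: partial_deriv_eq[OF D] inner_axis)
  show "partial_deriv i (\<lambda>x. chr k x * f x) x = chr k x * partial_deriv i f x + (- \<i> * cplx (k $ i)) * (chr k x * f x)"
    by (rule P[OF assms])
  show "(\<lambda>x. chr k x * f x) \<in> schwartz"
  proof (rule schwartz_coinduct)
    let ?A = "{\<lambda>x. chr k x * f x | f. f \<in> schwartz}"
    show "(\<lambda>x. chr k x * f x) \<in> ?A" using assms by blast
    show "schwartz_closed ?A" unfolding schwartz_closed_def
    proof (intro ballI conjI allI)
      fix g x l assume "g \<in> ?A"
      then obtain h where g: "g = (\<lambda>x. chr k x * h x)" and h: "h \<in> schwartz" by blast
      show "rapid g" unfolding g by (rule rapid_mult_bounded[OF schwartz_rapid[OF h], of _ 1]) simp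
      show "g differentiable (at x)" unfolding g
        by (intro differentiable_mult differentiableI[OF D] schwartz_differentiable h)
      show "partial_deriv l g \<in> lspan ?A"
        unfolding g P[OF h, abs_def] using h schwartz_partial_deriv[OF h]
        by (intro lspan_add lspan_cmult lspan_base) blast+
    qed
  qed
qed

text \<open>Integration by parts: the integral of the derivative of \<open>chr k x * f x\<close> is zero.\<close>

lemma fourier_of_partial_deriv:
  fixes f :: "'d::finite cfun"
  assumes f: "f \<in> schwartz"
  shows "fourier (partial_deriv i f) k = \<i> * cplx (k $ i) * fourier f k"
proof -
  have i1: "integrable lborel (\<lambda>x. chr k x * partial_deriv i f x)" "integrable lborel (\<lambda>x. chr k x * f x)"
    by (intro integrable_chr_mult schwartz_integrable schwartz_partial_deriv f)+
  have "0 = (LBINT x. partial_deriv i (\<lambda>x. chr k x * f x) x)"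
    using integral_partial_deriv_zero[OF schwartz_chr(1)[OF f]] by simp
  also have "\<dots> = (LBINT x. chr k x * partial_deriv i f x + (- \<i> * cplx (k $ i)) * (chr k x * f x))"
    unfolding schwartz_chr(2)[OF f] ..
  also have "\<dots> = (LBINT x. chr k x * partial_deriv i f x) + (- \<i> * cplx (k $ i)) * (LBINT x. chr k x * f x)"
    using i1 by (subst Bochner_Integration.integral_add) (auto simp del: mult_minus_left)
  finally have "(LBINT x. chr k x * partial_deriv i f x) = \<i> * cplx (k $ i) * (LBINT x. chr k x * f x)"
    by (simp add: eq_neg_iff_add_eq_0[symmetric] minus_equation_iff)
  then show ?thesis by (simp add: fourier_eq)
qed

lemma seminorm_upper:
  assumes "f \<in> schwartz"
  shows "norm x ^ N * norm (partial_derivs idx f x) \<le> schwartz_seminorm N idx f" "schwartz_seminorm N idx f \<ge> 0"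
proof -
  have "rapid (partial_derivs idx f)" using assms by (simp add: schwartz_iff)
  then obtain C where "\<And>x. norm x ^ N * norm (partial_derivs idx f x) \<le> C" unfolding rapid_def by metis
  then have bdd: "bdd_above (range (\<lambda>x. norm x ^ N * norm (partial_derivs idx f x)))" by (auto simp: bdd_above_def)
  show 1: "norm x ^ N * norm (partial_derivs idx f x) \<le> schwartz_seminorm N idx f" for x
    unfolding schwartz_seminorm_def by (rule cSUP_upper[OF _ bdd]) simp
  show "schwartz_seminorm N idx f \<ge> 0" by (rule order_trans[OF _ 1[of 0]]) simp
qed

lemma seminorm_partial_deriv: "schwartz_seminorm N idx (partial_deriv i f) = schwartz_seminorm N (idx @ [i]) f"
  by (simp add: schwartz_seminorm_def partial_derivs_snoc)

text \<open>Each factor \<open>norm k\<close> is traded for the coordinates of \<open>k\<close>, hence for one derivative of \<open>f\<close>. This is the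
quantitative form of continuity of the transform on the Schwartz space; it is needed for the functionals below to be
continuous.\<close>

lemma fourier_seminorm_bound:
  "\<exists>P C. finite P \<and> C \<ge> 0 \<and> (\<forall>f\<in>schwartz. \<forall>k. norm k ^ N * norm (fourier (f :: 'd::finite cfun) k)
      \<le> C * (\<Sum>(M,idx)\<in>P. schwartz_seminorm M idx f))"
proof (induction N)
  case 0
  let ?M = "Suc CARD('d)"
  let ?W = "\<integral>(x::real^'d). 1 / (1 + norm x) ^ ?M \<partial>lborel"
  let ?P = "{(0, []), (?M, [])} :: (nat \<times> 'd list) set"
  let ?C = "fconst TYPE('d) * (2 ^ ?M * ?W)"
  have "norm (fourier f k) \<le> ?C * (\<Sum>(M,idx)\<in>?P. schwartz_seminorm M idx f)" if f: "f \<in> schwartz" for f :: "'d cfun" and k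
  proof -
    let ?S = "schwartz_seminorm 0 [] f + schwartz_seminorm ?M [] f"
    have "norm (f x) \<le> (2 ^ ?M * ?S) * (1 / (1 + norm x) ^ ?M)" for x
    proof -
      have "(1 + norm x) ^ ?M \<le> (2 * max 1 (norm x)) ^ ?M" by (intro power_mono) auto
      also have "\<dots> = 2 ^ ?M * max 1 (norm x) ^ ?M" by (rule power_mult_distrib)
      also have "\<dots> \<le> 2 ^ ?M * (1 + norm x ^ ?M)" by (intro mult_left_mono) (auto simp: max_def)
      finally have "(1 + norm x) ^ ?M * norm (f x) \<le> 2 ^ ?M * (1 + norm x ^ ?M) * norm (f x)"
        by (intro mult_right_mono) auto
      also have "\<dots> = 2 ^ ?M * (norm x ^ 0 * norm (f x) + norm x ^ ?M * norm (f x))" by (simp add: algebra_simps)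
      also have "\<dots> \<le> 2 ^ ?M * ?S"
        using seminorm_upper(1)[OF f, of x 0 "[]"] seminorm_upper(1)[OF f, of x ?M "[]"]
        by (intro mult_left_mono add_mono) auto
      finally show ?thesis by (simp add: pos_le_divide_eq add_pos_nonneg mult.commute del: power_Suc)
    qed
    note bd = this
    have "(LBINT x. norm (f x)) \<le> (LBINT (x::real^'d). (2 ^ ?M * ?S) * (1 / (1 + norm x) ^ ?M))"
      by (intro Bochner_Integration.integral_mono integrable_norm schwartz_integrable f integrable_mult_right integrable_weight bd) auto
    also have "\<dots> = (2 ^ ?M * ?S) * ?W" by (rule integral_mult_right_zero)
    finally have "fconst TYPE('d) * (LBINT x. norm (f x)) \<le> fconst TYPE('d) * ((2 ^ ?M * ?S) * ?W)"
      using fconst_pos[where 'd='d] by (intro mult_left_mono) auto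
    then show ?thesis using fourier_norm_le[of f k] by (simp add: mult_ac del: power_Suc)
  qed
  moreover have "?C \<ge> 0" using fconst_pos[where 'd='d] by (intro mult_nonneg_nonneg integral_nonneg_AE) auto
  ultimately show ?case by (intro exI[of _ ?P] exI[of _ ?C]) auto
next
  case (Suc N)
  then obtain P C where P: "finite P" "C \<ge> 0"
    and b: "\<And>f k. f \<in> schwartz \<Longrightarrow> norm k ^ N * norm (fourier (f :: 'd cfun) k) \<le> C * (\<Sum>(M,idx)\<in>P. schwartz_seminorm M idx f)" by metis
  let ?Q = "(\<lambda>((M,idx),i). (M, idx @ [i])) ` (P \<times> (UNIV :: 'd set))"
  have inj: "inj_on (\<lambda>((M,idx),i). (M, idx @ [i])) (P \<times> (UNIV :: 'd set))" by (auto simp: inj_on_def)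
  have "norm k ^ Suc N * norm (fourier f k) \<le> C * (\<Sum>(M,idx)\<in>?Q. schwartz_seminorm M idx f)" if f: "f \<in> schwartz" for f :: "'d cfun" and k
  proof -
    have "norm k \<le> (\<Sum>i\<in>UNIV. \<bar>k $ i\<bar>)" by (rule norm_le_l1_cart)
    then have "norm k ^ Suc N * norm (fourier f k) \<le> (\<Sum>i\<in>UNIV. \<bar>k $ i\<bar>) * (norm k ^ N * norm (fourier f k))"
      by (simp add: mult.assoc mult_right_mono)
    also have "\<dots> = (\<Sum>i\<in>UNIV. norm k ^ N * norm (fourier (partial_deriv i f) k))"
      unfolding sum_distrib_right by (intro sum.cong refl) (simp add: fourier_of_partial_deriv[OF f] norm_mult)
    also have "\<dots> \<le> (\<Sum>i\<in>UNIV. C * (\<Sum>(M,idx)\<in>P. schwartz_seminorm M idx (partial_deriv i f)))"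
      by (intro sum_mono b schwartz_partial_deriv f)
    also have "\<dots> = C * (\<Sum>i\<in>UNIV. \<Sum>(M,idx)\<in>P. schwartz_seminorm M (idx @ [i]) f)"
      by (simp add: seminorm_partial_deriv sum_distrib_left)
    also have "(\<Sum>i\<in>UNIV. \<Sum>(M,idx)\<in>P. schwartz_seminorm M (idx @ [i]) f) = (\<Sum>p\<in>P. \<Sum>i\<in>UNIV. schwartz_seminorm (fst p) (snd p @ [i]) f)"
      by (subst sum.swap) (simp add: case_prod_unfold)
    also have "\<dots> = (\<Sum>(p,i)\<in>P \<times> UNIV. schwartz_seminorm (fst p) (snd p @ [i]) f)"
      by (rule sum.cartesian_product)
    also have "\<dots> = (\<Sum>(M,idx)\<in>?Q. schwartz_seminorm M idx f)"
      by (subst sum.reindex[OF inj]) (simp add: case_prod_unfold o_def)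
    finally show ?thesis .
  qed
  then show ?case using P by (intro exI[of _ ?Q] exI[of _ C]) auto
qed

lemma schwartz_fourier:
  fixes f :: "'d::finite cfun"
  assumes "f \<in> schwartz" shows "fourier f \<in> schwartz"
proof (rule schwartz_coinduct)
  let ?A = "fourier ` (schwartz :: 'd cfun set)"
  show "fourier f \<in> ?A" using assms by blast
  show "schwartz_closed ?A" unfolding schwartz_closed_def
  proof (intro ballI conjI allI)
    fix g x l assume "g \<in> ?A"
    then obtain h where g: "g = fourier h" and h: "h \<in> schwartz" by blast
    show "g differentiable (at x)" unfolding g by (rule fourier_partial_deriv(1)[OF h])
    show "partial_deriv l g \<in> lspan ?A"
      unfolding g fourier_partial_deriv(2)[OF h, abs_def]
      by (intro lspan_base imageI schwartz_cmult schwartz_coord h)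
    show "rapid g" unfolding g
    proof (rule rapidI)
      fix N show "\<exists>C. \<forall>x. norm x ^ N * norm (fourier h x) \<le> C"
        using fourier_seminorm_bound[of N, where 'd='d] h by blast
    qed
  qed
qed

text \<open>The transform satisfies the same first order system \<open>\<partial>\<^sub>i u = - k\<^sub>i u\<close> as the Gaussian, so their quotient is
constant.\<close>

lemma fourier_gauss: "fourier gauss = (gauss :: 'd::finite cfun)"
proof -
  let ?h = "\<lambda>k::real^'d. fourier gauss k * cplx (exp ((norm k)\<^sup>2 / 2))"
  have P: "partial_deriv i (fourier gauss) k = - (cplx (k $ i)) * fourier gauss k" for i and k :: "real^'d"
  proof -
    have "(\<lambda>x. (- \<i>) * (cplx (x $ i) * gauss x)) = (\<lambda>x::real^'d. \<i> * partial_deriv i gauss x)"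
      by (auto simp: partial_deriv_gauss(1))
    then have "partial_deriv i (fourier gauss) k = fourier (\<lambda>x. \<i> * partial_deriv i gauss x) k"
      unfolding fourier_partial_deriv(2)[OF schwartz_gauss] by (simp only:)
    also have "\<dots> = \<i> * (\<i> * cplx (k $ i) * fourier gauss k)"
      by (simp only: fourier_cmult fourier_of_partial_deriv[OF schwartz_gauss])
    finally show ?thesis by (simp add: mult.assoc[symmetric])
  qed
  have "(?h has_derivative (\<lambda>v. 0)) (at k within UNIV)" for k
  proof -
    have D1: "((\<lambda>u::real. exp (u / 2)) has_real_derivative (exp ((norm k)\<^sup>2 / 2) / 2)) (at ((norm k)\<^sup>2))"
      by (auto intro!: derivative_eq_intros)
    have D2: "(fourier gauss has_derivative (\<lambda>v. - (cplx (k \<bullet> v)) * fourier gauss k)) (at k)"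
    proof -
      have "(\<lambda>v. \<Sum>i\<in>UNIV. cplx (v $ i) * partial_deriv i (fourier gauss) k) = (\<lambda>v. - (cplx (k \<bullet> v)) * fourier gauss k)"
        by (auto simp: P inner_vec_def sum_distrib_left sum_distrib_right sum_negf mult_ac)
      then show ?thesis using has_derivative_partial_derivs[OF fourier_partial_deriv(1)[OF schwartz_gauss], of k] by simp
    qed
    show ?thesis
      using has_derivative_mult[OF D2 has_derivative_radial[OF D1]] by (simp add: algebra_simps)
  qed
  then have const: "?h k = ?h 0" for k by (intro has_derivative_zero_unique[of UNIV ?h]) auto
  have 0: "fourier gauss (0::real^'d) = 1"
  proof -
    have "(LBINT (x::real^'d). gauss x) = cplx (LBINT (x::real^'d). exp (- (norm x)\<^sup>2 / 2))"
      unfolding gauss_def by (rule integral_complex_of_real)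
    also have "\<dots> = cplx ((2 * pi) powr (real CARD('d) / 2))" using gauss_integral(2)[where 'a="real^'d"] by simp
    finally show ?thesis by (simp add: fourier_eq fconst_def of_real_mult[symmetric] powr_add[symmetric] del: of_real_mult)
  qed
  show ?thesis
  proof
    fix k :: "real^'d"
    have "fourier gauss k * cplx (exp ((norm k)\<^sup>2 / 2)) = 1" using const[of k] 0 by simp
    then have "fourier gauss k * cplx (exp ((norm k)\<^sup>2 / 2)) * cplx (exp (- (norm k)\<^sup>2 / 2))
       = cplx (exp (- (norm k)\<^sup>2 / 2))" by simp
    then show "fourier gauss k = gauss k"
      by (simp add: gauss_def mult.assoc of_real_mult[symmetric] exp_add[symmetric] del: of_real_mult)
  qed
qed

lemma integrable_pair_product:
  fixes f g :: "'d::finite cfun" and K :: "real^'d \<Rightarrow> real^'d \<Rightarrow> complex"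
  assumes f: "integrable lborel f" and g: "integrable lborel g"
    and K: "(\<lambda>p. K (fst p) (snd p)) \<in> borel_measurable (borel \<Otimes>\<^sub>M borel)" and B: "\<And>x y. norm (K x y) \<le> D"
  shows "integrable (lborel \<Otimes>\<^sub>M lborel) (case_prod (\<lambda>x y. K x y * (f x * g y)))"
proof -
  have fm [measurable]: "f \<in> borel_measurable borel" "g \<in> borel_measurable borel"
    using f g by (auto dest: borel_measurable_integrable)
  have Km [measurable]: "(\<lambda>p. K (fst p) (snd p)) \<in> borel_measurable (lborel \<Otimes>\<^sub>M lborel)"
    using K by (subst measurable_cong_sets[OF sets_pair_measure_cong[OF sets_lborel sets_lborel] refl]) 
  have ig: "integrable (lborel \<Otimes>\<^sub>M lborel) (\<lambda>p. f (fst p) * g (snd p))"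
  proof (rule lborel_pair.Fubini_integrable)
    show "integrable lborel (\<lambda>x. \<integral>y. norm (f (fst (x, y)) * g (snd (x, y))) \<partial>lborel)"
      using f by (simp add: norm_mult)
    show "AE x in lborel. integrable lborel (\<lambda>y. f (fst (x, y)) * g (snd (x, y)))"
      using g by simp
  qed measurable
  show ?thesis
  proof (rule Bochner_Integration.integrable_bound[OF integrable_mult_right[OF ig, of "cplx D"]])
    show "AE p in lborel \<Otimes>\<^sub>M lborel. norm (case_prod (\<lambda>x y. K x y * (f x * g y)) p) \<le> norm (cplx D * (f (fst p) * g (snd p)))"
    proof (rule AE_I2)
      fix p
      have "D \<ge> 0" using order_trans[OF norm_ge_zero B] .
      then show "norm (case_prod (\<lambda>x y. K x y * (f x * g y)) p) \<le> norm (cplx D * (f (fst p) * g (snd p)))"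
        using mult_right_mono[OF B[of "fst p" "snd p"], of "norm (f (fst p) * g (snd p))"]
        by (simp add: case_prod_unfold norm_mult)
    qed
  qed (simp add: case_prod_unfold)
qed

text \<open>Fubini's theorem for the symmetric kernel \<open>chr k x\<close>.\<close>

lemma fourier_multiplication:
  fixes f g :: "'d::finite cfun"
  assumes f: "integrable lborel f" and g: "integrable lborel g"
  shows "(LBINT k. fourier f k * g k) = (LBINT x. f x * fourier g x)"
proof -
  let ?c = "cplx (fconst TYPE('d))"
  have m: "(\<lambda>p::(real^'d)\<times>(real^'d). chr (snd p) (fst p)) \<in> borel_measurable (borel \<Otimes>\<^sub>M borel)"
    by (subst chr_commute) (rule chr_measurable2)
  have e: "fourier f k * g k = ?c * (LBINT x. chr k x * (f x * g k))" for k
    by (simp add: fourier_eq mult.assoc[symmetric])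
  have "(LBINT k. fourier f k * g k) = ?c * (LBINT k. (LBINT x. chr k x * (f x * g k)))"
    by (simp only: e integral_mult_right_zero)
  also have "(LBINT k. (LBINT x. chr k x * (f x * g k))) = (LBINT x. (LBINT k. chr k x * (f x * g k)))"
    by (rule lborel_pair.Fubini_integral) (rule integrable_pair_product[OF f g m, of 1], simp)
  also have "?c * \<dots> = (LBINT x. f x * fourier g x)"
  proof -
    have "(LBINT k. chr k x * (f x * g k)) = f x * (LBINT k. chr x k * g k)" for x
      by (simp add: chr_commute[of _ x] mult.left_commute[of _ "f x"])
    then have "?c * (LBINT x. (LBINT k. chr k x * (f x * g k))) = (LBINT x. ?c * (f x * (LBINT k. chr x k * g k)))"
      by simp
    then show ?thesis by (simp add: fourier_eq mult.left_commute)
  qed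
  finally show ?thesis .
qed

lemma fourier_modulated:
  fixes f :: "'d::finite cfun"
  assumes e: "\<epsilon> > 0" and f: "integrable lborel f"
  shows "fourier (\<lambda>k. chr (- x) k * f (\<epsilon> *\<^sub>R k)) y = cplx (1 / \<epsilon> ^ CARD('d)) * fourier f ((1 / \<epsilon>) *\<^sub>R (y - x))"
proof -
  let ?F = "\<lambda>k. chr ((1 / \<epsilon>) *\<^sub>R (y - x)) k * f k :: complex"
  have int: "integrable lborel ?F" by (intro integrable_chr_mult f)
  have c: "chr ((1 / \<epsilon>) *\<^sub>R (y - x)) (\<epsilon> *\<^sub>R k) = chr y k * chr (- x) k" for k
    using e by (simp add: chr_scale[symmetric] chr_add(1)[symmetric])
  have "(LBINT k. chr y k * (chr (- x) k * f (\<epsilon> *\<^sub>R k))) = (LBINT k. ?F (0 + \<epsilon> *\<^sub>R k))"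
    by (simp only: add_0_left c mult.assoc)
  also have "\<dots> = (LBINT k. ?F k) /\<^sub>R \<bar>\<epsilon>\<bar> ^ DIM(real^'d)"
    by (rule integral_affine_euclidean[OF int]) (use e in simp)
  finally have "(LBINT k. chr y k * (chr (- x) k * f (\<epsilon> *\<^sub>R k))) = (LBINT k. ?F k) /\<^sub>R \<epsilon> ^ CARD('d)"
    using e by simp
  then have "fourier (\<lambda>k. chr (- x) k * f (\<epsilon> *\<^sub>R k)) y = fourier f ((1 / \<epsilon>) *\<^sub>R (y - x)) /\<^sub>R \<epsilon> ^ CARD('d)"
    by (simp add: fourier_eq)
  then show ?thesis by (simp add: scaleR_conv_of_real divide_inverse)
qed

lemma fourier_modulated_gauss:
  fixes x :: "real^'d::finite"
  assumes e: "\<epsilon> > 0"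
  shows "fourier (\<lambda>k. chr (- x) k * gauss (\<epsilon> *\<^sub>R k)) y = cplx (1 / \<epsilon> ^ CARD('d)) * gauss ((1 / \<epsilon>) *\<^sub>R (y - x))"
  using fourier_modulated[OF e schwartz_integrable[OF schwartz_gauss]] by (simp add: fourier_gauss)

text \<open>A Gaussian convergence factor in the inversion integral is moved onto \<open>f\<close> by the multiplication formula, where
it becomes an approximate identity at \<open>x\<close>; both sides converge as the width tends to zero.\<close>

lemma fourier_inversion:
  fixes f :: "'d::finite cfun"
  assumes f: "f \<in> schwartz" shows "fourier (fourier f) (- x) = f x"
proof -
  define e where "e n = 1 / real (Suc n)" for n
  have e: "e n > 0" for n by (simp add: e_def)
  have e0: "e \<longlonglongrightarrow> 0" unfolding e_def using LIMSEQ_inverse_real_of_nat by (simp add: inverse_eq_divide)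
  note F = schwartz_fourier[OF f] and int = schwartz_integrable[OF f]
  have Fm [measurable]: "fourier f \<in> borel_measurable borel" by (rule schwartz_measurable[OF F])
  have fm [measurable]: "f \<in> borel_measurable borel" by (rule schwartz_measurable[OF f])
  have gm [measurable]: "gauss \<in> borel_measurable (borel :: (real^'d) measure)" by (rule schwartz_measurable[OF schwartz_gauss])
  have gcont: "isCont gauss (0::real^'d)" 
  proof -
    have "continuous_on UNIV (gauss :: 'd cfun)" by (rule schwartz_continuous[OF schwartz_gauss])
    then show ?thesis by (simp add: continuous_on_eq_continuous_at)
  qed
  have fcont: "isCont f x" using schwartz_continuous[OF f] by (simp add: continuous_on_eq_continuous_at)
  have gb: "norm (gauss y) \<le> 1" for y :: "real^'d" by (simp add: gauss_def)
  have g0: "gauss (0::real^'d) = 1" by (simp add: gauss_def)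
  obtain B where B: "\<And>x. norm (f x) \<le> B" using schwartz_bounded[OF f] by blast
  have eq: "(LBINT k. fourier f k * (chr (- x) k * gauss (e n *\<^sub>R k))) = (LBINT z. f (x + e n *\<^sub>R z) * gauss z)" for n
  proof -
    have ig: "integrable lborel (\<lambda>k. chr (- x) k * gauss (e n *\<^sub>R k))"
      using integrable_affine_euclidean[OF schwartz_integrable[OF schwartz_gauss], of "e n" "0::real^'d"] e[of n]
      by (intro integrable_chr_mult) simp
    have "(LBINT k. fourier f k * (chr (- x) k * gauss (e n *\<^sub>R k)))
       = (LBINT y. f y * (cplx (1 / e n ^ CARD('d)) * gauss ((1 / e n) *\<^sub>R (y - x))))"
      by (subst fourier_multiplication[OF int ig]) (simp add: fourier_modulated_gauss[OF e])
    also have "\<dots> = cplx (1 / e n ^ CARD('d)) * (LBINT y. f y * gauss ((1 / e n) *\<^sub>R (y - x)))"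
      by (subst integral_mult_right_zero[symmetric]) (simp add: mult_ac)
    also have "(LBINT z. f (x + e n *\<^sub>R z) * gauss ((1 / e n) *\<^sub>R ((x + e n *\<^sub>R z) - x)))
        = (LBINT y. f y * gauss ((1 / e n) *\<^sub>R (y - x))) /\<^sub>R \<bar>e n\<bar> ^ DIM(real^'d)"
    proof (rule integral_affine_euclidean)
      show "integrable lborel (\<lambda>y. f y * gauss ((1 / e n) *\<^sub>R (y - x)))"
        by (rule Bochner_Integration.integrable_bound[OF int])
           (use mult_left_mono[OF gb] in \<open>auto simp: norm_mult intro!: AE_I2\<close>)
    qed (use e[of n] in simp)
    then have "cplx (1 / e n ^ CARD('d)) * (LBINT y. f y * gauss ((1 / e n) *\<^sub>R (y - x)))
       = (LBINT z. f (x + e n *\<^sub>R z) * gauss z)"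
    proof -
      have c: "cplx (1 / e n ^ CARD('d)) * X = X /\<^sub>R e n ^ CARD('d)" for X :: complex
        by (simp add: scaleR_conv_of_real divide_inverse)
      have z: "(1 / e n) *\<^sub>R ((x + e n *\<^sub>R z) - x) = z" for z :: "real^'d" using e[of n] by simp
      assume "(LBINT z. f (x + e n *\<^sub>R z) * gauss ((1 / e n) *\<^sub>R ((x + e n *\<^sub>R z) - x)))
        = (LBINT y. f y * gauss ((1 / e n) *\<^sub>R (y - x))) /\<^sub>R \<bar>e n\<bar> ^ DIM(real^'d)"
      then show ?thesis using e[of n] unfolding c z by simp
    qed
    finally show ?thesis .
  qed
  have L1: "(\<lambda>n. \<integral>k. fourier f k * (chr (- x) k * gauss (e n *\<^sub>R k)) \<partial>lborel) \<longlonglongrightarrow> (LBINT k. fourier f k * (chr (- x) k * 1))"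
  proof (rule integral_dominated_convergence[where w="\<lambda>k. norm (fourier f k)"])
    show "AE k in lborel. (\<lambda>n. fourier f k * (chr (- x) k * gauss (e n *\<^sub>R k))) \<longlonglongrightarrow> fourier f k * (chr (- x) k * 1)"
    proof (rule AE_I2)
      fix k :: "real^'d"
      have "(\<lambda>n. e n *\<^sub>R k) \<longlonglongrightarrow> 0 *\<^sub>R k" by (intro tendsto_intros e0)
      then have "(\<lambda>n. gauss (e n *\<^sub>R k)) \<longlonglongrightarrow> gauss (0::real^'d)" using isCont_tendsto_compose[OF gcont] by simp
      then show "(\<lambda>n. fourier f k * (chr (- x) k * gauss (e n *\<^sub>R k))) \<longlonglongrightarrow> fourier f k * (chr (- x) k * 1)"
        unfolding g0 by (intro tendsto_intros)
    qed
    show "AE k in lborel. norm (fourier f k * (chr (- x) k * gauss (e n *\<^sub>R k))) \<le> norm (fourier f k)" for n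
      using mult_left_mono[OF gb] by (intro AE_I2) (fastforce simp: norm_mult)
    show "integrable lborel (\<lambda>k. norm (fourier f k))" by (intro integrable_norm schwartz_integrable F)
  qed measurable
  have L2: "(\<lambda>n. \<integral>z. f (x + e n *\<^sub>R z) * gauss z \<partial>lborel) \<longlonglongrightarrow> (LBINT (z::real^'d). f x * gauss z)"
  proof (rule integral_dominated_convergence[where w="\<lambda>z. B * norm (gauss z)"])
    show "AE z in lborel. (\<lambda>n. f (x + e n *\<^sub>R z) * gauss z) \<longlonglongrightarrow> f x * gauss z"
    proof (rule AE_I2)
      fix z :: "real^'d"
      have "(\<lambda>n. x + e n *\<^sub>R z) \<longlonglongrightarrow> x + 0 *\<^sub>R z" by (intro tendsto_intros e0)
      then have "(\<lambda>n. f (x + e n *\<^sub>R z)) \<longlonglongrightarrow> f x" using isCont_tendsto_compose[OF fcont] by simp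
      then show "(\<lambda>n. f (x + e n *\<^sub>R z) * gauss z) \<longlonglongrightarrow> f x * gauss z" by (intro tendsto_intros)
    qed
    show "AE z in lborel. norm (f (x + e n *\<^sub>R z) * gauss z) \<le> B * norm (gauss z)" for n
      using B by (intro AE_I2) (simp add: norm_mult mult_right_mono)
    show "integrable lborel (\<lambda>z::real^'d. B * norm (gauss z))" by (intro integrable_mult_right integrable_norm schwartz_integrable schwartz_gauss)
  qed measurable
  have "(LBINT k. fourier f k * (chr (- x) k * 1)) = (LBINT (z::real^'d). f x * gauss z)"
    using LIMSEQ_unique[OF L1[unfolded eq] L2] .
  then have "(LBINT k. chr (- x) k * fourier f k) = f x * (LBINT (z::real^'d). gauss z)" by (simp add: mult.commute)
  then have "fourier (fourier f) (- x) = f x * fourier gauss (0::real^'d)" by (simp add: fourier_eq)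
  then show ?thesis by (simp add: fourier_gauss g0)
qed

lemma fourier_fourier: "f \<in> schwartz \<Longrightarrow> fourier (fourier f) = (\<lambda>x. f (- x))"
  using fourier_inversion[of f "- x" for x] by auto

section \<open>Inverse transform, Phi and Psi\<close>

lemma schwartz_reflect: "f \<in> schwartz \<Longrightarrow> (\<lambda>x. f (- x)) \<in> schwartz"
  using schwartz_affine(1)[of f "- 1" 0] by simp

lemma Psi_reflect: "f \<in> Psi \<Longrightarrow> (\<lambda>x. f (- x)) \<in> Psi"
  using Psi_scale[of f "- 1"] by simp

lemma inj_on_fourier: "inj_on fourier (schwartz :: 'd::finite cfun set)"
proof (rule inj_onI)
  fix f g :: "'d cfun" assume f: "f \<in> schwartz" and g: "g \<in> schwartz" and eq: "fourier f = fourier g"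
  show "f = g"
  proof
    fix x show "f x = g x" using fourier_inversion[OF f, of x] fourier_inversion[OF g, of x] eq by simp
  qed
qed

lemma fourier_inv_eq:
  fixes \<psi> :: "'d::finite cfun"
  assumes "\<psi> \<in> schwartz" shows "fourier_inv \<psi> = (\<lambda>x. fourier \<psi> (- x))"
  unfolding fourier_inv_def
proof (rule inv_into_f_eq[OF inj_on_fourier])
  show "(\<lambda>x. fourier \<psi> (- x)) \<in> schwartz" by (intro schwartz_reflect schwartz_fourier assms)
  show "fourier (\<lambda>x. fourier \<psi> (- x)) = \<psi>"
  proof
    fix k
    show "fourier (\<lambda>x. fourier \<psi> (- x)) k = \<psi> k"
      by (subst fourier_reflect[OF schwartz_integrable[OF schwartz_fourier[OF assms]]]) (rule fourier_inversion[OF assms])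
  qed
qed

lemma fourier_inv_reflect:
  fixes \<psi> :: "'d::finite cfun"
  assumes "\<psi> \<in> schwartz" shows "fourier_inv (\<lambda>k. \<psi> (- k)) = fourier \<psi>"
  using fourier_inv_eq[OF schwartz_reflect[OF assms]] fourier_reflect[OF schwartz_integrable[OF assms]] by auto

lemma partial_derivs_fourier:
  fixes f :: "'d::finite cfun"
  assumes f: "f \<in> schwartz"
  shows "(\<lambda>x. (- \<i>) ^ length idx * (cplx (\<Prod>i\<leftarrow>idx. x $ i) * f x)) \<in> schwartz \<and>
     partial_derivs idx (fourier f) = fourier (\<lambda>x. (- \<i>) ^ length idx * (cplx (\<Prod>i\<leftarrow>idx. x $ i) * f x))"
proof (induction idx)
  case Nil then show ?case using f by simp
next
  case (Cons i idx)
  let ?g = "\<lambda>x::real^'d. (- \<i>) ^ length idx * (cplx (\<Prod>i\<leftarrow>idx. x $ i) * f x)"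
  have g: "?g \<in> schwartz" using Cons by blast
  have e: "(\<lambda>x::real^'d. (- \<i>) ^ length (i # idx) * (cplx (\<Prod>i\<leftarrow>i # idx. x $ i) * f x))
    = (\<lambda>x. (- \<i>) * (cplx (x $ i) * ?g x))" by (auto simp: mult_ac)
  have "partial_derivs (i # idx) (fourier f) = partial_deriv i (fourier ?g)" using Cons by simp
  also have "\<dots> = fourier (\<lambda>x. (- \<i>) * (cplx (x $ i) * ?g x))"
    by (intro ext fourier_partial_deriv(2) g)
  finally show ?case unfolding e using schwartz_cmult[OF schwartz_coord[OF g]] by blast
qed

text \<open>Derivatives of the transform at the origin are, up to powers of \<open>-\<i>\<close>, the moments of the function.\<close>

lemma fourier_Psi_iff:
  fixes f :: "'d::finite cfun"
  assumes f: "f \<in> schwartz" shows "fourier f \<in> Psi \<longleftrightarrow> f \<in> Phi"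
proof -
  have "partial_derivs idx (fourier f) 0 = 0 \<longleftrightarrow> (LINT x|lborel. cplx (\<Prod>i\<leftarrow>idx. x $ i) * f x) = 0" for idx
    using partial_derivs_fourier[OF f, of idx] fconst_pos[where 'd='d] by (simp add: fourier_eq)
  then have "(\<forall>idx. partial_derivs idx (fourier f) 0 = 0) \<longleftrightarrow>
      (\<forall>idx. (LINT x|lborel. cplx (\<Prod>i\<leftarrow>idx. x $ i) * f x) = 0)" by (simp only:)
  then show ?thesis using f schwartz_fourier[OF f] by (simp only: Psi_def Phi_def mem_Collect_eq simp_thms)
qed

lemma Phi_schwartz: "\<phi> \<in> Phi \<Longrightarrow> \<phi> \<in> schwartz" by (simp add: Phi_def)

lemma fourier_Phi: "\<phi> \<in> Phi \<Longrightarrow> fourier \<phi> \<in> Psi" by (simp add: fourier_Psi_iff Phi_schwartz)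

lemma fourier_Psi: assumes "\<psi> \<in> Psi" shows "fourier \<psi> \<in> Phi"
proof -
  have S: "\<psi> \<in> schwartz" by (rule Psi_schwartz[OF assms])
  have "fourier (fourier \<psi>) \<in> Psi" unfolding fourier_fourier[OF S] by (rule Psi_reflect[OF assms])
  then show ?thesis using fourier_Psi_iff[OF schwartz_fourier[OF S]] by simp
qed

lemma Psi_chr:
  fixes \<psi> :: "'d::finite cfun"
  assumes "\<psi> \<in> Psi" shows "(\<lambda>x. chr k x * \<psi> x) \<in> Psi"
proof (rule Psi_coinduct)
  let ?A = "{\<lambda>x. chr k x * f x | f. f \<in> Psi}"
  show "(\<lambda>x. chr k x * \<psi> x) \<in> lspan ?A" using assms by (intro lspan_base) blast
  show "g 0 = 0" if "g \<in> ?A" for g using that Psi_zero_at by auto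
  show "schwartz_closed ?A" unfolding schwartz_closed_def
  proof (intro ballI conjI allI)
    fix g x l assume "g \<in> ?A"
    then obtain h where g: "g = (\<lambda>x. chr k x * h x)" and h: "h \<in> Psi" by blast
    note hS = Psi_schwartz[OF h]
    have gS: "g \<in> schwartz" unfolding g by (rule schwartz_chr(1)[OF hS])
    then show "rapid g" "g differentiable (at x)" by (auto intro: schwartz_rapid schwartz_differentiable)
    show "partial_deriv l g \<in> lspan ?A"
      unfolding g schwartz_chr(2)[OF hS, abs_def] using h Psi_partial_deriv[OF h]
      by (intro lspan_add lspan_cmult lspan_base) blast+
  qed
qed

section \<open>Functions that annihilate test functions\<close>

text \<open>The measures with densities \<open>max 0 f\<close> and \<open>max 0 (- f)\<close> agree on boxes, which generate the Borel sets
and are stable under intersection.\<close>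

lemma AE_zero_if_box_integrals_zero_real:
  fixes f :: "'a::euclidean_space \<Rightarrow> real"
  assumes f[measurable]: "f \<in> borel_measurable borel"
    and int: "\<And>a b. integrable lborel (\<lambda>x. indicator (box a b) x * f x)"
    and zero: "\<And>a b. (LBINT x. indicator (box a b) x * f x) = 0"
  shows "AE x in lborel. f x = 0"
proof -
  define P where "P = density lborel (\<lambda>x. ennreal (f x))"
  define N where "N = density lborel (\<lambda>x. ennreal (- f x))"
  have eP: "emeasure P (box a b) = ennreal (LBINT x. indicator (box a b) x * max 0 (f x))"
    and eN: "emeasure N (box a b) = ennreal (LBINT x. indicator (box a b) x * max 0 (- f x))"
    and eq: "emeasure P (box a b) = emeasure N (box a b)" for a b
  proof -
    have i1: "integrable lborel (\<lambda>x. indicator (box a b) x * max 0 (f x))"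
      by (rule Bochner_Integration.integrable_bound[OF int[of a b]]) (auto simp: indicator_def)
    have i2: "integrable lborel (\<lambda>x. indicator (box a b) x * max 0 (- f x))"
      by (rule Bochner_Integration.integrable_bound[OF int[of a b]]) (auto simp: indicator_def)
    have "emeasure P (box a b) = (\<integral>\<^sup>+x. ennreal (indicator (box a b) x * max 0 (f x)) \<partial>lborel)"
      unfolding P_def by (subst emeasure_density) (auto intro!: nn_integral_cong simp: indicator_def max_def ennreal_neg)
    then show 1: "emeasure P (box a b) = ennreal (LBINT x. indicator (box a b) x * max 0 (f x))"
      by (subst (asm) nn_integral_eq_integral[OF i1]) auto
    have "emeasure N (box a b) = (\<integral>\<^sup>+x. ennreal (indicator (box a b) x * max 0 (- f x)) \<partial>lborel)"
      unfolding N_def by (subst emeasure_density) (auto intro!: nn_integral_cong simp: indicator_def max_def ennreal_neg)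
    then show 2: "emeasure N (box a b) = ennreal (LBINT x. indicator (box a b) x * max 0 (- f x))"
      by (subst (asm) nn_integral_eq_integral[OF i2]) auto
    have "(LBINT x. indicator (box a b) x * max 0 (f x)) - (LBINT x. indicator (box a b) x * max 0 (- f x))
       = (LBINT x. indicator (box a b) x * max 0 (f x) - indicator (box a b) x * max 0 (- f x))"
      using i1 i2 by simp
    also have "\<dots> = (LBINT x. indicator (box a b) x * f x)"
      by (intro Bochner_Integration.integral_cong) (auto simp: indicator_def max_def)
    finally show "emeasure P (box a b) = emeasure N (box a b)" unfolding 1 2 using zero by simp
  qed
  have "P = N"
  proof (rule measure_eqI_generator_eq)
    let ?E = "range (\<lambda>(a, b). box a b::'a set)"
    show "Int_stable ?E" by (auto simp: Int_stable_def box_Int_box)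
    show "?E \<subseteq> Pow UNIV" "sets P = sigma_sets UNIV ?E" "sets N = sigma_sets UNIV ?E"
      by (simp_all add: P_def N_def borel_eq_box)
    let ?A = "\<lambda>n::nat. box (- (real n *\<^sub>R One)) (real n *\<^sub>R One) :: 'a set"
    show "range ?A \<subseteq> ?E" "(\<Union>i. ?A i) = UNIV" unfolding UN_box_eq_UNIV by auto
    show "emeasure P (?A i) \<noteq> \<infinity>" for i unfolding eP by simp
    show "emeasure P X = emeasure N X" if "X \<in> ?E" for X using that eq by auto
  qed
  then have "AE x in lborel. ennreal (f x) = ennreal (- f x)"
    unfolding P_def N_def by (subst (asm) sigma_finite_measure.density_unique_iff[OF sigma_finite_lborel]) auto
  then show ?thesis
  proof (rule AE_mp, intro AE_I2 impI)
    fix x assume "ennreal (f x) = ennreal (- f x)"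
    then show "f x = 0"
      by (cases "f x \<ge> 0"; cases "f x = 0") (auto simp: ennreal_neg ennreal_eq_0_iff)
  qed
qed

lemma AE_zero_if_box_integrals_zero:
  fixes f :: "'a::euclidean_space \<Rightarrow> complex"
  assumes f[measurable]: "f \<in> borel_measurable borel"
    and int: "\<And>a b. integrable lborel (\<lambda>x. indicator (box a b) x * f x)"
    and zero: "\<And>a b. (LBINT x. indicator (box a b) x * f x) = 0"
  shows "AE x in lborel. f x = 0"
proof -
  have ind: "Re (indicator (box a b) x * f x) = indicator (box a b) x * Re (f x)"
       "Im (indicator (box a b) x * f x) = indicator (box a b) x * Im (f x)" for a b x
    by (auto simp: indicator_def)
  have "AE x in lborel. Re (f x) = 0"
  proof (rule AE_zero_if_box_integrals_zero_real)
    show "integrable lborel (\<lambda>x. indicator (box a b) x * Re (f x))" for a b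
      using integrable_Re[OF int[of a b]] unfolding ind .
    show "(LBINT x. indicator (box a b) x * Re (f x)) = 0" for a b
      using integral_Re[OF int[of a b]] zero[of a b] unfolding ind by simp
  qed auto
  moreover have "AE x in lborel. Im (f x) = 0"
  proof (rule AE_zero_if_box_integrals_zero_real)
    show "integrable lborel (\<lambda>x. indicator (box a b) x * Im (f x))" for a b
      using integrable_Im[OF int[of a b]] unfolding ind .
    show "(LBINT x. indicator (box a b) x * Im (f x)) = 0" for a b
      using integral_Im[OF int[of a b]] zero[of a b] unfolding ind by simp
  qed auto
  ultimately show ?thesis by (rule AE_mp[OF _ AE_mp]) (auto simp: complex_eq_iff)
qed

text \<open>Measurable functions of at most polynomial growth in the mean; integration against them defines functionals on
the Schwartz space.\<close>

definition tempered :: "'d::finite cfun \<Rightarrow> bool" where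
  "tempered w \<longleftrightarrow> w \<in> borel_measurable borel \<and> (\<exists>N::nat. integrable lborel (\<lambda>x. norm (w x) / (1 + norm x) ^ N))"

lemma integrable_weight_mult_schwartz:
  fixes f :: "'d::finite cfun"
  assumes "f \<in> schwartz" shows "integrable lborel (\<lambda>x. (1 + norm x) ^ N * norm (f x))"
proof -
  obtain C where C: "C \<ge> 0" "\<And>x. norm (f x) \<le> C / (1 + norm x) ^ (N + Suc CARD('d))"
    using rapidD[OF schwartz_rapid[OF assms]] by blast
  have [measurable]: "f \<in> borel_measurable borel" by (rule schwartz_measurable[OF assms])
  have "integrable lborel (\<lambda>x::real^'d. C * (1 / (1 + norm x) ^ Suc CARD('d)))"
    by (intro integrable_mult_right integrable_weight) auto
  then show ?thesis
  proof (rule Bochner_Integration.integrable_bound)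
    show "AE x in lborel. norm ((1 + norm x) ^ N * norm (f x)) \<le> norm (C * (1 / (1 + norm x) ^ Suc CARD('d)))"
    proof (rule AE_I2)
      fix x :: "real^'d"
      have p: "1 + norm x > 0" by (simp add: add_pos_nonneg)
      have "(1 + norm x) ^ N * norm (f x) \<le> (1 + norm x) ^ N * (C / (1 + norm x) ^ (N + Suc CARD('d)))"
        using C by (intro mult_left_mono) auto
      also have "\<dots> = C * (1 / (1 + norm x) ^ Suc CARD('d))" using p unfolding power_add by simp
      finally show "norm ((1 + norm x) ^ N * norm (f x)) \<le> norm (C * (1 / (1 + norm x) ^ Suc CARD('d)))"
        using C(1) p by (simp add: abs_mult del: power_Suc)
    qed
  qed auto
qed

lemma tempered_integrable:
  fixes w f :: "'d::finite cfun"
  assumes "tempered w" "f \<in> schwartz" shows "integrable lborel (\<lambda>x. w x * f x)"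
proof -
  obtain N where wm[measurable]: "w \<in> borel_measurable borel" and N: "integrable lborel (\<lambda>x. norm (w x) / (1 + norm x) ^ N)"
    using assms unfolding tempered_def by blast
  obtain C where C: "C \<ge> 0" "\<And>x. norm (f x) \<le> C / (1 + norm x) ^ N"
    using rapidD[OF schwartz_rapid[OF assms(2)]] by blast
  have [measurable]: "f \<in> borel_measurable borel" by (rule schwartz_measurable[OF assms(2)])
  show ?thesis
  proof (rule Bochner_Integration.integrable_bound[OF integrable_mult_right[OF N, of C]])
    show "AE x in lborel. norm (w x * f x) \<le> norm (C * (norm (w x) / (1 + norm x) ^ N))"
    proof (rule AE_I2)
      fix x
      show "norm (w x * f x) \<le> norm (C * (norm (w x) / (1 + norm x) ^ N))"
        using mult_left_mono[OF C(2)[of x], of "norm (w x)"] C(1) by (simp add: norm_mult abs_mult mult.commute)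
    qed
  qed auto
qed

lemma tempered_indicator_integrable:
  fixes w :: "'d::finite cfun"
  assumes "tempered w" "A \<in> sets borel" "bounded A"
  shows "integrable lborel (\<lambda>x. indicator A x * w x)"
proof -
  obtain N where wm[measurable]: "w \<in> borel_measurable borel" and N: "integrable lborel (\<lambda>x. norm (w x) / (1 + norm x) ^ N)"
    using assms unfolding tempered_def by blast
  obtain R where R: "\<And>x. x \<in> A \<Longrightarrow> norm x \<le> R" using assms(3) unfolding bounded_iff by blast
  have [measurable]: "A \<in> sets borel" by fact
  show ?thesis
  proof (rule Bochner_Integration.integrable_bound[OF integrable_mult_right[OF N, of "(1 + \<bar>R\<bar>) ^ N"]])
    show "AE x in lborel. norm (indicator A x * w x) \<le> norm ((1 + \<bar>R\<bar>) ^ N * (norm (w x) / (1 + norm x) ^ N))"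
    proof (rule AE_I2)
      fix x
      show "norm (indicator A x * w x) \<le> norm ((1 + \<bar>R\<bar>) ^ N * (norm (w x) / (1 + norm x) ^ N))"
      proof (cases "x \<in> A")
        case True
        have "(1 + norm x) ^ N \<le> (1 + \<bar>R\<bar>) ^ N" using R[OF True] by (intro power_mono) auto
        then have "norm (w x) * (1 + norm x) ^ N \<le> (1 + \<bar>R\<bar>) ^ N * norm (w x)" by (subst mult.commute) (intro mult_right_mono, auto)
        then have "norm (w x) \<le> (1 + \<bar>R\<bar>) ^ N * (norm (w x) / (1 + norm x) ^ N)"
          by (simp add: pos_le_divide_eq add_pos_nonneg)
        then show ?thesis using True by (simp add: abs_mult)
      qed simp
    qed
  qed auto
qed

text \<open>Only one fixed profile \<open>K\<close> and its dilates and translates are tested. Integrating the hypothesis over \<open>y\<close> in a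
box replaces \<open>w\<close> tested against mollifiers by \<open>w\<close> tested against the mollified indicator function of the box, which
converges to a multiple of the indicator function off the boundary.\<close>

lemma AE_zero_if_mollified_zero:
  fixes w K :: "'d::finite cfun"
  assumes w: "tempered w" and K: "K \<in> schwartz" and K1: "(LBINT x. K x) \<noteq> 0"
    and zero: "\<And>y n. (LBINT x. w x * K (real (Suc n) *\<^sub>R (x - y))) = 0"
  shows "AE x in lborel. w x = 0"
proof (rule AE_zero_if_box_integrals_zero)
  obtain N where wm[measurable]: "w \<in> borel_measurable borel" and N: "integrable lborel (\<lambda>x. norm (w x) / (1 + norm x) ^ N)"
    using w unfolding tempered_def by blast
  show "w \<in> borel_measurable borel" by fact
  have Km[measurable]: "K \<in> borel_measurable borel" by (rule schwartz_measurable[OF K])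
  fix a b :: "real^'d"
  let ?B = "box a b"
  have Bm[measurable]: "?B \<in> sets borel" by simp
  show "integrable lborel (\<lambda>x. indicator ?B x * w x)" by (rule tempered_indicator_integrable[OF w]) auto
  obtain R where R: "R \<ge> 0" "\<And>x. x \<in> ?B \<Longrightarrow> norm x \<le> R"
    using bounded_box[of a b] unfolding bounded_iff by (metis abs_ge_self abs_ge_zero order_trans)
  obtain C where C: "C \<ge> 0" "\<And>x. norm (K x) \<le> C / (1 + norm x) ^ N" using rapidD[OF schwartz_rapid[OF K]] by blast
  define m where "m n = real (Suc n)" for n
  have m: "m n \<ge> 1" for n by (simp add: m_def)
  \<comment> \<open>The indicator function of the box, mollified by \<open>K\<close> at scale \<open>1 / m n\<close>.\<close>
  define H where "H n x = (LBINT z. indicator ?B (x - (1 / m n) *\<^sub>R z) * K z)" for n x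
  have p: "1 + norm x > 0" for x :: "real^'d" by (simp add: add_pos_nonneg)
  have Heq: "H n x = cplx (m n ^ CARD('d)) * (LBINT y. indicator ?B y * K (m n *\<^sub>R (x - y)))" for n x
  proof -
    have "integrable lborel (\<lambda>y. K (m n *\<^sub>R x + (- m n) *\<^sub>R y))"
      by (rule integrable_affine_euclidean[OF schwartz_integrable[OF K]]) (use m[of n] in simp)
    then have i1: "integrable lborel (\<lambda>y. K (m n *\<^sub>R (x - y)))" by (simp add: algebra_simps)
    have i2: "integrable lborel (\<lambda>y. indicator ?B y * K (m n *\<^sub>R (x - y)))"
      by (rule Bochner_Integration.integrable_bound[OF i1]) (auto simp: indicator_def)
    have "(LBINT z. indicator ?B (x + (- (1 / m n)) *\<^sub>R z) * K (m n *\<^sub>R (x - (x + (- (1 / m n)) *\<^sub>R z))))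
       = (LBINT y. indicator ?B y * K (m n *\<^sub>R (x - y))) /\<^sub>R \<bar>- (1 / m n)\<bar> ^ DIM(real^'d)"
      by (rule integral_affine_euclidean[OF i2]) (use m[of n] in simp)
    moreover have "m n *\<^sub>R (x - (x + (- (1 / m n)) *\<^sub>R z)) = z" for z :: "real^'d" using m[of n] by simp
    ultimately have "H n x = (LBINT y. indicator ?B y * K (m n *\<^sub>R (x - y))) /\<^sub>R (1 / m n) ^ CARD('d)"
      using m[of n] by (simp add: H_def)
    then show ?thesis using m[of n] by (simp add: scaleR_conv_of_real power_divide)
  qed
  have H0: "(LBINT x. w x * H n x) = 0" for n
  proof -
    let ?w = "\<lambda>x. w x / cplx ((1 + norm x) ^ N)"
    let ?K = "\<lambda>x y. cplx ((1 + norm x) ^ N) * (indicator ?B y * K (m n *\<^sub>R (x - y)))"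
    have nw: "norm (?w x) = norm (w x) / (1 + norm x) ^ N" for x
      using p[of x] by (simp add: norm_divide norm_power del: of_real_power of_real_add)
    have iw: "integrable lborel ?w"
      by (rule integrable_norm_cancel) (use N in \<open>simp_all add: nw del: of_real_power\<close>)
    have iB: "integrable lborel (\<lambda>y. indicator ?B y :: complex)"
    proof -
      have "integrable lborel (\<lambda>y. indicator ?B y :: real)"
        by (rule integrable_real_indicator) (use emeasure_lborel_box_finite[of a b] in auto)
      then have "integrable lborel (\<lambda>y. cplx (indicator ?B y))" by (rule integrable_of_real)
      then show ?thesis by (simp add: of_real_indicator)
    qed
    have Kb: "norm (?K x y) \<le> (1 + R) ^ N * C" for x y
    proof (cases "y \<in> ?B")
      case True
      have "norm x \<le> norm (x - y) + norm y" using norm_triangle_sub[of x y] by simp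
      also have "\<dots> \<le> m n * norm (x - y) + R"
        using m[of n] R(2)[OF True] by (intro add_mono) (auto simp: mult_le_cancel_right1)
      finally have "norm x \<le> m n * norm (x - y) + R" .
      then have "1 + norm x \<le> (1 + R) * (1 + norm (m n *\<^sub>R (x - y)))"
      proof -
        define q where "q = norm (m n *\<^sub>R (x - y))"
        have 1: "0 \<le> R * q" using R(1) by (simp add: q_def)
        have 2: "norm x \<le> q + R" using \<open>norm x \<le> m n * norm (x - y) + R\<close> m[of n] by (simp add: q_def)
        have "(1 + R) * (1 + q) = 1 + q + R + R * q" by (simp add: algebra_simps)
        with 1 2 show ?thesis unfolding q_def[symmetric] by linarith
      qed
      then have "(1 + norm x) ^ N \<le> ((1 + R) * (1 + norm (m n *\<^sub>R (x - y)))) ^ N"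
        by (intro power_mono) auto
      also have "\<dots> = (1 + R) ^ N * (1 + norm (m n *\<^sub>R (x - y))) ^ N" by (rule power_mult_distrib)
      finally have "(1 + norm x) ^ N * norm (K (m n *\<^sub>R (x - y)))
          \<le> ((1 + R) ^ N * (1 + norm (m n *\<^sub>R (x - y))) ^ N) * (C / (1 + norm (m n *\<^sub>R (x - y))) ^ N)"
        using C(1) R(1) by (intro mult_mono C(2)) auto
      also have "\<dots> = (1 + R) ^ N * C" using p[of "m n *\<^sub>R (x - y)"] by simp
      finally show ?thesis using True p[of x] by (simp add: norm_mult norm_power del: of_real_power of_real_add)
    next
      case False then show ?thesis using C(1) R(1) by simp
    qed
    have pair: "integrable (lborel \<Otimes>\<^sub>M lborel) (case_prod (\<lambda>x y. ?K x y * (?w x * indicator ?B y)))"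
    proof (rule integrable_pair_product[OF iw iB _ Kb])
      have "(\<lambda>p::(real^'d)\<times>(real^'d). indicator ?B (snd p) :: complex) \<in> borel_measurable (borel \<Otimes>\<^sub>M borel)"
        by measurable
      then show "(\<lambda>p. cplx ((1 + norm (fst p)) ^ N) * (indicator ?B (snd p) * K (m n *\<^sub>R (fst p - snd p)))) \<in> borel_measurable (borel \<Otimes>\<^sub>M borel)"
        by measurable
    qed
    have e: "?K x y * (?w x * indicator ?B y) = w x * (indicator ?B y * K (m n *\<^sub>R (x - y)))" for x y
    proof -
      define q where "q = cplx ((1 + norm x) ^ N)"
      have "q \<noteq> 0" unfolding q_def of_real_eq_0_iff using p[of x] by simp
      then show ?thesis unfolding q_def[symmetric] by (auto simp: indicator_def)
    qed
    have "(LBINT x. w x * H n x) = cplx (m n ^ CARD('d)) * (LBINT x. (LBINT y. w x * (indicator ?B y * K (m n *\<^sub>R (x - y)))))"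
      unfolding Heq by (simp only: integral_mult_right_zero mult.left_commute[of "w _" "cplx _"])
    also have "(LBINT x. (LBINT y. w x * (indicator ?B y * K (m n *\<^sub>R (x - y)))))
       = (LBINT y. (LBINT x. w x * (indicator ?B y * K (m n *\<^sub>R (x - y)))))"
      using lborel_pair.Fubini_integral[OF pair] unfolding e by simp
    also have "\<dots> = (LBINT y. indicator ?B y * (LBINT x. w x * K (m n *\<^sub>R (x - y))))"
      by (simp only: integral_mult_right_zero mult.left_commute[of "w _" "indicator _ _"])
    also have "\<dots> = 0" using zero unfolding m_def by simp
    finally show ?thesis by simp
  qed
  define D where "D = (1 + R) ^ N * (LBINT z. (1 + norm z) ^ N * norm (K z))"
  \<comment> \<open>A majorant that is uniform in \<open>n\<close>, since the scales are at most \<open>1\<close>.\<close>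
  have Hb: "norm (H n x) \<le> D / (1 + norm x) ^ N" for n x
  proof -
    have "norm (H n x) \<le> (LBINT z. ((1 + R) ^ N / (1 + norm x) ^ N) * ((1 + norm z) ^ N * norm (K z)))"
      unfolding H_def
    proof (rule Bochner_Integration.integral_norm_bound_integral)
      show "integrable lborel (\<lambda>z. indicator ?B (x - (1 / m n) *\<^sub>R z) * K z)"
        by (rule Bochner_Integration.integrable_bound[OF schwartz_integrable[OF K]]) (auto simp: indicator_def)
      show "integrable lborel (\<lambda>z. ((1 + R) ^ N / (1 + norm x) ^ N) * ((1 + norm z) ^ N * norm (K z)))"
        by (intro integrable_mult_right integrable_weight_mult_schwartz K)
      fix z :: "real^'d"
      show "norm (indicator ?B (x - (1 / m n) *\<^sub>R z) * K z) \<le> ((1 + R) ^ N / (1 + norm x) ^ N) * ((1 + norm z) ^ N * norm (K z))"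
      proof (cases "x - (1 / m n) *\<^sub>R z \<in> ?B")
        case True
        have "norm x \<le> norm (x - (1 / m n) *\<^sub>R z) + norm ((1 / m n) *\<^sub>R z)" 
          using norm_triangle_ineq[of "x - (1 / m n) *\<^sub>R z" "(1 / m n) *\<^sub>R z"] by simp
        also have "norm ((1 / m n) *\<^sub>R z) \<le> norm z" using m[of n] by (simp add: divide_le_eq mult_le_cancel_left1)
        also have "norm (x - (1 / m n) *\<^sub>R z) \<le> R" by (rule R(2)[OF True])
        finally have 1: "norm x \<le> R + norm z" by simp
        have 2: "0 \<le> R * norm z" using R(1) by simp
        have "(1 + R) * (1 + norm z) = 1 + norm z + R + R * norm z" by (simp add: algebra_simps)
        with 1 2 have "1 + norm x \<le> (1 + R) * (1 + norm z)" by linarith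
        then have "(1 + norm x) ^ N \<le> (1 + R) ^ N * (1 + norm z) ^ N"
          by (subst power_mult_distrib[symmetric]) (intro power_mono, auto)
        then have "1 \<le> ((1 + R) ^ N * (1 + norm z) ^ N) / (1 + norm x) ^ N" using p[of x] by (simp add: pos_le_divide_eq)
        then have "1 \<le> ((1 + R) ^ N / (1 + norm x) ^ N) * (1 + norm z) ^ N" by simp
        from mult_right_mono[OF this, of "norm (K z)"] show ?thesis using True by (simp add: mult.assoc)
      qed (use R(1) in simp)
    qed
    also have "\<dots> = D / (1 + norm x) ^ N" unfolding D_def integral_mult_right_zero by simp
    finally show ?thesis .
  qed
  have ae: "AE x in lborel. x \<in> ?B \<or> x \<notin> cbox a b"
  proof -
    have "emeasure lborel (cbox a b - ?B) = emeasure lborel (cbox a b) - emeasure lborel ?B"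
      by (rule emeasure_Diff) (use emeasure_lborel_box_finite[of a b] in \<open>auto simp: box_subset_cbox less_top[symmetric]\<close>)
    also have "\<dots> = 0"
      by (simp add: emeasure_lborel_cbox_eq emeasure_lborel_box_eq)
    finally show ?thesis by (intro AE_I[where N="cbox a b - ?B"]) auto
  qed
  have lim: "(\<lambda>n. w x * H n x) \<longlonglongrightarrow> w x * (indicator ?B x * (LBINT z. K z))" if x: "x \<in> ?B \<or> x \<notin> cbox a b" for x
  proof -
    have "(\<lambda>n. H n x) \<longlonglongrightarrow> (LBINT z. indicator ?B x * K z)"
      unfolding H_def
    proof (rule integral_dominated_convergence[where w="\<lambda>z. norm (K z)"])
      show "AE z in lborel. (\<lambda>n. indicator ?B (x - (1 / m n) *\<^sub>R z) * K z) \<longlonglongrightarrow> indicator ?B x * K z"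
      proof (rule AE_I2)
        fix z :: "real^'d"
        have "(\<lambda>n. x - (1 / m n) *\<^sub>R z) \<longlonglongrightarrow> x - 0 *\<^sub>R z"
          unfolding m_def using LIMSEQ_inverse_real_of_nat by (intro tendsto_intros) (simp add: inverse_eq_divide)
        then have l: "(\<lambda>n. x - (1 / m n) *\<^sub>R z) \<longlonglongrightarrow> x" by simp
        have "eventually (\<lambda>n. indicator ?B (x - (1 / m n) *\<^sub>R z) = (indicator ?B x :: complex)) sequentially"
        proof (cases "x \<in> ?B")
          case True
          then show ?thesis using topological_tendstoD[OF l open_box True] by (auto elim: eventually_mono)
        next
          case False
          then have "x \<in> - cbox a b" using x by blast
          have "open (- cbox a b)" using closed_cbox[of a b] by (rule open_Compl)
          from topological_tendstoD[OF l this \<open>x \<in> - cbox a b\<close>]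
          have "eventually (\<lambda>n. x - (1 / m n) *\<^sub>R z \<in> - cbox a b) sequentially" .
          then show ?thesis using False box_subset_cbox[of a b] by (auto elim!: eventually_mono simp: indicator_def)
        qed
        then show "(\<lambda>n. indicator ?B (x - (1 / m n) *\<^sub>R z) * K z) \<longlonglongrightarrow> indicator ?B x * K z"
          by (intro tendsto_mult tendsto_const tendsto_eventually)
      qed
      show "integrable lborel (\<lambda>z. norm (K z))" by (intro integrable_norm schwartz_integrable K)
    qed (auto simp: indicator_def)
    then show ?thesis by (intro tendsto_mult tendsto_const) simp
  qed
  have Hm: "(\<lambda>x. H n x) \<in> borel_measurable borel" for n
  proof -
    have [measurable]: "(\<lambda>p::(real^'d)\<times>(real^'d). indicator ?B (fst p - (1 / m n) *\<^sub>R snd p) * K (snd p)) \<in> borel_measurable (borel \<Otimes>\<^sub>M lborel)"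
      by measurable
    have "(\<lambda>x. \<integral>z. (\<lambda>p. indicator ?B (fst p - (1 / m n) *\<^sub>R snd p) * K (snd p)) (x, z) \<partial>lborel) \<in> borel_measurable borel"
      by (rule lborel.borel_measurable_lebesgue_integral) (simp add: case_prod_unfold)
    then show ?thesis by (simp add: H_def)
  qed
  have "(\<lambda>n. \<integral>x. w x * H n x \<partial>lborel) \<longlonglongrightarrow> (LBINT x. w x * (indicator ?B x * (LBINT z. K z)))"
  proof (rule integral_dominated_convergence[where w="\<lambda>x. D * (norm (w x) / (1 + norm x) ^ N)"])
    show "AE x in lborel. (\<lambda>n. w x * H n x) \<longlonglongrightarrow> w x * (indicator ?B x * (LBINT z. K z))"
      using ae by (rule AE_mp) (intro AE_I2 impI lim)
    show "AE x in lborel. norm (w x * H n x) \<le> D * (norm (w x) / (1 + norm x) ^ N)" for n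
    proof (rule AE_I2)
      fix x show "norm (w x * H n x) \<le> D * (norm (w x) / (1 + norm x) ^ N)"
        using mult_left_mono[OF Hb[of n x], of "norm (w x)"] by (simp add: norm_mult mult.commute)
    qed
    show "integrable lborel (\<lambda>x. D * (norm (w x) / (1 + norm x) ^ N))" by (intro integrable_mult_right N)
  qed (use Hm in auto)
  then have "(LBINT x. w x * (indicator ?B x * (LBINT z. K z))) = 0"
    unfolding H0 by (simp add: LIMSEQ_const_iff)
  moreover have "w x * (indicator ?B x * (LBINT z. K z)) = (indicator ?B x * w x) * (LBINT z. K z)" for x by simp
  ultimately have "(LBINT x. indicator ?B x * w x) * (LBINT z. K z) = 0"
    by (simp only: integral_mult_left_zero)
  then show "(LBINT x. indicator ?B x * w x) = 0" using K1 by simp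
qed

text \<open>Test with dilated and translated Gaussians.\<close>

lemma tempered_annihilates_schwartz:
  fixes w :: "'d::finite cfun"
  assumes w: "tempered w" and z: "\<And>f. f \<in> schwartz \<Longrightarrow> (LBINT x. w x * f x) = 0"
  shows "AE x in lborel. w x = 0"
proof (rule AE_zero_if_mollified_zero[OF w schwartz_gauss])
  have "fourier gauss (0::real^'d) = cplx (fconst TYPE('d)) * (LBINT (x::real^'d). gauss x)"
    by (simp add: fourier_eq)
  moreover have "fourier gauss (0::real^'d) = 1" by (simp add: fourier_gauss) (simp add: gauss_def)
  ultimately show "(LBINT (x::real^'d). gauss x) \<noteq> 0" by auto
  fix y :: "real^'d" and n
  have "(\<lambda>x. gauss ((- (real (Suc n) *\<^sub>R y)) + real (Suc n) *\<^sub>R x)) \<in> schwartz"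
    by (rule schwartz_affine(1)[OF schwartz_gauss]) simp
  then have "(\<lambda>x. gauss (real (Suc n) *\<^sub>R (x - y))) \<in> schwartz" by (simp add: scaleR_diff_right del: of_nat_Suc)
  then show "(LBINT x. w x * gauss (real (Suc n) *\<^sub>R (x - y))) = 0" by (rule z)
qed

lemma AE_nonzero_real_vec: "AE x in lborel. x \<noteq> (0::real^'d::finite)" by (rule AE_lborel_singleton)

lemma tempered_mult_bounded:
  fixes w g :: "'d::finite cfun"
  assumes "tempered w" "g \<in> borel_measurable borel" "\<And>x. norm (g x) \<le> B * (1 + norm x) ^ M"
  shows "tempered (\<lambda>x. g x * w x)"
proof -
  obtain N where wm[measurable]: "w \<in> borel_measurable borel" and N: "integrable lborel (\<lambda>x. norm (w x) / (1 + norm x) ^ N)"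
    using assms unfolding tempered_def by blast
  have [measurable]: "g \<in> borel_measurable borel" by fact
  have "integrable lborel (\<lambda>x. norm (g x * w x) / (1 + norm x) ^ (M + N))"
  proof (rule Bochner_Integration.integrable_bound[OF integrable_mult_right[OF N, of B]])
    show "AE x in lborel. norm (norm (g x * w x) / (1 + norm x) ^ (M + N)) \<le> norm (B * (norm (w x) / (1 + norm x) ^ N))"
    proof (rule AE_I2)
      fix x :: "real^'d"
      have p: "1 + norm x > 0" by (simp add: add_pos_nonneg)
      have "norm (g x * w x) / (1 + norm x) ^ (M + N) = norm (g x) * norm (w x) / (1 + norm x) ^ (M + N)" by (simp add: norm_mult)
      also have "\<dots> \<le> (B * (1 + norm x) ^ M) * norm (w x) / (1 + norm x) ^ (M + N)"
        using p assms(3) by (intro divide_right_mono mult_right_mono) auto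
      also have "\<dots> = B * (norm (w x) / (1 + norm x) ^ N)" using p by (simp add: power_add)
      finally have "norm (g x * w x) / (1 + norm x) ^ (M + N) \<le> \<bar>B * (norm (w x) / (1 + norm x) ^ N)\<bar>" by linarith
      then show "norm (norm (g x * w x) / (1 + norm x) ^ (M + N)) \<le> norm (B * (norm (w x) / (1 + norm x) ^ N))"
        using p by simp
    qed
  qed auto
  then show ?thesis unfolding tempered_def by auto
qed

text \<open>Multiplying by a fixed element of \<open>Psi\<close> without zeros off the origin reduces this to arbitrary Schwartz
test functions.\<close>

lemma tempered_annihilates_Psi:
  fixes w :: "'d::finite cfun"
  assumes w: "tempered w" and z: "\<And>f. f \<in> Psi \<Longrightarrow> (LBINT x. w x * f x) = 0"
  shows "AE x in lborel. w x = 0"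
proof -
  have bS: "(bump :: 'd cfun) \<in> schwartz" by (rule Psi_schwartz[OF bump_Psi])
  obtain B where B: "\<And>x. norm (bump (x :: real^'d)) \<le> B" using schwartz_bounded[OF bS] by blast
  have "tempered (\<lambda>x. bump x * w x)"
    by (rule tempered_mult_bounded[OF w, of _ B 0]) (use B schwartz_measurable[OF bS] in auto)
  then have "AE x in lborel. bump x * w x = 0"
  proof (rule tempered_annihilates_schwartz)
    fix f :: "'d cfun" assume "f \<in> schwartz"
    from z[OF Psi_mult[OF this bump_Psi]] show "(LBINT x. bump x * w x * f x) = 0" by (simp add: mult_ac)
  qed
  with AE_nonzero_real_vec show ?thesis by (rule AE_mp[OF _ AE_mp]) (auto simp: bump_nonzero)
qed

text \<open>A condition common to all Lebesgue spaces \<open>L^p\<close> with \<open>1 \<le> p < \<infinity>\<close> and to continuous functions vanishing at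
infinity, closed under differences. It excludes the nonzero polynomials, which annihilate \<open>Phi\<close>.\<close>

definition small_at_infinity :: "'d::finite cfun \<Rightarrow> bool" where
  "small_at_infinity w \<longleftrightarrow> w \<in> borel_measurable borel \<and>
     (\<forall>\<delta>>0. integrable lborel (\<lambda>x. indicator {x. norm (w x) > \<delta>} x * norm (w x)))"

lemma tempered_add:
  fixes v w :: "'d::finite cfun"
  assumes "tempered v" "tempered w" shows "tempered (\<lambda>x. v x + w x)"
proof -
  obtain N where vm[measurable]: "v \<in> borel_measurable borel" and N: "integrable lborel (\<lambda>x. norm (v x) / (1 + norm x) ^ N)"
    using assms unfolding tempered_def by blast
  obtain M where wm[measurable]: "w \<in> borel_measurable borel" and M: "integrable lborel (\<lambda>x. norm (w x) / (1 + norm x) ^ M)"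
    using assms unfolding tempered_def by blast
  have "integrable lborel (\<lambda>x. norm (v x + w x) / (1 + norm x) ^ (N + M))"
  proof (rule Bochner_Integration.integrable_bound[OF Bochner_Integration.integrable_add[OF N M]])
    show "AE x in lborel. norm (norm (v x + w x) / (1 + norm x) ^ (N + M)) \<le> norm (norm (v x) / (1 + norm x) ^ N + norm (w x) / (1 + norm x) ^ M)"
    proof (rule AE_I2)
      fix x :: "real^'d"
      have p: "1 + norm x \<ge> 1" "1 + norm x > 0" by (simp_all add: add_pos_nonneg)
      have "norm (v x + w x) / (1 + norm x) ^ (N + M) \<le> (norm (v x) + norm (w x)) / (1 + norm x) ^ (N + M)"
        using p by (intro divide_right_mono norm_triangle_ineq) auto
      also have "\<dots> = norm (v x) / (1 + norm x) ^ (N + M) + norm (w x) / (1 + norm x) ^ (N + M)" by (rule add_divide_distrib)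
      also have "\<dots> \<le> norm (v x) / (1 + norm x) ^ N + norm (w x) / (1 + norm x) ^ M"
        using p by (intro add_mono divide_left_mono power_increasing) auto
      finally show "norm (norm (v x + w x) / (1 + norm x) ^ (N + M)) \<le> norm (norm (v x) / (1 + norm x) ^ N + norm (w x) / (1 + norm x) ^ M)"
        using p by simp
    qed
  qed auto
  then show ?thesis unfolding tempered_def by auto
qed

lemma small_tempered:
  fixes w :: "'d::finite cfun"
  assumes "small_at_infinity w" shows "tempered w"
proof -
  have wm[measurable]: "w \<in> borel_measurable borel" using assms by (simp add: small_at_infinity_def)
  have i: "integrable lborel (\<lambda>x. indicator {x. norm (w x) > 1} x * norm (w x))" using assms by (simp add: small_at_infinity_def)
  let ?N = "Suc CARD('d)"
  have "integrable lborel (\<lambda>x. norm (w x) / (1 + norm x) ^ ?N)"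
  proof (rule Bochner_Integration.integrable_bound)
    show "integrable lborel (\<lambda>x. 1 / (1 + norm x) ^ ?N + indicator {x. norm (w x) > 1} x * norm (w x))"
      by (intro Bochner_Integration.integrable_add i integrable_weight) simp
    show "AE x in lborel. norm (norm (w x) / (1 + norm x) ^ ?N) \<le> norm (1 / (1 + norm x) ^ ?N + indicator {x. norm (w x) > 1} x * norm (w x))"
    proof (rule AE_I2)
      fix x :: "real^'d"
      define t where "t = (1 + norm x) ^ ?N"
      have p: "t \<ge> 1" unfolding t_def by (rule one_le_power) simp
      then have t: "1 / t \<ge> 0" "norm (w x) / t \<ge> 0" "norm (w x) / t \<le> norm (w x)"
        using divide_left_mono[of 1 t "norm (w x)"] by auto
      have "norm (w x) / t \<le> 1 / t" if "norm (w x) \<le> 1"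
        using that p by (intro divide_right_mono) auto
      then show "norm (norm (w x) / (1 + norm x) ^ ?N) \<le> norm (1 / (1 + norm x) ^ ?N + indicator {x. norm (w x) > 1} x * norm (w x))"
        unfolding t_def[symmetric] using t
        by (cases "norm (w x) > 1") (auto simp: abs_of_nonneg add_nonneg_nonneg intro: add_increasing)
    qed
  qed measurable
  then show ?thesis using wm unfolding tempered_def by blast
qed

lemma small_diff:
  fixes v w :: "'d::finite cfun"
  assumes "small_at_infinity v" "small_at_infinity w" shows "small_at_infinity (\<lambda>x. v x - w x)"
  unfolding small_at_infinity_def
proof (intro conjI allI impI)
  have [measurable]: "v \<in> borel_measurable borel" "w \<in> borel_measurable borel" using assms by (auto simp: small_at_infinity_def)
  show "(\<lambda>x. v x - w x) \<in> borel_measurable borel" by measurable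
  fix \<delta> :: real assume d: "\<delta> > 0"
  let ?I = "\<lambda>u x. indicator {x. norm (u x) > \<delta> / 2} x * norm (u x :: complex)"
  show "integrable lborel (\<lambda>x. indicator {x. norm (v x - w x) > \<delta>} x * norm (v x - w x))"
  proof (rule Bochner_Integration.integrable_bound)
    show "integrable lborel (\<lambda>x. 2 * ?I v x + 2 * ?I w x)"
      using assms half_gt_zero[OF d] unfolding small_at_infinity_def
      by (intro Bochner_Integration.integrable_add integrable_mult_right) blast+
    show "AE x in lborel. norm (indicator {x. norm (v x - w x) > \<delta>} x * norm (v x - w x)) \<le> norm (2 * ?I v x + 2 * ?I w x)"
    proof (rule AE_I2)
      fix x
      show "norm (indicator {x. norm (v x - w x) > \<delta>} x * norm (v x - w x)) \<le> norm (2 * ?I v x + 2 * ?I w x)"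
        using norm_triangle_ineq4[of "v x" "w x"] norm_ge_zero[of "v x"] norm_ge_zero[of "w x"]
        by (auto simp: indicator_def simp del: norm_ge_zero)
    qed
  qed measurable
qed

text \<open>This is the injectivity of \<open>embed\<close>. The dilates of the transform \<open>K\<close> of the plateau differ by elements of
\<open>Phi\<close>, so the mollification of \<open>w\<close> by \<open>K\<close> is the same at every scale. As the scale becomes infinitely wide
it tends to zero: the part of \<open>w\<close> above level \<open>\<delta>\<close> is integrable and is spread out, the rest contributes at
most \<open>\<delta>\<close> times the mass of \<open>K\<close>. So all mollifications vanish.\<close>

lemma small_annihilates_Phi:
  fixes w :: "'d::finite cfun"
  assumes w: "small_at_infinity w" and z: "\<And>f. f \<in> Phi \<Longrightarrow> (LBINT x. w x * f x) = 0"
  shows "AE x in lborel. w x = 0"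
proof -
  have wm[measurable]: "w \<in> borel_measurable borel" using w by (simp add: small_at_infinity_def)
  note wt = small_tempered[OF w]
  define K :: "'d cfun" where "K = fourier plateau"
  have KS: "K \<in> schwartz" unfolding K_def by (intro schwartz_fourier plateau_schwartz)
  have Km[measurable]: "K \<in> borel_measurable borel" by (rule schwartz_measurable[OF KS])
  have K1: "(LBINT x. K x) \<noteq> 0"
  proof -
    have "fourier K 0 = cplx (fconst TYPE('d)) * (LBINT x. K x)" by (simp add: fourier_eq)
    moreover have "fourier K (- 0) = plateau (0::real^'d)" unfolding K_def by (rule fourier_inversion[OF plateau_schwartz])
    ultimately show ?thesis by (auto simp: plateau_def)
  qed
  have KaS: "(\<lambda>x. K (\<mu> *\<^sub>R (x - y))) \<in> schwartz" if "\<mu> > 0" for \<mu> y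
    using schwartz_affine(1)[OF KS, of \<mu> "- (\<mu> *\<^sub>R y)"] that by (simp add: scaleR_diff_right)
  \<comment> \<open>The mollification of \<open>w\<close> at \<open>y\<close> with scale \<open>1 / \<mu>\<close>.\<close>
  define I where "I \<mu> y = (LBINT x. w x * (cplx (\<mu> ^ CARD('d)) * K (\<mu> *\<^sub>R (x - y))))" for \<mu> y
  have Iint: "integrable lborel (\<lambda>x. w x * (cplx (\<mu> ^ CARD('d)) * K (\<mu> *\<^sub>R (x - y))))" if "\<mu> > 0" for \<mu> y
    by (intro tempered_integrable[OF wt] schwartz_cmult KaS that)
  \<comment> \<open>The difference of the two kernels lies in \<open>Phi\<close>.\<close>
  have const: "I \<mu> y = I \<nu> y" if mu: "\<mu> > 0" "\<nu> > 0" for \<mu> \<nu> y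
  proof -
    let ?g = "\<lambda>m k. chr (- y) k * plateau ((1 / m) *\<^sub>R k)"
    have gi: "integrable lborel (?g m)" if "m > 0" for m
      using integrable_affine_euclidean[OF schwartz_integrable[OF plateau_schwartz], of "1 / m" "0::real^'d"] that
      by (intro integrable_chr_mult) simp
    have F: "fourier (?g m) x = cplx (m ^ CARD('d)) * K (m *\<^sub>R (x - y))" if "m > 0" for m x
      using fourier_modulated[of "1 / m" plateau y x] that schwartz_integrable[OF plateau_schwartz, where 'd='d]
      by (simp add: K_def power_divide)
    have "(\<lambda>k. plateau ((1 / \<mu>) *\<^sub>R k) - plateau ((\<mu> / \<nu>) *\<^sub>R ((1 / \<mu>) *\<^sub>R k))) \<in> (Psi :: 'd cfun set)"
      using Psi_scale[OF plateau_dilation_diff[of "\<mu> / \<nu>", where 'd='d], of "1 / \<mu>"] mu by simp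
    then have "(\<lambda>k. chr (- y) k * (plateau ((1 / \<mu>) *\<^sub>R k) - plateau ((1 / \<nu>) *\<^sub>R k))) \<in> Psi"
      using mu by (intro Psi_chr) simp
    then have "(\<lambda>k. ?g \<mu> k - ?g \<nu> k) \<in> Psi" by (simp add: right_diff_distrib)
    then have "fourier (\<lambda>k. ?g \<mu> k - ?g \<nu> k) \<in> Phi" by (rule fourier_Psi)
    moreover have "fourier (\<lambda>k. ?g \<mu> k - ?g \<nu> k) = (\<lambda>x. cplx (\<mu> ^ CARD('d)) * K (\<mu> *\<^sub>R (x - y)) - cplx (\<nu> ^ CARD('d)) * K (\<nu> *\<^sub>R (x - y)))"
      using fourier_diff[OF gi[OF mu(1)] gi[OF mu(2)]] F mu by auto
    ultimately have "(\<lambda>x. cplx (\<mu> ^ CARD('d)) * K (\<mu> *\<^sub>R (x - y)) - cplx (\<nu> ^ CARD('d)) * K (\<nu> *\<^sub>R (x - y))) \<in> Phi"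
      by (simp only:)
    from z[OF this] have "(LBINT x. w x * (cplx (\<mu> ^ CARD('d)) * K (\<mu> *\<^sub>R (x - y)) - cplx (\<nu> ^ CARD('d)) * K (\<nu> *\<^sub>R (x - y)))) = 0" .
    then show ?thesis unfolding I_def using Iint[OF mu(1)] Iint[OF mu(2)] by (simp add: right_diff_distrib)
  qed
  obtain B where B: "B \<ge> 0" "\<And>x. norm (K x) \<le> B" using schwartz_bounded[OF KS] by blast
  define L where "L = (LBINT x. norm (K x))"
  have L: "L \<ge> 0" unfolding L_def by simp
  \<comment> \<open>Split \<open>w\<close> at the level \<open>\<delta>\<close>.\<close>
  have Ibound: "norm (I \<mu> y) \<le> \<delta> * L + \<mu> ^ CARD('d) * B * (LBINT x. indicator {x. norm (w x) > \<delta>} x * norm (w x))"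
    if mu: "\<mu> > 0" and d: "\<delta> > 0" for \<mu> \<delta> y
  proof -
    have iK: "integrable lborel (\<lambda>x. norm (K (\<mu> *\<^sub>R (x - y))))" by (intro integrable_norm schwartz_integrable KaS mu)
    have iw: "integrable lborel (\<lambda>x. indicator {x. norm (w x) > \<delta>} x * norm (w x))" using w d by (simp add: small_at_infinity_def)
    have sc: "(LBINT x. norm (K (\<mu> *\<^sub>R (x - y)))) = L / \<mu> ^ CARD('d)"
    proof -
      have "(LBINT x. norm (K (- (\<mu> *\<^sub>R y) + \<mu> *\<^sub>R x))) = (LBINT x. norm (K x)) /\<^sub>R \<bar>\<mu>\<bar> ^ DIM(real^'d)"
        by (rule integral_affine_euclidean) (use mu KS in \<open>auto intro: schwartz_integrable\<close>)
      then show ?thesis using mu by (simp add: L_def scaleR_diff_right divide_inverse mult.commute)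
    qed
    have "norm (I \<mu> y) \<le> (LBINT x. \<mu> ^ CARD('d) * (\<delta> * norm (K (\<mu> *\<^sub>R (x - y)))) + \<mu> ^ CARD('d) * B * (indicator {x. norm (w x) > \<delta>} x * norm (w x)))"
      unfolding I_def
    proof (rule Bochner_Integration.integral_norm_bound_integral[OF Iint[OF mu]])
      show "integrable lborel (\<lambda>x. \<mu> ^ CARD('d) * (\<delta> * norm (K (\<mu> *\<^sub>R (x - y)))) + \<mu> ^ CARD('d) * B * (indicator {x. norm (w x) > \<delta>} x * norm (w x)))"
        by (intro Bochner_Integration.integrable_add integrable_mult_right iK iw)
      fix x
      have "norm (w x) * norm (K (\<mu> *\<^sub>R (x - y))) \<le> \<delta> * norm (K (\<mu> *\<^sub>R (x - y))) + B * (indicator {x. norm (w x) > \<delta>} x * norm (w x))"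
      proof (cases "norm (w x) > \<delta>")
        case True
        have "norm (w x) * norm (K (\<mu> *\<^sub>R (x - y))) \<le> norm (w x) * B" by (intro mult_left_mono B) auto
        then show ?thesis using True d by (simp add: mult.commute add_increasing)
      next
        case False then show ?thesis by (simp add: mult_right_mono)
      qed
      then have "\<mu> ^ CARD('d) * (norm (w x) * norm (K (\<mu> *\<^sub>R (x - y)))) \<le> \<mu> ^ CARD('d) * (\<delta> * norm (K (\<mu> *\<^sub>R (x - y))) + B * (indicator {x. norm (w x) > \<delta>} x * norm (w x)))"
        using mu by (intro mult_left_mono) auto
      then show "norm (w x * (cplx (\<mu> ^ CARD('d)) * K (\<mu> *\<^sub>R (x - y)))) \<le> \<mu> ^ CARD('d) * (\<delta> * norm (K (\<mu> *\<^sub>R (x - y)))) + \<mu> ^ CARD('d) * B * (indicator {x. norm (w x) > \<delta>} x * norm (w x))"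
        using mu by (simp add: norm_mult norm_power algebra_simps)
    qed
    also have "\<dots> = (LBINT x. \<mu> ^ CARD('d) * (\<delta> * norm (K (\<mu> *\<^sub>R (x - y))))) + (LBINT x. \<mu> ^ CARD('d) * B * (indicator {x. norm (w x) > \<delta>} x * norm (w x)))"
      by (rule Bochner_Integration.integral_add) (intro integrable_mult_right iK iw)+
    also have "\<dots> = \<mu> ^ CARD('d) * (\<delta> * (L / \<mu> ^ CARD('d))) + \<mu> ^ CARD('d) * B * (LBINT x. indicator {x. norm (w x) > \<delta>} x * norm (w x))"
      by (simp only: integral_mult_right_zero sc)
    finally show ?thesis using mu by simp
  qed
  have I0: "I \<mu> y = 0" if mu: "\<mu> > 0" for \<mu> y
  proof (rule ccontr)
    assume "I \<mu> y \<noteq> 0"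
    define e where "e = norm (I \<mu> y)"
    have e: "e > 0" using \<open>I \<mu> y \<noteq> 0\<close> by (simp add: e_def)
    define \<delta> where "\<delta> = e / 2 / (L + 1)"
    have d1: "\<delta> > 0" using e L by (simp add: \<delta>_def)
    have "L + 1 \<noteq> 0" using L by linarith
    then have "\<delta> * (L + 1) = e / 2" unfolding \<delta>_def by (rule nonzero_eq_divide_eq[THEN iffD1, OF _ refl])
    then have "\<delta> * L + \<delta> = e / 2" by (simp add: distrib_left)
    then have d: "\<delta> > 0" "\<delta> * L < e" using d1 e by linarith+
    define J where "J = B * (LBINT x. indicator {x. norm (w x) > \<delta>} x * norm (w x))"
    have le: "e \<le> \<delta> * L + (1 / real (Suc n)) ^ CARD('d) * J" for n
      using Ibound[of "1 / real (Suc n)" \<delta> y] const[OF mu, of "1 / real (Suc n)" y] d by (simp add: e_def J_def mult.assoc)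
    have "(\<lambda>n. 1 / real (Suc n)) \<longlonglongrightarrow> 0" using LIMSEQ_inverse_real_of_nat by (simp add: inverse_eq_divide)
    then have "(\<lambda>n. \<delta> * L + (1 / real (Suc n)) ^ CARD('d) * J) \<longlonglongrightarrow> \<delta> * L + 0 ^ CARD('d) * J" by (intro tendsto_intros)
    then have "(\<lambda>n. \<delta> * L + (1 / real (Suc n)) ^ CARD('d) * J) \<longlonglongrightarrow> \<delta> * L" by (simp add: power_0_left)
    then have "e \<le> \<delta> * L" using le by (intro LIMSEQ_le_const) auto
    then show False using d by simp
  qed
  show ?thesis
  proof (rule AE_zero_if_mollified_zero[OF wt KS K1])
    fix y n
    have m: "real (Suc n) > 0" by simp
    have "cplx (real (Suc n) ^ CARD('d)) * (LBINT x. w x * K (real (Suc n) *\<^sub>R (x - y))) = I (real (Suc n)) y"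
      unfolding I_def by (simp only: integral_mult_right_zero mult.left_commute[of "w _" "cplx _"])
    then show "(LBINT x. w x * K (real (Suc n) *\<^sub>R (x - y))) = 0"
      unfolding I0[OF m] by (simp del: of_nat_Suc)
  qed
qed

section \<open>The Fourier transform of square integrable functions\<close>

definition L2 :: "'d::finite cfun \<Rightarrow> bool" where
  "L2 f \<longleftrightarrow> f \<in> borel_measurable borel \<and> integrable lborel (\<lambda>x. (norm (f x))\<^sup>2)"

text \<open>The squared norm, rather than the norm, keeps square roots out of the estimates.\<close>

definition nsq :: "'d::finite cfun \<Rightarrow> real" where
  "nsq f = (LBINT x. (norm (f x))\<^sup>2)"

lemma nsq_nonneg: "nsq f \<ge> 0" by (simp add: nsq_def)

lemma nn_nsq: "L2 f \<Longrightarrow> (\<integral>\<^sup>+x. ennreal ((norm (f x))\<^sup>2) \<partial>lborel) = ennreal (nsq f)"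
  unfolding L2_def nsq_def by (intro nn_integral_eq_integral) auto

lemma L2_if_nn:
  fixes f :: "'d::finite cfun"
  assumes "f \<in> borel_measurable borel" "(\<integral>\<^sup>+x. ennreal ((norm (f x))\<^sup>2) \<partial>lborel) \<le> ennreal A" "A \<ge> 0"
  shows "L2 f" "nsq f \<le> A"
proof -
  show L: "L2 f" unfolding L2_def
  proof
    show "integrable lborel (\<lambda>x. (norm (f x))\<^sup>2)"
      by (rule integrableI_nonneg) (use assms le_less_trans[OF assms(2)] in auto)
  qed fact
  show "nsq f \<le> A" using nn_nsq[OF L] assms by simp
qed

lemma L2_small:
  fixes f :: "'d::finite cfun"
  assumes "L2 f" shows "small_at_infinity f"
  unfolding small_at_infinity_def
proof (intro conjI allI impI)
  show fm[measurable]: "f \<in> borel_measurable borel" using assms by (simp add: L2_def)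
  fix \<delta> :: real assume d: "\<delta> > 0"
  show "integrable lborel (\<lambda>x. indicator {x. norm (f x) > \<delta>} x * norm (f x))"
  proof (rule Bochner_Integration.integrable_bound)
    show "integrable lborel (\<lambda>x. (1 / \<delta>) * (norm (f x))\<^sup>2)" using assms by (intro integrable_mult_right) (simp add: L2_def)
    show "AE x in lborel. norm (indicator {x. norm (f x) > \<delta>} x * norm (f x)) \<le> norm ((1 / \<delta>) * (norm (f x))\<^sup>2)"
    proof (rule AE_I2)
      fix x
      show "norm (indicator {x. norm (f x) > \<delta>} x * norm (f x)) \<le> norm ((1 / \<delta>) * (norm (f x))\<^sup>2)"
      proof (cases "norm (f x) > \<delta>")
        case True
        have "norm (f x) * \<delta> \<le> norm (f x) * norm (f x)" using True by (intro mult_left_mono) auto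
        then show ?thesis using True d by (simp add: power2_eq_square pos_le_divide_eq)
      qed simp
    qed
  qed measurable
qed

lemma L2_tempered: "L2 f \<Longrightarrow> tempered f" by (intro small_tempered L2_small)

lemma L2_pair:
  fixes u v :: "'d::finite cfun"
  assumes "L2 u" "L2 v"
  shows "integrable lborel (\<lambda>x. u x * v x)" "(norm (LBINT x. u x * v x))\<^sup>2 \<le> nsq u * nsq v"
    "(LBINT x. norm (u x * v x))\<^sup>2 \<le> nsq u * nsq v"
proof -
  have [measurable]: "u \<in> borel_measurable borel" "v \<in> borel_measurable borel" using assms by (auto simp: L2_def)
  have CS: "integrable lborel (\<lambda>x. norm (u x) * norm (v x))"
    "(LBINT x. \<bar>norm (u x) * norm (v x)\<bar>)\<^sup>2 \<le> (LBINT x. (norm (u x))\<^sup>2) * (LBINT x. (norm (v x))\<^sup>2)"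
    by (rule Cauchy_Schwarz_integral; use assms in \<open>auto simp: L2_def\<close>)+
  show 1: "integrable lborel (\<lambda>x. u x * v x)"
    by (rule Bochner_Integration.integrable_bound[OF CS(1)]) (auto simp: norm_mult)
  show 2: "(LBINT x. norm (u x * v x))\<^sup>2 \<le> nsq u * nsq v"
    using CS(2) by (simp add: nsq_def norm_mult)
  have "(norm (LBINT x. u x * v x))\<^sup>2 \<le> (LBINT x. norm (u x * v x))\<^sup>2"
    by (intro power_mono integral_norm_bound) simp
  with 2 show "(norm (LBINT x. u x * v x))\<^sup>2 \<le> nsq u * nsq v" by linarith
qed

lemma schwartz_L2:
  fixes f :: "'d::finite cfun"
  assumes "f \<in> schwartz" shows "L2 f"
proof -
  obtain B where B: "\<And>x. norm (f x) \<le> B" using schwartz_bounded[OF assms] by blast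
  have m[measurable]: "f \<in> borel_measurable borel" by (rule schwartz_measurable[OF assms])
  have "integrable lborel (\<lambda>x. (norm (f x))\<^sup>2)"
  proof (rule Bochner_Integration.integrable_bound)
    show "integrable lborel (\<lambda>x. B * norm (f x))" by (intro integrable_mult_right integrable_norm schwartz_integrable assms)
    show "AE x in lborel. norm ((norm (f x))\<^sup>2) \<le> norm (B * norm (f x))"
    proof (rule AE_I2)
      fix x
      have "norm (f x) * norm (f x) \<le> B * norm (f x)" by (intro mult_right_mono B) auto
      also have "\<dots> \<le> \<bar>B * norm (f x)\<bar>" by (rule abs_ge_self)
      finally show "norm ((norm (f x))\<^sup>2) \<le> norm (B * norm (f x))" by (simp add: power2_eq_square)
    qed
  qed measurable
  then show ?thesis using m by (simp add: L2_def)
qed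

lemma fourier_continuous:
  fixes f :: "'d::finite cfun"
  assumes "integrable lborel f" shows "continuous_on UNIV (fourier f)"
proof -
  have [measurable]: "f \<in> borel_measurable borel" using assms by (auto dest: borel_measurable_integrable)
  have "isCont (fourier f) k" for k
    unfolding continuous_at_sequentially
  proof (intro allI impI)
      fix X assume X: "X \<longlonglongrightarrow> k"
      have "(\<lambda>n. \<integral>x. chr (X n) x * f x \<partial>lborel) \<longlonglongrightarrow> (LBINT x. chr k x * f x)"
      proof (rule integral_dominated_convergence[where w="\<lambda>x. norm (f x)"])
        show "AE x in lborel. (\<lambda>n. chr (X n) x * f x) \<longlonglongrightarrow> chr k x * f x"
          unfolding chr_def by (intro AE_I2 tendsto_intros X)
      qed (use assms in \<open>auto simp: norm_mult\<close>)
      then show "(fourier f \<circ> X) \<longlonglongrightarrow> fourier f k"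
        unfolding fourier_eq[abs_def] o_def by (intro tendsto_intros)
  qed
  then show ?thesis by (intro continuous_at_imp_continuous_on) auto
qed

lemma fourier_measurable: "integrable lborel f \<Longrightarrow> fourier f \<in> borel_measurable borel"
  by (intro borel_measurable_continuous_onI fourier_continuous)

lemma cnj_fourier:
  fixes f :: "'d::finite cfun"
  shows "cnj (fourier f k) = fourier (\<lambda>x. cnj (f x)) (- k)"
proof -
  have "cnj (LBINT x. chr k x * f x) = (LBINT x. cnj (chr k x * f x))" by (rule Bochner_Integration.integral_cnj[symmetric])
  moreover have "cnj (chr k x) = chr (- k) x" for x by (simp add: chr_def exp_cnj)
  ultimately show ?thesis by (simp add: fourier_eq)
qed

text \<open>Insert a Gaussian factor into the integral of \<open>|fourier f|\<^sup>2\<close> and apply the multiplication formula. What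
arises is the double integral of \<open>f x * cnj (f y) * K (x - y)\<close> with a nonnegative kernel of mass one, which the
inequality between arithmetic and geometric means bounds by \<open>nsq f\<close>. Fatou's lemma removes the factor. Equality
in Plancherel's theorem comes later, from applying the contraction in both directions.\<close>

lemma fourier_contraction:
  fixes f :: "'d::finite cfun"
  assumes f: "integrable lborel f" and L: "L2 f"
  shows "L2 (fourier f)" "nsq (fourier f) \<le> nsq f"
proof -
  let ?c = "fconst TYPE('d)"
  have fm[measurable]: "f \<in> borel_measurable borel" using L by (simp add: L2_def)
  have Fm[measurable]: "fourier f \<in> borel_measurable borel" by (rule fourier_measurable[OF f])
  have gm[measurable]: "gauss \<in> borel_measurable (borel :: (real^'d) measure)" by (rule schwartz_measurable[OF schwartz_gauss])
  define e where "e n = 1 / real (Suc n)" for n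
  have e: "e n > 0" for n by (simp add: e_def)
  have e0: "e \<longlonglongrightarrow> 0" unfolding e_def using LIMSEQ_inverse_real_of_nat by (simp add: inverse_eq_divide)
  define g where "g n x = exp (- (norm (e n *\<^sub>R (x :: real^'d)))\<^sup>2 / 2)" for n x
  have gg: "cplx (g n x) = gauss (e n *\<^sub>R x)" for n x by (simp add: g_def gauss_def)
  have gpos: "g n x \<ge> 0" for n x by (simp add: g_def)
  define f' where "f' x = cnj (f (- x))" for x
  have f': "integrable lborel f'"
  proof -
    have "integrable lborel (\<lambda>x. f (0 + (- 1) *\<^sub>R x))" by (rule integrable_affine_euclidean[OF f]) simp
    then show ?thesis unfolding f'_def by (simp add: integrable_cnj)
  qed
  have Ff': "fourier f' k = cnj (fourier f k)" for k
  proof -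
    have "fourier f' k = fourier (\<lambda>x. cnj (f x)) (- k)"
      unfolding f'_def by (rule fourier_reflect) (use f in simp)
    then show ?thesis by (simp add: cnj_fourier)
  qed
  \<comment> \<open>With \<open>f'\<close> the reflected conjugate, \<open>h\<close> below is the damped conjugate transform; its own transform is, up to reflection, \<open>f'\<close> convolved with the Gaussian kernel \<open>K\<close>.\<close>
  have bound: "(\<integral>\<^sup>+k. ennreal ((norm (fourier f k))\<^sup>2 * g n k) \<partial>lborel) \<le> ennreal (nsq f)" for n
  proof -
    define K where "K z = ?c * (1 / e n ^ CARD('d)) * exp (- (norm ((1 / e n) *\<^sub>R (z :: real^'d)))\<^sup>2 / 2)" for z
    have Km[measurable]: "K \<in> borel_measurable borel" unfolding K_def by measurable
    have K0: "K z \<ge> 0" for z unfolding K_def using e[of n] fconst_pos[where 'd='d] by simp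
    have half: "ennreal (1/2 * t) = ennreal (1/2) * ennreal t" if "t \<ge> 0" for t
      by (rule ennreal_mult) (use that in auto)
    have ig: "integrable lborel (\<lambda>k. chr k' k * gauss (e n *\<^sub>R k))" for k' :: "real^'d"
      using integrable_affine_euclidean[OF schwartz_integrable[OF schwartz_gauss], of "e n" "0::real^'d"] e[of n]
      by (intro integrable_chr_mult) simp
    have ig0: "integrable lborel (\<lambda>k::real^'d. gauss (e n *\<^sub>R k))" using ig[of 0] by simp
    have K1: "(\<integral>\<^sup>+z. ennreal (K z) \<partial>lborel) = 1"
    proof -
      have G: "integrable lborel (\<lambda>z::real^'d. exp (- (norm z)\<^sup>2 / 2))" by (rule gauss_integral(1))
      have i: "integrable lborel (\<lambda>z::real^'d. exp (- (norm (0 + (1 / e n) *\<^sub>R z))\<^sup>2 / 2))"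
        by (rule integrable_affine_euclidean[OF G]) (use e[of n] in simp)
      have "(LBINT (z::real^'d). exp (- (norm (0 + (1 / e n) *\<^sub>R z))\<^sup>2 / 2)) = (LBINT (z::real^'d). exp (- (norm z)\<^sup>2 / 2)) /\<^sub>R \<bar>1 / e n\<bar> ^ DIM(real^'d)"
        by (rule integral_affine_euclidean[OF G]) (use e[of n] in simp)
      also have "(LBINT (z::real^'d). exp (- (norm z)\<^sup>2 / 2)) = (2 * pi) powr (real CARD('d) / 2)"
        using gauss_integral(2)[where 'a="real^'d"] by simp
      finally have "(LBINT z. K z) = ?c * (1 / e n ^ CARD('d)) * ((2 * pi) powr (real CARD('d) / 2) * e n ^ CARD('d))"
        using e[of n] by (simp add: K_def[abs_def] power_divide)
      also have "\<dots> = ?c * (2 * pi) powr (real CARD('d) / 2)" using e[of n] by simp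
      also have "\<dots> = 1" by (simp add: fconst_def powr_add[symmetric])
      finally have K1: "(LBINT z. K z) = 1" .
      have "integrable lborel K" unfolding K_def using i by (intro integrable_mult_right) simp
      from nn_integral_eq_integral[OF this] show ?thesis using K0 K1 by simp
    qed
    define h where "h k = fourier f' k * gauss (e n *\<^sub>R k)" for k
    have hi: "integrable lborel h" unfolding h_def
    proof (rule Bochner_Integration.integrable_bound)
      show "integrable lborel (\<lambda>k::real^'d. cplx (?c * (LBINT x. norm (f' x))) * gauss (e n *\<^sub>R k))"
        by (intro integrable_mult_right ig0)
      show "AE k in lborel. norm (fourier f' k * gauss (e n *\<^sub>R k)) \<le> norm (cplx (?c * (LBINT x. norm (f' x))) * gauss (e n *\<^sub>R k))"
      proof (rule AE_I2)
        fix k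
        have "norm (fourier f' k) \<le> norm (cplx (?c * (LBINT x. norm (f' x))))"
          using fourier_norm_le[of f' k] unfolding norm_of_real by linarith
        then show "norm (fourier f' k * gauss (e n *\<^sub>R k)) \<le> norm (cplx (?c * (LBINT x. norm (f' x))) * gauss (e n *\<^sub>R k))"
          unfolding norm_mult by (rule mult_right_mono) simp
      qed
    qed (use fourier_measurable[OF f'] in measurable)
    have Fh: "fourier h x = (LBINT y. f' y * cplx (K (y + x)))" for x
    proof -
      have "fourier h x = cplx ?c * (LBINT k. fourier f' k * (chr x k * gauss (e n *\<^sub>R k)))"
        unfolding fourier_eq h_def by (simp only: mult.left_commute)
      also have "(LBINT k. fourier f' k * (chr x k * gauss (e n *\<^sub>R k))) = (LBINT y. f' y * fourier (\<lambda>k. chr x k * gauss (e n *\<^sub>R k)) y)"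
        by (rule fourier_multiplication[OF f' ig])
      also have "(\<lambda>y. fourier (\<lambda>k. chr x k * gauss (e n *\<^sub>R k)) y) = (\<lambda>y. cplx (1 / e n ^ CARD('d)) * gauss ((1 / e n) *\<^sub>R (y + x)))"
        using fourier_modulated_gauss[OF e[of n], of "- x"] by auto
      finally have "fourier h x = (LBINT y. cplx ?c * (f' y * (cplx (1 / e n ^ CARD('d)) * gauss ((1 / e n) *\<^sub>R (y + x)))))"
        by (simp only: integral_mult_right_zero)
      also have "(\<lambda>y. cplx ?c * (f' y * (cplx (1 / e n ^ CARD('d)) * gauss ((1 / e n) *\<^sub>R (y + x))))) = (\<lambda>y. f' y * cplx (K (y + x)))"
        by (simp add: K_def gauss_def mult_ac)
      finally show ?thesis .
    qed
    have Fhb: "ennreal (norm (fourier h x)) \<le> (\<integral>\<^sup>+y. ennreal (norm (f y) * K (x - y)) \<partial>lborel)" for x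
    proof -
      have "ennreal (norm (fourier h x)) \<le> (\<integral>\<^sup>+y. ennreal (norm (f' y * cplx (K (y + x)))) \<partial>lborel)"
      proof (cases "integrable lborel (\<lambda>y. f' y * cplx (K (y + x)))")
        case True then show ?thesis unfolding Fh by (rule integral_norm_bound_ennreal)
      next
        case False then show ?thesis unfolding Fh by (simp add: not_integrable_integral_eq)
      qed
      also have "\<dots> = (\<integral>\<^sup>+y. ennreal (norm (f (- y)) * K (x + y)) \<partial>lborel)"
        using K0 by (simp add: f'_def norm_mult add.commute)
      also have "\<dots> = (\<integral>\<^sup>+y. ennreal (norm (f y) * K (x - y)) \<partial>lborel)"
        using nn_integral_affine_euclidean[of "\<lambda>y. ennreal (norm (f y) * K (x - y))" "- 1" 0] by simp
      finally show ?thesis .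
    qed
    have Q: "(LBINT k. fourier f k * h k) = (LBINT x. f x * fourier h x)" by (rule fourier_multiplication[OF f hi])
    have Qk: "fourier f k * h k = cplx ((norm (fourier f k))\<^sup>2 * g n k)" for k
    proof -
      have "fourier f k * cnj (fourier f k) = cplx ((norm (fourier f k))\<^sup>2)"
        by (rule complex_norm_square[symmetric])
      then show ?thesis unfolding h_def Ff' gg[symmetric] by (simp add: mult.assoc[symmetric])
    qed
    have iQ: "integrable lborel (\<lambda>k. fourier f k * h k)"
    proof (rule Bochner_Integration.integrable_bound)
      show "integrable lborel (\<lambda>k. cplx (?c * (LBINT x. norm (f x))) * h k)" by (intro integrable_mult_right hi)
      show "AE k in lborel. norm (fourier f k * h k) \<le> norm (cplx (?c * (LBINT x. norm (f x))) * h k)"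
      proof (rule AE_I2)
        fix k
        have "norm (fourier f k) \<le> norm (cplx (?c * (LBINT x. norm (f x))))"
          using fourier_norm_le[of f k] unfolding norm_of_real by linarith
        then show "norm (fourier f k * h k) \<le> norm (cplx (?c * (LBINT x. norm (f x))) * h k)"
          unfolding norm_mult by (rule mult_right_mono) simp
      qed
    qed (use hi in measurable)
    have "integrable lborel (\<lambda>k. (norm (fourier f k))\<^sup>2 * g n k)"
      using iQ unfolding Qk by (subst (asm) complex_of_real_integrable_eq)
    then have "(\<integral>\<^sup>+k. ennreal ((norm (fourier f k))\<^sup>2 * g n k) \<partial>lborel) = ennreal (LBINT k. (norm (fourier f k))\<^sup>2 * g n k)"
      by (rule nn_integral_eq_integral) (simp add: gpos)
    also have "\<dots> = ennreal (norm (LBINT k. fourier f k * h k))"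
    proof -
      have "(LBINT k. (norm (fourier f k))\<^sup>2 * g n k) \<ge> 0" using gpos by (intro integral_nonneg_AE) auto
      then show ?thesis unfolding Qk integral_complex_of_real norm_of_real by simp
    qed
    also have "\<dots> \<le> (\<integral>\<^sup>+x. ennreal (norm (f x * fourier h x)) \<partial>lborel)"
      unfolding Q
    proof (cases "integrable lborel (\<lambda>x. f x * fourier h x)")
      case True then show "ennreal (norm (LBINT x. f x * fourier h x)) \<le> (\<integral>\<^sup>+x. ennreal (norm (f x * fourier h x)) \<partial>lborel)"
        by (rule integral_norm_bound_ennreal)
    next
      case False then show "ennreal (norm (LBINT x. f x * fourier h x)) \<le> (\<integral>\<^sup>+x. ennreal (norm (f x * fourier h x)) \<partial>lborel)"
        by (simp add: not_integrable_integral_eq)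
    qed
    also have "\<dots> \<le> (\<integral>\<^sup>+x. ennreal (norm (f x)) * (\<integral>\<^sup>+y. ennreal (norm (f y) * K (x - y)) \<partial>lborel) \<partial>lborel)"
      unfolding norm_mult ennreal_mult[OF norm_ge_zero norm_ge_zero] by (intro nn_integral_mono mult_left_mono Fhb) simp
    also have "\<dots> = (\<integral>\<^sup>+x. (\<integral>\<^sup>+y. ennreal (norm (f x)) * ennreal (norm (f y) * K (x - y)) \<partial>lborel) \<partial>lborel)"
      by (intro nn_integral_cong nn_integral_cmult[symmetric]) measurable
    \<comment> \<open>The product \<open>|f x| |f y|\<close> is at most the mean of the squares.\<close>
    also have "\<dots> \<le> (\<integral>\<^sup>+x. (\<integral>\<^sup>+y. ennreal (1/2 * (norm (f x))\<^sup>2) * ennreal (K (x - y)) + ennreal (1/2 * (norm (f y))\<^sup>2) * ennreal (K (x - y)) \<partial>lborel) \<partial>lborel)"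
    proof (intro nn_integral_mono)
      fix x y
      have "norm (f x) * norm (f y) \<le> 1/2 * (norm (f x))\<^sup>2 + 1/2 * (norm (f y))\<^sup>2"
        using sum_squares_bound[of "norm (f x)" "norm (f y)"] by simp
      then have "norm (f x) * norm (f y) * K (x - y) \<le> (1/2 * (norm (f x))\<^sup>2 + 1/2 * (norm (f y))\<^sup>2) * K (x - y)"
        by (rule mult_right_mono) (rule K0)
      then have "ennreal (norm (f x) * norm (f y) * K (x - y)) \<le> ennreal (1/2 * (norm (f x))\<^sup>2 * K (x - y) + 1/2 * (norm (f y))\<^sup>2 * K (x - y))"
        by (intro ennreal_leI) (simp only: distrib_right)
      then show "ennreal (norm (f x)) * ennreal (norm (f y) * K (x - y)) \<le> ennreal (1/2 * (norm (f x))\<^sup>2) * ennreal (K (x - y)) + ennreal (1/2 * (norm (f y))\<^sup>2) * ennreal (K (x - y))"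
        using K0 by (simp only: ennreal_mult[symmetric] ennreal_plus[symmetric] norm_ge_zero mult_nonneg_nonneg zero_le_power2 mult.assoc)
    qed
    also have "\<dots> = (\<integral>\<^sup>+x. (\<integral>\<^sup>+y. ennreal (1/2 * (norm (f x))\<^sup>2) * ennreal (K (x - y)) \<partial>lborel) \<partial>lborel) + (\<integral>\<^sup>+x. (\<integral>\<^sup>+y. ennreal (1/2 * (norm (f y))\<^sup>2) * ennreal (K (x - y)) \<partial>lborel) \<partial>lborel)"
      by (subst nn_integral_add[symmetric]) (auto intro!: nn_integral_cong nn_integral_add)
    also have "(\<integral>\<^sup>+x. (\<integral>\<^sup>+y. ennreal (1/2 * (norm (f x))\<^sup>2) * ennreal (K (x - y)) \<partial>lborel) \<partial>lborel) = ennreal (1/2 * nsq f)"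
    proof -
      have k1: "(\<integral>\<^sup>+y. ennreal (K (x - y)) \<partial>lborel) = 1" for x
        using nn_integral_affine_euclidean[of "\<lambda>y. ennreal (K y)" "- 1" x] K1 by simp
      have "(\<integral>\<^sup>+y. ennreal (1/2 * (norm (f x))\<^sup>2) * ennreal (K (x - y)) \<partial>lborel) = ennreal (1/2) * ennreal ((norm (f x))\<^sup>2)" for x
        by (subst nn_integral_cmult, measurable) (simp only: k1 mult_1_right half zero_le_power2)
      then have "(\<integral>\<^sup>+x. (\<integral>\<^sup>+y. ennreal (1/2 * (norm (f x))\<^sup>2) * ennreal (K (x - y)) \<partial>lborel) \<partial>lborel) = (\<integral>\<^sup>+x. ennreal (1/2) * ennreal ((norm (f x))\<^sup>2) \<partial>lborel)"
        by simp
      also have "\<dots> = ennreal (1/2) * ennreal (nsq f)" by (subst nn_integral_cmult) (auto simp: nn_nsq[OF L])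
      finally show ?thesis by (simp only: half nsq_nonneg)
    qed
    also have "(\<integral>\<^sup>+x. (\<integral>\<^sup>+y. ennreal (1/2 * (norm (f y))\<^sup>2) * ennreal (K (x - y)) \<partial>lborel) \<partial>lborel) = ennreal (1/2 * nsq f)"
    proof -
      have "(\<integral>\<^sup>+x. (\<integral>\<^sup>+y. ennreal (1/2 * (norm (f y))\<^sup>2) * ennreal (K (x - y)) \<partial>lborel) \<partial>lborel) = (\<integral>\<^sup>+y. (\<integral>\<^sup>+x. ennreal (1/2 * (norm (f y))\<^sup>2) * ennreal (K (x - y)) \<partial>lborel) \<partial>lborel)"
        by (rule lborel_pair.Fubini') measurable
      moreover have k1: "(\<integral>\<^sup>+x. ennreal (K (x - y)) \<partial>lborel) = 1" for y
        using nn_integral_affine_euclidean[of "\<lambda>y. ennreal (K y)" 1 "- y"] K1 by simp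
      have "(\<integral>\<^sup>+x. ennreal (1/2 * (norm (f y))\<^sup>2) * ennreal (K (x - y)) \<partial>lborel) = ennreal (1/2) * ennreal ((norm (f y))\<^sup>2)" for y
        by (subst nn_integral_cmult, measurable) (simp only: k1 mult_1_right half zero_le_power2)
      then have "(\<integral>\<^sup>+y. (\<integral>\<^sup>+x. ennreal (1/2 * (norm (f y))\<^sup>2) * ennreal (K (x - y)) \<partial>lborel) \<partial>lborel) = (\<integral>\<^sup>+x. ennreal (1/2) * ennreal ((norm (f x))\<^sup>2) \<partial>lborel)"
        by simp
      also have "\<dots> = ennreal (1/2) * ennreal (nsq f)" by (subst nn_integral_cmult) (auto simp: nn_nsq[OF L])
      ultimately show ?thesis by (simp only: half nsq_nonneg)
    qed
    also have "ennreal (1/2 * nsq f) + ennreal (1/2 * nsq f) = ennreal (nsq f)"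
      by (subst ennreal_plus[symmetric]) (auto simp: nsq_nonneg)
    finally show ?thesis .
  qed
  have lim: "liminf (\<lambda>n. ennreal ((norm (fourier f k))\<^sup>2 * g n k)) = ennreal ((norm (fourier f k))\<^sup>2)" for k
  proof (rule lim_imp_Liminf)
    have "(\<lambda>n. e n *\<^sub>R k) \<longlonglongrightarrow> 0 *\<^sub>R k" by (intro tendsto_intros e0)
    then have "(\<lambda>n. g n k) \<longlonglongrightarrow> exp (- (norm (0 *\<^sub>R k))\<^sup>2 / 2)" unfolding g_def by (intro tendsto_intros e0) auto
    then have "(\<lambda>n. (norm (fourier f k))\<^sup>2 * g n k) \<longlonglongrightarrow> (norm (fourier f k))\<^sup>2 * 1" by (intro tendsto_intros) simp
    then show "(\<lambda>n. ennreal ((norm (fourier f k))\<^sup>2 * g n k)) \<longlonglongrightarrow> ennreal ((norm (fourier f k))\<^sup>2)" by simp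
  qed simp
  have gmm[measurable]: "g n \<in> borel_measurable borel" for n unfolding g_def by measurable
  have "(\<integral>\<^sup>+k. ennreal ((norm (fourier f k))\<^sup>2) \<partial>lborel) = (\<integral>\<^sup>+k. liminf (\<lambda>n. ennreal ((norm (fourier f k))\<^sup>2 * g n k)) \<partial>lborel)"
    unfolding lim ..
  also have "\<dots> \<le> liminf (\<lambda>n. \<integral>\<^sup>+k. ennreal ((norm (fourier f k))\<^sup>2 * g n k) \<partial>lborel)"
    by (rule nn_integral_liminf) measurable
  also have "\<dots> \<le> ennreal (nsq f)"
    by (rule Liminf_le) (use bound in \<open>auto intro: always_eventually\<close>)
  finally have "(\<integral>\<^sup>+k. ennreal ((norm (fourier f k))\<^sup>2) \<partial>lborel) \<le> ennreal (nsq f)" .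
  from L2_if_nn[OF Fm this nsq_nonneg] show "L2 (fourier f)" "nsq (fourier f) \<le> nsq f" by auto
qed

text \<open>Completeness of the space of square integrable functions, with a limit that inherits the bound \<open>A\<close>. Multiplying by a Gaussian makes the
sequence Cauchy in the mean, hence almost everywhere along a subsequence; Fatou's lemma does the rest.\<close>

lemma L2_complete_weak:
  fixes g :: "nat \<Rightarrow> 'd::finite cfun" and T :: "nat \<Rightarrow> real"
  assumes L: "\<And>n. L2 (g n)" and d: "\<And>m n. m \<le> n \<Longrightarrow> nsq (\<lambda>x. g n x - g m x) \<le> T m"
    and T: "T \<longlonglongrightarrow> 0" and A: "\<And>n. nsq (g n) \<le> A"
  shows "\<exists>G. L2 G \<and> nsq G \<le> A \<and> (\<forall>v. L2 v \<longrightarrow> (\<lambda>n. \<integral>x. g n x * v x \<partial>lborel) \<longlonglongrightarrow> (LBINT x. G x * v x))"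
proof -
  have gm[measurable]: "g n \<in> borel_measurable borel" for n using L by (simp add: L2_def)
  have A0: "A \<ge> 0" using nsq_nonneg[of "g 0"] A[of 0] by linarith
  have Ld: "L2 (\<lambda>x. g n x - g m x)" for m n
  proof -
    have "integrable lborel (\<lambda>x. (norm (g n x - g m x))\<^sup>2)"
    proof (rule Bochner_Integration.integrable_bound)
      show "integrable lborel (\<lambda>x. 2 * (norm (g n x))\<^sup>2 + 2 * (norm (g m x))\<^sup>2)"
        using L by (intro Bochner_Integration.integrable_add integrable_mult_right) (auto simp: L2_def)
      show "AE x in lborel. norm ((norm (g n x - g m x))\<^sup>2) \<le> norm (2 * (norm (g n x))\<^sup>2 + 2 * (norm (g m x))\<^sup>2)"
      proof (rule AE_I2)
        fix x
        have "(norm (g n x - g m x))\<^sup>2 \<le> (norm (g n x) + norm (g m x))\<^sup>2"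
          by (intro power_mono norm_triangle_ineq4) auto
        also have "\<dots> \<le> 2 * (norm (g n x))\<^sup>2 + 2 * (norm (g m x))\<^sup>2"
          using sum_squares_bound[of "norm (g n x)" "norm (g m x)"] by (simp add: power2_sum)
        finally show "norm ((norm (g n x - g m x))\<^sup>2) \<le> norm (2 * (norm (g n x))\<^sup>2 + 2 * (norm (g m x))\<^sup>2)" by simp
      qed
    qed measurable
    then show ?thesis unfolding L2_def by simp
  qed
  have Tn: "T m \<ge> 0" for m using d[of m m] nsq_nonneg[of "\<lambda>x. g m x - g m x"] by linarith
  have wS: "L2 (gauss :: 'd cfun)" by (rule schwartz_L2[OF schwartz_gauss])
  \<comment> \<open>The Gaussian factor is square integrable and has no zeros.\<close>
  define s where "s n x = gauss x * g n x" for n x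
  have si: "integrable lborel (s n)" for n unfolding s_def by (rule L2_pair(1)[OF wS L])
  have sd: "(LINT x|lborel. norm (s n x - s m x))\<^sup>2 \<le> nsq (gauss :: 'd cfun) * T m" if "m \<le> n" for m n
  proof -
    have "(LINT x|lborel. norm (s n x - s m x))\<^sup>2 = (LBINT x. norm (gauss x * (g n x - g m x)))\<^sup>2"
      by (simp add: s_def right_diff_distrib)
    also have "\<dots> \<le> nsq (gauss :: 'd cfun) * nsq (\<lambda>x. g n x - g m x)" by (rule L2_pair(3)[OF wS Ld])
    also have "\<dots> \<le> nsq (gauss :: 'd cfun) * T m" by (intro mult_left_mono d that nsq_nonneg)
    finally show ?thesis .
  qed
  obtain r where r: "strict_mono r" "AE x in lborel. Cauchy (\<lambda>i. s (r i) x)"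
  proof (rule cauchy_L1_AE_cauchy_subseq[of lborel s])
    fix \<epsilon> :: real assume e: "\<epsilon> > 0"
    have "(\<lambda>m. nsq (gauss :: 'd cfun) * T m) \<longlonglongrightarrow> nsq (gauss :: 'd cfun) * 0" by (intro tendsto_intros T)
    then have "eventually (\<lambda>m. nsq (gauss :: 'd cfun) * T m < \<epsilon>\<^sup>2) sequentially"
      using e by (intro order_tendstoD(2)) auto
    then obtain N where N: "\<And>m. m \<ge> N \<Longrightarrow> nsq (gauss :: 'd cfun) * T m < \<epsilon>\<^sup>2" unfolding eventually_sequentially by blast
    have lt: "(LINT x|lborel. norm (s i x - s j x)) < \<epsilon>" if "j \<ge> N" "j \<le> i" for i j
    proof -
      have "(LINT x|lborel. norm (s i x - s j x))\<^sup>2 < \<epsilon>\<^sup>2" using sd[OF that(2)] N[OF that(1)] by linarith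
      then show ?thesis by (rule power2_less_imp_less) (use e in simp)
    qed
    have "(LINT x|lborel. norm (s i x - s j x)) < \<epsilon>" if "i \<ge> N" "j \<ge> N" for i j
      using lt[of j i] lt[of i j] that by (cases "j \<le> i") (auto simp: norm_minus_commute)
    then show "\<exists>N. \<forall>i\<ge>N. \<forall>j\<ge>N. LINT x|lborel. norm (s i x - s j x) < \<epsilon>" by blast
  qed (use si in auto)
  define G where "G x = lim (\<lambda>i. g (r i) x)" for x
  have Gm[measurable]: "G \<in> borel_measurable borel"
    unfolding G_def[abs_def] by (rule borel_measurable_lim_metric) measurable
  have conv: "AE x in lborel. (\<lambda>i. g (r i) x) \<longlonglongrightarrow> G x"
    using r(2)
  proof (rule AE_mp, intro AE_I2 impI)
    fix x assume "Cauchy (\<lambda>i. s (r i) x)"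
    then have "convergent (\<lambda>i. s (r i) x)" by (simp add: Cauchy_convergent_iff)
    then obtain l where "(\<lambda>i. s (r i) x) \<longlonglongrightarrow> l" unfolding convergent_def by blast
    then have "(\<lambda>i. s (r i) x / gauss x) \<longlonglongrightarrow> l / gauss x" by (rule tendsto_divide[OF _ tendsto_const]) (simp add: gauss_def)
    then have "(\<lambda>i. g (r i) x) \<longlonglongrightarrow> l / gauss x" by (simp add: s_def gauss_def)
    then show "(\<lambda>i. g (r i) x) \<longlonglongrightarrow> G x" unfolding G_def by (simp add: limI)
  qed
  have fatou: "(\<integral>\<^sup>+x. ennreal ((norm (G x - u x))\<^sup>2) \<partial>lborel) \<le> ennreal B"
    if u[measurable]: "u \<in> borel_measurable borel" and B: "\<forall>\<^sub>F i in sequentially. (\<integral>\<^sup>+x. ennreal ((norm (g (r i) x - u x))\<^sup>2) \<partial>lborel) \<le> ennreal B" for u B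
  proof -
    have "(\<integral>\<^sup>+x. ennreal ((norm (G x - u x))\<^sup>2) \<partial>lborel) = (\<integral>\<^sup>+x. liminf (\<lambda>i. ennreal ((norm (g (r i) x - u x))\<^sup>2)) \<partial>lborel)"
    proof (rule nn_integral_cong_AE, use conv in \<open>rule AE_mp\<close>, intro AE_I2 impI)
      fix x assume c: "(\<lambda>i. g (r i) x) \<longlonglongrightarrow> G x"
      have "(\<lambda>i. (norm (g (r i) x - u x))\<^sup>2) \<longlonglongrightarrow> (norm (G x - u x))\<^sup>2" by (intro tendsto_intros c)
      then have "(\<lambda>i. ennreal ((norm (g (r i) x - u x))\<^sup>2)) \<longlonglongrightarrow> ennreal ((norm (G x - u x))\<^sup>2)" by simp
      then show "ennreal ((norm (G x - u x))\<^sup>2) = liminf (\<lambda>i. ennreal ((norm (g (r i) x - u x))\<^sup>2))"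
        by (intro lim_imp_Liminf[symmetric]) auto
    qed
    also have "\<dots> \<le> liminf (\<lambda>i. \<integral>\<^sup>+x. ennreal ((norm (g (r i) x - u x))\<^sup>2) \<partial>lborel)"
      by (rule nn_integral_liminf) measurable
    also have "\<dots> \<le> ennreal B" using B by (rule Liminf_le[rotated]) simp
    finally show ?thesis .
  qed
  have "(\<integral>\<^sup>+x. ennreal ((norm (G x - 0))\<^sup>2) \<partial>lborel) \<le> ennreal A"
    by (rule fatou) (auto simp: nn_nsq[OF L] A intro!: ennreal_leI always_eventually)
  then have GL: "L2 G" "nsq G \<le> A" using L2_if_nn[of G A] A0 by auto
  have dG: "L2 (\<lambda>x. G x - g m x)" "nsq (\<lambda>x. G x - g m x) \<le> T m" for m
  proof -
    have "(\<integral>\<^sup>+x. ennreal ((norm (G x - g m x))\<^sup>2) \<partial>lborel) \<le> ennreal (T m)"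
    proof (rule fatou)
      show "\<forall>\<^sub>F i in sequentially. (\<integral>\<^sup>+x. ennreal ((norm (g (r i) x - g m x))\<^sup>2) \<partial>lborel) \<le> ennreal (T m)"
        unfolding eventually_sequentially
      proof (intro exI[of _ m] allI impI)
        fix i assume "m \<le> i"
        then have "m \<le> r i" using seq_suble[OF r(1), of i] by linarith
        then show "(\<integral>\<^sup>+x. ennreal ((norm (g (r i) x - g m x))\<^sup>2) \<partial>lborel) \<le> ennreal (T m)"
          using nn_nsq[OF Ld] d by (simp add: ennreal_leI)
      qed
    qed simp
    then show "L2 (\<lambda>x. G x - g m x)" "nsq (\<lambda>x. G x - g m x) \<le> T m"
      using L2_if_nn[of "\<lambda>x. G x - g m x" "T m"] Tn by auto
  qed
  have "(\<lambda>n. \<integral>x. g n x * v x \<partial>lborel) \<longlonglongrightarrow> (LBINT x. G x * v x)" if v: "L2 v" for v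
  proof -
    have b: "norm ((LBINT x. g n x * v x) - (LBINT x. G x * v x)) \<le> sqrt (T n * nsq v)" for n
    proof -
      have "(LBINT x. g n x * v x) - (LBINT x. G x * v x) = - (LBINT x. (G x - g n x) * v x)"
        using L2_pair(1)[OF L v] L2_pair(1)[OF GL(1) v] by (simp add: left_diff_distrib)
      then have "(norm ((LBINT x. g n x * v x) - (LBINT x. G x * v x)))\<^sup>2 \<le> nsq (\<lambda>x. G x - g n x) * nsq v"
        using L2_pair(2)[OF dG(1) v] by simp
      also have "\<dots> \<le> T n * nsq v" by (intro mult_right_mono dG nsq_nonneg)
      finally show ?thesis by (rule real_le_rsqrt)
    qed
    have "(\<lambda>n. sqrt (T n * nsq v)) \<longlonglongrightarrow> sqrt (0 * nsq v)" by (intro tendsto_intros T)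
    then have "(\<lambda>n. sqrt (T n * nsq v)) \<longlonglongrightarrow> 0" by simp
    then have "(\<lambda>n. (LBINT x. g n x * v x) - (LBINT x. G x * v x)) \<longlonglongrightarrow> 0"
      by (rule Lim_null_comparison[rotated]) (use b in \<open>auto intro: always_eventually\<close>)
    then show ?thesis by (simp add: LIM_zero_iff)
  qed
  then show ?thesis using GL by blast
qed

text \<open>The transform of a square integrable function as the limit of the transforms of its restrictions to balls,
characterised by duality with Schwartz functions.\<close>

lemma L2_fourier_exists:
  fixes f :: "'d::finite cfun"
  assumes L: "L2 f"
  shows "\<exists>g. L2 g \<and> nsq g \<le> nsq f \<and> (\<forall>\<phi>\<in>schwartz. (LBINT x. g x * \<phi> x) = (LBINT x. f x * fourier \<phi> x))"
proof -
  have fm[measurable]: "f \<in> borel_measurable borel" using L by (simp add: L2_def)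
  have fi: "integrable lborel (\<lambda>x. (norm (f x))\<^sup>2)" using L by (simp add: L2_def)
  let ?B = "\<lambda>n::nat. cball (0::real^'d) (real n)"
  have Bm[measurable]: "?B n \<in> sets borel" for n by simp
  define F where "F n x = indicator (?B n) x * f x" for n x
  have Fm[measurable]: "F n \<in> borel_measurable borel" for n unfolding F_def by measurable
  have F1: "integrable lborel (F n)" for n
    unfolding F_def by (rule tempered_indicator_integrable[OF L2_tempered[OF L]]) auto
  define T where "T m = (LBINT x. indicator (- ?B m) x * (norm (f x))\<^sup>2)" for m
  have Ti: "integrable lborel (\<lambda>x. indicator (- ?B m) x * (norm (f x))\<^sup>2)" for m
    by (rule Bochner_Integration.integrable_bound[OF fi]) (auto simp: indicator_def)
  have FL: "L2 (F n)" for n unfolding L2_def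
  proof
    show "integrable lborel (\<lambda>x. (norm (F n x))\<^sup>2)"
      by (rule Bochner_Integration.integrable_bound[OF fi]) (auto simp: F_def indicator_def)
  qed simp
  have Fd: "nsq (\<lambda>x. F n x - F m x) \<le> T m" "L2 (\<lambda>x. F n x - F m x)" if "m \<le> n" for m n
  proof -
    have b: "(norm (F n x - F m x))\<^sup>2 \<le> indicator (- ?B m) x * (norm (f x))\<^sup>2" for x
      using that by (auto simp: F_def indicator_def)
    have i: "integrable lborel (\<lambda>x. (norm (F n x - F m x))\<^sup>2)"
      by (rule Bochner_Integration.integrable_bound[OF Ti[of m]]) (use b in \<open>auto simp: abs_mult\<close>)
    show "nsq (\<lambda>x. F n x - F m x) \<le> T m"
      unfolding nsq_def T_def by (rule Bochner_Integration.integral_mono[OF i Ti b])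
    show "L2 (\<lambda>x. F n x - F m x)" unfolding L2_def using i by simp
  qed
  have T0: "T \<longlonglongrightarrow> 0"
  proof -
    have "(\<lambda>m. \<integral>x. indicator (- ?B m) x * (norm (f x))\<^sup>2 \<partial>lborel) \<longlonglongrightarrow> (LBINT (x::real^'d). 0)"
    proof (rule integral_dominated_convergence[where w="\<lambda>x. (norm (f x))\<^sup>2"])
      show "AE x in lborel. (\<lambda>m. indicator (- ?B m) x * (norm (f x))\<^sup>2) \<longlonglongrightarrow> 0"
      proof (rule AE_I2, rule tendsto_eventually)
        fix x :: "real^'d"
        obtain N :: nat where "norm x \<le> real N" using real_arch_simple by blast
        then show "\<forall>\<^sub>F m in sequentially. indicator (- ?B m) x * (norm (f x))\<^sup>2 = 0"
          unfolding eventually_sequentially by (intro exI[of _ N]) (auto simp: indicator_def)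
      qed
    qed (use fi in \<open>auto simp: indicator_def\<close>)
    then show ?thesis by (simp add: T_def[abs_def])
  qed
  have "\<exists>G. L2 G \<and> nsq G \<le> nsq f \<and> (\<forall>v. L2 v \<longrightarrow> (\<lambda>n. \<integral>x. fourier (F n) x * v x \<partial>lborel) \<longlonglongrightarrow> (LBINT x. G x * v x))"
  proof (rule L2_complete_weak[OF fourier_contraction(1)[OF F1 FL] _ T0])
    show "nsq (\<lambda>x. fourier (F n) x - fourier (F m) x) \<le> T m" if "m \<le> n" for m n
    proof -
      have e: "(\<lambda>x. fourier (F n) x - fourier (F m) x) = fourier (\<lambda>x. F n x - F m x)"
        by (intro ext fourier_diff[symmetric] F1)
      have "nsq (fourier (\<lambda>x. F n x - F m x)) \<le> nsq (\<lambda>x. F n x - F m x)"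
        by (rule fourier_contraction(2)[OF _ Fd(2)[OF that]]) (intro Bochner_Integration.integrable_diff F1)
      then show ?thesis unfolding e using Fd(1)[OF that] by linarith
    qed
    show "nsq (fourier (F n)) \<le> nsq f" for n
    proof -
      have "nsq (F n) \<le> nsq f" unfolding nsq_def
        by (rule Bochner_Integration.integral_mono) (use FL[of n] fi in \<open>auto simp: L2_def F_def indicator_def\<close>)
      then show ?thesis using fourier_contraction(2)[OF F1 FL, of n] by linarith
    qed
  qed
  then obtain G where G: "L2 G" "nsq G \<le> nsq f"
    and lim: "\<And>v. L2 v \<Longrightarrow> (\<lambda>n. \<integral>x. fourier (F n) x * v x \<partial>lborel) \<longlonglongrightarrow> (LBINT x. G x * v x)" by blast
  have "(LBINT x. G x * \<phi> x) = (LBINT x. f x * fourier \<phi> x)" if p: "\<phi> \<in> schwartz" for \<phi>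
  proof -
    have i: "integrable lborel (\<lambda>x. f x * fourier \<phi> x)"
      by (rule L2_pair(1)[OF L schwartz_L2[OF schwartz_fourier[OF p]]])
    have [measurable]: "fourier \<phi> \<in> borel_measurable borel" by (rule schwartz_measurable[OF schwartz_fourier[OF p]])
    have "(\<lambda>n. \<integral>x. F n x * fourier \<phi> x \<partial>lborel) \<longlonglongrightarrow> (LBINT x. f x * fourier \<phi> x)"
    proof (rule integral_dominated_convergence[where w="\<lambda>x. norm (f x * fourier \<phi> x)"])
      show "AE x in lborel. (\<lambda>n. F n x * fourier \<phi> x) \<longlonglongrightarrow> f x * fourier \<phi> x"
      proof (rule AE_I2, rule tendsto_eventually)
        fix x :: "real^'d"
        obtain N :: nat where "norm x \<le> real N" using real_arch_simple by blast
        then show "\<forall>\<^sub>F n in sequentially. F n x * fourier \<phi> x = f x * fourier \<phi> x"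
          unfolding eventually_sequentially by (intro exI[of _ N]) (auto simp: indicator_def F_def)
      qed
      show "AE x in lborel. norm (F n x * fourier \<phi> x) \<le> norm (f x * fourier \<phi> x)" for n
        by (auto simp: F_def indicator_def)
    qed (use i in auto)
    moreover have "(LBINT x. fourier (F n) x * \<phi> x) = (LBINT x. F n x * fourier \<phi> x)" for n
      by (rule fourier_multiplication[OF F1 schwartz_integrable[OF p]])
    ultimately show ?thesis using LIMSEQ_unique[OF lim[OF schwartz_L2[OF p]]] by simp
  qed
  then show ?thesis using G by blast
qed

section \<open>Functionals given by their transform\<close>

text \<open>The element of the dual of \<open>Phi\<close> whose Fourier transform is the function \<open>a\<close>. Every functional in the proof has
this form, so that \<open>D_op\<close> becomes multiplication by a function.\<close>

definition dualT :: "'d::finite cfun \<Rightarrow> 'd functional" where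
  "dualT a = (\<lambda>\<phi>\<in>Phi. \<integral>k. a k * fourier \<phi> (- k) \<partial>lborel)"

text \<open>A functional that is Lipschitz for finitely many seminorms: the intersection of the corresponding
seminorm balls is a neighbourhood.\<close>

lemma schwartz_topology_continuous:
  fixes u :: "'d::finite functional"
  assumes V: "V \<subseteq> schwartz"
    and diff: "\<And>f g. f \<in> V \<Longrightarrow> g \<in> V \<Longrightarrow> norm (u f - u g) \<le> C * (\<Sum>(M,idx)\<in>P. schwartz_seminorm M idx (\<lambda>x. f x - g x))"
    and P: "finite P" and C: "C \<ge> 0"
  shows "continuous_map (subtopology schwartz_topology V) euclidean u"
  unfolding continuous_map_def
proof (intro conjI allI impI)
  show "u \<in> topspace (subtopology schwartz_topology V) \<rightarrow> topspace euclidean" by simp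
  fix U :: "complex set" assume U: "openin euclidean U"
  have seminorm_zero: "schwartz_seminorm M idx (\<lambda>x::real^'d. 0) = 0" for M idx
  proof -
    have "partial_derivs idx (\<lambda>x::real^'d. 0) = (\<lambda>x. 0)"
      by (induction idx) (auto simp: partial_deriv_const)
    then show ?thesis by (simp add: schwartz_seminorm_def)
  qed
  have sub: "openin schwartz_topology {g \<in> schwartz. schwartz_seminorm N idx (\<lambda>x. g x - f x) < e}"
    if "f \<in> schwartz" "e > 0" for N idx e and f :: "'d cfun"
    unfolding schwartz_topology_def using that by (intro topology_generated_by_Basis) blast
  show "openin (subtopology schwartz_topology V) {f \<in> topspace (subtopology schwartz_topology V). u f \<in> U}"
  proof (subst openin_subopen, intro ballI)
    fix f assume f: "f \<in> {f \<in> topspace (subtopology schwartz_topology V). u f \<in> U}"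
    have fV: "f \<in> V" "u f \<in> U" using f by auto
    then have fS: "f \<in> schwartz" using V by blast
    obtain e where e: "e > 0" "ball (u f) e \<subseteq> U" using U fV(2) unfolding open_openin[symmetric] open_contains_ball by blast
    define n where "n = real (card P) + 1"
    have n: "n > 0" by (simp add: n_def add_nonneg_pos)
    define \<delta> where "\<delta> = e / ((C + 1) * n)"
    have \<delta>: "\<delta> > 0" using e C n by (simp add: \<delta>_def)
    let ?W = "\<lambda>p. {g \<in> schwartz. schwartz_seminorm (fst p) (snd p) (\<lambda>x. g x - f x) < \<delta>}"
    let ?T = "\<Inter> (insert {g \<in> schwartz. schwartz_seminorm 0 [] (\<lambda>x. g x - f x) < \<delta>} (?W ` P))"
    have oT: "openin schwartz_topology ?T"
      by (rule openin_Inter) (use P in \<open>auto intro!: sub fS \<delta>\<close>)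
    have fT: "f \<in> ?T" using fS \<delta> by (auto simp: seminorm_zero)
    have ss: "?T \<subseteq> topspace schwartz_topology" using openin_subset[OF oT] .
    have "g \<in> {f \<in> topspace (subtopology schwartz_topology V). u f \<in> U}" if g: "g \<in> ?T" "g \<in> V" for g
    proof -
      have gS: "g \<in> schwartz" using g by blast
      have "norm (u g - u f) \<le> C * (\<Sum>(M,idx)\<in>P. schwartz_seminorm M idx (\<lambda>x. g x - f x))" by (rule diff[OF g(2) fV(1)])
      also have "\<dots> \<le> C * (\<Sum>p\<in>P. \<delta>)"
      proof (intro mult_left_mono C sum_mono)
        fix p assume "p \<in> P"
        then have "g \<in> ?W p" using g(1) by blast
        then show "(case p of (M, idx) \<Rightarrow> schwartz_seminorm M idx (\<lambda>x. g x - f x)) \<le> \<delta>" by (auto simp: case_prod_unfold)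
      qed
      also have "\<dots> = C * real (card P) * \<delta>" by simp
      also have "\<dots> < (C + 1) * n * \<delta>"
      proof -
        have "C * real (card P) \<le> C * n" using C by (intro mult_left_mono) (simp_all add: n_def)
        also have "\<dots> < (C + 1) * n" using n by (simp add: distrib_right)
        finally show ?thesis using \<delta> by (rule mult_strict_right_mono)
      qed
      also have "\<dots> = e" using C n unfolding \<delta>_def by simp
      finally have "u g \<in> U" using e(2) by (auto simp: dist_norm norm_minus_commute subset_iff)
      then show ?thesis using g ss by auto
    qed
    moreover have "openin (subtopology schwartz_topology V) (?T \<inter> V)" using oT by (auto simp: openin_subtopology)
    ultimately show "\<exists>T. openin (subtopology schwartz_topology V) T \<and> f \<in> T \<and> T \<subseteq> {f \<in> topspace (subtopology schwartz_topology V). u f \<in> U}"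
      using fT fV by (intro exI[of _ "?T \<inter> V"]) blast
  qed
qed

lemma Phi_add: "f \<in> Phi \<Longrightarrow> g \<in> Phi \<Longrightarrow> (\<lambda>x. f x + g x) \<in> Phi"
proof -
  assume fg: "f \<in> Phi" "g \<in> Phi"
  have "fourier (\<lambda>x. f x + g x) = (\<lambda>k. fourier f k + fourier g k)"
    by (intro ext fourier_add schwartz_integrable Phi_schwartz fg)
  then have "fourier (\<lambda>x. f x + g x) \<in> Psi" using Psi_add[OF fourier_Phi[OF fg(1)] fourier_Phi[OF fg(2)]] by simp
  then show ?thesis using fourier_Psi_iff[OF schwartz_add[OF Phi_schwartz[OF fg(1)] Phi_schwartz[OF fg(2)]]] by simp
qed

lemma Phi_cmult: "f \<in> Phi \<Longrightarrow> (\<lambda>x. c * f x) \<in> Phi"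
proof -
  assume f: "f \<in> Phi"
  have "fourier (\<lambda>x. c * f x) = (\<lambda>k. c * fourier f k)" by (intro ext fourier_cmult)
  then have "fourier (\<lambda>x. c * f x) \<in> Psi" using Psi_cmult[OF fourier_Phi[OF f]] by simp
  then show ?thesis using fourier_Psi_iff[OF schwartz_cmult[OF Phi_schwartz[OF f]]] by simp
qed

lemma dualT_integrable:
  assumes "tempered a" "\<phi> \<in> schwartz" shows "integrable lborel (\<lambda>k. a k * fourier \<phi> (- k))"
  by (intro tempered_integrable assms schwartz_reflect schwartz_fourier)

text \<open>Needed because \<open>fourier_dual_inv\<close> inverts on the topological dual only. The integral is controlled by
finitely many weighted sup norms of the transform, and these by seminorms.\<close>

lemma dualT_in_top_dual:
  fixes a :: "'d::finite cfun"
  assumes a: "tempered a" shows "dualT a \<in> top_dual Phi"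
proof -
  have add: "dualT a (\<lambda>x. f x + g x) = dualT a f + dualT a g" if "f \<in> Phi" "g \<in> Phi" for f g
    using that dualT_integrable[OF a] Phi_add[OF that]
    by (simp add: dualT_def fourier_add schwartz_integrable Phi_schwartz distrib_left)
  have cm: "dualT a (\<lambda>x. c * f x) = c * dualT a f" if "f \<in> Phi" for f c
    using that Phi_cmult[OF that, of c] by (simp add: dualT_def fourier_cmult mult.left_commute)
  obtain N where am: "a \<in> borel_measurable borel" and N: "integrable lborel (\<lambda>x. norm (a x) / (1 + norm x) ^ N)"
    using a unfolding tempered_def by blast
  obtain P0 C0 where P0: "finite P0" "C0 \<ge> 0" "\<And>f k. f \<in> schwartz \<Longrightarrow> norm k ^ 0 * norm (fourier (f :: 'd cfun) k) \<le> C0 * (\<Sum>(M,idx)\<in>P0. schwartz_seminorm M idx f)"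
    using fourier_seminorm_bound[of 0, where 'd='d] by blast
  obtain P1 C1 where P1: "finite P1" "C1 \<ge> 0" "\<And>f k. f \<in> schwartz \<Longrightarrow> norm k ^ N * norm (fourier (f :: 'd cfun) k) \<le> C1 * (\<Sum>(M,idx)\<in>P1. schwartz_seminorm M idx f)"
    using fourier_seminorm_bound[of N, where 'd='d] by blast
  define I where "I = (LBINT x. norm (a x) / (1 + norm x) ^ N)"
  have I0: "I \<ge> 0" unfolding I_def by simp
  let ?P = "P0 \<union> P1"
  have bound: "norm (dualT a f - dualT a g) \<le> (I * 2 ^ N * (C0 + C1)) * (\<Sum>(M,idx)\<in>?P. schwartz_seminorm M idx (\<lambda>x. f x - g x))"
    if f: "f \<in> Phi" and g: "g \<in> Phi" for f g
  proof -
    let ?h = "\<lambda>x. f x - g x"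
    have h: "?h \<in> Phi" using Phi_add[OF f Phi_cmult[OF g, of "- 1"]] by simp
    have hS: "?h \<in> schwartz" by (rule Phi_schwartz[OF h])
    let ?S = "\<Sum>(M,idx)\<in>?P. schwartz_seminorm M idx ?h"
    have S: "(\<Sum>(M,idx)\<in>P0. schwartz_seminorm M idx ?h) \<le> ?S" "(\<Sum>(M,idx)\<in>P1. schwartz_seminorm M idx ?h) \<le> ?S" "0 \<le> ?S"
      using P0(1) P1(1) seminorm_upper(2)[OF hS] by (auto intro!: sum_mono2 sum_nonneg simp: case_prod_unfold)
    have b: "norm (fourier ?h k) \<le> (2 ^ N * (C0 + C1) * ?S) / (1 + norm k) ^ N" for k
    proof -
      have "(1 + norm k) ^ N \<le> (2 * max 1 (norm k)) ^ N" by (intro power_mono) auto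
      also have "\<dots> = 2 ^ N * max 1 (norm k) ^ N" by (simp add: power_mult_distrib)
      also have "\<dots> \<le> 2 ^ N * (1 + norm k ^ N)" by (intro mult_left_mono) (auto simp: max_def)
      finally have "(1 + norm k) ^ N * norm (fourier ?h k) \<le> 2 ^ N * (1 + norm k ^ N) * norm (fourier ?h k)"
        by (intro mult_right_mono) auto
      also have "\<dots> = 2 ^ N * (norm k ^ 0 * norm (fourier ?h k) + norm k ^ N * norm (fourier ?h k))" by (simp add: algebra_simps)
      also have "\<dots> \<le> 2 ^ N * (C0 * ?S + C1 * ?S)"
        by (intro mult_left_mono add_mono order_trans[OF P0(3)[OF hS]] order_trans[OF P1(3)[OF hS]] S P0 P1) auto
      also have "\<dots> = 2 ^ N * (C0 + C1) * ?S" by (simp add: distrib_right)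
      finally show ?thesis by (simp add: pos_le_divide_eq add_pos_nonneg mult.commute)
    qed
    have ag: "dualT a ?h = dualT a f - dualT a g"
      using add[OF f Phi_cmult[OF g, of "- 1"]] cm[OF g, of "- 1"] by simp
    have "norm (dualT a ?h) \<le> (LBINT k. (2 ^ N * (C0 + C1) * ?S) * (norm (a k) / (1 + norm k) ^ N))"
      unfolding dualT_def using h
    proof (simp only: restrict_apply if_True, intro Bochner_Integration.integral_norm_bound_integral)
      show "integrable lborel (\<lambda>k. a k * fourier ?h (- k))" by (rule dualT_integrable[OF a hS])
      show "integrable lborel (\<lambda>k. (2 ^ N * (C0 + C1) * ?S) * (norm (a k) / (1 + norm k) ^ N))" by (intro integrable_mult_right N)
      fix k
      show "norm (a k * fourier ?h (- k)) \<le> (2 ^ N * (C0 + C1) * ?S) * (norm (a k) / (1 + norm k) ^ N)"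
        using mult_left_mono[OF b[of "- k"], of "norm (a k)"] by (simp add: norm_mult mult.commute)
    qed
    also have "\<dots> = (2 ^ N * (C0 + C1) * ?S) * I" unfolding I_def by (rule integral_mult_right_zero)
    also have "\<dots> = (I * 2 ^ N * (C0 + C1)) * ?S" by (simp only: mult_ac)
    finally show ?thesis unfolding ag .
  qed
  have "continuous_map (subtopology schwartz_topology Phi) euclidean (dualT a)"
  proof (rule schwartz_topology_continuous[OF _ bound])
    show "finite ?P" using P0 P1 by simp
    show "0 \<le> I * 2 ^ N * (C0 + C1)" using I0 P0(2) P1(2) by simp
  qed (auto intro: Phi_schwartz)
  then show ?thesis using add cm unfolding top_dual_def by (auto simp: dualT_def)
qed

lemma fourier_dual_dualT:
  fixes a :: "'d::finite cfun"
  shows "fourier_dual (dualT a) = (\<lambda>\<psi>\<in>Psi. \<integral>k. a k * \<psi> k \<partial>lborel)"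
proof (unfold fourier_dual_def, rule restrict_ext)
  fix \<psi> :: "'d cfun" assume p: "\<psi> \<in> Psi"
  have "dualT a (fourier_inv (\<lambda>k. \<psi> (- k))) = dualT a (fourier \<psi>)"
    by (simp only: fourier_inv_reflect[OF Psi_schwartz[OF p]])
  also have "\<dots> = (LBINT k. a k * fourier (fourier \<psi>) (- k))" by (simp add: dualT_def fourier_Psi[OF p])
  also have "\<dots> = (LBINT k. a k * \<psi> k)" by (simp only: fourier_inversion[OF Psi_schwartz[OF p]])
  finally show "dualT a (fourier_inv (\<lambda>k. \<psi> (- k))) = (LBINT k. a k * \<psi> k)" .
qed

text \<open>Every element of \<open>Phi\<close> is an inverse transform of an element of \<open>Psi\<close>, so the values of a functional on \<open>Phi\<close>
can be recovered; off \<open>Phi\<close> functionals are fixed by extensionality.\<close>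

lemma inj_on_fourier_dual: "inj_on fourier_dual (top_dual Phi :: 'd::finite functional set)"
proof (rule inj_onI)
  fix u v :: "'d functional" assume u: "u \<in> top_dual Phi" and v: "v \<in> top_dual Phi" and eq: "fourier_dual u = fourier_dual v"
  show "u = v"
  proof (rule extensionalityI[of _ Phi])
    show "u \<in> extensional Phi" "v \<in> extensional Phi" using u v by (auto simp: top_dual_def)
    fix \<phi> :: "'d cfun" assume p: "\<phi> \<in> Phi"
    define \<psi> where "\<psi> k = fourier \<phi> (- k)" for k
    have psi: "\<psi> \<in> Psi" unfolding \<psi>_def[abs_def] by (intro Psi_reflect fourier_Phi p)
    have "fourier_inv (\<lambda>k. \<psi> (- k)) = \<phi>"
    proof -
      have "fourier_inv (\<lambda>k. \<psi> (- k)) = fourier_inv (fourier \<phi>)" by (simp add: \<psi>_def)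
      also have "\<dots> = \<phi>" using fourier_inv_eq[OF schwartz_fourier[OF Phi_schwartz[OF p]]] fourier_inversion[OF Phi_schwartz[OF p]] by auto
      finally show ?thesis .
    qed
    then have "u \<phi> = fourier_dual u \<psi>" "v \<phi> = fourier_dual v \<psi>" using psi by (simp_all add: fourier_dual_def)
    then show "u \<phi> = v \<phi>" using eq by simp
  qed
qed

lemma rpow_nonneg: "x \<ge> 0 \<Longrightarrow> rpow x s \<ge> 0" by (simp add: rpow_def)

lemma rpow_measurable: "(\<lambda>x::real. rpow x s) \<in> borel_measurable borel"
  unfolding rpow_def by measurable

lemma rpow_bound:
  assumes "s \<ge> 0" shows "\<exists>N::nat. \<forall>x\<ge>0. rpow x s \<le> (1 + x) ^ N"
proof -
  obtain N :: nat where N: "s \<le> real N" using real_arch_simple by blast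
  have "rpow x s \<le> (1 + x) ^ N" if "x \<ge> 0" for x
  proof (cases "s = 0")
    case True then show ?thesis using that by (simp add: rpow_def)
  next
    case False
    have "x powr s \<le> (1 + x) powr s" using that assms by (intro powr_mono2) auto
    also have "\<dots> \<le> (1 + x) powr real N" using that N by (intro powr_mono) auto
    also have "\<dots> = (1 + x) ^ N" using that by (intro powr_realpow) auto
    finally show ?thesis using False by (simp add: rpow_def)
  qed
  then show ?thesis by blast
qed

text \<open>The Fourier multiplier \<open>|k|^s\<close>.\<close>

definition mulp :: "real \<Rightarrow> 'd::finite cfun \<Rightarrow> 'd cfun" where
  "mulp s a = (\<lambda>k. cplx (rpow (norm k) s) * a k)"

lemma tempered_mulp:
  fixes a :: "'d::finite cfun"
  assumes "tempered a" "s \<ge> 0" shows "tempered (mulp s a)"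
proof -
  obtain N where N: "\<And>x. x \<ge> 0 \<Longrightarrow> rpow x s \<le> (1 + x) ^ N" using rpow_bound[OF assms(2)] by blast
  have m: "(\<lambda>k::real^'d. cplx (rpow (norm k) s)) \<in> borel_measurable borel"
    using measurable_compose[OF borel_measurable_norm rpow_measurable, of s] by measurable
  show ?thesis unfolding mulp_def
  proof (rule tempered_mult_bounded[OF assms(1) m, of 1 N])
    fix k :: "real^'d"
    show "norm (cplx (rpow (norm k) s)) \<le> 1 * (1 + norm k) ^ N"
      using N[OF norm_ge_zero[of k]] rpow_nonneg[OF norm_ge_zero[of k], of s] by simp
  qed
qed

lemma mulp_Psi:
  fixes \<psi> :: "'d::finite cfun"
  assumes "\<psi> \<in> Psi" shows "mulp s \<psi> \<in> Psi"
proof -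
  have "mulp s \<psi> = (\<lambda>k. cplx (norm k powr s) * \<psi> k)"
    using Psi_zero_at[OF assms] by (auto simp: mulp_def rpow_def fun_eq_iff)
  then show ?thesis using Psi_norm_powr[OF assms] by simp
qed

text \<open>Both sides have the same Fourier transform, and \<open>fourier_dual\<close> is injective on the topological dual.\<close>

lemma D_op_dualT:
  fixes a :: "'d::finite cfun"
  assumes a: "tempered a" and s: "s \<ge> 0"
  shows "D_op s (dualT a) = dualT (mulp s a)"
proof -
  have "mult_norm_pow s (fourier_dual (dualT a)) = fourier_dual (dualT (mulp s a))"
    unfolding fourier_dual_dualT mult_norm_pow_def
  proof (rule restrict_ext)
    fix \<psi> :: "'d cfun" assume p: "\<psi> \<in> Psi"
    show "(\<lambda>\<psi>\<in>Psi. \<integral>k. a k * \<psi> k \<partial>lborel) (\<lambda>k. cplx (rpow (norm k) s) * \<psi> k) = (LBINT k. mulp s a k * \<psi> k)"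
      using mulp_Psi[OF p, of s] by (simp add: mulp_def mult_ac)
  qed
  then show ?thesis unfolding D_op_def fourier_dual_inv_def
    using inv_into_f_f[OF inj_on_fourier_dual dualT_in_top_dual[OF tempered_mulp[OF a s]]] by simp
qed

text \<open>A functional determines its transform, because tempered functions are determined by their values on \<open>Psi\<close>.\<close>

lemma dualT_eq_AE:
  fixes a b :: "'d::finite cfun"
  assumes a: "tempered a" and b: "tempered b" and eq: "dualT a = dualT b"
  shows "AE k in lborel. a k = b k"
proof -
  have "tempered (\<lambda>k. (- 1) * b k)" by (rule tempered_mult_bounded[OF b, of _ 1 0]) auto
  from tempered_add[OF a this] have t: "tempered (\<lambda>k. a k - b k)" by simp
  have "AE k in lborel. a k - b k = 0"
  proof (rule tempered_annihilates_Psi[OF t])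
    fix \<psi> :: "'d cfun" assume p: "\<psi> \<in> Psi"
    have "fourier_dual (dualT a) \<psi> = fourier_dual (dualT b) \<psi>" using eq by simp
    then have "(LBINT k. a k * \<psi> k) = (LBINT k. b k * \<psi> k)" using p by (simp add: fourier_dual_dualT)
    then show "(LBINT k. (a k - b k) * \<psi> k) = 0"
      using tempered_integrable[OF a Psi_schwartz[OF p]] tempered_integrable[OF b Psi_schwartz[OF p]] by (simp add: left_diff_distrib)
  qed
  then show ?thesis by simp
qed

text \<open>Passing from a function to its transform is the adjoint relation between \<open>fourier\<close> on both sides of the
duality bracket.\<close>

lemma embed_eq_dualT:
  fixes f g :: "'d::finite cfun"
  assumes "\<And>\<phi>. \<phi> \<in> schwartz \<Longrightarrow> (LBINT x. g x * \<phi> x) = (LBINT x. f x * fourier \<phi> x)"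
  shows "embed f = dualT g"
  unfolding embed_def dualT_def
proof (rule restrict_ext)
  fix \<phi> :: "'d cfun" assume p: "\<phi> \<in> Phi"
  let ?\<chi> = "\<lambda>k. fourier \<phi> (- k)"
  have S: "?\<chi> \<in> schwartz" by (intro schwartz_reflect schwartz_fourier Phi_schwartz p)
  have "fourier ?\<chi> = \<phi>"
    using fourier_reflect[OF schwartz_integrable[OF schwartz_fourier[OF Phi_schwartz[OF p]]]] fourier_inversion[OF Phi_schwartz[OF p]] by auto
  then show "(LINT x|lborel. f x * \<phi> x) = (LBINT k. g k * fourier \<phi> (- k))" using assms[OF S] by simp
qed

lemma L2_has_transform:
  fixes f :: "'d::finite cfun"
  assumes "L2 f" obtains g where "L2 g" "nsq g \<le> nsq f" "embed f = dualT g"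
proof -
  obtain g where g: "L2 g" "nsq g \<le> nsq f"
    and eq: "\<And>\<phi>. \<phi> \<in> schwartz \<Longrightarrow> (LBINT x. g x * \<phi> x) = (LBINT x. f x * fourier \<phi> x)"
    using L2_fourier_exists[OF assms] by blast
  from that[OF g embed_eq_dualT[OF eq]] show ?thesis by simp
qed

lemma nsq_reflect:
  fixes g :: "'d::finite cfun"
  assumes "L2 g" shows "L2 (\<lambda>x. g (- x))" "nsq (\<lambda>x. g (- x)) = nsq g"
proof -
  have [measurable]: "g \<in> borel_measurable borel" using assms by (simp add: L2_def)
  have i: "integrable lborel (\<lambda>x. (norm (g x))\<^sup>2)" using assms by (simp add: L2_def)
  show "L2 (\<lambda>x. g (- x))" unfolding L2_def
    using integrable_affine_euclidean[OF i, of "- 1" 0] by simp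
  show "nsq (\<lambda>x. g (- x)) = nsq g"
    unfolding nsq_def using integral_affine_euclidean[OF i, of "- 1" 0] by simp
qed

lemma reflect_integral:
  fixes g :: "'d::finite cfun"
  assumes "integrable lborel g" shows "(LBINT x. g (- x)) = (LBINT x. g x)"
  using integral_affine_euclidean[OF assms, of "- 1" 0] by simp

lemma embed_of_transform:
  fixes b :: "'d::finite cfun"
  assumes b: "integrable lborel b" "tempered b"
  shows "embed (\<lambda>x. fourier b (- x)) = dualT b"
  unfolding embed_def dualT_def
proof (rule restrict_ext)
  fix \<phi> :: "'d cfun" assume p: "\<phi> \<in> Phi"
  have ip: "integrable lborel \<phi>" by (rule schwartz_integrable[OF Phi_schwartz[OF p]])
  have br: "integrable lborel (\<lambda>x. b (- x))" using integrable_affine_euclidean[OF b(1), of "- 1" 0] by simp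
  have "(LINT x|lborel. fourier b (- x) * \<phi> x) = (LBINT x. fourier (\<lambda>k. b (- k)) x * \<phi> x)"
    by (simp only: fourier_reflect[OF b(1)])
  also have "\<dots> = (LBINT k. b (- k) * fourier \<phi> k)" by (rule fourier_multiplication[OF br ip])
  also have "\<dots> = (LBINT k. b k * fourier \<phi> (- k))"
    using reflect_integral[OF dualT_integrable[OF b(2) Phi_schwartz[OF p]]] by simp
  finally show "(LINT x|lborel. fourier b (- x) * \<phi> x) = (LBINT k. b k * fourier \<phi> (- k))" .
qed

lemma L2_dualT_exists:
  fixes b :: "'d::finite cfun"
  assumes b: "L2 b"
  obtains h where "L2 h" "nsq h \<le> nsq b" "embed h = dualT b"
proof -
  obtain g where g: "L2 g" "nsq g \<le> nsq b"
    and eq: "\<And>\<phi>. \<phi> \<in> schwartz \<Longrightarrow> (LBINT x. g x * \<phi> x) = (LBINT x. b x * fourier \<phi> x)"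
    using L2_fourier_exists[OF b] by blast
  have "embed (\<lambda>x. g (- x)) = dualT b"
    unfolding embed_def dualT_def
  proof (rule restrict_ext)
    fix \<phi> :: "'d cfun" assume p: "\<phi> \<in> Phi"
    have S: "(\<lambda>x. \<phi> (- x)) \<in> schwartz" by (intro schwartz_reflect Phi_schwartz p)
    have i: "integrable lborel (\<lambda>x. g x * \<phi> (- x))" by (rule tempered_integrable[OF L2_tempered[OF g(1)] S])
    have "(LINT x|lborel. g (- x) * \<phi> x) = (LBINT x. g x * \<phi> (- x))" using reflect_integral[OF i] by simp
    also have "\<dots> = (LBINT x. b x * fourier (\<lambda>x. \<phi> (- x)) x)" by (rule eq[OF S])
    also have "\<dots> = (LBINT x. b x * fourier \<phi> (- x))"
      by (simp only: fourier_reflect[OF schwartz_integrable[OF Phi_schwartz[OF p]]])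
    finally show "(LINT x|lborel. g (- x) * \<phi> x) = (LBINT k. b k * fourier \<phi> (- k))" .
  qed
  then show ?thesis using that nsq_reflect[OF g(1)] g(2) by simp
qed

section \<open>Representatives of elements of Lp\<close>

text \<open>For \<open>p \<ge> 1\<close> the function is at most a constant times its \<open>p\<close>-th power where it exceeds \<open>\<delta>\<close>; a function in
\<open>C\<^sub>0\<close> exceeds \<open>\<delta>\<close> only on a bounded set.\<close>

lemma Lp_fun_small:
  fixes f :: "'d::finite cfun"
  assumes p: "1 \<le> p" and f: "f \<in> Lp_fun p" shows "small_at_infinity f"
proof (cases "p = \<infinity>")
  case True
  then have c: "continuous_on UNIV f" and l: "(f \<longlongrightarrow> 0) at_infinity" using f by (auto simp: Lp_fun_def)
  have fm[measurable]: "f \<in> borel_measurable borel" using c by (rule borel_measurable_continuous_onI)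
  show ?thesis unfolding small_at_infinity_def
  proof (intro conjI allI impI fm)
    fix \<delta> :: real assume d: "\<delta> > 0"
    have "eventually (\<lambda>x. norm (f x) < \<delta>) at_infinity" using tendstoD[OF l d] by simp
    then obtain R where R: "\<And>x. norm x \<ge> R \<Longrightarrow> norm (f x) < \<delta>" unfolding eventually_at_infinity by blast
    have "compact (f ` cball 0 R)" by (intro compact_continuous_image continuous_on_subset[OF c]) auto
    then have "bounded (f ` cball 0 R)" by (rule compact_imp_bounded)
    then obtain B where "\<forall>z\<in>f ` cball 0 R. norm z \<le> B" unfolding bounded_iff by blast
    then have B: "\<And>x. x \<in> cball 0 R \<Longrightarrow> norm (f x) \<le> B" by simp
    show "integrable lborel (\<lambda>x. indicator {x. norm (f x) > \<delta>} x * norm (f x))"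
    proof (rule Bochner_Integration.integrable_bound)
      have "integrable lborel (\<lambda>x::real^'d. indicator (cball 0 R) x :: real)"
        by (rule integrable_real_indicator) (use emeasure_lborel_cball_finite[of "0::real^'d" R] in auto)
      then show "integrable lborel (\<lambda>x::real^'d. \<bar>B\<bar> * indicator (cball 0 R) x)" by (rule integrable_mult_right)
      show "AE x in lborel. norm (indicator {x. norm (f x) > \<delta>} x * norm (f x)) \<le> norm (\<bar>B\<bar> * indicator (cball 0 R) x)"
      proof (rule AE_I2)
        fix x
        show "norm (indicator {x. norm (f x) > \<delta>} x * norm (f x)) \<le> norm (\<bar>B\<bar> * indicator (cball 0 R) x)"
        proof (cases "norm (f x) > \<delta>")
          case True
          have "norm x < R"
          proof (rule ccontr)
            assume "\<not> norm x < R"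
            then have "norm (f x) < \<delta>" using R[of x] by simp
            then show False using True by simp
          qed
          then have "x \<in> cball 0 R" by simp
          moreover have "norm (f x) \<le> \<bar>B\<bar>" using B[OF \<open>x \<in> cball 0 R\<close>] by linarith
          ultimately show ?thesis by (simp add: indicator_def)
        qed simp
      qed
    qed measurable
  qed
next
  case False
  define q where "q = real_of_ereal p"
  have q: "q \<ge> 1" using p False by (cases p) (auto simp: q_def one_ereal_def)
  have fm[measurable]: "f \<in> borel_measurable borel" and fi: "integrable lborel (\<lambda>x. norm (f x) powr q)"
    using f False by (auto simp: Lp_fun_def q_def)
  show ?thesis unfolding small_at_infinity_def
  proof (intro conjI allI impI fm)
    fix \<delta> :: real assume d: "\<delta> > 0"
    show "integrable lborel (\<lambda>x. indicator {x. norm (f x) > \<delta>} x * norm (f x))"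
    proof (rule Bochner_Integration.integrable_bound[OF integrable_mult_right[OF fi, of "\<delta> powr (1 - q)"]])
      show "AE x in lborel. norm (indicator {x. norm (f x) > \<delta>} x * norm (f x)) \<le> norm (\<delta> powr (1 - q) * norm (f x) powr q)"
      proof (rule AE_I2)
        fix x
        show "norm (indicator {x. norm (f x) > \<delta>} x * norm (f x)) \<le> norm (\<delta> powr (1 - q) * norm (f x) powr q)"
        proof (cases "norm (f x) > \<delta>")
          case True
          let ?t = "norm (f x)"
          have t: "?t > 0" using True d by linarith
          have "?t = ?t powr (1 - q) * ?t powr q" using t by (simp add: powr_add[symmetric])
          also have "\<dots> \<le> \<delta> powr (1 - q) * ?t powr q"
            using True d q by (intro mult_right_mono powr_mono2') auto
          finally show ?thesis using True by (simp add: abs_mult)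
        qed simp
      qed
    qed measurable
  qed
qed

lemma embed_eq_AE:
  fixes f g :: "'d::finite cfun"
  assumes p: "1 \<le> p" and f: "f \<in> Lp_fun p" and g: "g \<in> Lp_fun p" and eq: "embed f = embed g"
  shows "AE x in lborel. f x = g x"
proof -
  note sf = Lp_fun_small[OF p f] and sg = Lp_fun_small[OF p g]
  have "AE x in lborel. f x - g x = 0"
  proof (rule small_annihilates_Phi[OF small_diff[OF sf sg]])
    fix \<phi> :: "'d cfun" assume ph: "\<phi> \<in> Phi"
    have "embed f \<phi> = embed g \<phi>" using eq by simp
    then have "(LBINT x. f x * \<phi> x) = (LBINT x. g x * \<phi> x)" using ph by (simp add: embed_def)
    then show "(LBINT x. (f x - g x) * \<phi> x) = 0"
      using tempered_integrable[OF small_tempered[OF sf] Phi_schwartz[OF ph]] tempered_integrable[OF small_tempered[OF sg] Phi_schwartz[OF ph]]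
      by (simp add: left_diff_distrib)
  qed
  then show ?thesis by simp
qed

lemma AE_eq_continuous:
  fixes f g :: "'d::finite cfun"
  assumes c: "continuous_on UNIV f" "continuous_on UNIV g" and ae: "AE x in lborel. f x = g x"
  shows "f = g"
proof
  fix x
  have "closed {x \<in> UNIV. f x = g x}" using closed_Collect_eq[OF c] by simp
  then have "closed {x. f x = g x}" by simp
  then show "f x = g x" using mem_closed_if_AE_lebesgue[of "{x. f x = g x}" x] ae AE_completion by auto
qed

text \<open>The norm is defined through an arbitrarily chosen representative; injectivity of the embedding makes the choice
irrelevant. For \<open>p = \<infinity>\<close> almost everywhere equality of continuous functions is equality.\<close>

lemma Lp_norm_embed:
  fixes f :: "'d::finite cfun"
  assumes p: "1 \<le> p" and f: "f \<in> Lp_fun p" shows "Lp_norm p (embed f) = Lp_fun_norm p f"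
proof -
  define g where "g = inv_into (Lp_fun p) embed (embed f)"
  have "embed f \<in> embed ` Lp_fun p" using f by (rule imageI)
  then have g: "g \<in> Lp_fun p" "embed g = embed f"
    unfolding g_def by (rule inv_into_into, rule f_inv_into_f)
  have ae: "AE x in lborel. g x = f x" by (rule embed_eq_AE[OF p g(1) f g(2)])
  have "Lp_fun_norm p g = Lp_fun_norm p f"
  proof (cases "p = \<infinity>")
    case True
    then have "g = f" using f g(1) ae by (intro AE_eq_continuous) (auto simp: Lp_fun_def)
    then show ?thesis by simp
  next
    case False
    have [measurable]: "f \<in> borel_measurable borel" "g \<in> borel_measurable borel" using f g(1) False by (auto simp: Lp_fun_def)
    have "(LINT x|lborel. norm (g x) powr real_of_ereal p) = (LINT x|lborel. norm (f x) powr real_of_ereal p)"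
      by (rule Bochner_Integration.integral_cong_AE) (use ae in \<open>auto elim!: AE_mp\<close>)
    then show ?thesis using False by (simp add: Lp_fun_norm_def)
  qed
  then show ?thesis by (simp add: Lp_norm_def g_def)
qed

lemma powr_two_norm: "norm z powr 2 = (norm z)\<^sup>2"
  by (cases "z = 0") auto

lemma Lp_fun_2: "f \<in> Lp_fun 2 \<longleftrightarrow> L2 f" "Lp_fun_norm 2 f = sqrt (nsq f)"
proof -
  have 2: "(2::ereal) \<noteq> \<infinity>" "real_of_ereal 2 = 2" by simp_all
  show "f \<in> Lp_fun 2 \<longleftrightarrow> L2 f" by (simp only: Lp_fun_def 2 if_False L2_def powr_two_norm mem_Collect_eq) simp
  show "Lp_fun_norm 2 f = sqrt (nsq f)"
    by (simp only: Lp_fun_norm_def 2 if_False nsq_def powr_two_norm) (simp add: powr_half_sqrt integral_nonneg_AE)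
qed

section \<open>Beta integrals and Fourier transforms of radial functions\<close>

text \<open>Write \<open>1 / (1 + s) powr q\<close> as a Gamma integral over an auxiliary variable and exchange the integrals.\<close>

lemma nn_integral_beta:
  assumes c: "c > 0" "q > c"
  shows "(\<integral>\<^sup>+s. indicator {0<..} s * ennreal (s powr (c - 1) / (1 + s) powr q) \<partial>lborel) = ennreal (Gamma c * Gamma (q - c) / Gamma q)"
proof -
  have q: "q > 0" using c by simp
  have G: "Gamma q > 0" "Gamma c > 0" "Gamma (q - c) > 0" using c q by (auto intro: Gamma_real_pos)
  let ?k = "\<lambda>s u. indicator {0<..} s * (indicator {0<..} u * ennreal (s powr (c - 1) * (u powr (q - 1) * exp (- (u * (1 + s))))))"
  have inner1: "(\<integral>\<^sup>+u. ?k s u \<partial>lborel) = ennreal (Gamma q) * (indicator {0<..} s * ennreal (s powr (c - 1) / (1 + s) powr q))" for s :: real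
  proof (cases "s > 0")
    case True
    have "(\<integral>\<^sup>+u. ?k s u \<partial>lborel) = (\<integral>\<^sup>+u. ennreal (s powr (c - 1)) * (indicator {0<..} u * ennreal (u powr (q - 1) * exp (- ((1 + s) * u)))) \<partial>lborel)"
      using True by (intro nn_integral_cong) (auto simp: indicator_def ennreal_mult[symmetric] mult_ac)
    also have "\<dots> = ennreal (s powr (c - 1)) * ennreal (Gamma q * (1 + s) powr (- q))"
      by (subst nn_integral_cmult, measurable, subst nn_integral_Gamma_scaled) (use True q in auto)
    finally show ?thesis using True G by (simp add: ennreal_mult[symmetric] powr_minus_divide)
  qed simp
  have inner2: "(\<integral>\<^sup>+s. ?k s u \<partial>lborel) = ennreal (Gamma c) * (indicator {0<..} u * ennreal (u powr (q - c - 1) * exp (- (1 * u))))" for u :: real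
  proof (cases "u > 0")
    case True
    have "(\<integral>\<^sup>+s. ?k s u \<partial>lborel) = (\<integral>\<^sup>+s. ennreal (u powr (q - 1) * exp (- u)) * (indicator {0<..} s * ennreal (s powr (c - 1) * exp (- (u * s)))) \<partial>lborel)"
    proof (intro nn_integral_cong)
      fix s :: real
      have "exp (- (u * (1 + s))) = exp (- u) * exp (- (u * s))" unfolding distrib_left mult_1_right minus_add_distrib exp_add by (rule refl)
      then have e: "s powr (c - 1) * (u powr (q - 1) * exp (- (u * (1 + s)))) = (u powr (q - 1) * exp (- u)) * (s powr (c - 1) * exp (- (u * s)))" by simp
      show "?k s u = ennreal (u powr (q - 1) * exp (- u)) * (indicator {0<..} s * ennreal (s powr (c - 1) * exp (- (u * s))))"
        unfolding e using True by (cases "s > 0") (simp_all add: ennreal_mult)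
    qed
    also have "\<dots> = ennreal (u powr (q - 1) * exp (- u)) * ennreal (Gamma c * u powr (- c))"
      by (subst nn_integral_cmult, measurable, subst nn_integral_Gamma_scaled) (use True c in auto)
    also have "\<dots> = ennreal (u powr (q - 1) * exp (- u) * (Gamma c * u powr (- c)))" using G by (intro ennreal_mult[symmetric]) auto
    also have "u powr (q - 1) * exp (- u) * (Gamma c * u powr (- c)) = Gamma c * ((u powr (q - 1) * u powr (- c)) * exp (- u))" by simp
    also have "u powr (q - 1) * u powr (- c) = u powr (q - c - 1)" using True by (simp add: powr_add[symmetric] algebra_simps)
    finally show ?thesis using True G by (simp add: ennreal_mult[symmetric])
  qed simp
  have "ennreal (Gamma q) * (\<integral>\<^sup>+s. indicator {0<..} s * ennreal (s powr (c - 1) / (1 + s) powr q) \<partial>lborel) = (\<integral>\<^sup>+s. (\<integral>\<^sup>+u. ?k s u \<partial>lborel) \<partial>lborel)"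
    unfolding inner1 by (subst nn_integral_cmult) auto
  also have "\<dots> = (\<integral>\<^sup>+u. (\<integral>\<^sup>+s. ?k s u \<partial>lborel) \<partial>lborel)"
    by (rule lborel_pair.Fubini') measurable
  also have "\<dots> = ennreal (Gamma c) * ennreal (Gamma (q - c) * 1 powr (- (q - c)))"
    unfolding inner2 by (subst nn_integral_cmult, measurable, subst nn_integral_Gamma_scaled) (use c in auto)
  finally have *: "ennreal (Gamma q) * (\<integral>\<^sup>+s. indicator {0<..} s * ennreal (s powr (c - 1) / (1 + s) powr q) \<partial>lborel) = ennreal (Gamma c * Gamma (q - c))"
    (is "_ * ?I = _") using G by (simp add: ennreal_mult[symmetric])
  have "?I = ennreal (1 / Gamma q) * (ennreal (Gamma q) * ?I)"
    using G by (simp add: mult.assoc[symmetric] ennreal_mult[symmetric])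
  also have "\<dots> = ennreal (Gamma c * Gamma (q - c) / Gamma q)" unfolding * using G by (simp add: ennreal_mult[symmetric])
  finally show ?thesis .
qed

lemma nn_integral_beta_powr:
  assumes a: "a > 0" and c: "c > 0" "q > c" and e: "e = a * c"
  shows "(\<integral>\<^sup>+\<xi>. indicator {0<..} \<xi> * ennreal (\<xi> powr (e - 1) / (1 + \<xi> powr a) powr q) \<partial>lborel)
    = ennreal (Gamma c * Gamma (q - c) / Gamma q / a)"
proof -
  define f where "f s = ennreal (1 / a) * ennreal (s powr (c - 1) / (1 + s) powr q)" for s
  have [measurable]: "f \<in> borel_measurable borel" unfolding f_def by measurable
  have "(\<integral>\<^sup>+\<xi>. indicator {0<..} \<xi> * ennreal (\<xi> powr (e - 1) / (1 + \<xi> powr a) powr q) \<partial>lborel)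
     = (\<integral>\<^sup>+\<rho>. ennreal (a * \<rho> powr (a - 1)) * indicator {0<..} \<rho> * f (\<rho> powr a) \<partial>lborel)"
  proof (rule nn_integral_cong)
    fix \<xi> :: real
    show "indicator {0<..} \<xi> * ennreal (\<xi> powr (e - 1) / (1 + \<xi> powr a) powr q) = ennreal (a * \<xi> powr (a - 1)) * indicator {0<..} \<xi> * f (\<xi> powr a)"
    proof (cases "\<xi> > 0")
      case True
      have "\<xi> powr (a - 1) * (\<xi> powr a) powr (c - 1) = \<xi> powr (e - 1)"
        unfolding powr_powr powr_add[symmetric] e by (simp add: algebra_simps)
      then have "\<xi> powr (e - 1) / (1 + \<xi> powr a) powr q = (a * \<xi> powr (a - 1)) * ((1 / a) * ((\<xi> powr a) powr (c - 1) / (1 + \<xi> powr a) powr q))"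
        using a by (simp add: field_simps)
      also have "ennreal \<dots> = ennreal (a * \<xi> powr (a - 1)) * f (\<xi> powr a)"
        unfolding f_def using a by (subst ennreal_mult, simp, simp, subst ennreal_mult) auto
      finally show ?thesis using True by simp
    qed simp
  qed
  also have "\<dots> = (\<integral>\<^sup>+s. indicator {0<..} s * f s \<partial>lborel)" by (rule nn_integral_powr_substitution[OF a]) simp
  also have "\<dots> = (\<integral>\<^sup>+s. ennreal (1 / a) * (indicator {0<..} s * ennreal (s powr (c - 1) / (1 + s) powr q)) \<partial>lborel)"
    unfolding f_def by (simp add: mult_ac)
  also have "\<dots> = ennreal (1 / a) * ennreal (Gamma c * Gamma (q - c) / Gamma q)"
    by (subst nn_integral_cmult) (auto simp: nn_integral_beta[OF c])
  also have "\<dots> = ennreal ((1 / a) * (Gamma c * Gamma (q - c) / Gamma q))"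
    by (rule ennreal_mult[symmetric]) (use a c in \<open>auto intro!: divide_nonneg_nonneg mult_nonneg_nonneg Gamma_real_nonneg\<close>)
  also have "(1 / a) * (Gamma c * Gamma (q - c) / Gamma q) = Gamma c * Gamma (q - c) / Gamma q / a" by simp
  finally show ?thesis .
qed

lemma Gamma_reflection_real:
  assumes "0 < c" "c < (1::real)" shows "Gamma c * Gamma (1 - c) = pi / sin (pi * c)"
proof -
  have "Gamma (cplx c) * Gamma (1 - cplx c) = of_real pi / sin (of_real pi * cplx c)"
    by (rule Gamma_reflection_complex)
  moreover have "Gamma (1 - cplx c) = cplx (Gamma (1 - c))"
    using Gamma_complex_of_real[of "1 - c"] by simp
  ultimately have "cplx (Gamma c * Gamma (1 - c)) = cplx (pi / sin (pi * c))"
    by (simp add: Gamma_complex_of_real sin_of_real[symmetric])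
  then show ?thesis by (simp only: of_real_eq_iff)
qed

lemma schwartz_inner_power_gauss: "(\<lambda>k::real^'d::finite. cplx ((k \<bullet> x) ^ n) * gauss k) \<in> schwartz"
proof (induction n)
  case 0 then show ?case using schwartz_gauss by simp
next
  case (Suc n)
  have "(\<lambda>k. \<Sum>i\<in>UNIV. cplx (x $ i) * (cplx (k $ i) * (cplx ((k \<bullet> x) ^ n) * gauss k))) \<in> schwartz"
    by (intro schwartz_sum schwartz_cmult schwartz_coord Suc)
  moreover have "(\<lambda>k. \<Sum>i\<in>UNIV. cplx (x $ i) * (cplx (k $ i) * (cplx ((k \<bullet> x) ^ n) * gauss k)))
     = (\<lambda>k::real^'d. cplx ((k \<bullet> x) ^ Suc n) * gauss k)"
  proof
    fix k :: "real^'d"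
    have "cplx (k \<bullet> x) = (\<Sum>i\<in>UNIV. cplx (x $ i) * cplx (k $ i))"
      by (simp add: inner_vec_def mult.commute)
    then show "(\<Sum>i\<in>UNIV. cplx (x $ i) * (cplx (k $ i) * (cplx ((k \<bullet> x) ^ n) * gauss k))) = cplx ((k \<bullet> x) ^ Suc n) * gauss k"
      by (simp only: power_Suc of_real_mult mult.assoc sum_distrib_right)
  qed
  ultimately show ?case by simp
qed

text \<open>Integrate the divergence of \<open>(k \<bullet> x) ^ (n + 1) * gauss k\<close> in the direction \<open>x\<close>.\<close>

lemma gauss_moment_recursion:
  fixes x :: "real^'d::finite"
  defines "M n \<equiv> (LBINT k. cplx ((k \<bullet> x) ^ n) * gauss k)"
  shows "M (n + 2) = of_nat (n + 1) * cplx ((norm x)\<^sup>2) * M n"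
proof -
  let ?q = "\<lambda>n k. cplx ((k \<bullet> x) ^ n) * gauss k :: complex"
  have int: "integrable lborel (?q n)" for n by (rule schwartz_integrable[OF schwartz_inner_power_gauss])
  have intc: "integrable lborel (\<lambda>k. cplx (k $ i) * ?q n k)" for n i
    by (rule schwartz_integrable[OF schwartz_coord[OF schwartz_inner_power_gauss]])
  have P: "partial_deriv i (?q (n + 1)) k = (of_nat (n + 1) * cplx (x $ i)) * ?q n k - cplx (k $ i) * ?q (n + 1) k" for i k
  proof -
    have D: "((\<lambda>k. cplx ((k \<bullet> x) ^ (n + 1))) has_derivative (\<lambda>v. cplx (real (n + 1) * (v \<bullet> x) * (k \<bullet> x) ^ n))) (at k)"
    proof (intro has_derivative_of_real)
      have "((\<lambda>k. (k \<bullet> x) ^ (n + 1)) has_derivative (\<lambda>v. real (n + 1) * (v \<bullet> x) * (k \<bullet> x) ^ (n + 1 - 1))) (at k)"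
        by (intro has_derivative_power has_derivative_inner_left has_derivative_ident)
      then show "((\<lambda>k. (k \<bullet> x) ^ (n + 1)) has_derivative (\<lambda>v. real (n + 1) * (v \<bullet> x) * (k \<bullet> x) ^ n)) (at k)" by simp
    qed
    have "partial_deriv i (?q (n + 1)) k = cplx ((k \<bullet> x) ^ (n + 1)) * partial_deriv i gauss k
        + partial_deriv i (\<lambda>k. cplx ((k \<bullet> x) ^ (n + 1))) k * gauss k"
      by (rule partial_deriv_mult) (use D partial_deriv_gauss(2) differentiableI in blast)+
    then show ?thesis
      unfolding partial_deriv_gauss(1) partial_deriv_eq[OF D] by (simp add: inner_axis' algebra_simps)
  qed
  have e: "(of_nat (n + 1) * cplx (x $ i)) * M n = (LBINT k. cplx (k $ i) * ?q (n + 1) k)" for i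
  proof -
    have "0 = (LBINT k. partial_deriv i (?q (n + 1)) k)"
      by (rule integral_partial_deriv_zero[OF schwartz_inner_power_gauss, symmetric])
    also have "\<dots> = (LBINT k. (of_nat (n + 1) * cplx (x $ i)) * ?q n k - cplx (k $ i) * ?q (n + 1) k)"
      unfolding P ..
    also have "\<dots> = (of_nat (n + 1) * cplx (x $ i)) * M n - (LBINT k. cplx (k $ i) * ?q (n + 1) k)"
      unfolding M_def by (subst Bochner_Integration.integral_diff[OF integrable_mult_right[OF int] intc]) (simp only: integral_mult_right_zero)
    finally show ?thesis by simp
  qed
  have xk: "cplx (k \<bullet> x) = (\<Sum>i\<in>UNIV. cplx (x $ i) * cplx (k $ i))" for k
    by (simp add: inner_vec_def mult.commute)
  have "M (n + 2) = (LBINT k. (\<Sum>i\<in>UNIV. cplx (x $ i) * (cplx (k $ i) * ?q (n + 1) k)))"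
    unfolding M_def
  proof (rule Bochner_Integration.integral_cong[OF refl])
    fix k
    have "?q (n + 2) k = cplx (k \<bullet> x) * ?q (n + 1) k" by simp
    then show "?q (n + 2) k = (\<Sum>i\<in>UNIV. cplx (x $ i) * (cplx (k $ i) * ?q (n + 1) k))"
      unfolding xk by (simp only: sum_distrib_right mult.assoc)
  qed
  also have "\<dots> = (\<Sum>i\<in>UNIV. cplx (x $ i) * (LBINT k. cplx (k $ i) * ?q (n + 1) k))"
    by (subst Bochner_Integration.integral_sum) (auto simp only: integral_mult_right_zero intro: integrable_mult_right intc)
  also have "\<dots> = (\<Sum>i\<in>UNIV. cplx (x $ i) * ((of_nat (n + 1) * cplx (x $ i)) * M n))"
    unfolding e ..
  also have "\<dots> = of_nat (n + 1) * (\<Sum>i\<in>UNIV. cplx (x $ i) * cplx (x $ i)) * M n"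
    by (simp only: sum_distrib_left sum_distrib_right mult_ac)
  also have "(\<Sum>i\<in>UNIV. cplx (x $ i) * cplx (x $ i)) = cplx ((norm x)\<^sup>2)"
    by (simp add: power2_norm_eq_inner inner_vec_def)
  finally show ?thesis .
qed

lemma gauss_even_moment:
  fixes x :: "real^'d::finite"
  shows "integrable lborel (\<lambda>k. (k \<bullet> x) ^ (2 * m) * exp (- (norm k)\<^sup>2 / 2))"
    "(LBINT k. (k \<bullet> x) ^ (2 * m) * exp (- (norm k)\<^sup>2 / 2))
      = norm x ^ (2 * m) * fact (2 * m) / (2 ^ m * fact m) * (2 * pi) powr (real CARD('d) / 2)"
proof -
  let ?q = "\<lambda>n k. cplx ((k \<bullet> x) ^ n) * gauss k :: complex"
  have c: "?q n k = cplx ((k \<bullet> x) ^ n * exp (- (norm k)\<^sup>2 / 2))" for n k by (simp add: gauss_def)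
  have "integrable lborel (?q n)" for n by (rule schwartz_integrable[OF schwartz_inner_power_gauss])
  then show "integrable lborel (\<lambda>k. (k \<bullet> x) ^ (2 * m) * exp (- (norm k)\<^sup>2 / 2))"
    unfolding c complex_of_real_integrable_eq by blast
  have "(LBINT k. ?q (2 * m) k) = cplx (norm x ^ (2 * m) * fact (2 * m) / (2 ^ m * fact m) * (2 * pi) powr (real CARD('d) / 2))"
  proof (induction m)
    case 0
    have "(LBINT k. ?q (2 * 0) k) = cplx (LBINT (k::real^'d). exp (- (norm k)\<^sup>2 / 2))"
      unfolding c by simp
    also have "(LBINT (k::real^'d). exp (- (norm k)\<^sup>2 / 2)) = (2 * pi) powr (real CARD('d) / 2)"
      using gauss_integral(2)[where 'a="real^'d"] by simp
    finally show ?case by simp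
  next
    case (Suc m)
    let ?P = "(2 * pi) powr (real CARD('d) / 2)"
    have "(LBINT k. ?q (2 * Suc m) k) = of_nat (2 * m + 1) * cplx ((norm x)\<^sup>2) * (LBINT k. ?q (2 * m) k)"
      using gauss_moment_recursion[of x "2 * m"] by simp
    also have "\<dots> = cplx (real (2 * m + 1) * (norm x)\<^sup>2 * (norm x ^ (2 * m) * fact (2 * m) / (2 ^ m * fact m) * ?P))"
      unfolding Suc by simp
    also have "real (2 * m + 1) * (norm x)\<^sup>2 * (norm x ^ (2 * m) * fact (2 * m) / (2 ^ m * fact m) * ?P)
       = norm x ^ (2 * Suc m) * fact (2 * Suc m) / (2 ^ Suc m * fact (Suc m)) * ?P"
    proof -
      have f: "fact (2 * Suc m) = (2 * real (Suc m)) * (real (2 * m + 1) * fact (2 * m))" by simp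
      have n: "norm x ^ (2 * Suc m) = (norm x)\<^sup>2 * norm x ^ (2 * m)" by (simp add: power_add[symmetric])
      have g: "fact (Suc m) = real (Suc m) * fact m" by simp
      define A where "A = real (Suc m)"
      have A: "A \<noteq> 0" unfolding A_def by simp
      show ?thesis unfolding f n g power_Suc[of 2 m] A_def[symmetric] using A by (simp add: field_simps)
    qed
    finally show ?case .
  qed
  then show "(LBINT k. (k \<bullet> x) ^ (2 * m) * exp (- (norm k)\<^sup>2 / 2))
      = norm x ^ (2 * m) * fact (2 * m) / (2 ^ m * fact m) * (2 * pi) powr (real CARD('d) / 2)"
    unfolding c integral_complex_of_real of_real_eq_iff .
qed

text \<open>The coefficients of \<open>J\<^sub>\<nu>(z) / z\<^sup>\<nu>\<close> for \<open>\<nu> = d/2 - 1\<close> in powers of \<open>- z\<^sup>2\<close>.\<close>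

definition bessel_coeff :: "nat \<Rightarrow> nat \<Rightarrow> real" where
  "bessel_coeff d m = 1 / (fact m * 2 powr (2 * real m + real d / 2 - 1) * Gamma (real m + real d / 2))"

lemma bessel_coeff_pos: "d > 0 \<Longrightarrow> bessel_coeff d m > 0"
  unfolding bessel_coeff_def by (intro divide_pos_pos mult_pos_pos Gamma_real_pos) auto

text \<open>Both the Gaussian and the ball see the same homogeneous function, so in polar coordinates their even moments
differ by a one-dimensional factor only: the ball moment is read off from the Gaussian one.\<close>

lemma ball_even_moment:
  fixes x :: "real^'d::finite"
  assumes R: "R > 0"
  shows "integrable lborel (\<lambda>k. indicator (cball 0 R) k * (k \<bullet> x) ^ (2 * m))"
    "(LBINT k. indicator (cball 0 R) k * (k \<bullet> x) ^ (2 * m))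
      = norm x ^ (2 * m) * fact (2 * m) * (2 * pi) powr (real CARD('d) / 2) * bessel_coeff CARD('d) m * R ^ (CARD('d) + 2 * m) / real (CARD('d) + 2 * m)"
proof -
  let ?d = "CARD('d)"
  let ?p = "\<lambda>k. (k \<bullet> x) ^ (2 * m)"
  let ?n = "?d + 2 * m"
  have d: "?d > 0" by simp
  have n: "?n > 0" using d by linarith
  have p0: "?p k \<ge> 0" for k :: "real^'d" by simp
  have pm[measurable]: "?p \<in> borel_measurable borel" by measurable
  have Bm[measurable]: "cball (0::real^'d) r \<in> sets borel" for r by simp
  have ib: "integrable lborel (\<lambda>k. indicator (cball 0 r) k * ?p k)" for r
  proof (rule Bochner_Integration.integrable_bound)
    have "integrable lborel (\<lambda>k::real^'d. indicator (cball 0 r) k :: real)"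
      by (rule integrable_real_indicator) (use emeasure_lborel_cball_finite[of "0::real^'d" r] in auto)
    then show "integrable lborel (\<lambda>k::real^'d. (r * norm x) ^ (2 * m) * indicator (cball 0 r) k)" by (rule integrable_mult_right)
    show "AE k in lborel. norm (indicator (cball 0 r) k * ?p k) \<le> norm ((r * norm x) ^ (2 * m) * indicator (cball 0 r) k)"
    proof (rule AE_I2)
      fix k :: "real^'d"
      show "norm (indicator (cball 0 r) k * ?p k) \<le> norm ((r * norm x) ^ (2 * m) * indicator (cball 0 r) k)"
      proof (cases "k \<in> cball 0 r")
        case True
        have "\<bar>k \<bullet> x\<bar> \<le> norm k * norm x" by (rule Cauchy_Schwarz_ineq2)
        also have "\<dots> \<le> r * norm x" using True by (intro mult_right_mono) auto
        finally have "\<bar>k \<bullet> x\<bar> ^ (2 * m) \<le> (r * norm x) ^ (2 * m)" by (intro power_mono) auto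
        then show ?thesis using True by (simp add: power_even_abs)
      qed simp
    qed
  qed measurable
  then show "integrable lborel (\<lambda>k. indicator (cball 0 R) k * ?p k)" by blast
  define E where "E = (LBINT k. indicator (cball 0 1) k * ?p k)"
  have E0: "E \<ge> 0" unfolding E_def by (intro integral_nonneg_AE) auto
  define C where "C = E * real ?n"
  have C0: "C \<ge> 0" using E0 by (simp add: C_def)
  have nnb: "(\<integral>\<^sup>+k. ennreal (?p k) * indicator (cball 0 r) k \<partial>lborel) = ennreal (LBINT k. indicator (cball 0 r) k * ?p k)" for r
  proof -
    have "(\<integral>\<^sup>+k. ennreal (?p k) * indicator (cball 0 r) k \<partial>lborel) = (\<integral>\<^sup>+k. ennreal (indicator (cball 0 r) k * ?p k) \<partial>lborel)"
      by (intro nn_integral_cong) (auto simp: indicator_def)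
    then show ?thesis using nn_integral_eq_integral[OF ib[of r]] by simp
  qed
  have vol: "(\<integral>\<^sup>+k. ennreal (?p k) * indicator (cball 0 1) k \<partial>lborel) = ennreal (C / real (DIM(real^'d) + 2 * m))"
  proof -
    have "real ?n \<noteq> 0" using n unfolding of_nat_eq_0_iff by linarith
    moreover have "DIM(real^'d) = ?d" by simp
    ultimately have "C / real (DIM(real^'d) + 2 * m) = E" unfolding C_def by (metis nonzero_mult_div_cancel_right)
    then show ?thesis unfolding nnb E_def by simp
  qed
  have W0: "2 powr (real ?n / 2 - 1) * Gamma (real ?n / 2) \<ge> 0"
    by (intro mult_nonneg_nonneg Gamma_real_nonneg divide_nonneg_nonneg) (auto simp del: of_nat_add)
  have polar: "(\<integral>\<^sup>+k. ennreal (?p k) * h (norm k) \<partial>lborel) = (\<integral>\<^sup>+\<rho>. ennreal (C * \<rho> ^ (?n - 1)) * indicator {0<..} \<rho> * h \<rho> \<partial>lborel)"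
    if [measurable]: "h \<in> borel_measurable borel" for h
    using nn_integral_homogeneous_radial[OF pm p0 _ C0 vol that] by (simp add: power_mult_distrib)
  have "ennreal (norm x ^ (2 * m) * fact (2 * m) / (2 ^ m * fact m) * (2 * pi) powr (real ?d / 2)) = (\<integral>\<^sup>+k. ennreal (?p k * exp (- (norm k)\<^sup>2 / 2)) \<partial>lborel)"
    unfolding gauss_even_moment(2)[symmetric]
    by (rule nn_integral_eq_integral[OF gauss_even_moment(1), symmetric]) auto
  also have "\<dots> = (\<integral>\<^sup>+k. ennreal (?p k) * ennreal (exp (- (norm k)\<^sup>2 / 2)) \<partial>lborel)"
    by (simp add: ennreal_mult)
  also have "\<dots> = (\<integral>\<^sup>+\<rho>. ennreal (C * \<rho> ^ (?n - 1)) * indicator {0<..} \<rho> * ennreal (exp (- \<rho>\<^sup>2 / 2)) \<partial>lborel)"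
    using polar[of "\<lambda>\<rho>. ennreal (exp (- \<rho>\<^sup>2 / 2))"] by simp
  also have "\<dots> = (\<integral>\<^sup>+\<rho>. ennreal C * (ennreal (\<rho> ^ (?n - 1)) * indicator {0<..} \<rho> * ennreal (exp (- \<rho>\<^sup>2 / 2))) \<partial>lborel)"
    using C0 by (intro nn_integral_cong) (auto simp: ennreal_mult mult_ac indicator_def)
  also have "\<dots> = ennreal C * ennreal (2 powr (real ?n / 2 - 1) * Gamma (real ?n / 2))"
    by (subst nn_integral_cmult, simp, subst nn_integral_gauss_moment[OF n]) auto
  also have "\<dots> = ennreal (C * (2 powr (real ?n / 2 - 1) * Gamma (real ?n / 2)))"
    using C0 W0 by (intro ennreal_mult[symmetric])
  finally have eqC: "norm x ^ (2 * m) * fact (2 * m) / (2 ^ m * fact m) * (2 * pi) powr (real ?d / 2) = C * (2 powr (real ?n / 2 - 1) * Gamma (real ?n / 2))"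
    using mult_nonneg_nonneg[OF C0 W0] by (subst (asm) ennreal_inj) auto
  have G: "Gamma (real m + real ?d / 2) > 0" by (intro Gamma_real_pos) (simp add: add_nonneg_pos)
  have h: "real ?n / 2 = real m + real ?d / 2" by simp
  have pw: "2 powr (real m + real ?d / 2 - 1) * 2 ^ m = 2 powr (2 * real m + real ?d / 2 - 1)"
    unfolding powr_realpow[symmetric, of 2 m, simplified] powr_add[symmetric] by (simp add: add_diff_eq)
  have Ceq: "C = norm x ^ (2 * m) * fact (2 * m) * (2 * pi) powr (real ?d / 2) * bessel_coeff ?d m"
  proof -
    have "C * (2 powr (real m + real ?d / 2 - 1) * Gamma (real m + real ?d / 2)) * (2 ^ m * fact m) = norm x ^ (2 * m) * fact (2 * m) * (2 * pi) powr (real ?d / 2)"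
      using eqC unfolding h by (simp add: field_simps)
    then have "C * (fact m * 2 powr (2 * real m + real ?d / 2 - 1) * Gamma (real m + real ?d / 2)) = norm x ^ (2 * m) * fact (2 * m) * (2 * pi) powr (real ?d / 2)"
      unfolding pw[symmetric] by (simp only: mult_ac)
    then show ?thesis unfolding bessel_coeff_def using G by (simp add: field_simps)
  qed
  have "ennreal (LBINT k. indicator (cball 0 R) k * ?p k) = (\<integral>\<^sup>+k. ennreal (?p k) * indicator {..R} (norm k) \<partial>lborel)"
    unfolding nnb[symmetric] by (intro nn_integral_cong) (auto simp: indicator_def)
  also have "\<dots> = (\<integral>\<^sup>+\<rho>. ennreal (C * \<rho> ^ (?n - 1)) * indicator {0<..} \<rho> * indicator {..R} \<rho> \<partial>lborel)"
    by (rule polar) simp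
  also have "\<dots> = emeasure (density lborel (\<lambda>\<rho>. ennreal (C * \<rho> ^ (?n - 1)) * indicator {0<..} \<rho>)) {..R}"
    by (subst emeasure_density) auto
  also have "\<dots> = ennreal (C / real ?n * R ^ ?n)" by (rule emeasure_density_power_atMost[OF C0 R n])
  finally have "(LBINT k. indicator (cball 0 R) k * ?p k) = C / real ?n * R ^ ?n"
    using C0 R by (subst (asm) ennreal_inj) (auto intro!: integral_nonneg_AE)
  then show "(LBINT k. indicator (cball 0 R) k * ?p k)
      = norm x ^ (2 * m) * fact (2 * m) * (2 * pi) powr (real ?d / 2) * bessel_coeff ?d m * R ^ ?n / real ?n"
    unfolding Ceq by simp
qed

text \<open>The entire function \<open>J\<^sub>\<nu>(z) / z\<^sup>\<nu>\<close> with \<open>\<nu> = d/2 - 1\<close>, defined also at \<open>z = 0\<close>.\<close>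

definition bessel_kernel :: "nat \<Rightarrow> real \<Rightarrow> real" where
  "bessel_kernel d z = (\<Sum>m. (- 1) ^ m * bessel_coeff d m * (z\<^sup>2) ^ m)"

lemma bessel_summable:
  assumes d: "d > 0" shows "summable (\<lambda>m. (- 1) ^ m * bessel_coeff d m * s ^ m)"
proof (rule summable_comparison_test)
  show "\<exists>N. \<forall>m\<ge>N. norm ((- 1) ^ m * bessel_coeff d m * s ^ m) \<le> bessel_coeff d 0 * (2 / real d) ^ m * (inverse (fact m) * \<bar>s\<bar> ^ m)"
  proof (intro exI allI impI)
    fix m
    have "bessel_coeff d m \<le> bessel_coeff d 0 * (2 / real d) ^ m * inverse (fact m)"
    proof (induction m)
      case (Suc m)
      have G: "Gamma (real m + real d / 2) > 0" using d by (intro Gamma_real_pos) (simp add: add_nonneg_pos)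
      have g: "Gamma (real (Suc m) + real d / 2) = (real m + real d / 2) * Gamma (real m + real d / 2)"
      proof -
        have "Gamma ((real m + real d / 2) + 1) = (real m + real d / 2) * Gamma (real m + real d / 2)"
          by (rule Gamma_plus1) (use d in \<open>auto dest!: nonpos_Ints_nonpos\<close>)
        then show ?thesis by (simp add: algebra_simps)
      qed
      have p: "2 powr (2 * real (Suc m) + real d / 2 - 1) = 4 * 2 powr (2 * real m + real d / 2 - 1)"
      proof -
        have "2 * real (Suc m) + real d / 2 - 1 = 2 + (2 * real m + real d / 2 - 1)" by simp
        then show ?thesis by (simp only: powr_add) simp
      qed
      have pos: "real m + real d / 2 > 0" using d by (simp add: add_nonneg_pos)
      have "bessel_coeff d (Suc m) = bessel_coeff d m * (1 / (4 * real (Suc m) * (real m + real d / 2)))"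
        unfolding bessel_coeff_def g p by (simp add: mult_ac)
      also have "\<dots> \<le> bessel_coeff d m * (2 / real d * inverse (real (Suc m)))"
      proof (intro mult_left_mono)
        have "1 / (4 * real (Suc m) * (real m + real d / 2)) \<le> 1 / (real (Suc m) * (real d / 2))"
        proof (intro divide_left_mono mult_mono)
          show "0 < 4 * real (Suc m) * (real m + real d / 2) * (real (Suc m) * (real d / 2))"
            using pos d by (intro mult_pos_pos) auto
        qed (use d in auto)
        also have "\<dots> = 2 / real d * inverse (real (Suc m))" by (simp add: field_simps)
        finally show "1 / (4 * real (Suc m) * (real m + real d / 2)) \<le> 2 / real d * inverse (real (Suc m))" .
      qed (use bessel_coeff_pos[OF d] in \<open>simp add: less_imp_le\<close>)
      also have "\<dots> \<le> (bessel_coeff d 0 * (2 / real d) ^ m * inverse (fact m)) * (2 / real d * inverse (real (Suc m)))"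
        by (rule mult_right_mono[OF Suc]) simp
      also have "\<dots> = bessel_coeff d 0 * (2 / real d) ^ Suc m * inverse (fact (Suc m))"
        by (simp add: mult_ac)
      finally show ?case .
    qed simp
    then have "bessel_coeff d m * \<bar>s\<bar> ^ m \<le> (bessel_coeff d 0 * (2 / real d) ^ m * inverse (fact m)) * \<bar>s\<bar> ^ m"
      by (rule mult_right_mono) simp
    then show "norm ((- 1) ^ m * bessel_coeff d m * s ^ m) \<le> bessel_coeff d 0 * (2 / real d) ^ m * (inverse (fact m) * \<bar>s\<bar> ^ m)"
      using bessel_coeff_pos[OF d, of m] by (simp add: norm_mult norm_power abs_mult mult.assoc power_abs)
  qed
  have "summable (\<lambda>m. bessel_coeff d 0 * (inverse (fact m) * (2 / real d * \<bar>s\<bar>) ^ m))"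
    by (intro summable_mult summable_exp)
  then show "summable (\<lambda>m. bessel_coeff d 0 * (2 / real d) ^ m * (inverse (fact m) * \<bar>s\<bar> ^ m))"
    by (simp only: power_mult_distrib mult.assoc mult.left_commute mult.commute)
qed

lemma bessel_J_kernel:
  assumes d: "d > 0" and z: "z > 0"
  shows "bessel_J (real d / 2 - 1) z / z powr (real d / 2 - 1) = bessel_kernel d z"
proof -
  let ?\<nu> = "real d / 2 - 1"
  have t: "(- 1) ^ m / fact m * rGamma (real m + ?\<nu> + 1) * (z / 2) powr (2 * real m + ?\<nu>) = z powr ?\<nu> * ((- 1) ^ m * bessel_coeff d m * (z\<^sup>2) ^ m)" for m
  proof -
    have "real m + ?\<nu> + 1 = real m + real d / 2" by simp
    then have 1: "rGamma (real m + ?\<nu> + 1) = 1 / Gamma (real m + real d / 2)"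
      by (simp add: rGamma_inverse_Gamma inverse_eq_divide)
    have "(z / 2) powr (2 * real m + ?\<nu>) = z powr (2 * real m + ?\<nu>) / 2 powr (2 * real m + ?\<nu>)"
      using z by (simp add: powr_divide)
    also have "z powr (2 * real m + ?\<nu>) = z powr real (2 * m) * z powr ?\<nu>" by (simp add: powr_add)
    also have "z powr real (2 * m) = (z\<^sup>2) ^ m" using z by (simp only: powr_realpow power_mult)
    finally have 2: "(z / 2) powr (2 * real m + ?\<nu>) = (z\<^sup>2) ^ m * z powr ?\<nu> / 2 powr (2 * real m + real d / 2 - 1)" by (simp only: add_diff_eq)
    show ?thesis unfolding 1 2 bessel_coeff_def by (simp only: times_divide_eq_right times_divide_eq_left divide_divide_eq_left mult.assoc mult.left_commute mult.commute mult_1_left mult_1_right)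
  qed
  have "bessel_J ?\<nu> z = z powr ?\<nu> * bessel_kernel d z"
    unfolding bessel_J_def t bessel_kernel_def by (rule suminf_mult[OF bessel_summable[OF d]])
  then show ?thesis using z by simp
qed

lemma bessel_kernel_measurable [measurable]: "bessel_kernel d \<in> borel_measurable borel"
  unfolding bessel_kernel_def by measurable

text \<open>Integrate the cosine series term by term over the ball; the resulting power series in \<open>R\<close> can be
differentiated, which yields the spherical mean without integrating over a sphere.\<close>

lemma ball_cos_integral:
  fixes x :: "real^'d::finite"
  shows "\<exists>F. F 0 = 0 \<and> (\<forall>R>0. F R = (LBINT k. indicator (cball 0 R) k * cos (k \<bullet> x))) \<and>
    (\<forall>R. (F has_real_derivative ((2 * pi) powr (real CARD('d) / 2) * (R ^ (CARD('d) - 1) * bessel_kernel CARD('d) (norm x * R)))) (at R))"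
proof -
  let ?d = "CARD('d)"
  let ?c = "(2 * pi) powr (real ?d / 2)"
  have d: "?d > 0" by simp
  define a where "a m = (- 1) ^ m * bessel_coeff ?d m * ((norm x)\<^sup>2) ^ m" for m
  define h where "h m = a m / real (?d + 2 * m)" for m
  have asum: "summable (\<lambda>m. a m * s ^ m)" for s
    using bessel_summable[OF d, of "(norm x)\<^sup>2 * s"] by (simp add: a_def power_mult_distrib mult_ac)
  have asum': "summable (\<lambda>m. norm (a m * s ^ m))" for s
    by (rule powser_insidea[OF asum[of "\<bar>s\<bar> + 1"]]) simp
  have hle: "norm (h m * s ^ m) \<le> norm (a m * s ^ m)" for m s
  proof -
    have "1 \<le> real (?d + 2 * m)" using d unfolding real_of_nat_ge_one_iff by linarith
    then have "\<bar>a m\<bar> / real (?d + 2 * m) \<le> \<bar>a m\<bar> / 1" by (intro frac_le) auto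
    then have "\<bar>h m\<bar> \<le> \<bar>a m\<bar>" by (simp add: h_def)
    then show ?thesis by (simp add: norm_mult mult_right_mono abs_mult)
  qed
  have hsum': "summable (\<lambda>m. norm (h m * s ^ m))" for s
    by (rule summable_comparison_test[OF _ asum'[of s]]) (use hle in auto)
  have hsum: "summable (\<lambda>m. h m * s ^ m)" for s by (rule summable_norm_cancel[OF hsum'])
  define H where "H s = (\<Sum>m. h m * s ^ m)" for s
  define H' where "H' s = (\<Sum>m. diffs h m * s ^ m)" for s
  have HD: "(H has_real_derivative H' s) (at s)" for s
    unfolding H_def[abs_def] H'_def by (rule termdiffs_strong_converges_everywhere[OF hsum])
  \<comment> \<open>This differential equation expresses the division by \<open>d + 2 m\<close> in \<open>h\<close>.\<close>
  have Heq: "real ?d * H s + 2 * (s * H' s) = (\<Sum>m. a m * s ^ m)" for s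
  proof -
    have "(\<lambda>m. of_nat m * h m * s ^ (m - Suc 0)) sums H' s"
      unfolding H'_def by (rule diffs_equiv[OF termdiff_converges_all[OF hsum]])
    then have "(\<lambda>m. s * (of_nat m * h m * s ^ (m - Suc 0))) sums (s * H' s)" by (rule sums_mult)
    moreover have "s * (of_nat m * h m * s ^ (m - Suc 0)) = real m * (h m * s ^ m)" for m
      by (cases m) auto
    ultimately have s1: "(\<lambda>m. real m * (h m * s ^ m)) sums (s * H' s)" by simp
    have s2: "(\<lambda>m. h m * s ^ m) sums H s" unfolding H_def by (rule summable_sums[OF hsum])
    have "(\<lambda>m. real ?d * (h m * s ^ m) + 2 * (real m * (h m * s ^ m))) sums (real ?d * H s + 2 * (s * H' s))"
      by (intro sums_add sums_mult s1 s2)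
    moreover have "real ?d * (h m * s ^ m) + 2 * (real m * (h m * s ^ m)) = a m * s ^ m" for m
    proof -
      have "real ?d * (h m * s ^ m) + 2 * (real m * (h m * s ^ m)) = (real (?d + 2 * m) * h m) * s ^ m" by (simp add: algebra_simps)
      moreover have "real (?d + 2 * m) * h m = a m"
      proof -
        have "real (?d + 2 * m) \<noteq> 0" using d unfolding of_nat_eq_0_iff by linarith
        then show ?thesis unfolding h_def by (metis nonzero_mult_div_cancel_left times_divide_eq_right)
      qed
      ultimately show ?thesis by simp
    qed
    ultimately show ?thesis by (simp add: sums_iff)
  qed
  have kern: "(\<Sum>m. a m * (R\<^sup>2) ^ m) = bessel_kernel ?d (norm x * R)" for R
    by (simp add: bessel_kernel_def a_def power_mult_distrib mult_ac)
  define F where "F R = ?c * (R ^ ?d * H (R\<^sup>2))" for R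
  have D: "(F has_real_derivative (?c * (R ^ (?d - 1) * bessel_kernel ?d (norm x * R)))) (at R)" for R
  proof -
    have "((\<lambda>R. H (R\<^sup>2)) has_real_derivative (H' (R\<^sup>2) * (2 * R))) (at R)"
      by (rule DERIV_chain2[OF HD]) (auto intro!: derivative_eq_intros)
    then have "((\<lambda>R. ?c * (R ^ ?d * H (R\<^sup>2))) has_real_derivative (?c * (R ^ ?d * (H' (R\<^sup>2) * (2 * R)) + (real ?d * R ^ (?d - 1)) * H (R\<^sup>2)))) (at R)"
      by (auto intro!: derivative_eq_intros)
    moreover have "R ^ ?d * (H' (R\<^sup>2) * (2 * R)) + (real ?d * R ^ (?d - 1)) * H (R\<^sup>2) = R ^ (?d - 1) * bessel_kernel ?d (norm x * R)"
    proof -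
      have "R ^ ?d = R ^ (?d - 1) * R" using d by (metis power_minus_mult)
      then have "R ^ ?d * (H' (R\<^sup>2) * (2 * R)) + (real ?d * R ^ (?d - 1)) * H (R\<^sup>2) = R ^ (?d - 1) * (real ?d * H (R\<^sup>2) + 2 * (R\<^sup>2 * H' (R\<^sup>2)))"
        by (simp add: algebra_simps power2_eq_square)
      then show ?thesis unfolding Heq kern .
    qed
    ultimately show ?thesis unfolding F_def[abs_def] by simp
  qed
  have I: "F R = (LBINT k. indicator (cball 0 R) k * cos (k \<bullet> x))" if R: "R > 0" for R
  proof -
    define f where "f m k = indicator (cball 0 R) k * ((- 1) ^ m / fact (2 * m) * (k \<bullet> x) ^ (2 * m))" for m and k :: "real^'d"
    have fe: "f m = (\<lambda>k. ((- 1) ^ m / fact (2 * m)) * (indicator (cball 0 R) k * (k \<bullet> x) ^ (2 * m)))" for m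
      by (auto simp: f_def)
    have fi: "integrable lborel (f m)" for m
      unfolding fe by (intro integrable_mult_right ball_even_moment(1) R)
    have cancel: "(s / F) * (X * F * C * b * (P * Q) / N) = C * P * (s * b * X / N * Q)" if "F \<noteq> 0" for s F X C b P Q N :: real
      using that by simp
    have fin: "(LBINT k. norm (f m k)) = ?c * R ^ ?d * norm (h m * (R\<^sup>2) ^ m)" for m
    proof -
      have "norm (f m k) = (1 / fact (2 * m)) * (indicator (cball 0 R) k * (k \<bullet> x) ^ (2 * m))" for k
        by (simp add: f_def abs_mult power_even_abs)
      then have "(LBINT k. norm (f m k)) = (1 / fact (2 * m)) * (norm x ^ (2 * m) * fact (2 * m) * ?c * bessel_coeff ?d m * R ^ (?d + 2 * m) / real (?d + 2 * m))"
        by (simp only: integral_mult_right_zero ball_even_moment(2)[OF R])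
      also have "\<dots> = ?c * R ^ ?d * (bessel_coeff ?d m * ((norm x)\<^sup>2) ^ m / real (?d + 2 * m) * (R\<^sup>2) ^ m)"
        unfolding power_add power_mult[of "norm x" 2 m] power_mult[of R 2 m] by (subst cancel) simp_all
      also have "bessel_coeff ?d m * ((norm x)\<^sup>2) ^ m / real (?d + 2 * m) * (R\<^sup>2) ^ m = norm (h m * (R\<^sup>2) ^ m)"
        using bessel_coeff_pos[OF d, of m] by (simp add: h_def a_def abs_mult)
      finally show ?thesis .
    qed
    have fiv: "(LBINT k. f m k) = ?c * R ^ ?d * (h m * (R\<^sup>2) ^ m)" for m
    proof -
      have "(LBINT k. f m k) = ((- 1) ^ m / fact (2 * m)) * (norm x ^ (2 * m) * fact (2 * m) * ?c * bessel_coeff ?d m * R ^ (?d + 2 * m) / real (?d + 2 * m))"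
        unfolding fe by (simp only: integral_mult_right_zero ball_even_moment(2)[OF R])
      also have "\<dots> = ?c * R ^ ?d * (h m * (R\<^sup>2) ^ m)"
        unfolding h_def a_def power_add power_mult[of "norm x" 2 m] power_mult[of R 2 m] by (rule cancel) simp
      finally show ?thesis .
    qed
    have cs: "(\<lambda>m. f m k) sums (indicator (cball 0 R) k * cos (k \<bullet> x))" for k
      unfolding f_def by (intro sums_mult cos_paired)
    have "(LBINT k. (\<Sum>m. f m k)) = (\<Sum>m. \<integral>k. f m k \<partial>lborel)"
    proof (rule integral_suminf[OF fi])
      show "AE k in lborel. summable (\<lambda>m. norm (f m k))"
      proof (rule AE_I2, rule summable_comparison_test)
        fix k :: "real^'d"
        show "summable (\<lambda>m. inverse (fact m) * ((k \<bullet> x)\<^sup>2) ^ m)" by (rule summable_exp)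
        show "\<exists>N. \<forall>m\<ge>N. norm (norm (f m k)) \<le> inverse (fact m) * ((k \<bullet> x)\<^sup>2) ^ m"
        proof (intro exI allI impI)
          fix m
          have "norm (norm (f m k)) \<le> inverse (fact (2 * m)) * ((k \<bullet> x)\<^sup>2) ^ m"
            unfolding power_mult[of "k \<bullet> x" 2 m, symmetric] by (simp add: f_def abs_mult power_even_abs divide_inverse indicator_def)
          also have "\<dots> \<le> inverse (fact m) * ((k \<bullet> x)\<^sup>2) ^ m"
            by (intro mult_right_mono le_imp_inverse_le fact_mono) auto
          finally show "norm (norm (f m k)) \<le> inverse (fact m) * ((k \<bullet> x)\<^sup>2) ^ m" .
        qed
      qed
      show "summable (\<lambda>m. \<integral>k. norm (f m k) \<partial>lborel)" unfolding fin by (intro summable_mult hsum')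
    qed
    also have "(\<lambda>k. \<Sum>m. f m k) = (\<lambda>k. indicator (cball 0 R) k * cos (k \<bullet> x))"
      using cs by (simp add: sums_iff)
    also have "(\<Sum>m. \<integral>k. f m k \<partial>lborel) = ?c * R ^ ?d * H (R\<^sup>2)"
      unfolding fiv H_def by (rule suminf_mult[OF hsum])
    finally show ?thesis by (simp add: F_def)
  qed
  have "F 0 = 0" using d by (simp add: F_def power_0_left)
  then show ?thesis using I D by (intro exI[of _ F]) auto
qed

lemma bessel_kernel_0: "bessel_kernel d 0 = bessel_coeff d 0"
  unfolding bessel_kernel_def using powser_zero[of "\<lambda>m. (- 1) ^ m * bessel_coeff d m"] by simp

text \<open>The spherical mean of \<open>cos (k \<bullet> x)\<close> is a multiple of the Bessel kernel. The oscillating density is replaced by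
the nonnegative density \<open>1 + cos (k \<bullet> x)\<close>, to which the comparison of measures on initial segments applies, and
the contribution of the constant is subtracted at the end.\<close>

lemma radial_cos_integral:
  fixes x :: "real^'d::finite" and h :: "real \<Rightarrow> real"
  assumes h[measurable]: "h \<in> borel_measurable borel" and h0: "\<And>\<rho>. h \<rho> \<ge> 0"
    and hi: "integrable lborel (\<lambda>k::real^'d. h (norm k))"
  shows "(LBINT k. cos (k \<bullet> x) * h (norm k))
    = (2 * pi) powr (real CARD('d) / 2) * (\<integral>\<rho>. indicator {0<..} \<rho> * (\<rho> ^ (CARD('d) - 1) * bessel_kernel CARD('d) (norm x * \<rho>) * h \<rho>) \<partial>lborel)"
proof -
  let ?d = "CARD('d)"
  let ?c = "(2 * pi) powr (real ?d / 2)"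
  let ?A = "sphere_area ?d"
  have d: "?d > 0" by simp
  have A: "?A > 0" by (rule sphere_area_pos[OF d])
  have Bm[measurable]: "cball (0::real^'d) r \<in> sets borel" for r by simp
  obtain F where F0: "F 0 = 0" and FI: "\<And>R. R > 0 \<Longrightarrow> F R = (LBINT k. indicator (cball 0 R) k * cos (k \<bullet> x))"
    and FD: "\<And>R. (F has_real_derivative (?c * (R ^ (?d - 1) * bessel_kernel ?d (norm x * R)))) (at R)"
    using ball_cos_integral[of x] by blast
  define V where "V R = ?A / real ?d * R ^ ?d" for R :: real
  have VD: "(V has_real_derivative (?A * R ^ (?d - 1))) (at R)" for R
    unfolding V_def using d by (auto intro!: derivative_eq_intros)
  have indi: "integrable lborel (\<lambda>k::real^'d. indicator (cball 0 r) k :: real)" for r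
    by (rule integrable_real_indicator) (use emeasure_lborel_cball_finite[of "0::real^'d" r] in auto)
  have cosi: "integrable lborel (\<lambda>k::real^'d. indicator (cball 0 r) k * cos (k \<bullet> x))" for r
    by (rule Bochner_Integration.integrable_bound[OF indi[of r]]) (auto simp: indicator_def)
  have VI: "V R = (LBINT k. indicator (cball (0::real^'d) R) k)" if R: "R > 0" for R
  proof -
    have "ennreal (LBINT k. indicator (cball (0::real^'d) R) k) = (\<integral>\<^sup>+k. ennreal (indicator (cball (0::real^'d) R) k) \<partial>lborel)"
      by (rule nn_integral_eq_integral[OF indi, symmetric]) auto
    also have "\<dots> = (\<integral>\<^sup>+(k::real^'d). indicator {..R} (norm k) \<partial>lborel)" by (intro nn_integral_cong) (auto simp: indicator_def)
    also have "\<dots> = (\<integral>\<^sup>+\<rho>. ennreal (?A * \<rho> ^ (?d - 1)) * indicator {0<..} \<rho> * indicator {..R} \<rho> \<partial>lborel)"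
      using nn_integral_radial[of "indicator {..R}", where 'a="real^'d"] by simp
    also have "\<dots> = emeasure (density lborel (\<lambda>\<rho>. ennreal (?A * \<rho> ^ (?d - 1)) * indicator {0<..} \<rho>)) {..R}"
      by (subst emeasure_density) auto
    also have "\<dots> = ennreal (V R)" unfolding V_def by (rule emeasure_density_power_atMost) (use A R d in auto)
    finally show ?thesis using A R by (subst (asm) ennreal_inj) (auto simp: V_def intro!: integral_nonneg_AE)
  qed
  \<comment> \<open>For \<open>|\<sigma>| \<le> 1\<close> the integral of \<open>1 + \<sigma> cos (k \<bullet> x)\<close> over a ball increases with the radius; its derivative is therefore nonnegative.\<close>
  have deriv_nonneg: "?A * R ^ (?d - 1) + \<sigma> * (?c * (R ^ (?d - 1) * bessel_kernel ?d (norm x * R))) \<ge> 0"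
    if R: "R > 0" and s: "\<bar>\<sigma>\<bar> \<le> 1" for R \<sigma>
  proof (rule mono_on_imp_deriv_nonneg[where A="{0<..}"])
    show "((\<lambda>R. V R + \<sigma> * F R) has_real_derivative (?A * R ^ (?d - 1) + \<sigma> * (?c * (R ^ (?d - 1) * bessel_kernel ?d (norm x * R))))) (at R)"
      by (intro DERIV_add DERIV_cmult VD FD)
    show "mono_on {0<..} (\<lambda>R. V R + \<sigma> * F R)"
    proof (rule mono_onI)
      fix r t :: real assume rt: "r \<in> {0<..}" "t \<in> {0<..}" "r \<le> t"
      have e: "V r + \<sigma> * F r = (LBINT k. indicator (cball 0 r) k + \<sigma> * (indicator (cball 0 r) k * cos (k \<bullet> x)))" if "r > 0" for r
        using VI[OF that] FI[OF that] indi[of r] cosi[of r] by simp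
      have "(LBINT k. indicator (cball 0 r) k + \<sigma> * (indicator (cball 0 r) k * cos (k \<bullet> x)))
          \<le> (LBINT k. indicator (cball 0 t) k + \<sigma> * (indicator (cball 0 t) k * cos (k \<bullet> x)))"
      proof (rule Bochner_Integration.integral_mono)
        show "integrable lborel (\<lambda>k::real^'d. indicator (cball 0 r) k + \<sigma> * (indicator (cball 0 r) k * cos (k \<bullet> x)))" for r
          by (intro Bochner_Integration.integrable_add integrable_mult_right indi cosi)
        then show "integrable lborel (\<lambda>k::real^'d. indicator (cball 0 t) k + \<sigma> * (indicator (cball 0 t) k * cos (k \<bullet> x)))" .
        fix k :: "real^'d"
        have "\<bar>\<sigma> * cos (k \<bullet> x)\<bar> \<le> 1 * 1" unfolding abs_mult by (intro mult_mono s) auto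
        then have "0 \<le> 1 + \<sigma> * cos (k \<bullet> x)" by linarith
        then show "indicator (cball 0 r) k + \<sigma> * (indicator (cball 0 r) k * cos (k \<bullet> x)) \<le> indicator (cball 0 t) k + \<sigma> * (indicator (cball 0 t) k * cos (k \<bullet> x))"
          using rt by (auto simp: indicator_def)
      qed
      then show "V r + \<sigma> * F r \<le> V t + \<sigma> * F t" using e rt by simp
    qed
  qed (use R in \<open>auto simp: interior_open\<close>)
  define q where "q \<rho> = ?A * \<rho> ^ (?d - 1) + ?c * (\<rho> ^ (?d - 1) * bessel_kernel ?d (norm x * \<rho>))" for \<rho>
  have qm[measurable]: "q \<in> borel_measurable borel" unfolding q_def by measurable
  have q0: "q \<rho> \<ge> 0" if "\<rho> \<ge> 0" for \<rho>
  proof (cases "\<rho> = 0")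
    case True
    have "?c * bessel_coeff ?d 0 > 0" using bessel_coeff_pos[OF d, of 0] by (intro mult_pos_pos) auto
    then show ?thesis using A True by (cases "?d = 1") (auto simp: q_def bessel_kernel_0 power_0_left)
  next
    case False then show ?thesis using deriv_nonneg[of \<rho> 1] that by (simp add: q_def)
  qed
  define M where "M = distr (density lborel (\<lambda>k. ennreal (1 + cos (k \<bullet> x)))) borel (norm :: real^'d \<Rightarrow> real)"
  define N where "N = density lborel (\<lambda>\<rho>. ennreal (q \<rho>) * indicator {0<..} \<rho>)"
  have c0: "0 \<le> 1 + cos y" for y :: real using cos_ge_minus_one[of y] by linarith
  have eM: "emeasure M {..R} = (\<integral>\<^sup>+k. ennreal (1 + cos (k \<bullet> x)) * indicator (cball 0 R) k \<partial>lborel)" for R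
  proof -
    have "emeasure M {..R} = emeasure (density lborel (\<lambda>k. ennreal (1 + cos (k \<bullet> x)))) (norm -` {..R} \<inter> UNIV)"
      unfolding M_def by (subst emeasure_distr) auto
    also have "norm -` {..R} \<inter> UNIV = cball (0::real^'d) R" by auto
    finally show ?thesis by (subst (asm) emeasure_density) auto
  qed
  have eMR: "emeasure M {..R} = ennreal (V R + F R)" if R: "R > 0" for R
  proof -
    have "emeasure M {..R} = (\<integral>\<^sup>+k. ennreal (indicator (cball 0 R) k + indicator (cball 0 R) k * cos (k \<bullet> x)) \<partial>lborel)"
      unfolding eM by (intro nn_integral_cong) (auto simp: indicator_def)
    also have "\<dots> = ennreal (LBINT k. indicator (cball 0 R) k + indicator (cball 0 R) k * cos (k \<bullet> x))"
      by (rule nn_integral_eq_integral) (use indi[of R] cosi[of R] c0 in \<open>auto simp: indicator_def\<close>)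
    finally show ?thesis using VI[OF R] FI[OF R] indi[of R] cosi[of R] by simp
  qed
  have "M = N"
  proof (rule measure_eq_if_atMost_eq)
    show "sets M = sets borel" "sets N = sets borel" by (auto simp: M_def N_def)
    have "(\<integral>\<^sup>+k. ennreal (1 + cos (k \<bullet> x)) * indicator (cball 0 0) k \<partial>lborel) = (\<integral>\<^sup>+(k::real^'d). 0 \<partial>lborel)"
      by (rule nn_integral_cong_AE, rule AE_I[where N="{0}"]) (auto simp: indicator_def split: if_splits)
    then show "emeasure M {..0} = 0" unfolding eM by simp
    show "emeasure N {..0} = 0"
      unfolding N_def by (subst emeasure_density) (auto simp: nn_integral_0_iff_AE indicator_def)
    show "emeasure M {..R} = emeasure N {..R}" if R: "R > 0" for R
    proof -
      have "emeasure N {..R} = (\<integral>\<^sup>+\<rho>. ennreal (q \<rho>) * indicator {0<..} \<rho> * indicator {..R} \<rho> \<partial>lborel)"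
        unfolding N_def by (subst emeasure_density) auto
      also have "\<dots> = (\<integral>\<^sup>+\<rho>. ennreal (q \<rho>) * indicator {0..R} \<rho> \<partial>lborel)"
        by (rule nn_integral_cong_AE, rule AE_I[where N="{0}"]) (auto simp: indicator_def split: if_splits)
      also have "\<dots> = ennreal ((V R + F R) - (V 0 + F 0))"
      proof (rule nn_integral_FTC_Icc)
        show "((\<lambda>R. V R + F R) has_real_derivative q \<rho>) (at \<rho>)" for \<rho>
          unfolding q_def by (intro DERIV_add VD FD)
      qed (use q0 R in auto)
      finally show ?thesis unfolding eMR[OF R] using d by (simp add: F0 V_def power_0_left)
    qed
    show "emeasure M {..R} < \<infinity>" if "R > 0" for R using eMR[OF that] by simp
  qed
  then have "(\<integral>\<^sup>+\<rho>. ennreal (h \<rho>) \<partial>M) = (\<integral>\<^sup>+\<rho>. ennreal (h \<rho>) \<partial>N)" by simp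
  then have MN: "(\<integral>\<^sup>+k. ennreal (1 + cos (k \<bullet> x)) * ennreal (h (norm k)) \<partial>lborel) = (\<integral>\<^sup>+\<rho>. ennreal (q \<rho>) * indicator {0<..} \<rho> * ennreal (h \<rho>) \<partial>lborel)"
    unfolding M_def N_def by (simp add: nn_integral_distr nn_integral_density)
  have i1: "integrable lborel (\<lambda>k. cos (k \<bullet> x) * h (norm k))"
  proof (rule Bochner_Integration.integrable_bound[OF hi])
    show "AE k in lborel. norm (cos (k \<bullet> x) * h (norm k)) \<le> norm (h (norm k))"
      using h0 by (intro AE_I2) (simp add: abs_mult mult_left_le_one_le)
  qed measurable
  have i2: "integrable lborel (\<lambda>k. (1 + cos (k \<bullet> x)) * h (norm k))"
    using Bochner_Integration.integrable_add[OF hi i1] by (simp add: distrib_right)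
  have nnI: "integrable lborel g \<and> (LBINT \<rho>. g \<rho>) = r" if "g \<in> borel_measurable borel" "\<And>\<rho>. g \<rho> \<ge> 0" "(\<integral>\<^sup>+\<rho>. ennreal (g \<rho>) \<partial>lborel) = ennreal r" "r \<ge> 0"
    for g :: "real \<Rightarrow> real" and r
  proof
    show "integrable lborel g" by (rule integrableI_nonneg) (use that in auto)
    show "(LBINT \<rho>. g \<rho>) = r" by (subst integral_eq_nn_integral) (use that in auto)
  qed
  define r1 where "r1 = (LBINT (k::real^'d). h (norm k))"
  define r2 where "r2 = (LBINT k. (1 + cos (k \<bullet> x)) * h (norm k))"
  define g1 where "g1 \<rho> = indicator {0<..} \<rho> * (?A * \<rho> ^ (?d - 1) * h \<rho>)" for \<rho>
  define g2 where "g2 \<rho> = indicator {0<..} \<rho> * (q \<rho> * h \<rho>)" for \<rho>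
  have G1: "integrable lborel g1 \<and> (LBINT \<rho>. g1 \<rho>) = r1"
  proof (rule nnI)
    show "g1 \<in> borel_measurable borel" unfolding g1_def by measurable
    show "g1 \<rho> \<ge> 0" for \<rho> using h0 A by (auto simp: g1_def indicator_def)
    have "(\<integral>\<^sup>+\<rho>. ennreal (g1 \<rho>) \<partial>lborel) = (\<integral>\<^sup>+\<rho>. ennreal (?A * \<rho> ^ (?d - 1)) * indicator {0<..} \<rho> * ennreal (h \<rho>) \<partial>lborel)"
      using h0 A by (intro nn_integral_cong) (auto simp: g1_def indicator_def ennreal_mult)
    also have "\<dots> = (\<integral>\<^sup>+(k::real^'d). ennreal (h (norm k)) \<partial>lborel)"
      using nn_integral_radial[of "\<lambda>\<rho>. ennreal (h \<rho>)", where 'a="real^'d"] by simp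
    also have "\<dots> = ennreal r1" unfolding r1_def by (rule nn_integral_eq_integral[OF hi]) (use h0 in auto)
    finally show "(\<integral>\<^sup>+\<rho>. ennreal (g1 \<rho>) \<partial>lborel) = ennreal r1" .
    show "r1 \<ge> 0" unfolding r1_def using h0 by (intro integral_nonneg_AE) auto
  qed
  have G2: "integrable lborel g2 \<and> (LBINT \<rho>. g2 \<rho>) = r2"
  proof (rule nnI)
    show "g2 \<in> borel_measurable borel" unfolding g2_def by measurable
    show "g2 \<rho> \<ge> 0" for \<rho> using h0 q0 by (auto simp: g2_def indicator_def)
    have "(\<integral>\<^sup>+\<rho>. ennreal (g2 \<rho>) \<partial>lborel) = (\<integral>\<^sup>+\<rho>. ennreal (q \<rho>) * indicator {0<..} \<rho> * ennreal (h \<rho>) \<partial>lborel)"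
      using h0 q0 by (intro nn_integral_cong) (auto simp: g2_def indicator_def ennreal_mult)
    also have "\<dots> = (\<integral>\<^sup>+k. ennreal ((1 + cos (k \<bullet> x)) * h (norm k)) \<partial>lborel)"
      unfolding MN[symmetric] using h0 c0 by (intro nn_integral_cong) (simp add: ennreal_mult)
    also have "\<dots> = ennreal r2" unfolding r2_def by (rule nn_integral_eq_integral[OF i2]) (use h0 c0 in auto)
    finally show "(\<integral>\<^sup>+\<rho>. ennreal (g2 \<rho>) \<partial>lborel) = ennreal r2" .
    show "r2 \<ge> 0" unfolding r2_def using h0 c0 by (intro integral_nonneg_AE) auto
  qed
  have "(LBINT k. cos (k \<bullet> x) * h (norm k)) = r2 - r1"
    unfolding r1_def r2_def using i1 hi by (simp add: distrib_right)
  also have "\<dots> = (LBINT \<rho>. g2 \<rho> - g1 \<rho>)" using G1 G2 by simp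
  also have "\<dots> = (\<integral>\<rho>. ?c * (indicator {0<..} \<rho> * (\<rho> ^ (?d - 1) * bessel_kernel ?d (norm x * \<rho>) * h \<rho>)) \<partial>lborel)"
    by (intro Bochner_Integration.integral_cong refl) (simp add: g1_def g2_def q_def algebra_simps)
  also have "\<dots> = ?c * (\<integral>\<rho>. indicator {0<..} \<rho> * (\<rho> ^ (?d - 1) * bessel_kernel ?d (norm x * \<rho>) * h \<rho>) \<partial>lborel)"
    by (rule integral_mult_right_zero)
  finally show ?thesis .
qed

lemma radial_weight_integral:
  assumes n: "0 < n" and j: "0 \<le> j" and c: "(2 * j + real CARD('d::finite)) / (2 * n) < q"
  shows "integrable lborel (\<lambda>k::real^'d. norm k powr (2 * j) / (1 + norm k powr (2 * n)) powr q)"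
    "(LBINT (k::real^'d). norm k powr (2 * j) / (1 + norm k powr (2 * n)) powr q)
      = sphere_area CARD('d) * (Gamma ((2 * j + real CARD('d)) / (2 * n)) * Gamma (q - (2 * j + real CARD('d)) / (2 * n)) / Gamma q / (2 * n))"
proof -
  let ?d = "CARD('d)"
  let ?c = "(2 * j + real ?d) / (2 * n)"
  let ?V = "Gamma ?c * Gamma (q - ?c) / Gamma q / (2 * n)"
  have d: "?d > 0" by simp
  have A: "sphere_area ?d > 0" by (rule sphere_area_pos[OF d])
  have c0: "?c > 0" using n j d by (intro divide_pos_pos add_nonneg_pos) auto
  have V: "?V \<ge> 0" using n c c0 by (intro divide_nonneg_nonneg mult_nonneg_nonneg Gamma_real_nonneg) auto
  have "(\<integral>\<^sup>+(k::real^'d). ennreal (norm k powr (2 * j) / (1 + norm k powr (2 * n)) powr q) \<partial>lborel)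
    = (\<integral>\<^sup>+\<rho>. ennreal (sphere_area ?d * \<rho> ^ (?d - 1)) * indicator {0<..} \<rho> * ennreal (\<rho> powr (2 * j) / (1 + \<rho> powr (2 * n)) powr q) \<partial>lborel)"
    using nn_integral_radial[of "\<lambda>\<rho>. ennreal (\<rho> powr (2 * j) / (1 + \<rho> powr (2 * n)) powr q)", where 'a="real^'d"] by simp
  also have "\<dots> = (\<integral>\<^sup>+\<rho>. ennreal (sphere_area ?d) * (indicator {0<..} \<rho> * ennreal (\<rho> powr ((2 * j + real ?d) - 1) / (1 + \<rho> powr (2 * n)) powr q)) \<partial>lborel)"
  proof (rule nn_integral_cong)
    fix \<rho> :: real
    show "ennreal (sphere_area ?d * \<rho> ^ (?d - 1)) * indicator {0<..} \<rho> * ennreal (\<rho> powr (2 * j) / (1 + \<rho> powr (2 * n)) powr q)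
      = ennreal (sphere_area ?d) * (indicator {0<..} \<rho> * ennreal (\<rho> powr ((2 * j + real ?d) - 1) / (1 + \<rho> powr (2 * n)) powr q))"
    proof (cases "\<rho> > 0")
      case True
      have "\<rho> ^ (?d - 1) * \<rho> powr (2 * j) = \<rho> powr ((2 * j + real ?d) - 1)"
        using True d by (simp add: powr_realpow[symmetric] powr_add[symmetric] of_nat_diff algebra_simps)
      then have "sphere_area ?d * \<rho> ^ (?d - 1) * (\<rho> powr (2 * j) / (1 + \<rho> powr (2 * n)) powr q)
          = sphere_area ?d * (\<rho> powr ((2 * j + real ?d) - 1) / (1 + \<rho> powr (2 * n)) powr q)"
        by (simp add: mult.assoc)
      then show ?thesis using True A by (simp add: ennreal_mult[symmetric])
    qed simp
  qed
  also have "\<dots> = ennreal (sphere_area ?d) * ennreal ?V"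
    by (subst nn_integral_cmult, measurable, subst nn_integral_beta_powr[OF _ c0 c]) (use n in auto)
  also have "\<dots> = ennreal (sphere_area ?d * ?V)" using A V by (intro ennreal_mult[symmetric]) auto
  finally have *: "(\<integral>\<^sup>+(k::real^'d). ennreal (norm k powr (2 * j) / (1 + norm k powr (2 * n)) powr q) \<partial>lborel) = ennreal (sphere_area ?d * ?V)" .
  show "integrable lborel (\<lambda>k::real^'d. norm k powr (2 * j) / (1 + norm k powr (2 * n)) powr q)"
    by (rule integrableI_nonneg) (use * in auto)
  show "(LBINT (k::real^'d). norm k powr (2 * j) / (1 + norm k powr (2 * n)) powr q) = sphere_area ?d * ?V"
  proof (subst integral_eq_nn_integral)
    show "enn2real (\<integral>\<^sup>+(k::real^'d). ennreal (norm k powr (2 * j) / (1 + norm k powr (2 * n)) powr q) \<partial>lborel) = sphere_area ?d * ?V"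
      unfolding * by (rule enn2real_ennreal[OF mult_nonneg_nonneg[OF less_imp_le[OF A] V]])
  qed auto
qed

definition gn_weight :: "real \<Rightarrow> real \<Rightarrow> real \<Rightarrow> real" where
  "gn_weight s n \<rho> = \<rho> powr s / (1 + \<rho> powr (2 * n))"

lemma gn_weight_measurable [measurable]: "gn_weight s n \<in> borel_measurable borel"
  unfolding gn_weight_def by measurable

lemma gn_weight_nonneg: "gn_weight s n \<rho> \<ge> 0"
  unfolding gn_weight_def by (intro divide_nonneg_nonneg add_nonneg_nonneg) auto

lemma gn_weight_integral:
  assumes n: "0 < n" and j: "0 \<le> j" and c: "(2 * j + real CARD('d::finite)) / (2 * n) < 1"
  shows "integrable lborel (\<lambda>k::real^'d. gn_weight (2 * j) n (norm k))"
    "(LBINT (k::real^'d). gn_weight (2 * j) n (norm k))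
       = sphere_area CARD('d) * pi / (2 * n * sin (pi * ((2 * j + real CARD('d)) / (2 * n))))"
proof -
  let ?c = "(2 * j + real CARD('d)) / (2 * n)"
  have c0: "?c > 0" using n j by (intro divide_pos_pos add_nonneg_pos) auto
  have e: "norm k powr (2 * j) / (1 + norm k powr (2 * n)) powr 1 = gn_weight (2 * j) n (norm k)" for k :: "real^'d"
    by (simp add: gn_weight_def add_nonneg_nonneg)
  show "integrable lborel (\<lambda>k::real^'d. gn_weight (2 * j) n (norm k))"
    using radial_weight_integral(1)[OF n j c] unfolding e .
  show "(LBINT (k::real^'d). gn_weight (2 * j) n (norm k)) = sphere_area CARD('d) * pi / (2 * n * sin (pi * ?c))"
    using radial_weight_integral(2)[OF n j c] unfolding e Gamma_reflection_real[OF c0 c] by (simp add: mult.commute)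
qed

text \<open>The definition of \<open>gn_L\<close> is the radial form of an inverse Fourier transform. The sine part vanishes by symmetry; at
the origin the value is a Beta integral, evaluated by the reflection formula for Gamma.\<close>

lemma gn_L_eq_fourier:
  fixes x :: "real^'d::finite"
  assumes n: "0 < n" and j: "0 \<le> j" and c: "(2 * j + real CARD('d)) / (2 * n) < 1"
  shows "fourier (\<lambda>k. cplx (gn_weight (2 * j) n (norm k))) (- x) = cplx (gn_L CARD('d) j n (norm x))"
proof -
  let ?d = "CARD('d)"
  let ?c = "(2 * pi) powr (real ?d / 2)"
  let ?h = "gn_weight (2 * j) n"
  have d: "?d > 0" by simp
  have hi: "integrable lborel (\<lambda>k::real^'d. ?h (norm k))" by (rule gn_weight_integral(1)[OF n j c])
  have fc: "fconst TYPE('d) * ?c = 1" by (simp add: fconst_def powr_add[symmetric])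
  have ci: "integrable lborel (\<lambda>k. cos (k \<bullet> x) * ?h (norm k))"
    by (rule Bochner_Integration.integrable_bound[OF hi]) (auto simp: abs_mult gn_weight_nonneg mult_left_le_one_le)
  have si: "integrable lborel (\<lambda>k. sin (k \<bullet> x) * ?h (norm k))"
    by (rule Bochner_Integration.integrable_bound[OF hi]) (auto simp: abs_mult gn_weight_nonneg mult_left_le_one_le)
  have s0: "(LBINT k. sin (k \<bullet> x) * ?h (norm k)) = 0"
  proof -
    have "(LBINT k. sin ((0 + (- 1) *\<^sub>R k) \<bullet> x) * ?h (norm (0 + (- 1) *\<^sub>R k))) = (LBINT k. sin (k \<bullet> x) * ?h (norm k)) /\<^sub>R \<bar>- 1\<bar> ^ DIM(real^'d)"
      by (rule integral_affine_euclidean[OF si]) simp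
    then show ?thesis by simp
  qed
  have chr: "chr (- x) k * cplx (?h (norm k)) = cplx (cos (k \<bullet> x) * ?h (norm k)) + \<i> * cplx (sin (k \<bullet> x) * ?h (norm k))" for k
  proof -
    have "chr (- x) k = cis (k \<bullet> x)" by (simp add: chr_def cis_conv_exp inner_commute)
    then show ?thesis by (simp add: complex_eq_iff)
  qed
  have "(LBINT k. chr (- x) k * cplx (?h (norm k))) = cplx (LBINT k. cos (k \<bullet> x) * ?h (norm k))"
    unfolding chr using ci si s0
    by (subst Bochner_Integration.integral_add) (simp_all only: integrable_of_real integrable_mult_right integral_mult_right_zero integral_complex_of_real of_real_0 mult_zero_right add_0_right)
  then have 1: "fourier (\<lambda>k. cplx (?h (norm k))) (- x) = cplx (fconst TYPE('d) * (LBINT k. cos (k \<bullet> x) * ?h (norm k)))"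
    by (simp add: fourier_eq)
  have "fconst TYPE('d) * (LBINT k. cos (k \<bullet> x) * ?h (norm k)) = gn_L ?d j n (norm x)"
  proof (cases "x = 0")
    case True
    have G: "Gamma (real ?d / 2) > 0" by (intro Gamma_real_pos) auto
    let ?s = "sin (pi * ((2 * j + real ?d) / (2 * n)))"
    have "fconst TYPE('d) * (LBINT k. cos (k \<bullet> x) * ?h (norm k)) = fconst TYPE('d) * (sphere_area ?d * pi / (2 * n * ?s))"
      using True gn_weight_integral(2)[OF n j c] by simp
    also have "\<dots> = (fconst TYPE('d) * pi powr (real ?d / 2)) * (pi / (Gamma (real ?d / 2) * n * ?s))"
      by (simp add: sphere_area_def)
    also have "fconst TYPE('d) * pi powr (real ?d / 2) = 1 / 2 powr (real ?d / 2)"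
      unfolding fconst_def by (simp add: powr_mult powr_minus field_simps)
    finally show ?thesis using True by (simp add: gn_L_def mult.assoc)
  next
    case False
    then have nx: "norm x > 0" by simp
    have "fconst TYPE('d) * (LBINT k. cos (k \<bullet> x) * ?h (norm k)) = (fconst TYPE('d) * ?c) * (\<integral>\<rho>. indicator {0<..} \<rho> * (\<rho> ^ (?d - 1) * bessel_kernel ?d (norm x * \<rho>) * ?h \<rho>) \<partial>lborel)"
      by (subst radial_cos_integral) (use hi in \<open>auto simp: gn_weight_nonneg\<close>)
    also have "\<dots> = (\<integral>\<rho>. indicator {0<..} \<rho> * (\<rho> ^ (?d - 1) * bessel_kernel ?d (norm x * \<rho>) * ?h \<rho>) \<partial>lborel)" unfolding fc by simp
    also have "\<dots> = gn_L ?d j n (norm x)"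
      unfolding gn_L_def set_lebesgue_integral_def
    proof (simp only: False norm_eq_zero if_False, intro Bochner_Integration.integral_cong refl)
      fix \<rho> :: real
      show "indicator {0<..} \<rho> * (\<rho> ^ (?d - 1) * bessel_kernel ?d (norm x * \<rho>) * ?h \<rho>)
        = indicator {0<..} \<rho> *\<^sub>R (bessel_J (real ?d / 2 - 1) (norm x * \<rho>) / (norm x * \<rho>) powr (real ?d / 2 - 1) * (\<rho> powr (real ?d + 2 * j - 1) / (1 + \<rho> powr (2 * n))))"
      proof (cases "\<rho> > 0")
        case True
        have "\<rho> ^ (?d - 1) * \<rho> powr (2 * j) = \<rho> powr (real ?d + 2 * j - 1)"
          using True d by (simp add: powr_realpow[symmetric] powr_add[symmetric] of_nat_diff algebra_simps)
        moreover have "bessel_J (real ?d / 2 - 1) (norm x * \<rho>) / (norm x * \<rho>) powr (real ?d / 2 - 1) = bessel_kernel ?d (norm x * \<rho>)"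
          by (rule bessel_J_kernel[OF d]) (use nx True in simp)
        ultimately show ?thesis using True by (simp add: gn_weight_def)
      qed simp
    qed
    finally show ?thesis .
  qed
  then show ?thesis unfolding 1 by simp
qed

section \<open>Plancherel and the Sobolev spaces\<close>

text \<open>Plancherel's theorem. A function and its transform are each obtained from the other by a map that does not increase
the norm, and transforms are unique, so both norms are equal.\<close>

lemma L2_dualT:
  fixes a :: "'d::finite cfun"
  assumes a: "L2 a"
  shows "dualT a \<in> Lp 2" "Lp_norm 2 (dualT a) = sqrt (nsq a)"
proof -
  obtain h where h: "L2 h" "nsq h \<le> nsq a" "embed h = dualT a" by (rule L2_dualT_exists[OF a])
  obtain g where g: "L2 g" "nsq g \<le> nsq h" "embed h = dualT g" by (rule L2_has_transform[OF h(1)])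
  have eq: "dualT g = dualT a" using g(3) h(3) by (rule trans[OF sym])
  have ae: "AE k in lborel. g k = a k" by (rule dualT_eq_AE[OF L2_tempered[OF g(1)] L2_tempered[OF a] eq])
  have [measurable]: "g \<in> borel_measurable borel" "a \<in> borel_measurable borel" using a g(1) by (auto simp: L2_def)
  have "nsq g = nsq a" unfolding nsq_def by (intro integral_cong_AE) (use ae in auto)
  then have e: "nsq h = nsq a" using g(2) h(2) by linarith
  have hl: "h \<in> Lp_fun 2" by (rule iffD2[OF Lp_fun_2(1) h(1)])
  show "dualT a \<in> Lp 2" unfolding Lp_def h(3)[symmetric] by (rule imageI[OF hl])
  have "(1::ereal) \<le> 2" by (simp add: one_ereal_def)
  then show "Lp_norm 2 (dualT a) = sqrt (nsq a)"
    unfolding h(3)[symmetric] using Lp_norm_embed[OF _ hl] unfolding Lp_fun_2(2) e by blast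
qed

lemma Lp_2_transform:
  fixes u :: "'d::finite functional"
  assumes "u \<in> Lp 2" obtains a where "L2 a" "u = dualT a"
proof -
  obtain f :: "'d cfun" where f: "u = embed f" "f \<in> Lp_fun 2" using assms unfolding Lp_def by (rule imageE)
  have "L2 f" by (rule iffD1[OF Lp_fun_2(1) f(2)])
  then obtain g where g: "L2 g" "nsq g \<le> nsq f" "embed f = dualT g" by (rule L2_has_transform)
  show thesis by (rule that[OF g(1)]) (simp only: f(1) g(3))
qed

text \<open>The Sobolev space is described on the transform side as a weighted space of square integrable functions, where
norms of \<open>D_op n\<close> are explicit integrals.\<close>

lemma sobolev_H_transform:
  fixes f :: "'d::finite functional"
  assumes n: "n \<ge> 0" and f: "f \<in> sobolev_H n"
  obtains a where "L2 a" "L2 (mulp n a)" "f = dualT a" "D_op n f = dualT (mulp n a)"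
proof -
  have f2: "f \<in> Lp 2" "D_op n f \<in> Lp 2" using f by (auto simp: sobolev_H_def)
  obtain a where a: "L2 a" "f = dualT a" by (rule Lp_2_transform[OF f2(1)])
  obtain h where h: "L2 h" "D_op n f = dualT h" by (rule Lp_2_transform[OF f2(2)])
  have D: "D_op n f = dualT (mulp n a)" unfolding a(2) by (rule D_op_dualT[OF L2_tempered[OF a(1)] n])
  have t: "tempered (mulp n a)" by (rule tempered_mulp[OF L2_tempered[OF a(1)] n])
  have ae: "AE k in lborel. h k = mulp n a k"
    by (rule dualT_eq_AE[OF L2_tempered[OF h(1)] t]) (simp only: h(2)[symmetric] D)
  have m[measurable]: "mulp n a \<in> borel_measurable borel" using t by (simp add: tempered_def)
  have [measurable]: "h \<in> borel_measurable borel" using h(1) by (simp add: L2_def)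
  have "integrable lborel (\<lambda>k. (norm (mulp n a k))\<^sup>2)"
    by (rule integrable_cong_AE_imp[of _ "\<lambda>k. (norm (h k))\<^sup>2"]) (use h(1) ae in \<open>auto simp: L2_def\<close>)
  then have "L2 (mulp n a)" using m by (simp add: L2_def)
  from that[OF a(1) this a(2) D] show thesis .
qed

lemma dualT_in_sobolev_H:
  fixes a :: "'d::finite cfun"
  assumes n: "n \<ge> 0" and a: "L2 a" "L2 (mulp n a)"
  shows "dualT a \<in> sobolev_H n" "D_op n (dualT a) = dualT (mulp n a)"
proof -
  show D: "D_op n (dualT a) = dualT (mulp n a)" by (rule D_op_dualT[OF L2_tempered[OF a(1)] n])
  show "dualT a \<in> sobolev_H n" unfolding sobolev_H_def mem_Collect_eq D
    by (rule conjI[OF L2_dualT(1)[OF a(1)] L2_dualT(1)[OF a(2)]])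
qed

lemma fourier_uniform_modulus:
  fixes b :: "'d::finite cfun"
  assumes b: "integrable lborel b" and e: "e > 0"
  obtains \<delta> where "\<delta> > 0" "\<And>x t. norm t < \<delta> \<Longrightarrow> norm (fourier b (x + t) - fourier b x) < e"
proof -
  define \<omega> where "\<omega> t = (LBINT k. norm (b k) * norm (chr t k - 1))" for t :: "real^'d"
  have [measurable]: "b \<in> borel_measurable borel" using b by auto
  have chm[measurable]: "chr t \<in> borel_measurable borel" for t :: "real^'d" unfolding chr_def by measurable
  have fc: "fconst TYPE('d) > 0" by (simp add: fconst_def)
  have ch2: "norm (chr t k - 1) \<le> 2" for t k :: "real^'d"
    using norm_triangle_ineq4[of "chr t k" 1] chr_simps(1)[of t k] by simp
  have bnd: "norm (norm (b k) * norm (chr t k - 1)) \<le> 2 * norm (b k)" for t k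
    using mult_left_mono[OF ch2[of t k] norm_ge_zero[of "b k"]] by simp
  have b2: "integrable lborel (\<lambda>k. 2 * norm (b k))" using b by simp
  have diff: "norm (fourier b (x + t) - fourier b x) \<le> fconst TYPE('d) * \<omega> t" for x t
  proof -
    have "fourier b (x + t) - fourier b x = cplx (fconst TYPE('d)) * (LBINT k. chr (x + t) k * b k - chr x k * b k)"
      unfolding fourier_eq using integrable_chr_mult[OF b] by (simp add: right_diff_distrib)
    moreover have "norm (LBINT k. chr (x + t) k * b k - chr x k * b k) \<le> \<omega> t"
      unfolding \<omega>_def
    proof (rule Bochner_Integration.integral_norm_bound_integral)
      show "integrable lborel (\<lambda>k. chr (x + t) k * b k - chr x k * b k)"
        by (intro Bochner_Integration.integrable_diff integrable_chr_mult[OF b])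
      show "integrable lborel (\<lambda>k. norm (b k) * norm (chr t k - 1))"
        by (rule Bochner_Integration.integrable_bound[OF b2]) (use bnd in auto)
      fix k
      have "chr (x + t) k = chr x k * chr t k" by (simp add: chr_def inner_add_left exp_add[symmetric] algebra_simps)
      then have "chr (x + t) k * b k - chr x k * b k = chr x k * (b k * (chr t k - 1))" by (simp add: algebra_simps)
      then show "norm (chr (x + t) k * b k - chr x k * b k) \<le> norm (b k) * norm (chr t k - 1)"
        by (simp add: norm_mult chr_simps(1))
    qed
    ultimately show ?thesis using fc by (simp add: norm_mult)
  qed
  have "\<exists>\<delta>>0. \<forall>t. norm t < \<delta> \<longrightarrow> \<omega> t < e / fconst TYPE('d)"
  proof (rule ccontr)
    assume neg: "\<not> ?thesis"
    have "\<forall>m. \<exists>t. norm t < inverse (real (Suc m)) \<and> \<not> \<omega> t < e / fconst TYPE('d)"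
    proof
      fix m
      have "inverse (real (Suc m)) > 0" by simp
      then show "\<exists>t. norm t < inverse (real (Suc m)) \<and> \<not> \<omega> t < e / fconst TYPE('d)" using neg by blast
    qed
    then obtain t where t: "\<And>m. norm (t m) < inverse (real (Suc m))" "\<And>m. \<not> \<omega> (t m) < e / fconst TYPE('d)"
      by (rule choice[THEN exE]) auto
    have t0: "t \<longlonglongrightarrow> 0"
    proof (rule Lim_null_comparison)
      show "\<forall>\<^sub>F m in sequentially. norm (t m) \<le> inverse (real (Suc m))" by (rule eventuallyI) (rule less_imp_le[OF t(1)])
      show "(\<lambda>m. inverse (real (Suc m))) \<longlonglongrightarrow> 0" by (rule LIMSEQ_inverse_real_of_nat)
    qed
    have lim: "(\<lambda>m. norm (b k) * norm (chr (t m) k - 1)) \<longlonglongrightarrow> 0" for k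
    proof -
      have "(\<lambda>m. norm (b k) * norm (exp (- (\<i> * cplx (t m \<bullet> k))) - 1)) \<longlonglongrightarrow> norm (b k) * norm (exp (- (\<i> * cplx (0 \<bullet> k))) - 1)"
        by (intro tendsto_intros t0)
      then show ?thesis by (simp add: chr_def)
    qed
    have "(\<lambda>m. \<omega> (t m)) \<longlonglongrightarrow> (LBINT (k::real^'d). 0)"
      unfolding \<omega>_def by (rule integral_dominated_convergence[where w="\<lambda>k. 2 * norm (b k)"]) (use b2 lim bnd in auto)
    then have "(\<lambda>m. \<omega> (t m)) \<longlonglongrightarrow> 0" by simp
    then have "e / fconst TYPE('d) \<le> 0" by (rule LIMSEQ_le_const) (use t(2) in \<open>auto simp: not_less\<close>)
    then show False using e fc by (simp add: divide_le_0_iff)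
  qed
  then obtain \<delta> where \<delta>: "\<delta> > 0" "\<And>t. norm t < \<delta> \<Longrightarrow> \<omega> t < e / fconst TYPE('d)" by auto
  show thesis
  proof (rule that[OF \<delta>(1)])
    fix x t :: "real^'d" assume "norm t < \<delta>"
    then have "fconst TYPE('d) * \<omega> t < e" using \<delta>(2)[of t] fc by (simp add: field_simps)
    then show "norm (fourier b (x + t) - fourier b x) < e" using diff[of x t] by linarith
  qed
qed

text \<open>A uniformly continuous square integrable function tends to zero: a large value persists on a ball of fixed
radius, and the square integral over the complement of a large ball is small.\<close>

lemma fourier_L2_vanishes:
  fixes b :: "'d::finite cfun"
  assumes b: "integrable lborel b" and L: "L2 (fourier b)"
  shows "(fourier b \<longlongrightarrow> 0) at_infinity"
  unfolding Lim_at_infinity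
proof (intro allI impI)
  fix e :: real assume e: "e > 0"
  obtain \<delta> where \<delta>: "\<delta> > 0" "\<And>x t. norm t < \<delta> \<Longrightarrow> norm (fourier b (x + t) - fourier b x) < e / 2"
    by (rule fourier_uniform_modulus[OF b, of "e / 2"]) (use e in auto)
  have Fm[measurable]: "fourier b \<in> borel_measurable borel" and Fi: "integrable lborel (\<lambda>y. (norm (fourier b y))\<^sup>2)"
    using L by (auto simp: L2_def)
  define T where "T m = (LBINT y. indicator {y. norm y > real m} y * (norm (fourier b y))\<^sup>2)" for m :: nat
  have Tb: "norm (indicator {y. norm y > real m} y * (norm (fourier b y))\<^sup>2) \<le> (norm (fourier b y))\<^sup>2" for m :: nat and y
    by (auto simp: indicator_def)
  have Ti: "integrable lborel (\<lambda>y. indicator {y. norm y > real m} y * (norm (fourier b y))\<^sup>2)" for m :: nat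
    by (rule Bochner_Integration.integrable_bound[OF Fi]) (use Tb in auto)
  have "T \<longlonglongrightarrow> (LBINT (y::real^'d). 0)"
    unfolding T_def
  proof (rule integral_dominated_convergence[where w="\<lambda>y. (norm (fourier b y))\<^sup>2"])
    show "AE y in lborel. (\<lambda>m. indicator {y. norm y > real m} y * (norm (fourier b y))\<^sup>2) \<longlonglongrightarrow> 0"
    proof (rule AE_I2)
      fix y :: "real^'d"
      obtain m0 :: nat where m0: "norm y \<le> real m0" using real_arch_simple by blast
      have "\<forall>\<^sub>F m in sequentially. 0 = indicator {y. norm y > real m} y * (norm (fourier b y))\<^sup>2"
        unfolding eventually_sequentially by (rule exI[of _ m0]) (use m0 in \<open>auto simp: indicator_def\<close>)
      then show "(\<lambda>m. indicator {y. norm y > real m} y * (norm (fourier b y))\<^sup>2) \<longlonglongrightarrow> 0"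
        by (rule Lim_transform_eventually[OF tendsto_const])
    qed
  qed (use Fi Tb in auto)
  then have T0: "T \<longlonglongrightarrow> 0" by simp
  \<comment> \<open>The volume of a ball of radius \<open>\<delta>\<close>, which does not depend on the centre.\<close>
  define V where "V = unit_ball_vol (real DIM(real^'d)) * \<delta> ^ DIM(real^'d)"
  have V: "measure lborel (ball x \<delta>) = V" for x :: "real^'d"
    unfolding V_def by (rule content_ball) (use \<delta>(1) in simp)
  have Vpos: "V > 0" unfolding V_def using \<delta>(1) by simp
  have "(e / 2)\<^sup>2 * V > 0" using e Vpos by simp
  then have "\<forall>\<^sub>F m in sequentially. T m < (e / 2)\<^sup>2 * V" by (rule order_tendstoD(2)[OF T0])
  then obtain m where m: "T m < (e / 2)\<^sup>2 * V" unfolding eventually_sequentially by auto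
  show "\<exists>R. \<forall>x. norm x \<ge> R \<longrightarrow> dist (fourier b x) 0 < e"
  proof (intro exI allI impI, rule ccontr)
    fix x :: "real^'d" assume x: "norm x \<ge> real m + \<delta>" and "\<not> dist (fourier b x) 0 < e"
    then have big: "norm (fourier b x) \<ge> e" by simp
    have "(e / 2)\<^sup>2 * V = (LBINT y. (e / 2)\<^sup>2 * indicator (ball x \<delta>) y)" by (simp add: V)
    also have "\<dots> \<le> T m"
      unfolding T_def
    proof (rule Bochner_Integration.integral_mono[OF _ Ti])
      show "integrable lborel (\<lambda>y. (e / 2)\<^sup>2 * indicator (ball x \<delta>) y)"
        by (intro integrable_mult_right integrable_real_indicator) (auto intro: emeasure_bounded_finite[unfolded infinity_ennreal_def])
      fix y :: "real^'d"
      show "(e / 2)\<^sup>2 * indicator (ball x \<delta>) y \<le> indicator {y. norm y > real m} y * (norm (fourier b y))\<^sup>2"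
      proof (cases "y \<in> ball x \<delta>")
        case True
        then have d: "norm (x - y) < \<delta>" by (simp add: dist_norm)
        have "norm x \<le> norm (x - y) + norm y" using norm_triangle_ineq[of "x - y" y] by simp
        then have far: "norm y > real m" using d x by linarith
        have "norm (fourier b (y + (x - y)) - fourier b y) < e / 2" by (rule \<delta>(2)[OF d])
        then have "norm (fourier b x - fourier b y) < e / 2" by simp
        then have "e / 2 \<le> norm (fourier b y)" using big norm_triangle_ineq2[of "fourier b x" "fourier b y"] by linarith
        then have "(e / 2)\<^sup>2 \<le> (norm (fourier b y))\<^sup>2" by (rule power_mono) (use e in simp)
        then show ?thesis using True far by simp
      qed (simp add: indicator_def)
    qed
    finally show False using m by simp
  qed
qed

text \<open>The sup norm is bounded by the mean of \<open>|b|\<close> and the square norm by that of \<open>b\<close>; for \<open>2 < r < \<infinity>\<close> the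
\<open>L^r\<close> norm interpolates between both. With \<open>e = 1 / r\<close> the two endpoints are included in a single formula.\<close>

lemma fourier_Lp:
  fixes b :: "'d::finite cfun"
  assumes b: "integrable lborel b" "L2 b" and r: "2 \<le> r" "1 / r = ereal e"
  shows "(\<lambda>x. fourier b (- x)) \<in> Lp_fun r"
    and "M > 0 \<Longrightarrow> N > 0 \<Longrightarrow> (fconst TYPE('d) * (LBINT k. norm (b k)))\<^sup>2 \<le> M \<Longrightarrow> nsq b \<le> N \<Longrightarrow>
      (Lp_fun_norm r (\<lambda>x. fourier b (- x)))\<^sup>2 \<le> M powr (1 - 2 * e) * N powr (2 * e)"
proof -
  let ?g = "\<lambda>x. fourier b (- x)"
  let ?m = "fconst TYPE('d) * (LBINT k. norm (b k))"
  have m0: "?m \<ge> 0" by (intro mult_nonneg_nonneg integral_nonneg_AE) (auto simp: fconst_def)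
  have gle: "norm (?g x) \<le> ?m" for x by (rule fourier_norm_le)
  have L: "L2 (fourier b)" "nsq (fourier b) \<le> nsq b" by (rule fourier_contraction[OF b])+
  have Lg: "L2 ?g" "nsq ?g \<le> nsq b" using nsq_reflect[OF L(1)] L(2) by auto
  have gm[measurable]: "?g \<in> borel_measurable borel" and gi: "integrable lborel (\<lambda>x. (norm (?g x))\<^sup>2)"
    using Lg(1) by (auto simp: L2_def)
  have gc: "continuous_on UNIV ?g"
    by (intro continuous_on_compose2[OF fourier_continuous[OF b(1)]] continuous_intros) auto
  have cases: "r = \<infinity> \<and> e = 0 \<or> (\<exists>p. r = ereal p \<and> p \<ge> 2 \<and> e = 1 / p)"
  proof (cases r)
    case (real p)
    then have p: "p \<ge> 2" using r(1) by simp
    moreover have "1 / r = ereal (1 / p)" unfolding real one_ereal_def using p by simp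
    ultimately show ?thesis using r(2) real by simp
  next
    case PInf
    then show ?thesis using r(2) by (simp add: zero_ereal_def)
  next
    case MInf
    then show ?thesis using r(1) by simp
  qed
  have pw: "norm (?g x) powr p \<le> s powr (p - 2) * (norm (?g x))\<^sup>2" if "p \<ge> 2" "s > 0" "?m \<le> s" for p s x
  proof (cases "?g x = 0")
    case False
    then have pos: "norm (?g x) > 0" by simp
    have "norm (?g x) powr p = norm (?g x) powr (p - 2) * norm (?g x) powr 2" unfolding powr_add[symmetric] by simp
    also have "\<dots> = norm (?g x) powr (p - 2) * (norm (?g x))\<^sup>2" by (simp only: powr_two_norm)
    also have "\<dots> \<le> s powr (p - 2) * (norm (?g x))\<^sup>2"
    proof (rule mult_right_mono)
      have "norm (?g x) \<le> s" using gle[of x] that(3) by linarith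
      then show "norm (?g x) powr (p - 2) \<le> s powr (p - 2)" using that(1) by (intro powr_mono2) auto
    qed simp
    finally show ?thesis .
  qed simp
  have pi: "integrable lborel (\<lambda>x. norm (?g x) powr p)" if p: "p \<ge> 2" for p
  proof (rule Bochner_Integration.integrable_bound)
    show "integrable lborel (\<lambda>x. (?m + 1) powr (p - 2) * (norm (?g x))\<^sup>2)" using gi by simp
    have "norm (norm (?g x) powr p) \<le> norm ((?m + 1) powr (p - 2) * (norm (?g x))\<^sup>2)" for x
    proof -
      have "norm (?g x) powr p \<le> (?m + 1) powr (p - 2) * (norm (?g x))\<^sup>2"
        by (rule pw[OF p]) (use m0 in linarith)+
      then show ?thesis by simp
    qed
    then show "AE x in lborel. norm (norm (?g x) powr p) \<le> norm ((?m + 1) powr (p - 2) * (norm (?g x))\<^sup>2)" by simp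
  qed measurable
  show "?g \<in> Lp_fun r"
    using cases
  proof (elim disjE conjE exE)
    assume ri: "r = \<infinity>"
    have "filterlim uminus at_infinity (at_infinity :: (real^'d) filter)"
      by (simp add: filterlim_at_infinity_conv_norm_at_top filterlim_norm_at_top)
    then have "(?g \<longlongrightarrow> 0) at_infinity"
      by (rule filterlim_compose[OF fourier_L2_vanishes[OF b(1) L(1)]])
    then show ?thesis using gc by (simp add: Lp_fun_def ri)
  next
    fix p assume p: "r = ereal p" "p \<ge> 2"
    then show ?thesis using pi[OF p(2)] by (simp add: Lp_fun_def)
  qed
  assume M: "M > 0" and N: "N > 0" and mM: "?m\<^sup>2 \<le> M" and bN: "nsq b \<le> N"
  define s where "s = sqrt M"
  have s: "s > 0" "?m \<le> s" "M = s powr 2" using M mM real_le_rsqrt[OF mM] by (auto simp: s_def powr_half_sqrt_powr powr_numeral)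
  show "(Lp_fun_norm r ?g)\<^sup>2 \<le> M powr (1 - 2 * e) * N powr (2 * e)"
    using cases
  proof (elim disjE conjE exE)
    assume ri: "r = \<infinity>" "e = 0"
    have "(SUP x. norm (?g x)) \<le> s"
    proof (rule cSUP_least)
      fix x show "norm (?g x) \<le> s" using gle[of x] s(2) by linarith
    qed simp
    moreover have "0 \<le> (SUP x. norm (?g x))"
    proof (rule cSUP_upper2[of _ _ 0])
      show "bdd_above (range (\<lambda>x. norm (?g x)))" using gle by (intro bdd_aboveI[of _ ?m]) auto
    qed auto
    ultimately have "(SUP x. norm (?g x))\<^sup>2 \<le> s\<^sup>2" by (intro power_mono)
    then show ?thesis using M N by (simp add: Lp_fun_norm_def ri s_def)
  next
    fix p assume p: "r = ereal p" "p \<ge> 2" "e = 1 / p"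
    define I where "I = (LBINT x. norm (?g x) powr p)"
    have I0: "I \<ge> 0" unfolding I_def by (intro integral_nonneg_AE) auto
    have "I \<le> (LBINT x. s powr (p - 2) * (norm (?g x))\<^sup>2)"
      unfolding I_def by (rule Bochner_Integration.integral_mono[OF pi[OF p(2)]]) (use gi pw[OF p(2) s(1,2)] in auto)
    also have "\<dots> = s powr (p - 2) * nsq ?g" by (simp add: nsq_def)
    also have "\<dots> \<le> s powr (p - 2) * N" using Lg(2) bN by (intro mult_left_mono) auto
    finally have IN: "I \<le> s powr (p - 2) * N" .
    have "(I powr (1 / p))\<^sup>2 = I powr (2 / p)"
      using p(2) by (simp add: power2_eq_square flip: powr_add)
    also have "\<dots> \<le> (s powr (p - 2) * N) powr (2 / p)" using IN I0 p(2) by (intro powr_mono2) auto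
    also have "\<dots> = s powr ((p - 2) * (2 / p)) * N powr (2 / p)" using s(1) N by (simp add: powr_mult powr_powr)
    also have "s powr ((p - 2) * (2 / p)) = M powr (1 - 2 * e)"
      unfolding s(3) powr_powr p(3) using p(2) by (simp add: field_simps)
    finally show ?thesis by (simp add: Lp_fun_norm_def p(1) I_def p(3))
  qed
qed

section \<open>The inequality with an explicit constant\<close>

lemma le_if_le_add_small:
  fixes X Y Z :: real
  assumes H: "\<And>\<epsilon>. \<epsilon> > 0 \<Longrightarrow> X \<le> Y + \<epsilon> * Z" shows "X \<le> Y"
proof (rule ccontr)
  assume "\<not> X \<le> Y"
  then have d: "X - Y > 0" by simp
  define w where "w = \<bar>Z\<bar> + 1"
  have w: "w > 0" "Z \<le> w" by (auto simp: w_def)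
  have "(X - Y) / (2 * w) > 0" using d w(1) by simp
  then have "X \<le> Y + (X - Y) / (2 * w) * Z" by (rule H)
  moreover have "(X - Y) / (2 * w) * Z \<le> (X - Y) / (2 * w) * w" using d w by (intro mult_left_mono) auto
  moreover have "(X - Y) / (2 * w) * w = (X - Y) / 2" using w(1) by simp
  ultimately show False using d by simp
qed

lemma rpow_pos_eq: "x > 0 \<Longrightarrow> rpow x s = x powr s"
  by (simp add: rpow_def)

lemma rpow_sqrt: "x \<ge> 0 \<Longrightarrow> rpow (sqrt x) s = sqrt (rpow x s)"
proof (cases "s = 0")
  case False
  assume x: "x \<ge> 0"
  have "sqrt x powr s = x powr (1/2 * s)" using x by (simp add: powr_half_sqrt[symmetric] powr_powr)
  also have "\<dots> = sqrt (x powr s)" using x by (simp add: powr_half_sqrt[symmetric] powr_powr)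
  finally show ?thesis using False by (simp add: rpow_def)
qed (simp add: rpow_def)

text \<open>The bounds for all dilation parameters \<open>\<mu>\<close> are combined into a product bound. In the generic case the
minimum over \<open>\<mu>\<close> is attained at \<open>\<mu> = \<theta> A / ((1 - \<theta>) B)\<close>. The auxiliary \<open>S > 0\<close> above \<open>A + \<mu> B\<close> covers
vanishing \<open>A\<close> or \<open>B\<close>, where the bound follows by a limit in \<open>\<mu>\<close>.\<close>

lemma scaling_optimum:
  fixes A B K X \<theta> :: real
  assumes t: "0 \<le> \<theta>" "\<theta> < 1" and A: "0 \<le> A" and B: "0 \<le> B"
    and H: "\<And>\<mu> S. \<mu> > 0 \<Longrightarrow> S > 0 \<Longrightarrow> A + \<mu> * B \<le> S \<Longrightarrow> X \<le> K * \<mu> powr (- \<theta>) * S"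
  shows "X \<le> K / (rpow (1 - \<theta>) (1 - \<theta>) * rpow \<theta> \<theta>) * (rpow A (1 - \<theta>) * rpow B \<theta>)"
proof (cases "\<theta> = 0")
  case True
  have "X \<le> K * A"
  proof (rule le_if_le_add_small)
    fix \<epsilon> :: real assume e: "\<epsilon> > 0"
    have "X \<le> K * \<epsilon> powr (- \<theta>) * (A + \<epsilon> * B + \<epsilon>)"
      by (rule H[OF e]) (use e A B in \<open>auto intro: add_nonneg_pos\<close>)
    then show "X \<le> K * A + \<epsilon> * (K * (B + 1))" using True e by (simp add: algebra_simps)
  qed
  then show ?thesis using True A by (simp add: rpow_def)
next
  case False
  then have t0: "\<theta> > 0" and t1: "1 - \<theta> > 0" using t by auto
  consider "A = 0" | "B = 0" | "A > 0" "B > 0" using A B by linarith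
  then show ?thesis
  proof cases
    case 1
    have "X \<le> 0"
    proof (rule le_if_le_add_small)
      fix \<epsilon> :: real assume e: "\<epsilon> > 0"
      define \<mu> where "\<mu> = \<epsilon> powr (1 / (1 - \<theta>))"
      have m: "\<mu> > 0" "\<mu> powr (1 - \<theta>) = \<epsilon>" using e t1 by (auto simp: \<mu>_def powr_powr)
      have "X \<le> K * \<mu> powr (- \<theta>) * (\<mu> * (B + 1))"
      proof (rule H[OF m(1)])
        show "\<mu> * (B + 1) > 0" using m(1) B by (intro mult_pos_pos) auto
        show "A + \<mu> * B \<le> \<mu> * (B + 1)" using m(1) 1 by (simp add: algebra_simps)
      qed
      also have "\<dots> = K * (\<mu> powr (- \<theta>) * \<mu> powr 1) * (B + 1)" using m(1) by simp
      also have "\<mu> powr (- \<theta>) * \<mu> powr 1 = \<epsilon>" unfolding powr_add[symmetric] using m(2) by simp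
      finally show "X \<le> 0 + \<epsilon> * (K * (B + 1))" by (simp add: mult_ac)
    qed
    then show ?thesis using 1 t1 by (simp add: rpow_def)
  next
    case 2
    have "X \<le> 0"
    proof (rule le_if_le_add_small)
      fix \<epsilon> :: real assume e: "\<epsilon> > 0"
      define \<mu> where "\<mu> = \<epsilon> powr (- 1 / \<theta>)"
      have m: "\<mu> > 0" "\<mu> powr (- \<theta>) = \<epsilon>" using e t0 by (auto simp: \<mu>_def powr_powr)
      have "X \<le> K * \<mu> powr (- \<theta>) * (A + 1)"
        by (rule H[OF m(1)]) (use A 2 in \<open>auto intro: add_nonneg_pos\<close>)
      then show "X \<le> 0 + \<epsilon> * (K * (A + 1))" unfolding m(2) by (simp add: mult_ac)
    qed
    then show ?thesis using 2 t0 by (simp add: rpow_def)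
  next
    case 3
    define T where "T = 1 - \<theta>"
    have T: "T > 0" "T + \<theta> = 1" using t1 by (auto simp: T_def)
    \<comment> \<open>The minimiser: the derivative of \<open>\<mu> powr (- \<theta>) * (A + \<mu> * B)\<close> vanishes here.\<close>
    define \<mu> where "\<mu> = \<theta> * A / (T * B)"
    have m: "\<mu> > 0" using 3 t0 T by (simp add: \<mu>_def)
    have S: "A + \<mu> * B = A / T"
    proof -
      have "A + \<mu> * B = A * (T + \<theta>) / T" using 3 T(1) by (simp add: \<mu>_def field_simps)
      then show ?thesis using T(2) by simp
    qed
    have X: "X \<le> K * \<mu> powr (- \<theta>) * (A / T)" by (rule H[OF m]) (use S 3 T in auto)
    have "\<mu> powr (- \<theta>) = (T powr \<theta> * B powr \<theta>) / (\<theta> powr \<theta> * A powr \<theta>)"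
      unfolding \<mu>_def using 3 t0 T by (simp add: powr_minus_divide powr_divide powr_mult)
    moreover have "A = A powr T * A powr \<theta>" "T = T powr T * T powr \<theta>"
      using 3 T by (simp_all flip: powr_add)
    ultimately have "\<mu> powr (- \<theta>) * (A / T) = (T powr \<theta> * B powr \<theta>) / (\<theta> powr \<theta> * A powr \<theta>) * ((A powr T * A powr \<theta>) / (T powr T * T powr \<theta>))"
      by metis
    also have "\<dots> = (A powr T * B powr \<theta>) / (T powr T * \<theta> powr \<theta>)"
      using 3 t0 T by (simp add: field_simps)
    finally have "X \<le> K * ((A powr T * B powr \<theta>) / (T powr T * \<theta> powr \<theta>))" using X by (simp only: mult.assoc)
    then show ?thesis using 3 t0 T by (simp add: rpow_pos_eq T_def[symmetric])
  qed
qed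

text \<open>The integral of \<open>|k|^(2j) / (1 + |k|^(2n))\<close> over the whole space.\<close>

definition gn_Q :: "nat \<Rightarrow> real \<Rightarrow> real \<Rightarrow> real" where
  "gn_Q d j n = sphere_area d * pi / (2 * n * sin (pi * ((2 * j + real d) / (2 * n))))"

lemma gn_Q_pos:
  assumes "0 < n" "0 \<le> j" "d > 0" "(2 * j + real d) / (2 * n) < 1"
  shows "gn_Q d j n > 0"
proof -
  have c0: "(2 * j + real d) / (2 * n) > 0" using assms by (intro divide_pos_pos add_nonneg_pos) auto
  have "sin (pi * ((2 * j + real d) / (2 * n))) > 0"
  proof (rule sin_gt_zero)
    show "0 < pi * ((2 * j + real d) / (2 * n))" by (rule mult_pos_pos[OF pi_gt_zero c0])
    show "pi * ((2 * j + real d) / (2 * n)) < pi" using mult_strict_left_mono[OF assms(4) pi_gt_zero] by simp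
  qed
  then show ?thesis unfolding gn_Q_def using assms sphere_area_pos[of d] by simp
qed

lemma norm_mulp: "norm (mulp s a k) = rpow (norm k) s * norm (a k)"
  by (simp add: mulp_def norm_mult rpow_nonneg)

lemma powr_square: "x \<ge> (0::real) \<Longrightarrow> (x powr s)\<^sup>2 = x powr (2 * s)"
  by (simp add: power2_eq_square flip: powr_add)

lemma scaled_weight:
  assumes n: "0 < n" and j: "0 \<le> j" and c: "(2 * j + real CARD('d::finite)) / (2 * n) < 1" and mu: "\<mu> > 0"
  shows "integrable lborel (\<lambda>k::real^'d. (rpow (norm k) j)\<^sup>2 / (1 + \<mu> * norm k powr (2 * n)))"
    "(LBINT (k::real^'d). (rpow (norm k) j)\<^sup>2 / (1 + \<mu> * norm k powr (2 * n)))
      = \<mu> powr (- ((2 * j + real CARD('d)) / (2 * n))) * gn_Q CARD('d) j n"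
proof -
  define s where "s = \<mu> powr (1 / (2 * n))"
  have s: "s > 0" "s powr (2 * n) = \<mu>" using mu n by (auto simp: s_def powr_powr)
  let ?w = "\<lambda>k::real^'d. (rpow (norm k) j)\<^sup>2 / (1 + \<mu> * norm k powr (2 * n))"
  let ?h = "\<lambda>k::real^'d. gn_weight (2 * j) n (norm k)"
  let ?v = "\<lambda>k::real^'d. s powr (- (2 * j)) * ?h (0 + s *\<^sub>R k)"
  note hi = gn_weight_integral[OF n j c]
  have w: "?w k = ?v k" if "k \<noteq> 0" for k
  proof -
    have nk: "norm k > 0" using that by simp
    have "?h (0 + s *\<^sub>R k) = s powr (2 * j) * norm k powr (2 * j) / (1 + \<mu> * norm k powr (2 * n))"
      using s nk by (simp add: gn_weight_def powr_mult)
    moreover have "s powr (- (2 * j)) * s powr (2 * j) = 1" using s(1) by (simp flip: powr_add)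
    ultimately have "?v k = norm k powr (2 * j) / (1 + \<mu> * norm k powr (2 * n))"
      by (simp only: times_divide_eq_right mult.assoc[symmetric] mult_1_left)
    then show ?thesis using nk by (simp only: rpow_pos_eq powr_square[OF norm_ge_zero])
  qed
  have ae: "AE k in lborel. ?v k = ?w k" using AE_lborel_singleton[of "0::real^'d"] by eventually_elim (rule w[symmetric])
  have [measurable]: "(\<lambda>x::real. rpow x j) \<in> borel_measurable borel" by (rule rpow_measurable)
  have vi: "integrable lborel ?v"
    by (intro integrable_mult_right integrable_affine_euclidean[of ?h] hi(1)) (use s in simp)
  show "integrable lborel ?w" by (rule integrable_cong_AE_imp[OF vi _ ae]) measurable
  have "(LBINT k. ?w k) = (LBINT k. ?v k)"
    by (rule integral_cong_AE[symmetric]) (use ae in \<open>measurable\<close>)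
  also have "\<dots> = s powr (- (2 * j)) * (LBINT k. ?h (0 + s *\<^sub>R k))" by (rule integral_mult_right_zero)
  also have "(LBINT k. ?h (0 + s *\<^sub>R k)) = (LBINT k. ?h k) /\<^sub>R \<bar>s\<bar> ^ DIM(real^'d)"
    by (rule integral_affine_euclidean[OF hi(1)]) (use s in simp)
  also have "\<dots> = gn_Q CARD('d) j n * s powr (- real CARD('d))"
    unfolding hi(2) gn_Q_def[symmetric] using s(1) by (simp add: powr_minus powr_realpow)
  also have "s powr (- (2 * j)) * (gn_Q CARD('d) j n * s powr (- real CARD('d))) = (s powr (- (2 * j)) * s powr (- real CARD('d))) * gn_Q CARD('d) j n" by simp
  also have "s powr (- (2 * j)) * s powr (- real CARD('d)) = \<mu> powr (- ((2 * j + real CARD('d)) / (2 * n)))"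
    unfolding powr_add[symmetric] s_def powr_powr by (rule arg_cong[where f="\<lambda>x. \<mu> powr x"]) (use n in \<open>simp add: field_simps\<close>)
  finally show "(LBINT k. ?w k) = \<mu> powr (- ((2 * j + real CARD('d)) / (2 * n))) * gn_Q CARD('d) j n" .
qed

lemma rpow_square_pos: "n > 0 \<Longrightarrow> x \<ge> 0 \<Longrightarrow> (rpow x n)\<^sup>2 = x powr (2 * n)"
  by (simp add: rpow_def powr_square)

text \<open>Cauchy and Schwarz for the factorisation
\<open>|k|^j |a| = (|k|^j / sqrt (1 + \<mu> |k|^(2n))) * (sqrt (1 + \<mu> |k|^(2n)) |a|)\<close>. Equality holds for
\<open>|a| = |k|^j / (1 + \<mu> |k|^(2n))\<close>, which for \<open>\<mu> = 1\<close> is the trial function of the lower bound; this is why the estimate is sharp at the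
endpoint \<open>r = \<infinity>\<close>.\<close>

lemma mulp_L1_bound:
  fixes a :: "'d::finite cfun"
  assumes n: "0 < n" and j: "0 \<le> j" and c: "(2 * j + real CARD('d)) / (2 * n) < 1"
    and a: "L2 a" "L2 (mulp n a)"
  shows "integrable lborel (mulp j a)"
    and "\<mu> > 0 \<Longrightarrow> (LBINT k. norm (mulp j a k))\<^sup>2
      \<le> \<mu> powr (- ((2 * j + real CARD('d)) / (2 * n))) * gn_Q CARD('d) j n * (nsq a + \<mu> * nsq (mulp n a))"
proof -
  have [measurable]: "a \<in> borel_measurable borel" using a by (simp add: L2_def)
  have rm[measurable]: "(\<lambda>x::real. rpow x j) \<in> borel_measurable borel" by (rule rpow_measurable)
  have bm[measurable]: "mulp j a \<in> borel_measurable borel" unfolding mulp_def by measurable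
  have ai: "integrable lborel (\<lambda>k. (norm (a k))\<^sup>2)" "integrable lborel (\<lambda>k. (norm (mulp n a k))\<^sup>2)" using a by (auto simp: L2_def)
  have main: "integrable lborel (\<lambda>k. norm (mulp j a k)) \<and> (LBINT k. norm (mulp j a k))\<^sup>2
      \<le> \<mu> powr (- ((2 * j + real CARD('d)) / (2 * n))) * gn_Q CARD('d) j n * (nsq a + \<mu> * nsq (mulp n a))" if mu: "\<mu> > 0" for \<mu>
  proof -
    define f where "f k = rpow (norm k) j / sqrt (1 + \<mu> * norm k powr (2 * n))" for k :: "real^'d"
    define g where "g k = sqrt (1 + \<mu> * norm k powr (2 * n)) * norm (a k)" for k
    have [measurable]: "f \<in> borel_measurable borel" "g \<in> borel_measurable borel" unfolding f_def g_def by measurable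
    have pos: "1 + \<mu> * norm k powr (2 * n) > 0" for k :: "real^'d" using mu by (intro add_pos_nonneg) auto
    have f2: "(f k)\<^sup>2 = (rpow (norm k) j)\<^sup>2 / (1 + \<mu> * norm k powr (2 * n))" for k
      unfolding f_def power_divide using pos[of k] by simp
    have g2: "(g k)\<^sup>2 = (norm (a k))\<^sup>2 + \<mu> * (norm (mulp n a k))\<^sup>2" for k
      unfolding g_def norm_mulp power_mult_distrib rpow_square_pos[OF n norm_ge_zero] using pos[of k] by (simp add: algebra_simps)
    have fg: "f k * g k = norm (mulp j a k)" for k
      unfolding f_def g_def norm_mulp using pos[of k] by simp
    have fi: "integrable lborel (\<lambda>k. (f k)\<^sup>2)" unfolding f2 by (rule scaled_weight(1)[OF n j c mu])
    have gi: "integrable lborel (\<lambda>k. (g k)\<^sup>2)" unfolding g2 using ai by simp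
    have gv: "(LBINT k. (g k)\<^sup>2) = nsq a + \<mu> * nsq (mulp n a)" unfolding g2 nsq_def using ai by simp
    have "integrable lborel (\<lambda>k. f k * g k)" "(LBINT k. \<bar>f k * g k\<bar>)\<^sup>2 \<le> (LBINT k. (f k)\<^sup>2) * (LBINT k. (g k)\<^sup>2)"
      by (rule Cauchy_Schwarz_integral[OF _ _ fi gi], simp, simp)+
    then show ?thesis unfolding fg abs_norm_cancel gv f2 scaled_weight(2)[OF n j c mu] by (rule conjI)
  qed
  show "integrable lborel (mulp j a)" using main[of 1] bm by (simp add: integrable_norm_iff)
  show "(LBINT k. norm (mulp j a k))\<^sup>2
      \<le> \<mu> powr (- ((2 * j + real CARD('d)) / (2 * n))) * gn_Q CARD('d) j n * (nsq a + \<mu> * nsq (mulp n a))" if "\<mu> > 0"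
    by (rule conjunct2[OF main[OF that]])
qed

lemma powr_le_one_plus:
  assumes "0 \<le> s" "s \<le> 1" "t \<ge> (0::real)" shows "t powr s \<le> 1 + t"
proof (cases "t \<le> 1")
  case True
  have "t powr s \<le> 1 powr s" by (rule powr_mono2) (use assms True in auto)
  then show ?thesis using assms by simp
next
  case False
  have "t powr s \<le> t powr 1" by (rule powr_mono) (use assms False in auto)
  then show ?thesis using assms by simp
qed

text \<open>Pointwise, \<open>|k|^(2j)\<close> is at most \<open>\<mu> powr (- (j / n)) * (1 + \<mu> |k|^(2n))\<close>, because \<open>0 \<le> j / n \<le> 1\<close>.\<close>

lemma mulp_L2_bound:
  fixes a :: "'d::finite cfun"
  assumes n: "0 < n" and j: "0 \<le> j" "j \<le> n" and a: "L2 a" "L2 (mulp n a)"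
  shows "L2 (mulp j a)"
    and "\<mu> > 0 \<Longrightarrow> nsq (mulp j a) \<le> \<mu> powr (- (j / n)) * (nsq a + \<mu> * nsq (mulp n a))"
proof -
  have [measurable]: "a \<in> borel_measurable borel" using a by (simp add: L2_def)
  have rm[measurable]: "(\<lambda>x::real. rpow x j) \<in> borel_measurable borel" by (rule rpow_measurable)
  have bm[measurable]: "mulp j a \<in> borel_measurable borel" unfolding mulp_def by measurable
  have ai: "integrable lborel (\<lambda>k. (norm (a k))\<^sup>2)" "integrable lborel (\<lambda>k. (norm (mulp n a k))\<^sup>2)" using a by (auto simp: L2_def)
  have pw: "(rpow (norm k) j)\<^sup>2 \<le> \<mu> powr (- (j / n)) * (1 + \<mu> * norm k powr (2 * n))" if mu: "\<mu> > 0" for \<mu> and k :: "real^'d"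
  proof (cases "norm k = 0")
    case True
    show ?thesis
    proof (cases "j = 0")
      case True
      then show ?thesis using mu by (simp add: rpow_def)
    next
      case False
      have "rpow (norm k) j = 0" using True False by (simp add: rpow_def)
      then show ?thesis using mu by (simp add: add_nonneg_nonneg)
    qed
  next
    case False
    then have nk: "norm k > 0" by simp
    have "(\<mu> * norm k powr (2 * n)) powr (j / n) \<le> 1 + \<mu> * norm k powr (2 * n)"
      by (rule powr_le_one_plus) (use n j mu in auto)
    moreover have "(\<mu> * norm k powr (2 * n)) powr (j / n) = \<mu> powr (j / n) * norm k powr (2 * j)"
      using mu nk n by (simp add: powr_mult powr_powr)
    ultimately have "\<mu> powr (- (j / n)) * (\<mu> powr (j / n) * norm k powr (2 * j)) \<le> \<mu> powr (- (j / n)) * (1 + \<mu> * norm k powr (2 * n))"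
      by (intro mult_left_mono) auto
    moreover have "\<mu> powr (- (j / n)) * \<mu> powr (j / n) = 1" using mu by (simp flip: powr_add)
    ultimately have "norm k powr (2 * j) \<le> \<mu> powr (- (j / n)) * (1 + \<mu> * norm k powr (2 * n))"
      by (simp only: mult.assoc[symmetric] mult_1_left)
    then show ?thesis using nk by (simp only: rpow_pos_eq powr_square[OF norm_ge_zero])
  qed
  have pw': "(norm (mulp j a k))\<^sup>2 \<le> \<mu> powr (- (j / n)) * ((norm (a k))\<^sup>2 + \<mu> * (norm (mulp n a k))\<^sup>2)" if mu: "\<mu> > 0" for \<mu> k
  proof -
    have "(norm (mulp j a k))\<^sup>2 = (rpow (norm k) j)\<^sup>2 * (norm (a k))\<^sup>2" by (simp only: norm_mulp power_mult_distrib)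
    also have "\<dots> \<le> \<mu> powr (- (j / n)) * (1 + \<mu> * norm k powr (2 * n)) * (norm (a k))\<^sup>2"
      by (rule mult_right_mono[OF pw[OF mu]]) simp
    also have "\<dots> = \<mu> powr (- (j / n)) * ((norm (a k))\<^sup>2 + \<mu> * (norm (mulp n a k))\<^sup>2)"
      unfolding norm_mulp power_mult_distrib rpow_square_pos[OF n norm_ge_zero] by (simp add: algebra_simps)
    finally show ?thesis .
  qed
  have i2: "integrable lborel (\<lambda>k. \<mu> powr (- (j / n)) * ((norm (a k))\<^sup>2 + \<mu> * (norm (mulp n a k))\<^sup>2))" for \<mu>
    using ai by simp
  have bi: "integrable lborel (\<lambda>k. (norm (mulp j a k))\<^sup>2)"
    by (rule Bochner_Integration.integrable_bound[OF i2[of 1]]) (use pw'[of 1] in \<open>auto intro!: AE_I2\<close>)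
  show "L2 (mulp j a)" using bm bi by (simp add: L2_def)
  show "nsq (mulp j a) \<le> \<mu> powr (- (j / n)) * (nsq a + \<mu> * nsq (mulp n a))" if "\<mu> > 0"
  proof -
    have "nsq (mulp j a) \<le> (LBINT k. \<mu> powr (- (j / n)) * ((norm (a k))\<^sup>2 + \<mu> * (norm (mulp n a k))\<^sup>2))"
      unfolding nsq_def by (rule Bochner_Integration.integral_mono[OF bi i2 pw'[OF that]])
    also have "\<dots> = \<mu> powr (- (j / n)) * (nsq a + \<mu> * nsq (mulp n a))" using ai by (simp add: nsq_def)
    finally show ?thesis .
  qed
qed

text \<open>The mean bound and the square bound are interpolated with weights \<open>1 - 2 e\<close> and \<open>2 e\<close>. The relation between
\<open>\<theta>\<close> and \<open>r\<close> says exactly that the powers of \<open>\<mu>\<close> combine to \<open>\<mu> powr (- \<theta>)\<close>.\<close>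

lemma D_op_dualT_bound:
  fixes a :: "'d::finite cfun"
  assumes n: "0 < n" and j: "0 \<le> j" "j \<le> n" and c: "(2 * j + real CARD('d)) / (2 * n) < 1"
    and a: "L2 a" "L2 (mulp n a)" and r: "2 \<le> r" "1 / r = ereal e"
    and t: "0 \<le> \<theta>" "\<theta> < 1" "\<theta> = (2 * j + real CARD('d)) / (2 * n) * (1 - 2 * e) + j / n * (2 * e)"
  shows "(\<lambda>x. fourier (mulp j a) (- x)) \<in> Lp_fun r"
    and "D_op j (dualT a) = embed (\<lambda>x. fourier (mulp j a) (- x))"
    and "(Lp_norm r (D_op j (dualT a)))\<^sup>2
      \<le> ((fconst TYPE('d))\<^sup>2 * gn_Q CARD('d) j n) powr (1 - 2 * e) / (rpow (1 - \<theta>) (1 - \<theta>) * rpow \<theta> \<theta>)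
         * (rpow (nsq a) (1 - \<theta>) * rpow (nsq (mulp n a)) \<theta>)"
proof -
  let ?b = "mulp j a"
  let ?c = "(2 * j + real CARD('d)) / (2 * n)"
  let ?g = "\<lambda>x. fourier ?b (- x)"
  define K where "K = (fconst TYPE('d))\<^sup>2 * gn_Q CARD('d) j n"
  have K: "K > 0" unfolding K_def using fconst_pos[where 'd='d] gn_Q_pos[OF n j(1) _ c] by simp
  have b1: "integrable lborel ?b" by (rule mulp_L1_bound(1)[OF n j(1) c a])
  have b2: "L2 ?b" by (rule mulp_L2_bound(1)[OF n j a])
  show gL: "?g \<in> Lp_fun r" by (rule fourier_Lp(1)[OF b1 b2 r])
  show eq: "D_op j (dualT a) = embed ?g"
    unfolding D_op_dualT[OF L2_tempered[OF a(1)] j(1)] by (rule embed_of_transform[OF b1 L2_tempered[OF b2], symmetric])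
  have "(1::ereal) \<le> 2" by (simp add: one_ereal_def)
  then have r1: "1 \<le> r" using r(1) by (rule order_trans)
  have main: "(Lp_fun_norm r ?g)\<^sup>2 \<le> K powr (1 - 2 * e) * \<mu> powr (- \<theta>) * S"
    if mu: "\<mu> > 0" and S: "S > 0" "nsq a + \<mu> * nsq (mulp n a) \<le> S" for \<mu> S
  proof -
    let ?M = "K * \<mu> powr (- ?c) * S"
    let ?N = "\<mu> powr (- (j / n)) * S"
    have "(fconst TYPE('d) * (LBINT k. norm (?b k)))\<^sup>2 = (fconst TYPE('d))\<^sup>2 * (LBINT k. norm (?b k))\<^sup>2"
      by (rule power_mult_distrib)
    also have "\<dots> \<le> (fconst TYPE('d))\<^sup>2 * (\<mu> powr (- ?c) * gn_Q CARD('d) j n * (nsq a + \<mu> * nsq (mulp n a)))"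
      by (rule mult_left_mono[OF mulp_L1_bound(2)[OF n j(1) c a mu]]) simp
    also have "\<dots> = K * \<mu> powr (- ?c) * (nsq a + \<mu> * nsq (mulp n a))" by (simp add: K_def mult_ac)
    also have "\<dots> \<le> ?M" by (rule mult_left_mono[OF S(2)]) (use K in simp)
    finally have M: "(fconst TYPE('d) * (LBINT k. norm (?b k)))\<^sup>2 \<le> ?M" .
    have "nsq ?b \<le> \<mu> powr (- (j / n)) * (nsq a + \<mu> * nsq (mulp n a))" by (rule mulp_L2_bound(2)[OF n j a mu])
    also have "\<dots> \<le> ?N" by (rule mult_left_mono[OF S(2)]) simp
    finally have N: "nsq ?b \<le> ?N" .
    have "(Lp_fun_norm r ?g)\<^sup>2 \<le> ?M powr (1 - 2 * e) * ?N powr (2 * e)"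
      by (rule fourier_Lp(2)[OF b1 b2 r _ _ M N]) (use K mu S(1) in simp_all)
    also have "\<dots> = K powr (1 - 2 * e) * (\<mu> powr (- ?c * (1 - 2 * e)) * \<mu> powr (- (j / n) * (2 * e))) * (S powr (1 - 2 * e) * S powr (2 * e))"
      using K mu S(1) by (simp add: powr_mult powr_powr mult_ac)
    also have "S powr (1 - 2 * e) * S powr (2 * e) = S" using S(1) by (simp flip: powr_add)
    also have "\<mu> powr (- ?c * (1 - 2 * e)) * \<mu> powr (- (j / n) * (2 * e)) = \<mu> powr (- \<theta>)"
    proof -
      have "- ?c * (1 - 2 * e) + - (j / n) * (2 * e) = - \<theta>" unfolding t(3) by simp
      then show ?thesis by (simp only: powr_add[symmetric])
    qed
    finally show ?thesis .
  qed
  show "(Lp_norm r (D_op j (dualT a)))\<^sup>2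
      \<le> ((fconst TYPE('d))\<^sup>2 * gn_Q CARD('d) j n) powr (1 - 2 * e) / (rpow (1 - \<theta>) (1 - \<theta>) * rpow \<theta> \<theta>)
         * (rpow (nsq a) (1 - \<theta>) * rpow (nsq (mulp n a)) \<theta>)"
    unfolding eq Lp_norm_embed[OF r1 gL] K_def[symmetric]
    by (rule scaling_optimum[OF t(1,2) nsq_nonneg nsq_nonneg main])
qed

lemma gn_inequality_explicit:
  assumes n: "0 < n" and j: "0 \<le> j" "j \<le> n" and c: "(2 * j + real CARD('d::finite)) / (2 * n) < 1"
    and r: "2 \<le> r" "1 / r = ereal e"
    and t: "0 \<le> \<theta>" "\<theta> < 1" "\<theta> = (2 * j + real CARD('d)) / (2 * n) * (1 - 2 * e) + j / n * (2 * e)"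
  shows "gn_inequality TYPE('d) j n \<theta> r (sqrt (((fconst TYPE('d))\<^sup>2 * gn_Q CARD('d) j n) powr (1 - 2 * e) / (rpow (1 - \<theta>) (1 - \<theta>) * rpow \<theta> \<theta>)))"
proof -
  define U where "U = ((fconst TYPE('d))\<^sup>2 * gn_Q CARD('d) j n) powr (1 - 2 * e) / (rpow (1 - \<theta>) (1 - \<theta>) * rpow \<theta> \<theta>)"
  have U: "U \<ge> 0" unfolding U_def using t by (intro divide_nonneg_nonneg mult_nonneg_nonneg rpow_nonneg) auto
  have n0: "n \<ge> 0" using n by simp
  have key: "f \<in> L2_rj r j \<and> Lp_norm r (D_op j f) \<le> sqrt U * rpow (Lp_norm 2 f) (1 - \<theta>) * rpow (Lp_norm 2 (D_op n f)) \<theta>"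
    if f: "f \<in> sobolev_H n" for f :: "'d functional"
  proof -
    obtain a where a: "L2 a" "L2 (mulp n a)" and fa: "f = dualT a" and Df: "D_op n f = dualT (mulp n a)"
      by (rule sobolev_H_transform[OF n0 f])
    note B = D_op_dualT_bound[OF n j c a r t]
    have "D_op j (dualT a) \<in> Lp r" unfolding Lp_def B(2) by (rule imageI[OF B(1)])
    then have m: "f \<in> L2_rj r j" unfolding L2_rj_def fa using L2_dualT(1)[OF a(1)] by simp
    have "Lp_norm r (D_op j f) \<le> sqrt (U * (rpow (nsq a) (1 - \<theta>) * rpow (nsq (mulp n a)) \<theta>))"
      unfolding fa by (rule real_le_rsqrt) (use B(3) in \<open>simp only: U_def\<close>)
    also have "\<dots> = sqrt U * rpow (sqrt (nsq a)) (1 - \<theta>) * rpow (sqrt (nsq (mulp n a))) \<theta>"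
      by (simp only: real_sqrt_mult rpow_sqrt[OF nsq_nonneg] mult.assoc)
    finally show ?thesis using m unfolding Df unfolding fa L2_dualT(2)[OF a(1)] L2_dualT(2)[OF a(2)] by (rule conjI[rotated])
  qed
  show ?thesis unfolding gn_inequality_def U_def[symmetric] using key U by (intro conjI subsetI ballI) auto
qed

text \<open>The admissible constants form a closed set that is bounded below; as soon as there is one, the infimum is
attained and \<open>LEAST\<close> denotes it.\<close>

lemma gn_sharp_least:
  fixes T :: "'d::finite itself"
  assumes U: "gn_inequality T j n \<theta> r U"
  shows "gn_inequality T j n \<theta> r (gn_sharp T j n \<theta> r)"
    and "gn_inequality T j n \<theta> r G \<Longrightarrow> gn_sharp T j n \<theta> r \<le> G"
proof -
  let ?H = "sobolev_H n :: 'd functional set"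
  define S where "S = {G. gn_inequality T j n \<theta> r G}"
  have "S = {G. 0 \<le> G} \<inter> {G. ?H \<subseteq> L2_rj r j} \<inter>
     (\<Inter>f\<in>?H. {G. Lp_norm r (D_op j f) \<le> G * rpow (Lp_norm 2 f) (1 - \<theta>) * rpow (Lp_norm 2 (D_op n f)) \<theta>})"
    unfolding S_def gn_inequality_def by auto
  also have "closed \<dots>"
    by (intro closed_Int closed_INT ballI closed_Collect_le closed_Collect_const continuous_intros)
  finally have cl: "closed S" .
  have ne: "S \<noteq> {}" using U by (auto simp: S_def)
  have bb: "bdd_below S" by (rule bdd_belowI[of _ 0]) (simp add: S_def gn_inequality_def)
  have inf: "Inf S \<in> S" by (rule closed_contains_Inf[OF ne bb cl])
  have least: "gn_sharp T j n \<theta> r = Inf S"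
    unfolding gn_sharp_def by (rule Least_equality) (use inf bb in \<open>auto simp: S_def intro: cInf_lower\<close>)
  show "gn_inequality T j n \<theta> r (gn_sharp T j n \<theta> r)" using inf unfolding least by (simp add: S_def)
  show "gn_sharp T j n \<theta> r \<le> G" if "gn_inequality T j n \<theta> r G"
    unfolding least by (rule cInf_lower[OF _ bb]) (use that in \<open>simp add: S_def\<close>)
qed

section \<open>The trial function and the lower constant\<close>

text \<open>For \<open>s = j\<close> this is the transform for which the Cauchy--Schwarz estimate of the mean of \<open>|k|^j a\<close> is an
equality; multipliers only change the exponent \<open>s\<close>.\<close>

definition trial :: "real \<Rightarrow> real \<Rightarrow> 'd::finite cfun" where
  "trial s n = (\<lambda>k. cplx (gn_weight s n (norm k)))"

lemma mulp_trial: "mulp s (trial t n) = trial (t + s) n"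
proof
  fix k
  show "mulp s (trial t n) k = trial (t + s) n k"
  proof (cases "k = 0")
    case False
    then have "norm k > 0" by simp
    then show ?thesis unfolding mulp_def trial_def of_real_mult[symmetric] of_real_eq_iff
      by (simp add: rpow_pos_eq gn_weight_def powr_add)
  qed (simp add: mulp_def trial_def gn_weight_def)
qed

lemma trial_L2:
  assumes n: "0 < n" and s: "0 \<le> s" and c: "(2 * s + real CARD('d::finite)) / (2 * n) < 2"
  shows "L2 (trial s n :: 'd cfun)"
    "nsq (trial s n :: 'd cfun) = sphere_area CARD('d) * (Gamma ((2 * s + real CARD('d)) / (2 * n)) * Gamma (2 - (2 * s + real CARD('d)) / (2 * n)) / (2 * n))"
proof -
  have sq: "(norm ((trial s n :: 'd cfun) k))\<^sup>2 = norm k powr (2 * s) / (1 + norm k powr (2 * n)) powr 2" for k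
  proof -
    have p: "1 + norm k powr (2 * n) > 0" by (intro add_pos_nonneg) auto
    have "(norm ((trial s n :: 'd cfun) k))\<^sup>2 = (norm k powr s)\<^sup>2 / (1 + norm k powr (2 * n))\<^sup>2"
      unfolding trial_def norm_of_real power2_abs gn_weight_def power_divide by (rule refl)
    also have "(1 + norm k powr (2 * n))\<^sup>2 = (1 + norm k powr (2 * n)) powr 2" using p by (simp add: powr_numeral)
    finally show ?thesis by (simp only: powr_square[OF norm_ge_zero])
  qed
  have G2: "Gamma 2 = (1::real)" using Gamma_fact[of 1, where 'a=real] by simp
  have [measurable]: "(trial s n :: 'd cfun) \<in> borel_measurable borel" unfolding trial_def by measurable
  note R = radial_weight_integral[OF n s c]
  show "L2 (trial s n :: 'd cfun)" unfolding L2_def sq using R(1) by simp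
  show "nsq (trial s n :: 'd cfun) = sphere_area CARD('d) * (Gamma ((2 * s + real CARD('d)) / (2 * n)) * Gamma (2 - (2 * s + real CARD('d)) / (2 * n)) / (2 * n))"
    unfolding nsq_def sq R(2) G2 by simp
qed

text \<open>Both norms are Beta integrals at neighbouring arguments, so by the functional equation of Gamma they are
multiples \<open>1 - c\<close> and \<open>c\<close> of the same constant.\<close>

lemma trial_norms:
  assumes n: "0 < n" and j: "0 \<le> j" and c: "c = (2 * j + real CARD('d::finite)) / (2 * n)" "c < 1"
  shows "L2 (trial j n :: 'd cfun)" "nsq (trial j n :: 'd cfun) = (1 - c) * gn_Q CARD('d) j n"
    "L2 (mulp n (trial j n) :: 'd cfun)" "nsq (mulp n (trial j n) :: 'd cfun) = c * gn_Q CARD('d) j n"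
proof -
  have c0: "c > 0" unfolding c(1) using n j by (intro divide_pos_pos add_nonneg_pos) auto
  have c': "(2 * (j + n) + real CARD('d)) / (2 * n) = c + 1" unfolding c(1) using n by (simp add: field_simps)
  have np: "z \<notin> \<int>\<^sub>\<le>\<^sub>0" if "z > 0" for z :: real using that by (auto elim!: nonpos_Ints_cases)
  have Q: "gn_Q CARD('d) j n = sphere_area CARD('d) * (Gamma c * Gamma (1 - c) / (2 * n))"
    unfolding Gamma_reflection_real[OF c0 c(2)] gn_Q_def c(1)[symmetric] by (simp add: mult_ac)
  have l1: "(2 * j + real CARD('d)) / (2 * n) < 2" "(2 * (j + n) + real CARD('d)) / (2 * n) < 2" "0 \<le> j + n"
    unfolding c' c(1)[symmetric] using c(2) n j by auto
  have G1: "Gamma (2 - c) = (1 - c) * Gamma (1 - c)" using Gamma_plus1[OF np[of "1 - c"]] c(2) by simp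
  have G2: "Gamma (c + 1) = c * Gamma c" by (rule Gamma_plus1[OF np[OF c0]])
  have G3: "2 - (c + 1) = 1 - c" by simp
  show "L2 (trial j n :: 'd cfun)" by (rule trial_L2(1)[OF n j l1(1)])
  show "nsq (trial j n :: 'd cfun) = (1 - c) * gn_Q CARD('d) j n"
    unfolding trial_L2(2)[OF n j l1(1)] unfolding c(1)[symmetric] G1 Q by simp
  show "L2 (mulp n (trial j n) :: 'd cfun)" unfolding mulp_trial by (rule trial_L2(1)[OF n l1(3,2)])
  show "nsq (mulp n (trial j n) :: 'd cfun) = c * gn_Q CARD('d) j n"
    unfolding mulp_trial trial_L2(2)[OF n l1(3,2)] unfolding c' G2 G3 Q by simp
qed

lemma trial_fourier:
  assumes n: "0 < n" and j: "0 \<le> j" and c: "(2 * j + real CARD('d::finite)) / (2 * n) < 1"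
  shows "integrable lborel (mulp j (trial j n) :: 'd cfun)"
    "(\<lambda>x. fourier (mulp j (trial j n) :: 'd cfun) (- x)) = (\<lambda>x. cplx (gn_L CARD('d) j n (norm x)))"
proof -
  have e: "(mulp j (trial j n) :: 'd cfun) = (\<lambda>k. cplx (gn_weight (2 * j) n (norm k)))"
    unfolding mulp_trial by (simp add: trial_def)
  show "integrable lborel (mulp j (trial j n) :: 'd cfun)" unfolding e using gn_weight_integral(1)[OF n j c] by simp
  show "(\<lambda>x. fourier (mulp j (trial j n) :: 'd cfun) (- x)) = (\<lambda>x. cplx (gn_L CARD('d) j n (norm x)))"
    unfolding e gn_L_eq_fourier[OF n j c] by (rule refl)
qed

text \<open>Along a coordinate axis \<open>gn_L\<close> is the transform of an integrable function. The absolute value makes the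
statement meaningful on the whole line.\<close>

lemma gn_L_abs_continuous:
  assumes n: "0 < n" and j: "0 \<le> j" and c: "(2 * j + real CARD('d::finite)) / (2 * n) < 1"
  shows "continuous_on UNIV (\<lambda>\<rho>. gn_L CARD('d) j n \<bar>\<rho>\<bar>)"
proof -
  obtain i :: 'd where True by simp
  define F where "F = fourier (mulp j (trial j n) :: 'd cfun)"
  have "continuous_on UNIV F" unfolding F_def by (rule fourier_continuous[OF trial_fourier(1)[OF n j c]])
  moreover have "continuous_on UNIV (\<lambda>\<rho>::real. - (\<rho> *\<^sub>R axis i 1) :: real^'d)" by (intro continuous_intros)
  ultimately have "continuous_on UNIV (\<lambda>\<rho>. F (- (\<rho> *\<^sub>R axis i 1)))" by (rule continuous_on_compose2) simp
  then have "continuous_on UNIV (\<lambda>\<rho>. Re (F (- (\<rho> *\<^sub>R axis i 1))))" by (rule continuous_on_Re)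
  moreover have "Re (F (- (\<rho> *\<^sub>R axis i 1))) = gn_L CARD('d) j n \<bar>\<rho>\<bar>" for \<rho>
    unfolding F_def using fun_cong[OF trial_fourier(2)[OF n j c], of "\<rho> *\<^sub>R axis i 1"] by simp
  ultimately show ?thesis by simp
qed

text \<open>For finite \<open>r\<close> the norm of the function with radial profile \<open>gn_L\<close> is computed in polar coordinates. In the sup norm case only
the value at the origin is compared, which suffices for a lower bound.\<close>

lemma gn_I_trial:
  fixes r :: ereal
  assumes n: "0 < n" and j: "0 \<le> j" and c: "c = (2 * j + real CARD('d::finite)) / (2 * n)" "c < 1"
    and g: "(\<lambda>x::real^'d. cplx (gn_L CARD('d) j n (norm x))) \<in> Lp_fun r"
    and r: "2 \<le> r" "\<theta> = c \<longleftrightarrow> r = \<infinity>"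
  shows "gn_I CARD('d) j n \<theta> r \<le> Lp_fun_norm r (\<lambda>x::real^'d. cplx (gn_L CARD('d) j n (norm x)))"
    and "\<theta> \<noteq> c \<Longrightarrow> gn_I CARD('d) j n \<theta> r = Lp_fun_norm r (\<lambda>x::real^'d. cplx (gn_L CARD('d) j n (norm x)))"
proof -
  let ?d = "CARD('d)"
  let ?L = "gn_L ?d j n"
  let ?g = "\<lambda>x::real^'d. cplx (?L (norm x))"
  have cc: "j / n + real ?d / (2 * n) = c" unfolding c(1) using n by (simp add: field_simps)
  have fin: "gn_I ?d j n \<theta> r = Lp_fun_norm r ?g" if tc: "\<theta> \<noteq> c"
  proof -
    have ri: "r \<noteq> \<infinity>" using tc r(2) by simp
    define p where "p = real_of_ereal r"
    have Lm: "(\<lambda>\<rho>. ?L \<bar>\<rho>\<bar>) \<in> borel_measurable borel"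
      using gn_L_abs_continuous[OF n j c(2)[unfolded c(1)]] by (rule borel_measurable_continuous_onI)
    define h where "h \<rho> = \<bar>?L \<bar>\<rho>\<bar>\<bar> powr p" for \<rho>
    have hm[measurable]: "h \<in> borel_measurable borel" unfolding h_def using Lm by measurable
    define F where "F \<rho> = sphere_area ?d * (indicator {0<..} \<rho> * (\<rho> ^ (?d - 1) * h \<rho>))" for \<rho> :: real
    have [measurable]: "F \<in> borel_measurable borel" unfolding F_def by measurable
    have A: "sphere_area ?d > 0" by (rule sphere_area_pos) simp
    have F0: "F \<rho> \<ge> 0" for \<rho> unfolding F_def h_def using A by (auto simp: indicator_def)
    have "(LBINT x. norm (?g x) powr p) = (LBINT (x::real^'d). h (norm x))" by (simp add: h_def)
    also have "\<dots> = enn2real (\<integral>\<^sup>+(x::real^'d). ennreal (h (norm x)) \<partial>lborel)"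
      by (rule integral_eq_nn_integral) (auto simp: h_def[symmetric], simp add: h_def)
    also have "(\<integral>\<^sup>+(x::real^'d). ennreal (h (norm x)) \<partial>lborel)
        = (\<integral>\<^sup>+\<rho>. ennreal (sphere_area ?d * \<rho> ^ (?d - 1)) * indicator {0<..} \<rho> * ennreal (h \<rho>) \<partial>lborel)"
      using nn_integral_radial[of "\<lambda>\<rho>. ennreal (h \<rho>)", where 'a="real^'d"] by simp
    also have "\<dots> = (\<integral>\<^sup>+\<rho>. ennreal (F \<rho>) \<partial>lborel)"
    proof (rule nn_integral_cong)
      fix \<rho> :: real
      show "ennreal (sphere_area ?d * \<rho> ^ (?d - 1)) * indicator {0<..} \<rho> * ennreal (h \<rho>) = ennreal (F \<rho>)"
      proof (cases "\<rho> > 0")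
        case True
        have "ennreal (sphere_area ?d * \<rho> ^ (?d - 1)) * ennreal (h \<rho>) = ennreal (sphere_area ?d * \<rho> ^ (?d - 1) * h \<rho>)"
          using True A by (intro ennreal_mult[symmetric]) (auto simp: h_def)
        then show ?thesis using True by (simp add: F_def mult.assoc)
      qed (simp add: F_def)
    qed
    also have "enn2real (\<integral>\<^sup>+\<rho>. ennreal (F \<rho>) \<partial>lborel) = (LBINT \<rho>. F \<rho>)"
      by (rule integral_eq_nn_integral[symmetric]) (use F0 in auto)
    also have "\<dots> = sphere_area ?d * (LBINT \<rho>:{0<..}. \<rho> ^ (?d - 1) * \<bar>?L \<rho>\<bar> powr p)"
      unfolding F_def set_lebesgue_integral_def h_def
      by (subst integral_mult_right_zero, rule arg_cong[where f="\<lambda>x. sphere_area ?d * x"], intro Bochner_Integration.integral_cong refl) (auto simp: indicator_def)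
    finally show ?thesis unfolding gn_I_def Lp_fun_norm_def cc using tc ri by (simp add: sphere_area_def p_def)
  qed
  then show "\<theta> \<noteq> c \<Longrightarrow> gn_I ?d j n \<theta> r = Lp_fun_norm r ?g" .
  show "gn_I ?d j n \<theta> r \<le> Lp_fun_norm r ?g"
  proof (cases "\<theta> = c")
    case True
    then have ri: "r = \<infinity>" using r(2) by simp
    have g': "continuous_on UNIV ?g" "(?g \<longlongrightarrow> 0) at_infinity" using g by (auto simp: Lp_fun_def ri)
    have bd: "bdd_above (range (\<lambda>x. norm (?g x)))"
    proof -
      obtain R where R: "\<And>x. norm x \<ge> R \<Longrightarrow> norm (?g x) < 1"
        using g'(2) unfolding Lim_at_infinity by (metis dist_0_norm dist_commute zero_less_one)
      have "bounded (?g ` cball 0 R)"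
        by (intro compact_imp_bounded compact_continuous_image continuous_on_subset[OF g'(1)]) auto
      then obtain B where B0: "\<forall>y\<in>?g ` cball 0 R. norm y \<le> B" unfolding bounded_iff by (rule exE)
      have B: "norm (?g x) \<le> B" if "norm x \<le> R" for x
        by (rule bspec[OF B0 imageI]) (use that in simp)
      show ?thesis
      proof (rule bdd_aboveI2[where M="max 1 B"])
        fix x show "norm (?g x) \<le> max 1 B" using R[of x] B[of x] by linarith
      qed
    qed
    have "gn_I ?d j n \<theta> r = ?L 0" using True by (simp add: gn_I_def gn_L_def cc c(1))
    also have "\<dots> \<le> norm (?g 0)" by simp
    also have "\<dots> \<le> (SUP x. norm (?g x))" by (rule cSUP_upper[OF UNIV_I bd])
    finally show ?thesis by (simp add: Lp_fun_norm_def ri)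
  qed (simp add: fin)
qed

lemma rpow_pos: "x > 0 \<Longrightarrow> rpow x s > 0"
  by (simp add: rpow_def)

lemma rpow_self_pos: "x \<ge> 0 \<Longrightarrow> rpow x x > 0"
  by (simp add: rpow_def)

lemma gn_Q_eq:
  assumes "n > 0" "c = (2 * j + real d) / (2 * n)"
  shows "gn_Q d j n = pi powr (real d / 2 + 1) / (Gamma (real d / 2) * n * sin (pi * c))"
  using assms by (simp add: gn_Q_def sphere_area_def powr_add)

text \<open>In this form the lower constant is visibly the quotient of \<open>gn_I\<close> by the right hand side of the inequality for the trial
function.\<close>

lemma gn_G_lower_eq:
  assumes n: "0 < n" and j: "0 \<le> j" and d: "d > 0" and c: "c = (2 * j + real d) / (2 * n)" "c < 1"
    and t: "0 \<le> \<theta>" "\<theta> < 1"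
  shows "gn_G_lower d j n \<theta> r = gn_I d j n \<theta> r / sqrt (gn_Q d j n * (rpow (1 - c) (1 - \<theta>) * rpow c \<theta>))"
proof -
  define X where "X = pi powr (real d / 2 + 1)"
  define Y where "Y = Gamma (real d / 2) * n * sin (pi * c)"
  define P where "P = rpow (1 - \<theta>) (1 - \<theta>) * rpow \<theta> \<theta>"
  define W where "W = rpow (1 - c) (1 - \<theta>) * rpow c \<theta>"
  define I where "I = gn_I d j n \<theta> r"
  have c0: "c > 0" unfolding c(1) using n j d by (intro divide_pos_pos add_nonneg_pos) auto
  have cc: "j / n + real d / (2 * n) = c" "1 - j / n - real d / (2 * n) = 1 - c" unfolding c(1) using n by (simp_all add: field_simps)
  have P: "P > 0" unfolding P_def using t by (intro mult_pos_pos rpow_self_pos) auto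
  have W: "W > 0" unfolding W_def using c0 c(2) by (intro mult_pos_pos rpow_pos) auto
  have Q: "gn_Q d j n = X / Y" unfolding X_def Y_def by (rule gn_Q_eq[OF n c(1)])
  have X: "X > 0" by (simp add: X_def)
  have "X / Y > 0" unfolding Q[symmetric] by (rule gn_Q_pos[OF n j d]) (use c in simp)
  then have Y: "Y > 0" using X by (simp add: zero_less_divide_iff)
  have pi: "pi powr (real d / 4 + 1 / 2) = sqrt X"
    unfolding X_def powr_half_sqrt[OF powr_ge_zero, symmetric] powr_powr by (rule arg_cong[where f="\<lambda>x. pi powr x"]) simp
  have "gn_G_lower d j n \<theta> r = I / sqrt X * sqrt (Y * (P / W)) / sqrt P"
    unfolding gn_G_lower_def gn_S_lower_def cc pi I_def Y_def P_def W_def by (rule refl)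
  also have "\<dots> = I * sqrt (Y / (X * W))"
    using X Y P W by (simp add: real_sqrt_mult real_sqrt_divide)
  also have "\<dots> = I / sqrt (X / Y * W)"
    using X Y W by (simp add: real_sqrt_mult real_sqrt_divide)
  finally show ?thesis unfolding Q I_def W_def .
qed

text \<open>The value of \<open>gn_L\<close> at the origin is the integral of its transform, so bounding the sup norm by that integral
loses nothing.\<close>

lemma gn_I_endpoint:
  assumes n: "0 < n" and c: "c = (2 * j + real CARD('d::finite)) / (2 * n)"
  shows "gn_I CARD('d) j n c r = fconst TYPE('d) * gn_Q CARD('d) j n"
proof -
  have cc: "j / n + real CARD('d) / (2 * n) = c" unfolding c using n by (simp add: field_simps)
  have "fconst TYPE('d) = 1 / (2 powr (real CARD('d) / 2) * pi powr (real CARD('d) / 2))"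
    unfolding fconst_def by (simp add: powr_mult powr_minus_divide)
  then have "fconst TYPE('d) * pi powr (real CARD('d) / 2 + 1) = pi / 2 powr (real CARD('d) / 2)"
    unfolding powr_add by simp
  then show ?thesis unfolding gn_I_def cc gn_Q_eq[OF n c] by (simp add: mult_ac)
qed

lemma endpoint_constant:
  assumes n: "0 < n" and j: "0 \<le> j" and c: "c = (2 * j + real CARD('d::finite)) / (2 * n)" "c < 1" and P: "P > 0"
  shows "fconst TYPE('d) * sqrt (gn_Q CARD('d) j n) / sqrt P
    = 1 / sqrt P * (1 / (2 powr (real CARD('d) / 2) * pi powr (real CARD('d) / 4 - 1 / 2) * sqrt (Gamma (real CARD('d) / 2) * n * sin (pi * c))))"
proof -
  let ?d = "real CARD('d)"
  have 1: "sqrt (pi powr (?d / 2 + 1)) = pi powr (?d / 4 + 1 / 2)"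
    unfolding powr_half_sqrt[OF powr_ge_zero, symmetric] powr_powr by (rule arg_cong[where f="\<lambda>x. pi powr x"]) simp
  have 2: "pi powr (?d / 2) = pi powr (?d / 4 + 1 / 2) * pi powr (?d / 4 - 1 / 2)" by (simp flip: powr_add)
  have 3: "fconst TYPE('d) = 1 / (2 powr (?d / 2) * pi powr (?d / 2))"
    unfolding fconst_def by (simp add: powr_mult powr_minus_divide)
  show ?thesis unfolding gn_Q_eq[OF n c(1)] real_sqrt_divide 1 3 2 by simp
qed

section \<open>The sharp constant\<close>

theorem corollary5p20:
  fixes j n \<theta> :: real and r :: ereal
  assumes "0 < n" and "0 \<le> j" and "j \<le> n"
    and "j / n \<le> \<theta>" and "\<theta> \<le> j / n + real CARD('d::finite) / (2 * n)"
    and "j / n + real CARD('d) / (2 * n) < 1"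
    and "2 \<le> r" and "1 / r = ereal (1 / 2 - (\<theta> * n - j) / real CARD('d))"
  shows "continuous_on {0..} (gn_L CARD('d) j n) \<and>
    gn_sharp TYPE('d) j n \<theta> r \<ge> gn_G_lower CARD('d) j n \<theta> r \<and>
    (\<theta> = 0 \<longrightarrow>
       j = 0 \<and> r = 2 \<and>
       gn_sharp TYPE('d) j n \<theta> r = gn_G_lower CARD('d) j n \<theta> r \<and>
       gn_sharp TYPE('d) j n \<theta> r = 1) \<and>
    (\<theta> = j / n + real CARD('d) / (2 * n) \<longrightarrow>
       gn_sharp TYPE('d) j n \<theta> r = gn_G_lower CARD('d) j n \<theta> r \<and>
       gn_sharp TYPE('d) j n \<theta> r =
         1 / sqrt (rpow (1 - \<theta>) (1 - \<theta>) * rpow \<theta> \<theta>) *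
         (1 / (2 powr (real CARD('d) / 2) * pi powr (real CARD('d) / 4 - 1 / 2) *
               sqrt (Gamma (real CARD('d) / 2) * n * sin (pi * \<theta>)))))"
proof -
  note n = assms(1) and j = assms(2) and jn = assms(3) and r2 = assms(7)
  let ?d = "CARD('d)"
  define c where "c = (2 * j + real ?d) / (2 * n)"
  define e where "e = 1 / 2 - (\<theta> * n - j) / real ?d"
  define Q where "Q = gn_Q ?d j n"
  define P where "P = rpow (1 - \<theta>) (1 - \<theta>) * rpow \<theta> \<theta>"
  define W where "W = rpow (1 - c) (1 - \<theta>) * rpow c \<theta>"
  define U where "U = sqrt (((fconst TYPE('d))\<^sup>2 * Q) powr (1 - 2 * e) / P)"
  define G where "G = gn_sharp TYPE('d) j n \<theta> r"
  have d: "?d > 0" "real ?d > 0" by auto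
  have cc: "j / n + real ?d / (2 * n) = c" unfolding c_def using n by (simp add: field_simps)
  have c1: "c < 1" and tc: "\<theta> \<le> c" using assms(5,6) unfolding cc by auto
  have c0: "c > 0" unfolding c_def using n j d by (intro divide_pos_pos add_nonneg_pos) auto
  have t0: "0 \<le> \<theta>" using assms(4) n j by (meson divide_nonneg_pos order_trans)
  have t1: "\<theta> < 1" using tc c1 by linarith
  have r: "1 / r = ereal e" using assms(8) unfolding e_def .
  \<comment> \<open>The relation between \<open>r\<close> and \<open>\<theta>\<close>: \<open>\<theta>\<close> interpolates between \<open>j / n\<close> at \<open>r = 2\<close> and \<open>c\<close> at \<open>r = \<infinity>\<close>.\<close>
  have te: "\<theta> = c * (1 - 2 * e) + j / n * (2 * e)"
    unfolding c_def e_def using n d by (simp add: field_simps)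
  have tce: "\<theta> = c \<longleftrightarrow> e = 0"
    unfolding c_def e_def using n d by (auto simp: field_simps)
  have tcr: "\<theta> = c \<longleftrightarrow> r = \<infinity>"
  proof -
    have "e = 0 \<longleftrightarrow> r = \<infinity>"
    proof (cases r)
      case (real p)
      then have "p \<ge> 2" using r2 by simp
      then show ?thesis using r unfolding real one_ereal_def by (auto simp: divide_eq_0_iff)
    next
      case PInf
      then show ?thesis using r by (simp add: zero_ereal_def)
    next
      case MInf
      then show ?thesis using r2 by simp
    qed
    then show ?thesis using tce by simp
  qed
  have c': "(2 * j + real ?d) / (2 * n) < 1" using c1 by (simp add: c_def)
  have te': "\<theta> = (2 * j + real ?d) / (2 * n) * (1 - 2 * e) + j / n * (2 * e)" using te by (simp add: c_def)
  have Q: "Q > 0" unfolding Q_def by (rule gn_Q_pos[OF n j d(1) c'])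
  have P: "P > 0" unfolding P_def using t0 t1 by (intro mult_pos_pos rpow_self_pos) auto
  have W: "W > 0" unfolding W_def using c0 c1 by (intro mult_pos_pos rpow_pos) auto
  have upper: "gn_inequality TYPE('d) j n \<theta> r U"
    unfolding U_def P_def Q_def by (rule gn_inequality_explicit[OF n j jn c' r2 r t0 t1 te'])
  have G: "gn_inequality TYPE('d) j n \<theta> r G" "G \<le> U"
    unfolding G_def by (rule gn_sharp_least(1)[OF upper], rule gn_sharp_least(2)[OF upper upper])
  note tr = trial_norms[OF n j c_def c1, folded Q_def]
  let ?a = "trial j n :: 'd cfun"
  let ?g = "\<lambda>x::real^'d. cplx (gn_L ?d j n (norm x))"
  note B = D_op_dualT_bound(1,2)[OF n j jn c' tr(1,3) r2 r t0 t1 te', unfolded trial_fourier(2)[OF n j c']]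
  have "(1::ereal) \<le> 2" by (simp add: one_ereal_def)
  then have r1: "1 \<le> r" using r2 by (rule order_trans)
  have DL: "Lp_norm r (D_op j (dualT ?a)) = Lp_fun_norm r ?g" unfolding B(2) by (rule Lp_norm_embed[OF r1 B(1)])
  note GI = gn_I_trial[OF n j c_def c1 B(1) r2 tcr]
  have low: "gn_G_lower ?d j n \<theta> r = gn_I ?d j n \<theta> r / sqrt (Q * W)"
    unfolding Q_def W_def by (rule gn_G_lower_eq[OF n j d(1) c_def c1 t0 t1])
  have den: "rpow (sqrt ((1 - c) * Q)) (1 - \<theta>) * rpow (sqrt (c * Q)) \<theta> = sqrt (Q * W)"
  proof -
    have p: "(1 - c) * Q > 0" "c * Q > 0" "1 - c > 0" using Q c0 c1 by auto
    have "rpow ((1 - c) * Q) (1 - \<theta>) * rpow (c * Q) \<theta> = (Q powr (1 - \<theta>) * Q powr \<theta>) * W"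
      unfolding rpow_pos_eq[OF p(1)] rpow_pos_eq[OF p(2)] W_def rpow_pos_eq[OF p(3)] rpow_pos_eq[OF c0]
      using p Q c0 by (simp add: powr_mult)
    also have "Q powr (1 - \<theta>) * Q powr \<theta> = Q" using Q by (simp flip: powr_add)
    finally show ?thesis using p by (simp only: rpow_sqrt less_imp_le real_sqrt_mult[symmetric])
  qed
  have lower: "gn_G_lower ?d j n \<theta> r \<le> G"
  proof -
    have n0: "n \<ge> 0" using n by simp
    note H = dualT_in_sobolev_H[OF n0 tr(1,3)]
    have "Lp_norm r (D_op j (dualT ?a)) \<le> G * rpow (Lp_norm 2 (dualT ?a)) (1 - \<theta>) * rpow (Lp_norm 2 (D_op n (dualT ?a))) \<theta>"
      by (rule bspec[OF conjunct2[OF conjunct2[OF G(1)[unfolded gn_inequality_def]]] H(1)])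
    then have "Lp_fun_norm r ?g \<le> G * sqrt (Q * W)"
      unfolding H(2) DL L2_dualT(2)[OF tr(1)] L2_dualT(2)[OF tr(3)] tr(2,4) mult.assoc den .
    then have "gn_I ?d j n \<theta> r \<le> G * sqrt (Q * W)" using GI(1) by (rule order_trans[rotated])
    then show ?thesis unfolding low using Q W by (simp add: divide_le_eq)
  qed
  have cont: "continuous_on {0..} (gn_L ?d j n)"
    using continuous_on_subset[OF gn_L_abs_continuous[OF n j c'], of "{0..}"] by (rule continuous_on_eq) auto
  have casea: "j = 0 \<and> r = 2 \<and> G = gn_G_lower ?d j n \<theta> r \<and> G = 1" if z: "\<theta> = 0"
  proof -
    have j0: "j = 0" using assms(4) n j z by (simp add: divide_le_0_iff)
    have e2: "e = 1 / 2" by (simp add: e_def z j0)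
    have rr: "r = 2"
    proof (cases r)
      case (real p)
      then have p: "p \<ge> 2" using r2 by simp
      then have "1 / p = 1 / 2" using r e2 unfolding real one_ereal_def by simp
      then show ?thesis using real by (simp add: field_simps)
    next
      case PInf
      then show ?thesis using r e2 by (simp add: zero_ereal_def)
    next
      case MInf
      then show ?thesis using r2 by simp
    qed
    \<comment> \<open>The interpolation weight of the mean bound is zero, so its constant disappears.\<close>
    have "U = 1" unfolding U_def P_def e2 z using Q fconst_pos[where 'd='d] by (simp add: rpow_def)
    then have le: "G \<le> 1" using G(2) by simp
    \<comment> \<open>In the case \<open>\<theta> = 0\<close> both sides of the inequality are the same norm, so the trial quotient is \<open>1\<close> by Plancherel.\<close>
    have m0: "mulp 0 ?a = ?a" by (simp add: mulp_def rpow_def)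
    have "D_op 0 (dualT ?a) = dualT ?a" using D_op_dualT[OF L2_tempered[OF tr(1)], of 0] unfolding m0 by simp
    then have D0: "D_op j (dualT ?a) = dualT ?a" unfolding j0 .
    have "gn_I ?d j n \<theta> r = Lp_fun_norm r ?g" using GI(2) z c0 by simp
    also have "\<dots> = sqrt ((1 - c) * Q)"
      using DL unfolding D0 rr L2_dualT(2)[OF tr(1)] tr(2) by (rule sym)
    also have "(1 - c) * Q = Q * W" using c1 by (simp add: W_def z rpow_def)
    finally have "gn_G_lower ?d j n \<theta> r = 1" unfolding low using Q W by simp
    then show ?thesis using le lower j0 rr by auto
  qed
  have caseb: "G = gn_G_lower ?d j n \<theta> r \<and> G = 1 / sqrt P * (1 / (2 powr (real ?d / 2) * pi powr (real ?d / 4 - 1 / 2) *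
               sqrt (Gamma (real ?d / 2) * n * sin (pi * \<theta>))))" if z: "\<theta> = c"
  proof -
    let ?k = "fconst TYPE('d) * sqrt Q / sqrt P"
    have k0: "fconst TYPE('d) > 0" by (rule fconst_pos)
    have e0: "e = 0" using z tce by simp
    have U: "U = ?k" unfolding U_def e0 using Q k0 by (simp add: real_sqrt_mult real_sqrt_divide)
    have I: "gn_I ?d j n \<theta> r = fconst TYPE('d) * Q" unfolding z Q_def by (rule gn_I_endpoint[OF n c_def])
    have WP: "W = P" unfolding W_def P_def z by (rule refl)
    have "gn_G_lower ?d j n \<theta> r = fconst TYPE('d) * Q / (sqrt Q * sqrt P)" unfolding low I WP by (simp add: real_sqrt_mult)
    also have "\<dots> = fconst TYPE('d) * (Q / sqrt Q) / sqrt P" by simp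
    also have "Q / sqrt Q = sqrt Q" using Q by (simp add: real_div_sqrt)
    finally have L: "gn_G_lower ?d j n \<theta> r = ?k" .
    have "G = ?k" using lower G(2) unfolding L U by simp
    moreover have "?k = 1 / sqrt P * (1 / (2 powr (real ?d / 2) * pi powr (real ?d / 4 - 1 / 2) *
               sqrt (Gamma (real ?d / 2) * n * sin (pi * \<theta>))))"
      unfolding z Q_def by (rule endpoint_constant[OF n j c_def c1 P])
    ultimately show ?thesis using L by simp
  qed
  show ?thesis
    unfolding G_def[symmetric] P_def[symmetric] cc using cont lower casea caseb by blast
qed

end
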